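(* Let $\mathbf k$ be a field and $n\ge1$. For each $r$ with $1\le r\le n$, there is an $\mathfrak S_n$-module isomorphism $$\phi:\textstyle\bigwedge^r\mathcal{L}ie_2(n)\to WH^{n-r}(\Pi_n^w)\otimes\operatorname{sgn}_n$$ determined by $$\phi([F,\sigma])=\operatorname{sgn}(\sigma)\operatorname{sgn}(F)\,\bar c(F,\sigma),\qquad (F,\sigma)\in\mathcal{BF}_{n,r},$$ where if $F$ is the sequence $T_1,\dots,T_r$ of bicolored binary trees then $$\operatorname{sgn}(F):=(-1)^{|I(T_2)|+|I(T_4)|+\cdots+|I(T_{2\lfloor r/2\rfloor})|}\operatorname{sgn}(T_1)\operatorname{sgn}(T_2)\cdots\operatorname{sgn}(T_r).$$
   Context: Poset. Let $[n]=\{1,\dots,n\}$. A weighted partition of $[n]$ is a set $\{B_1^{v_1},\dots,B_t^{v_t}\}$ where $\{B_1,\dots,B_t\}$ is a partition of $[n]$ and $v_i\in\{0,1,\dots,|B_i|-1\}$. The poset $\Pi_n^w$ is the set of weighted partitions of $[n]$ ordered by: $\{A_1^{w_1},\dots,A_s^{w_s}\}\le\{B_1^{v_1},\dots,B_t^{v_t}\}$ iff $\{A_j\}$ refines $\{B_k\}$ and whenever $B_k=A_{i_1}\cup\cdots\cup A_{i_l}$, then $v_k-(w_{i_1}+\cdots+w_{i_l})\in\{0,\dots,l-1\}$. Its minimum is $\hat 0=\{\{1\}^0,\dots,\{n\}^0\}$. $\mathfrak S_n$ acts on $\Pi_n^w$ by replacing each element $x$ of each block by $\sigma(x)$ (weights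 unchanged), hence on chains. Cohomology. For a finite poset $P$ the reduced cochain space $C_r(P)$ has basis the chains $\alpha_0<\cdots<\alpha_r$ ($C_{-1}$ is spanned by the empty chain), with $\delta_r(\alpha_0<\cdots<\alpha_r)=\sum_{i=0}^{r+1}(-1)^i\sum_{\alpha\in(\alpha_{i-1},\alpha_i)}(\alpha_0<\cdots<\alpha_{i-1}<\alpha<\alpha_i<\cdots<\alpha_r)$, where $\alpha_{-1},\alpha_{r+1}$ are an adjoined minimum and maximum; $\tilde H^r(P)=\ker\delta_r/\operatorname{im}\delta_{r-1}$. Maximal chains are identified with their classes in top cohomology. For a degenerate interval, $\tilde H^r((x,x))=\mathbf k$ if $r=-2$ and $0$ otherwise. Whitney cohomology of a poset $P$ with minimum $\hat 0$ is $WH^r(P)=\bigoplus_{x\in P}\tilde H^{r-2}((\hat 0,x);\mathbf k)$; $\mathfrak S_n$ acts on $WH^r(\Pi_n^w)$ through its action on chains. Lie side. Two Lie brackets $[\cdot,\cdot]$ (blue) and $\langle\cdot,\cdot\rangle$ (red) on one vector space are compatible if every linear combination is a Lie bracket; equivalently $[x,\langle y,z\rangle]+[z,\langle x,y\rangle]+[y,\langle z,x\rangle]+\langle x,[y,z]\rangle+\langle z,[x,y]\rangle+\langle y,[z,x]\rangle=0$ (mixed Jacobi). Consider the free Lie algebra over $\mathbf k$ on generators $[n]$ with two compatible brackets (subject only to antisymmetry and Jacobi for each bracket and mixed Jacobi). $\bigwedge^r\mathcal{L}ie_2(n)$ denotes the multilinear component of its $r$th exterior power, i.e. the span of wedge products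 of $r$ bracketings in which, altogether, each element of $[n]$ appears exactly once. $\mathfrak S_n$ acts by replacing each letter $x$ by $\sigma(x)$. Trees and forests. A bicolored binary tree is a complete plane binary tree (every internal node has a left and a right child) with each internal node colored red or blue. For a tree $(T,\sigma)$ whose leaves are labeled from left to right by a word $\sigma$ of distinct labels, $[T,\sigma]$ is the leaf's label if $T$ is a single leaf; otherwise, with left and right labeled subtrees $(T_1,\sigma_1),(T_2,\sigma_2)$, it is the blue bracket $[[T_1,\sigma_1],[T_2,\sigma_2]]$ if the root is blue and the red bracket $\langle[T_1,\sigma_1],[T_2,\sigma_2]\rangle$ if the root is red. $I(T)$ is the set of internal nodes. $\operatorname{sgn}(T)=1$ if $I(T)=\emptyset$ and $\operatorname{sgn}(T)=(-1)^{|I(T_2)|}\operatorname{sgn}(T_1)\operatorname{sgn}(T_2)$ if $T$ has left subtree $T_1$ and right subtree $T_2$. A bicolored binary forest is a sequence of bicolored binary trees. $\mathcal{BF}_{n,r}$ is the set of pairs $(F,\sigma)$ with $F$ a bicolored binary forest with $r$ trees and $n$ leaves in total and $\sigma\in\mathfrak S_n$, the $j$th leaf of $F$ from left to right being labeled $\sigma(j)$. If the labeled trees of $(F,\sigma)$ are $(T_1,\sigma_1),\dots,(T_r,\sigma_r)$ in order, then $[F,\sigma]=[T_1,\sigma_1]\wedge\cdots\wedge[T_r,\sigma_r]$. $\operatorname{sgn}(\sigma)$ is the sign of the permutation, $\operatorname{sgn}_n$ the sign representation, and the underlying space of $M\otimes\operatorname{sgn}_n$ is identified with $M$. Chains. Put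 $u(\text{blue})=0$, $u(\text{red})=1$; to $u$-merge two blocks $A^a,B^b$ means to replace them by $(A\cup B)^{a+b+u}$. Postorder on a tree lists the internal nodes of the left subtree (recursively), then those of the right subtree, then the root; postorder on a forest lists the trees in order, each in postorder. $c(F,\sigma)$ is the unrefinable chain of $\Pi_n^w$ starting at $\hat 0$ whose rank $k$ element ($1\le k\le n-r$) is obtained from its rank $k-1$ element by $u(\mathrm{col}_k)$-merging the blocks whose underlying sets are the leaf label sets of the left and right subtrees of the $k$th internal node in postorder, $\mathrm{col}_k$ being its color. If $x$ is the top element of $c(F,\sigma)$, then $\bar c(F,\sigma)=c(F,\sigma)\setminus\{\hat 0,x\}$, viewed in $\tilde H^{n-r-2}((\hat 0,x))\subseteq WH^{n-r}(\Pi_n^w)$ (when $r=n$, so $x=\hat 0$, it is read as the generator of $\tilde H^{-2}((\hat 0,\hat 0))$). *)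

theory Defs
  imports
    "HOL-Algebra.Module"
    "HOL-Algebra.AbelCoset"
    "HOL-Algebra.Sym_Groups"
    "HOL-Library.Poly_Mapping"
    "HOL-Library.Disjoint_Sets"
begin

section \<open>Linear algebra: free modules, quotients, linear maps\<close>

definition field_ring :: "'k::field ring" where
  "field_ring = \<lparr>carrier = UNIV, monoid.mult = (*), one = 1, zero = 0, add = (+)\<rparr>"

text \<open>The record \<^type>\<open>module\<close> extends the ring record; the fields \<^const>\<open>monoid.mult\<close> and
  \<^const>\<open>one\<close> play no role for modules and are left unspecified throughout.\<close>

definition scale :: "'k::field \<Rightarrow> ('x \<Rightarrow>\<^sub>0 'k) \<Rightarrow> ('x \<Rightarrow>\<^sub>0 'k)" where
  "scale a f = Poly_Mapping.map ((*) a) f"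

definition free_module :: "'x set \<Rightarrow> ('k::field, 'x \<Rightarrow>\<^sub>0 'k) module" where
  "free_module X = \<lparr>carrier = {f. Poly_Mapping.keys f \<subseteq> X}, monoid.mult = undefined, one = undefined,
     zero = 0, add = (+), smult = scale\<rparr>"

definition lin_ext :: "('x \<Rightarrow> ('y \<Rightarrow>\<^sub>0 'k)) \<Rightarrow> ('x \<Rightarrow>\<^sub>0 'k::field) \<Rightarrow> ('y \<Rightarrow>\<^sub>0 'k)" where
  "lin_ext g f = (\<Sum>x\<in>Poly_Mapping.keys f. scale (Poly_Mapping.lookup f x) (g x))"

definition push :: "('x \<Rightarrow> 'y) \<Rightarrow> ('x \<Rightarrow>\<^sub>0 'k::field) \<Rightarrow> ('y \<Rightarrow>\<^sub>0 'k)" where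
  "push g = lin_ext (\<lambda>x. Poly_Mapping.single (g x) 1)"

definition module_span :: "('k::field, 'v) module \<Rightarrow> 'v set \<Rightarrow> 'v set" where
  "module_span M S = \<Inter>{H. submodule H field_ring M \<and> S \<subseteq> H}"

text \<open>The quotient of \<open>M\<close> by a submodule \<open>U\<close>; the class of \<open>x\<close> is the coset \<open>U +>\<^bsub>M\<^esub> x\<close>.
  Scalars act through representatives (for the scalar \<open>0\<close> the elementwise product would not
  be a coset).\<close>

definition quotient_module :: "('k, 'v) module \<Rightarrow> 'v set \<Rightarrow> ('k, 'v set) module" where
  "quotient_module M U = \<lparr>carrier = a_rcosets\<^bsub>M\<^esub> U, monoid.mult = undefined, one = undefined,
     zero = U, add = set_add M, smult = (\<lambda>a A. \<Union>x\<in>A. U +>\<^bsub>M\<^esub> (a \<odot>\<^bsub>M\<^esub> x))\<rparr>"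

text \<open>The direct sum of a family indexed by a finite set.\<close>

definition direct_sum :: "'i set \<Rightarrow> ('i \<Rightarrow> ('k, 'v) module) \<Rightarrow> ('k, 'i \<Rightarrow> 'v) module" where
  "direct_sum I M = \<lparr>carrier = (\<Pi>\<^sub>E i\<in>I. carrier (M i)), monoid.mult = undefined, one = undefined,
     zero = (\<lambda>i\<in>I. \<zero>\<^bsub>M i\<^esub>), add = (\<lambda>f g. \<lambda>i\<in>I. f i \<oplus>\<^bsub>M i\<^esub> g i),
     smult = (\<lambda>a f. \<lambda>i\<in>I. a \<odot>\<^bsub>M i\<^esub> f i)\<rparr>"

definition linear_maps :: "('k, 'v) module \<Rightarrow> ('k, 'w) module \<Rightarrow> ('v \<Rightarrow> 'w) set" where
  "linear_maps M N = {h. h \<in> carrier M \<rightarrow> carrier N \<and>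
     (\<forall>x\<in>carrier M. \<forall>y\<in>carrier M. h (x \<oplus>\<^bsub>M\<^esub> y) = h x \<oplus>\<^bsub>N\<^esub> h y) \<and>
     (\<forall>a. \<forall>x\<in>carrier M. h (a \<odot>\<^bsub>M\<^esub> x) = a \<odot>\<^bsub>N\<^esub> h x)}"

definition equivariant_isos ::
    "nat \<Rightarrow> ('k, 'v) module \<Rightarrow> ((nat \<Rightarrow> nat) \<Rightarrow> 'v \<Rightarrow> 'v) \<Rightarrow>
     ('k, 'w) module \<Rightarrow> ((nat \<Rightarrow> nat) \<Rightarrow> 'w \<Rightarrow> 'w) \<Rightarrow> ('v \<Rightarrow> 'w) set" where
  "equivariant_isos n M actM N actN =
     {h \<in> linear_maps M N. bij_betw h (carrier M) (carrier N) \<and>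
        (\<forall>\<tau>\<in>carrier (sym_group n). \<forall>x\<in>carrier M. h (actM \<tau> x) = actN \<tau> (h x))}"

text \<open>The action on \<open>N \<otimes> sgn\<close>, whose underlying space is identified with \<open>N\<close>.\<close>

definition sign_twist :: "('k::field, 'w) module \<Rightarrow> ((nat \<Rightarrow> nat) \<Rightarrow> 'w \<Rightarrow> 'w) \<Rightarrow>
    (nat \<Rightarrow> nat) \<Rightarrow> 'w \<Rightarrow> 'w" where
  "sign_twist N act \<tau> x = of_int (sign \<tau>) \<odot>\<^bsub>N\<^esub> act \<tau> x"

text \<open>The \<open>r\<close>th exterior power of \<open>V\<close>: the free module on \<open>r\<close>-tuples of vectors, modulo
  multilinearity and vanishing on tuples with two equal entries.\<close>

definition ext_relations :: "nat \<Rightarrow> ('k::field, 'v) module \<Rightarrow> ('v list \<Rightarrow>\<^sub>0 'k) set" where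
  "ext_relations r V =
     {Poly_Mapping.single (xs[i := x \<oplus>\<^bsub>V\<^esub> y]) 1
        - Poly_Mapping.single (xs[i := x]) 1 - Poly_Mapping.single (xs[i := y]) 1 | xs i x y.
        length xs = r \<and> set xs \<subseteq> carrier V \<and> i < r \<and> x \<in> carrier V \<and> y \<in> carrier V}
   \<union> {Poly_Mapping.single (xs[i := a \<odot>\<^bsub>V\<^esub> x]) 1 - Poly_Mapping.single (xs[i := x]) a | xs i a x.
        length xs = r \<and> set xs \<subseteq> carrier V \<and> i < r \<and> x \<in> carrier V}
   \<union> {Poly_Mapping.single xs 1 | xs.
        length xs = r \<and> set xs \<subseteq> carrier V \<and> (\<exists>i j. i < j \<and> j < r \<and> xs ! i = xs ! j)}"

definition tuple_module :: "nat \<Rightarrow> ('k::field, 'v) module \<Rightarrow> ('k, 'v list \<Rightarrow>\<^sub>0 'k) module" where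
  "tuple_module r V = free_module {xs. length xs = r \<and> set xs \<subseteq> carrier V}"

definition ext_kernel :: "nat \<Rightarrow> ('k::field, 'v) module \<Rightarrow> ('v list \<Rightarrow>\<^sub>0 'k) set" where
  "ext_kernel r V = module_span (tuple_module r V) (ext_relations r V)"

definition ext_power :: "nat \<Rightarrow> ('k::field, 'v) module \<Rightarrow> ('k, ('v list \<Rightarrow>\<^sub>0 'k) set) module" where
  "ext_power r V = quotient_module (tuple_module r V) (ext_kernel r V)"

definition wedge :: "('k::field, 'v) module \<Rightarrow> 'v list \<Rightarrow> ('v list \<Rightarrow>\<^sub>0 'k) set" where
  "wedge V xs = ext_kernel (length xs) V +>\<^bsub>tuple_module (length xs) V\<^esub> Poly_Mapping.single xs 1"


section \<open>Bicolored binary trees and forests\<close>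

datatype color = Blue | Red

text \<open>Trees with labelled leaves. The unlabelled trees are those of type \<open>unit btree\<close>; a pair
  \<open>(T, w)\<close> of an unlabelled tree and a word is turned into a labelled tree by \<open>label\<close>.\<close>

datatype 'a btree = Leaf 'a | Node color "'a btree" "'a btree"

primrec leaf_word :: "'a btree \<Rightarrow> 'a list" where
  "leaf_word (Leaf a) = [a]"
| "leaf_word (Node c l r) = leaf_word l @ leaf_word r"

abbreviation nleaves :: "'a btree \<Rightarrow> nat" where
  "nleaves T \<equiv> length (leaf_word T)"

primrec ninternal :: "'a btree \<Rightarrow> nat" where
  "ninternal (Leaf a) = 0"
| "ninternal (Node c l r) = ninternal l + ninternal r + 1"

primrec label :: "'a btree \<Rightarrow> 'b list \<Rightarrow> 'b btree" where
  "label (Leaf a) w = Leaf (hd w)"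
| "label (Node c l r) w = Node c (label l (take (nleaves l) w)) (label r (drop (nleaves l) w))"

primrec label_forest :: "'a btree list \<Rightarrow> 'b list \<Rightarrow> 'b btree list" where
  "label_forest [] w = []"
| "label_forest (T # F) w = label T (take (nleaves T) w) # label_forest F (drop (nleaves T) w)"

definition BF :: "nat \<Rightarrow> nat \<Rightarrow> (unit btree list \<times> (nat \<Rightarrow> nat)) set" where
  "BF n r = {(F, \<sigma>). length F = r \<and> (\<Sum>T\<leftarrow>F. nleaves T) = n \<and> \<sigma> permutes {1..n}}"

definition labelled :: "nat \<Rightarrow> unit btree list \<Rightarrow> (nat \<Rightarrow> nat) \<Rightarrow> nat btree list" where
  "labelled n F \<sigma> = label_forest F (map \<sigma> [1..<Suc n])"

primrec tree_sgn :: "'a btree \<Rightarrow> int" where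
  "tree_sgn (Leaf a) = 1"
| "tree_sgn (Node c l r) = (-1) ^ ninternal r * tree_sgn l * tree_sgn r"

text \<open>\<open>T\<^sub>i\<close> is \<open>F ! (i - 1)\<close>.\<close>

definition forest_sgn :: "'a btree list \<Rightarrow> int" where
  "forest_sgn F = (-1) ^ (\<Sum>i | i \<in> {1..length F} \<and> even i. ninternal (F ! (i - 1)))
                  * (\<Prod>T\<leftarrow>F. tree_sgn T)"


section \<open>The free Lie algebra with two compatible brackets\<close>

text \<open>The free algebra with two bilinear operations on the generating set \<open>X\<close> has as basis the
  labelled bicolored trees with leaf labels in \<open>X\<close>.\<close>

definition free_alg :: "'a set \<Rightarrow> ('k::field, 'a btree \<Rightarrow>\<^sub>0 'k) module" where
  "free_alg X = free_module {T. set (leaf_word T) \<subseteq> X}"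

definition free_bracket :: "color \<Rightarrow> ('a btree \<Rightarrow>\<^sub>0 'k::field) \<Rightarrow> ('a btree \<Rightarrow>\<^sub>0 'k) \<Rightarrow> ('a btree \<Rightarrow>\<^sub>0 'k)"
  where "free_bracket c f g = lin_ext (\<lambda>S. push (Node c S) g) f"

text \<open>Antisymmetry, Jacobi for each bracket, mixed Jacobi. Antisymmetry is \<open>[x,y] = -[y,x]\<close>; in
  characteristic 2 adding \<open>[x,x] = 0\<close> would not change the multilinear component.\<close>

definition lie_relations :: "'a set \<Rightarrow> ('a btree \<Rightarrow>\<^sub>0 'k::field) set" where
  "lie_relations X =
     {free_bracket c x y + free_bracket c y x | c x y.
        x \<in> carrier (free_alg X) \<and> y \<in> carrier (free_alg X)}
   \<union> {free_bracket c x (free_bracket c y z) + free_bracket c z (free_bracket c x y)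
        + free_bracket c y (free_bracket c z x) | c x y z.
        x \<in> carrier (free_alg X) \<and> y \<in> carrier (free_alg X) \<and> z \<in> carrier (free_alg X)}
   \<union> {free_bracket Blue x (free_bracket Red y z) + free_bracket Blue z (free_bracket Red x y)
        + free_bracket Blue y (free_bracket Red z x) + free_bracket Red x (free_bracket Blue y z)
        + free_bracket Red z (free_bracket Blue x y) + free_bracket Red y (free_bracket Blue z x)
        | x y z.
        x \<in> carrier (free_alg X) \<and> y \<in> carrier (free_alg X) \<and> z \<in> carrier (free_alg X)}"

definition lie_ideal :: "'a set \<Rightarrow> ('a btree \<Rightarrow>\<^sub>0 'k::field) set" where
  "lie_ideal X = \<Inter>{J. submodule J field_ring (free_alg X) \<and> lie_relations X \<subseteq> J \<and>
     (\<forall>c. \<forall>x\<in>carrier (free_alg X). \<forall>y\<in>J. free_bracket c x y \<in> J \<and> free_bracket c y x \<in> J)}"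

definition lie2 :: "'a set \<Rightarrow> ('k::field, ('a btree \<Rightarrow>\<^sub>0 'k) set) module" where
  "lie2 X = quotient_module (free_alg X) (lie_ideal X)"

definition lie_bracket :: "'a set \<Rightarrow> color \<Rightarrow> ('a btree \<Rightarrow>\<^sub>0 'k::field) set \<Rightarrow>
    ('a btree \<Rightarrow>\<^sub>0 'k) set \<Rightarrow> ('a btree \<Rightarrow>\<^sub>0 'k) set" where
  "lie_bracket X c A B = (\<Union>a\<in>A. \<Union>b\<in>B. lie_ideal X +>\<^bsub>free_alg X\<^esub> free_bracket c a b)"

primrec bracketing :: "'a set \<Rightarrow> 'a btree \<Rightarrow> ('a btree \<Rightarrow>\<^sub>0 'k::field) set" where
  "bracketing X (Leaf a) = lie_ideal X +>\<^bsub>free_alg X\<^esub> Poly_Mapping.single (Leaf a) 1"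
| "bracketing X (Node c l r) = lie_bracket X c (bracketing X l) (bracketing X r)"

definition wedge_bracketing :: "'a set \<Rightarrow> 'a btree list \<Rightarrow> (('a btree \<Rightarrow>\<^sub>0 'k::field) set list \<Rightarrow>\<^sub>0 'k) set"
  where "wedge_bracketing X G = wedge (lie2 X) (map (bracketing X) G)"

text \<open>The multilinear component of the \<open>r\<close>th exterior power of the free algebra on \<open>[n]\<close>.\<close>

definition wedge_lie2 :: "nat \<Rightarrow> nat \<Rightarrow> ('k::field, ((nat btree \<Rightarrow>\<^sub>0 'k) set list \<Rightarrow>\<^sub>0 'k) set) module" where
  "wedge_lie2 n r = (ext_power r (lie2 {1..n}))\<lparr>carrier :=
     module_span (ext_power r (lie2 {1..n}))
       {wedge_bracketing {1..n} G | G. length G = r \<and>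
          distinct (concat (map leaf_word G)) \<and> set (concat (map leaf_word G)) = {1..n}}\<rparr>"

text \<open>Substitution of letters. It acts on a quotient by taking images of cosets, so each level
  (tree algebra, its Lie quotient, tuples, exterior power) contributes a \<open>push\<close> or an image.\<close>

definition wedge_lie2_act :: "(nat \<Rightarrow> nat) \<Rightarrow> ((nat btree \<Rightarrow>\<^sub>0 'k::field) set list \<Rightarrow>\<^sub>0 'k) set \<Rightarrow>
    ((nat btree \<Rightarrow>\<^sub>0 'k) set list \<Rightarrow>\<^sub>0 'k) set" where
  "wedge_lie2_act \<tau> A = push (map (\<lambda>B. push (map_btree \<tau>) ` B)) ` A"


section \<open>Cohomology of finite posets\<close>

text \<open>A poset is a carrier set \<open>P\<close> with a relation \<open>leq\<close>; the chain
  \<open>\<alpha>\<^sub>0 < \<dots> < \<alpha>\<^sub>j\<close> is the list of its \<open>j + 1\<close> elements, and \<open>[]\<close> is the empty chain.\<close>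

definition strict :: "('p \<Rightarrow> 'p \<Rightarrow> bool) \<Rightarrow> 'p \<Rightarrow> 'p \<Rightarrow> bool" where
  "strict leq x y \<longleftrightarrow> leq x y \<and> x \<noteq> y"

definition poset_chains :: "'p set \<Rightarrow> ('p \<Rightarrow> 'p \<Rightarrow> bool) \<Rightarrow> int \<Rightarrow> 'p list set" where
  "poset_chains P leq j = {c. sorted_wrt (strict leq) c \<and> set c \<subseteq> P \<and> int (length c) = j + 1}"

definition cochains :: "'p set \<Rightarrow> ('p \<Rightarrow> 'p \<Rightarrow> bool) \<Rightarrow> int \<Rightarrow> ('k::field, 'p list \<Rightarrow>\<^sub>0 'k) module" where
  "cochains P leq j = free_module (poset_chains P leq j)"

definition coboundary :: "'p set \<Rightarrow> ('p \<Rightarrow> 'p \<Rightarrow> bool) \<Rightarrow> ('p list \<Rightarrow>\<^sub>0 'k::field) \<Rightarrow> ('p list \<Rightarrow>\<^sub>0 'k)" where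
  "coboundary P leq = lin_ext (\<lambda>c. \<Sum>i\<le>length c. \<Sum>\<alpha> |
      \<alpha> \<in> P \<and> (0 < i \<longrightarrow> strict leq (c ! (i - 1)) \<alpha>) \<and> (i < length c \<longrightarrow> strict leq \<alpha> (c ! i)).
      Poly_Mapping.single (take i c @ \<alpha> # drop i c) ((-1) ^ i))"

definition reduced_cohomology ::
    "'p set \<Rightarrow> ('p \<Rightarrow> 'p \<Rightarrow> bool) \<Rightarrow> int \<Rightarrow> ('k::field, ('p list \<Rightarrow>\<^sub>0 'k) set) module" where
  "reduced_cohomology P leq j = quotient_module
     ((cochains P leq j)\<lparr>carrier := {f \<in> carrier (cochains P leq j). coboundary P leq f = 0}\<rparr>)
     (coboundary P leq ` carrier (cochains P leq (j - 1)))"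

definition open_interval :: "'p set \<Rightarrow> ('p \<Rightarrow> 'p \<Rightarrow> bool) \<Rightarrow> 'p \<Rightarrow> 'p \<Rightarrow> 'p set" where
  "open_interval P leq x y = {z \<in> P. strict leq x z \<and> strict leq z y}"

text \<open>By convention the degenerate interval \<open>(x, x)\<close> has cohomology the ground field in degree
  \<open>-2\<close> only. That copy of the field is realised as the free module on the empty list, so that
  its generator has the same form as the class of a chain.\<close>

definition interval_cohomology :: "'p set \<Rightarrow> ('p \<Rightarrow> 'p \<Rightarrow> bool) \<Rightarrow> 'p \<Rightarrow> 'p \<Rightarrow> int \<Rightarrow>
    ('k::field, ('p list \<Rightarrow>\<^sub>0 'k) set) module" where
  "interval_cohomology P leq x y j =
     (if x = y then quotient_module (free_module (if j = -2 then {[]} else {})) {0}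
      else reduced_cohomology (open_interval P leq x y) leq j)"

definition whitney_cohomology :: "'p set \<Rightarrow> ('p \<Rightarrow> 'p \<Rightarrow> bool) \<Rightarrow> 'p \<Rightarrow> nat \<Rightarrow>
    ('k::field, 'p \<Rightarrow> ('p list \<Rightarrow>\<^sub>0 'k) set) module" where
  "whitney_cohomology P leq b m = direct_sum P (\<lambda>x. interval_cohomology P leq b x (int m - 2))"

text \<open>The class of a top-dimensional chain \<open>c\<close> of the open interval below \<open>x\<close> (or of \<open>[]\<close> in the
  degenerate case), as an element of the summand indexed by \<open>x\<close>. As the zero of a quotient is the
  submodule divided out, the coset is formed in the ambient free module.\<close>

definition chain_class :: "'p set \<Rightarrow> ('p \<Rightarrow> 'p \<Rightarrow> bool) \<Rightarrow> 'p \<Rightarrow> nat \<Rightarrow> 'p \<Rightarrow> 'p list \<Rightarrow>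
    'p \<Rightarrow> ('p list \<Rightarrow>\<^sub>0 'k::field) set" where
  "chain_class P leq b m x c = (\<lambda>y\<in>P.
     let Z = \<zero>\<^bsub>interval_cohomology P leq b y (int m - 2)\<^esub> in
     if y = x then Z +>\<^bsub>free_module UNIV\<^esub> Poly_Mapping.single c 1 else Z)"


section \<open>The poset of weighted partitions\<close>

text \<open>A weighted block \<open>B\<^sup>v\<close> is the pair \<open>(B, v)\<close>.\<close>

type_synonym wpartition = "(nat set \<times> nat) set"

definition wpartitions :: "nat \<Rightarrow> wpartition set" where
  "wpartitions n = {P. partition_on {1..n} (fst ` P) \<and> inj_on fst P \<and>
     (\<forall>(B, v)\<in>P. v \<in> {0..card B - 1})}"

definition wp_le :: "wpartition \<Rightarrow> wpartition \<Rightarrow> bool" where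
  "wp_le P Q \<longleftrightarrow> (\<forall>(A, w)\<in>P. \<exists>(B, v)\<in>Q. A \<subseteq> B) \<and>
     (\<forall>(B, v)\<in>Q. let S = {(A, w) \<in> P. A \<subseteq> B} in
        int v - (\<Sum>(A, w)\<in>S. int w) \<in> {0..int (card S) - 1})"

definition wp_bot :: "nat \<Rightarrow> wpartition" where
  "wp_bot n = (\<lambda>i. ({i}, 0)) ` {1..n}"

definition wp_act :: "(nat \<Rightarrow> nat) \<Rightarrow> wpartition \<Rightarrow> wpartition" where
  "wp_act \<tau> P = (\<lambda>(B, v). (\<tau> ` B, v)) ` P"

definition WH :: "nat \<Rightarrow> nat \<Rightarrow> ('k::field, wpartition \<Rightarrow> (wpartition list \<Rightarrow>\<^sub>0 'k) set) module" where
  "WH n m = whitney_cohomology (wpartitions n) wp_le (wp_bot n) m"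

text \<open>The image of the summand at \<open>x\<close> lies in the summand at \<open>\<tau> x\<close>.\<close>

definition WH_act :: "nat \<Rightarrow> (nat \<Rightarrow> nat) \<Rightarrow> (wpartition \<Rightarrow> (wpartition list \<Rightarrow>\<^sub>0 'k::field) set) \<Rightarrow>
    wpartition \<Rightarrow> (wpartition list \<Rightarrow>\<^sub>0 'k) set" where
  "WH_act n \<tau> f = (\<lambda>y\<in>wpartitions n. push (map (wp_act \<tau>)) ` f (wp_act (Hilbert_Choice.inv \<tau>) y))"


section \<open>The chain of a labelled forest\<close>

fun col_weight :: "color \<Rightarrow> nat" where
  "col_weight Blue = 0"
| "col_weight Red = 1"

definition wt :: "wpartition \<Rightarrow> nat set \<Rightarrow> nat" where
  "wt P B = (THE v. (B, v) \<in> P)"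

definition merge :: "nat \<Rightarrow> nat set \<Rightarrow> nat set \<Rightarrow> wpartition \<Rightarrow> wpartition" where
  "merge u A B P = insert (A \<union> B, wt P A + wt P B + u) {(C, v) \<in> P. C \<noteq> A \<and> C \<noteq> B}"

text \<open>The internal nodes in postorder, each as its colour and the label sets of its subtrees.\<close>

primrec postorder :: "'a btree \<Rightarrow> (color \<times> 'a set \<times> 'a set) list" where
  "postorder (Leaf a) = []"
| "postorder (Node c l r) = postorder l @ postorder r @ [(c, set (leaf_word l), set (leaf_word r))]"

primrec merge_chain :: "wpartition \<Rightarrow> (color \<times> nat set \<times> nat set) list \<Rightarrow> wpartition list" where
  "merge_chain P [] = [P]"
| "merge_chain P (s # ss) =
     P # merge_chain (case s of (c, A, B) \<Rightarrow> merge (col_weight c) A B P) ss"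

definition forest_chain :: "nat \<Rightarrow> nat btree list \<Rightarrow> wpartition list" where
  "forest_chain n G = merge_chain (wp_bot n) (concat (map postorder G))"

definition forest_class :: "nat \<Rightarrow> nat btree list \<Rightarrow> wpartition \<Rightarrow> (wpartition list \<Rightarrow>\<^sub>0 'k::field) set" where
  "forest_class n G = (let c = forest_chain n G; x = last c in
     chain_class (wpartitions n) wp_le (wp_bot n) (n - length G) x
       (filter (\<lambda>p. p \<noteq> wp_bot n \<and> p \<noteq> x) c))"

end

theory Submission
  imports Defs "HOL.Vector_Spaces" "HOL.Rat" "HOL-Library.Multiset" "HOL-Library.Product_Lexorder"
begin

text \<open>Both sides are presented by generators and relations and the presentations are matched. The
  multilinear part of the exterior power is spanned by the labelled forests, modulo swapping of trees,
  antisymmetry and the (mixed) Jacobi relations. On the other side the interval below a weighted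
  partition with \<open>t\<close> blocks has cohomology in its top degree only, because the poset is
  edge-lexicographically labelled by (least element of the first block, least element of the second
  block, weight added); so only the \<open>x\<close> with \<open>r\<close> blocks contribute, and there the cohomology is spanned
  by the maximal chains modulo the sums over all fillings of a chain with one missing rank. Every
  maximal chain arises from a forest by performing its merges in some order; the sign makes the
  class independent of the order. An open rank two interval consists either of two
  elements (merges of two disjoint pairs, giving the independence of the order) or of the three or six
  ways of merging three blocks, whose sum is a Jacobi or mixed Jacobi relation.\<close>

section \<open>Linear algebra of finitely supported functions\<close>

text \<open>Neither side is given a basis: both are quotients of a space of forests, and the two
  spaces of relations are compared. The ambient exterior power is not multilinear, so
  non-multilinear forests are themselves made relators; this settles the alternating law in
  characteristic 2, since a forest with two equal trees is such a relator. The obstacle is the way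
  back from chains to forests: a chain forgets the order of the trees and of the two children of
  each node, and every exchange costs a sign. The relation \<open>real\<close> carries this sign
  along a sequence of merges. It also explains the sign in the statement: a merge performed behind k
  earlier trees contributes (-1)^k. Normalising by least leaves shows that the sign is determined by
  the chain. A relator occurs inside a larger forest, so the merges outside it must act with one
  sign common to all its terms; contexts with a hole provide this. Since Whitney cohomology sums
  over all elements of the poset, surjectivity also needs the cohomology at elements with a wrong
  number of blocks to vanish.\<close>

abbreviation sng :: "'x \<Rightarrow> ('x \<Rightarrow>\<^sub>0 'k::field)" where
  "sng x \<equiv> Poly_Mapping.single x 1"

lemma lookup_scale [simp]: "Poly_Mapping.lookup (scale a f) x = a * Poly_Mapping.lookup f x"
  by (simp add: scale_def Poly_Mapping.map.rep_eq when_def)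

interpretation pm: vector_space "scale :: 'k::field \<Rightarrow> ('x \<Rightarrow>\<^sub>0 'k) \<Rightarrow> _"
  by unfold_locales (auto intro!: poly_mapping_eqI simp: lookup_add algebra_simps)

lemma scale_single [simp]: "scale a (Poly_Mapping.single x b) = Poly_Mapping.single x (a * b)"
  by (rule poly_mapping_eqI) (simp add: lookup_single when_def)

lemma keys_scale: "Poly_Mapping.keys (scale a f) \<subseteq> Poly_Mapping.keys f"
  by (auto simp: in_keys_iff)

text \<open>Linearity is demanded on the whole type. Carriers of free modules then enter only as
  conditions on keys, and no module structure has to be carried through the computations.\<close>

definition lin :: "(('x \<Rightarrow>\<^sub>0 'k::field) \<Rightarrow> ('y \<Rightarrow>\<^sub>0 'k)) \<Rightarrow> bool" where
  "lin h \<longleftrightarrow> (\<forall>f g. h (f + g) = h f + h g) \<and> (\<forall>a f. h (scale a f) = scale a (h f))"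

lemma lin_add: "lin h \<Longrightarrow> h (f + g) = h f + h g"
  and lin_scale: "lin h \<Longrightarrow> h (scale a f) = scale a (h f)"
  by (auto simp: lin_def)

lemma lin_0: "lin h \<Longrightarrow> h 0 = 0"
  using lin_scale[of h 0 0] by simp

lemma lin_minus: "lin h \<Longrightarrow> h (- f) = - h f"
  using lin_scale[of h "-1" f] by simp

lemma lin_diff: "lin h \<Longrightarrow> h (f - g) = h f - h g"
  using lin_add[of h f "- g"] lin_minus[of h g] by simp

lemma lin_sum: "lin h \<Longrightarrow> h (\<Sum>x\<in>A. f x) = (\<Sum>x\<in>A. h (f x))"
  by (induction A rule: infinite_finite_induct) (auto simp: lin_0 lin_add)

lemma lin_comp: "lin h \<Longrightarrow> lin h' \<Longrightarrow> lin (\<lambda>x. h (h' x))"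
  by (auto simp: lin_def)

lemma lin_plus: "lin h \<Longrightarrow> lin h' \<Longrightarrow> lin (\<lambda>x. h x + h' x)"
  by (auto simp: lin_def pm.scale_right_distrib algebra_simps)

lemma lin_uminus: "lin h \<Longrightarrow> lin (\<lambda>x. - h x)"
  by (auto simp: lin_def)

lemma lin_sub: "lin h \<Longrightarrow> lin h' \<Longrightarrow> lin (\<lambda>x. h x - h' x)"
  using lin_plus[of h "\<lambda>x. - h' x"] lin_uminus[of h'] by simp

lemma lin_smult: "lin h \<Longrightarrow> lin (\<lambda>x. scale a (h x))"
  by (auto simp: lin_def pm.scale_right_distrib mult.commute)

lemma lin_id: "lin (\<lambda>x. x)"
  by (auto simp: lin_def)

lemma lin_zero: "lin (\<lambda>x. 0)"
  by (auto simp: lin_def)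

lemma lin_sum_fun: "(\<And>i. i \<in> A \<Longrightarrow> lin (h i)) \<Longrightarrow> lin (\<lambda>x. \<Sum>i\<in>A. h i x)"
  by (induction A rule: infinite_finite_induct) (auto simp: lin_zero intro!: lin_plus)

lemma lin_ext_superset:
  assumes "finite A" "Poly_Mapping.keys f \<subseteq> A"
  shows "lin_ext g f = (\<Sum>x\<in>A. scale (Poly_Mapping.lookup f x) (g x))"
  unfolding lin_ext_def using assms
  by (intro sum.mono_neutral_left) (auto simp: in_keys_iff)

lemma lin_lin_ext [simp]: "lin (lin_ext g)"
proof -
  have "lin_ext g (f + h) = lin_ext g f + lin_ext g h" for f h
  proof -
    let ?A = "Poly_Mapping.keys f \<union> Poly_Mapping.keys h"
    have "Poly_Mapping.keys (f + h) \<subseteq> ?A" by (rule Poly_Mapping.keys_add)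
    then show ?thesis
      by (simp add: lin_ext_superset[of ?A] lookup_add pm.scale_left_distrib sum.distrib)
  qed
  moreover have "lin_ext g (scale a f) = scale a (lin_ext g f)" for a f
    using keys_scale[of a f]
    by (simp add: lin_ext_superset[of "Poly_Mapping.keys f"] pm.scale_sum_right)
  ultimately show ?thesis by (simp add: lin_def)
qed

lemma lin_ext_single [simp]: "lin_ext g (Poly_Mapping.single x a) = scale a (g x)"
  by (cases "a = 0") (simp_all add: lin_ext_def)

lemma lin_push [simp]: "lin (push g)"
  by (simp add: push_def)

lemma push_single [simp]: "push g (Poly_Mapping.single x a) = Poly_Mapping.single (g x) a"
  by (simp add: push_def)

lemma pm_eq_sum: "f = (\<Sum>x\<in>Poly_Mapping.keys f. scale (Poly_Mapping.lookup f x) (sng x))"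
  by (rule poly_mapping_eqI)
    (auto simp: lookup_sum lookup_single when_def in_keys_iff)

text \<open>A function is the combination of the basis vectors at its own keys, so agreement is
  tested only there. Membership of \<open>f\<close> in a carrier is exploited by turning it into a
  property of these keys.\<close>

lemma lin_eqI:
  assumes "lin h" "lin h'" "\<And>x. x \<in> Poly_Mapping.keys f \<Longrightarrow> h (sng x) = h' (sng x)"
  shows "h f = h' f"
proof -
  have "h (\<Sum>x\<in>Poly_Mapping.keys f. scale (Poly_Mapping.lookup f x) (sng x)) =
    h' (\<Sum>x\<in>Poly_Mapping.keys f. scale (Poly_Mapping.lookup f x) (sng x))"
    using assms by (simp add: lin_sum lin_scale del: scale_single)
  then show ?thesis unfolding pm_eq_sum[symmetric] .
qed

lemma lin_ext_sng [simp]: "lin_ext sng f = f"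
  using lin_eqI[of "lin_ext sng" "\<lambda>x. x" f] by (simp add: lin_id)

lemma push_push: "push g (push h f) = push (g \<circ> h) f"
  by (rule lin_eqI) (auto intro: lin_comp)

lemma push_id [simp]: "push (\<lambda>x. x) f = f" "push id f = f"
  by (rule lin_eqI; auto simp: lin_id)+

lemma push_lin_ext: "push g (lin_ext h f) = lin_ext (\<lambda>x. push g (h x)) f"
  by (rule lin_eqI) (auto intro: lin_comp simp: lin_scale)

lemma lin_ext_push: "lin_ext h (push g f) = lin_ext (h \<circ> g) f"
  by (rule lin_eqI) (auto intro: lin_comp)

lemma lin_lin_ext_fun: "(\<And>x. lin (g x)) \<Longrightarrow> lin (\<lambda>z. lin_ext (\<lambda>x. g x z) f)"
  unfolding lin_ext_def by (intro lin_sum_fun lin_smult)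

lemma lin_in_subspace:
  assumes "lin h" "pm.subspace V" "\<And>x. x \<in> Poly_Mapping.keys f \<Longrightarrow> h (sng x) \<in> V"
  shows "h f \<in> V"
proof -
  have "h (\<Sum>x\<in>Poly_Mapping.keys f. scale (Poly_Mapping.lookup f x) (sng x)) \<in> V"
    using assms
    by (auto simp: lin_sum lin_scale simp del: scale_single intro!: pm.subspace_sum pm.subspace_scale)
  then show ?thesis unfolding pm_eq_sum[symmetric] .
qed

lemma subspace_keys: "pm.subspace {f. Poly_Mapping.keys f \<subseteq> A}"
  by (intro pm.subspaceI) (auto dest!: subsetD[OF Poly_Mapping.keys_add] subsetD[OF keys_scale])

lemma lin_ext_keys:
  assumes "\<And>x. x \<in> Poly_Mapping.keys f \<Longrightarrow> Poly_Mapping.keys (g x) \<subseteq> A"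
  shows "Poly_Mapping.keys (lin_ext g f) \<subseteq> A"
  using lin_in_subspace[OF lin_lin_ext subspace_keys[of A], of f g] assms by auto

lemma push_keys: "Poly_Mapping.keys (push g f) \<subseteq> g ` Poly_Mapping.keys f"
  unfolding push_def by (rule lin_ext_keys) auto

lemma lin_span_subset:
  assumes "lin h" "pm.subspace V" "\<And>x. x \<in> S \<Longrightarrow> h x \<in> V" "f \<in> pm.span S"
  shows "h f \<in> V"
  using assms(4)
proof (induction rule: pm.span_induct_alt)
  case base then show ?case using assms by (simp add: lin_0 pm.subspace_0)
next
  case (step c x y) then show ?case
    using assms by (simp add: lin_add lin_scale pm.subspace_add pm.subspace_scale)
qed

lemma subspace_lin_vimage:
  "lin h \<Longrightarrow> pm.subspace V \<Longrightarrow> pm.subspace {f. h f \<in> V}"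
  by (auto simp: pm.subspace_def lin_0 lin_add lin_scale)

lemma subspace_lin_image: "lin h \<Longrightarrow> pm.subspace V \<Longrightarrow> pm.subspace (h ` V)"
  unfolding pm.subspace_def
  by (auto simp flip: lin_add lin_scale intro!: image_eqI[of 0 h 0] simp: lin_0)

lemma sub_trans: "pm.subspace V \<Longrightarrow> f - g \<in> V \<Longrightarrow> g - h \<in> V \<Longrightarrow> f - h \<in> V"
  using pm.subspace_add[of V "f - g" "g - h"] by simp

lemma sub_sym: "pm.subspace V \<Longrightarrow> f - g \<in> V \<Longrightarrow> g - f \<in> V"
  using pm.subspace_neg[of V "f - g"] by simp

section \<open>Cosets\<close>

text \<open>Every module whose cosets are taken below adds with the \<open>+\<close> of the type, so
  all cosets \<open>+>\<close> reduce to this one operation.\<close>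

definition cos :: "'v::ab_group_add set \<Rightarrow> 'v \<Rightarrow> 'v set" where
  "cos U x = (\<lambda>u. u + x) ` U"

definition pm_module :: "('k::field, 'x \<Rightarrow>\<^sub>0 'k, 'm) module_scheme \<Rightarrow> bool" where
  "pm_module M \<longleftrightarrow> add M = (+) \<and> zero M = 0 \<and> smult M = scale \<and> pm.subspace (carrier M)"

lemma pm_module_free [simp]: "pm_module (free_module X)"
  by (simp add: pm_module_def free_module_def subspace_keys)

lemma carrier_free: "carrier (free_module X) = {f. Poly_Mapping.keys f \<subseteq> X}"
  by (simp add: free_module_def)

lemma pm_moduleD [simp]:
  "pm_module M \<Longrightarrow> x \<oplus>\<^bsub>M\<^esub> y = x + y"
  "pm_module M \<Longrightarrow> \<zero>\<^bsub>M\<^esub> = 0"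
  "pm_module M \<Longrightarrow> a \<odot>\<^bsub>M\<^esub> x = scale a x"
  "pm_module M \<Longrightarrow> pm.subspace (carrier M)"
  by (auto simp: pm_module_def)

lemma a_r_coset_pm: "add M = (+) \<Longrightarrow> U +>\<^bsub>M\<^esub> x = cos U x"
  by (auto simp: a_r_coset_defs cos_def)

lemma set_add_cos:
  assumes "add M = (+)" "pm.subspace U"
  shows "cos U x <+>\<^bsub>M\<^esub> cos U y = cos U (x + y)"
proof -
  have "\<exists>u\<in>U. v + x + (w + y) = u + (x + y)" if "v \<in> U" "w \<in> U" for v w
    using that assms by (intro bexI[of _ "v + w"]) (auto simp: pm.subspace_add)
  moreover have "\<exists>v\<in>U. \<exists>w\<in>U. u + (x + y) = (v + x) + (w + y)" if "u \<in> U" for u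
    using that assms by (intro bexI[of _ u] bexI[of _ 0]) (auto simp: pm.subspace_0)
  ultimately show ?thesis using assms(1) by (auto simp: set_add_defs cos_def) 
qed

lemma cos_eq_iff:
  assumes "pm.subspace U"
  shows "cos U x = cos U y \<longleftrightarrow> x - y \<in> U"
proof
  assume "cos U x = cos U y"
  moreover have "x \<in> cos U x" unfolding cos_def using pm.subspace_0[OF assms] by force
  ultimately have "x \<in> cos U y" by simp
  then show "x - y \<in> U" by (auto simp: cos_def)
next
  assume *: "x - y \<in> U"
  have "\<exists>w\<in>U. u + x = w + y" if "u \<in> U" for u
    using that * assms by (intro bexI[of _ "u + (x - y)"]) (auto simp: pm.subspace_add)
  moreover have "\<exists>w\<in>U. u + y = w + x" if "u \<in> U" for u
    using that * assms by (intro bexI[of _ "u - (x - y)"]) (auto simp: pm.subspace_diff)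
  ultimately show "cos U x = cos U y" by (auto simp: cos_def image_iff)
qed

lemma mem_cos: "y \<in> cos U x \<longleftrightarrow> y - x \<in> U"
  unfolding cos_def by (auto simp: image_iff) (metis diff_add_cancel)

lemma self_mem_cos: "pm.subspace U \<Longrightarrow> x \<in> cos U x"
  by (simp add: mem_cos pm.subspace_0)

lemma cos_0 [simp]: "cos U 0 = U"
  by (auto simp: cos_def)

text \<open>The union runs over a nonempty family of equal cosets. This covers the scalar 0 as well,
  where all representatives collapse to the same class.\<close>

lemma smult_cos:
  assumes "add M = (+)" "smult M = scale" "pm.subspace U"
  shows "(\<Union>x\<in>cos U y. U +>\<^bsub>M\<^esub> (a \<odot>\<^bsub>M\<^esub> x)) = cos U (scale a y)"
proof -
  have "U +>\<^bsub>M\<^esub> (a \<odot>\<^bsub>M\<^esub> x) = cos U (scale a y)" if "x \<in> cos U y" for x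
    using that assms pm.subspace_scale[of U "x - y" a]
    by (simp add: cos_eq_iff mem_cos pm.scale_right_diff_distrib a_r_coset_pm)
  then show ?thesis using self_mem_cos[OF assms(3), of y] by blast
qed

lemma carrier_quotient:
  assumes "add M = (+)"
  shows "carrier (quotient_module M U) = cos U ` carrier M"
  using assms by (auto simp: quotient_module_def A_RCOSETS_def' a_r_coset_pm)

lemma add_quotient:
  assumes "add M = (+)" "pm.subspace U"
  shows "cos U x \<oplus>\<^bsub>quotient_module M U\<^esub> cos U y = cos U (x + y)"
  using assms by (simp add: quotient_module_def set_add_cos)

lemma smult_quotient:
  assumes "add M = (+)" "smult M = scale" "pm.subspace U"
  shows "a \<odot>\<^bsub>quotient_module M U\<^esub> cos U x = cos U (scale a x)"
  using smult_cos[OF assms, of a x] assms by (simp add: quotient_module_def)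

lemma zero_quotient [simp]: "\<zero>\<^bsub>quotient_module M U\<^esub> = U"
  by (simp add: quotient_module_def)

lemma submodule_field_iff:
  assumes M: "pm_module M"
  shows "submodule H field_ring M \<longleftrightarrow> pm.subspace H \<and> H \<subseteq> carrier M"
proof
  assume "submodule H field_ring M"
  then interpret submodule H field_ring M .
  have "scale a x \<in> H" if "x \<in> H" for a x
    using smult_closed[of a x] that M by (simp add: field_ring_def)
  moreover have "x + y \<in> H" if "x \<in> H" "y \<in> H" for x y
    using m_closed[of x y] that M by simp
  moreover have "0 \<in> H" using one_closed M by simp
  ultimately show "pm.subspace H \<and> H \<subseteq> carrier M"
    using subset by (auto simp: pm.subspace_def)
next
  assume H: "pm.subspace H \<and> H \<subseteq> carrier M"
  \<comment> \<open>\<open>submodule\<close> asks for closure under the inverse of the additive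
    monoid of \<open>M\<close>, a definite description; the group axioms identify it with
    negation.\<close>
  interpret grp: group "add_monoid M"
  proof (rule groupI)
    fix x assume "x \<in> carrier (add_monoid M)"
    then show "\<exists>y\<in>carrier (add_monoid M). y \<otimes>\<^bsub>add_monoid M\<^esub> x = \<one>\<^bsub>add_monoid M\<^esub>"
      using M by (intro bexI[of _ "- x"]) (auto simp: pm.subspace_neg)
  qed (use M in \<open>auto simp: pm.subspace_add pm.subspace_0\<close>)
  have inv: "m_inv (add_monoid M) x = - x" if "x \<in> carrier M" for x
    using that M by (intro grp.inv_equality) (auto simp: pm.subspace_neg)
  show "submodule H field_ring M"
  proof (intro submodule.intro subgroup.intro submodule_axioms.intro)
    fix x assume "x \<in> H"
    then show "m_inv (add_monoid M) x \<in> H" using H by (subst inv) (auto simp: pm.subspace_neg)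
  qed (use H M in \<open>auto simp: pm.subspace_add pm.subspace_0 pm.subspace_scale\<close>)
qed

lemma module_span_pm:
  assumes M: "pm_module M" and S: "S \<subseteq> carrier M"
  shows "module_span M S = pm.span S"
proof -
  have "pm.span S \<subseteq> carrier M" using M S by (simp add: pm.span_minimal)
  then show ?thesis
    unfolding module_span_def submodule_field_iff[OF M]
    using pm.span_minimal[of S] pm.span_superset[of S] pm.subspace_span[of S] by blast
qed

section \<open>Multilinear forests and their relations\<close>

abbreviation forest_word :: "'a btree list \<Rightarrow> 'a list" where
  "forest_word G \<equiv> concat (map leaf_word G)"

definition MF :: "'a set \<Rightarrow> nat \<Rightarrow> 'a btree list set" where
  "MF X r = {G. length G = r \<and> distinct (forest_word G) \<and> set (forest_word G) = X}"

text \<open>Trees with one hole, represented as functions of the tree put into the hole. The ideal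
  generated by relators is spanned by the relators placed into such contexts, so ideals can be
  handled term by term.\<close>

inductive_set tctx :: "('a btree \<Rightarrow> 'a btree) set" where
  tctx_id: "(\<lambda>t. t) \<in> tctx"
| tctx_left: "H \<in> tctx \<Longrightarrow> (\<lambda>t. Node c (H t) S) \<in> tctx"
| tctx_right: "H \<in> tctx \<Longrightarrow> (\<lambda>t. Node c S (H t)) \<in> tctx"

definition fctx :: "('a btree \<Rightarrow> 'a btree list) set" where
  "fctx = {\<lambda>t. G1 @ H t # G2 | G1 H G2. H \<in> tctx}"

lemma fctxI: "H \<in> tctx \<Longrightarrow> (\<lambda>t. G1 @ H t # G2) \<in> fctx"
  by (auto simp: fctx_def)

lemma fctxE:
  assumes "C \<in> fctx"
  obtains G1 H G2 where "C = (\<lambda>t. G1 @ H t # G2)" "H \<in> tctx"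
  using assms by (auto simp: fctx_def)

text \<open>The introduction rules grow a context at its root; these extensions at the hole are the
  ones needed to descend into a bracket.\<close>

lemma tctx_inner:
  assumes "H \<in> tctx"
  shows "(\<lambda>t. H (Node c t S)) \<in> tctx" "(\<lambda>t. H (Node c S t)) \<in> tctx"
  using assms by (induction) (auto intro: tctx.intros)

lemma fctx_inner:
  assumes "C \<in> fctx"
  shows "(\<lambda>t. C (Node c t S)) \<in> fctx" "(\<lambda>t. C (Node c S t)) \<in> fctx"
  using assms fctxI[OF tctx_inner(1), of _ _ c S] fctxI[OF tctx_inner(2), of _ _ c S]
  by (auto elim!: fctxE)

lemma tctx_mset:
  "H \<in> tctx \<Longrightarrow> mset (leaf_word t) = mset (leaf_word t') \<Longrightarrow>
    mset (leaf_word (H t)) = mset (leaf_word (H t'))"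
  by (induction rule: tctx.induct) auto

lemma fctx_mset:
  "C \<in> fctx \<Longrightarrow> mset (leaf_word t) = mset (leaf_word t') \<Longrightarrow>
    mset (forest_word (C t)) = mset (forest_word (C t'))"
  by (auto elim!: fctxE dest: tctx_mset)

lemma fctx_length: "C \<in> fctx \<Longrightarrow> length (C t) = length (C t')"
  by (auto elim!: fctxE)

lemma MF_cong:
  "length G = length G' \<Longrightarrow> mset (forest_word G) = mset (forest_word G') \<Longrightarrow>
    G \<in> MF X r \<longleftrightarrow> G' \<in> MF X r"
  using mset_eq_imp_distinct_iff[of "forest_word G" "forest_word G'"]
    mset_eq_setD[of "forest_word G" "forest_word G'"]
  unfolding MF_def by simp

lemma MF_swap: "G1 @ S # T # G2 \<in> MF X r \<longleftrightarrow> G1 @ T # S # G2 \<in> MF X r"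
  by (rule MF_cong) auto

lemma MF_fctx:
  "C \<in> fctx \<Longrightarrow> mset (leaf_word t) = mset (leaf_word t') \<Longrightarrow> C t \<in> MF X r \<longleftrightarrow> C t' \<in> MF X r"
  by (intro MF_cong fctx_mset fctx_length)

lemma leaf_word_neq_Nil [simp]: "leaf_word t \<noteq> []"
  by (induction t) auto

text \<open>Outer colour \<open>c\<close>, inner colour \<open>c'\<close>. Equal colours give the
  Jacobi relator of one bracket; the sum of the two mixed choices is the mixed Jacobi
  relator.\<close>

definition jac :: "color \<Rightarrow> color \<Rightarrow> ('a btree \<Rightarrow> 'b) \<Rightarrow> 'a btree \<Rightarrow> 'a btree \<Rightarrow> 'a btree \<Rightarrow>
    ('b \<Rightarrow>\<^sub>0 'k::field)" where
  "jac c c' C x y z = sng (C (Node c x (Node c' y z))) + sng (C (Node c z (Node c' x y)))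
     + sng (C (Node c y (Node c' z x)))"

text \<open>Non-multilinear forests are relators too, so the other relators can be stated for
  arbitrary trees and contexts: all terms of such a relator have the same leaves and are multilinear
  together or not at all.\<close>

definition relgens :: "'a set \<Rightarrow> nat \<Rightarrow> ('a btree list \<Rightarrow>\<^sub>0 'k::field) set" where
  "relgens X r = {sng G | G. G \<notin> MF X r}
   \<union> {sng (G1 @ S # T # G2) + sng (G1 @ T # S # G2) | G1 S T G2. True}
   \<union> {sng (C (Node c S T)) + sng (C (Node c T S)) | C c S T. C \<in> fctx}
   \<union> {jac c c C x y z | C c x y z. C \<in> fctx}
   \<union> {jac Blue Red C x y z + jac Red Blue C x y z | C x y z. C \<in> fctx}"

definition relspace :: "'a set \<Rightarrow> nat \<Rightarrow> ('a btree list \<Rightarrow>\<^sub>0 'k::field) set" where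
  "relspace X r = pm.span (relgens X r)"

lemma subspace_relspace [simp]: "pm.subspace (relspace X r)"
  by (simp add: relspace_def)

lemma relspace_nonMF: "G \<notin> MF X r \<Longrightarrow> sng G \<in> relspace X r"
  unfolding relspace_def by (rule pm.span_base) (auto simp: relgens_def)

lemma relspace_swap: "sng (G1 @ S # T # G2) + sng (G1 @ T # S # G2) \<in> relspace X r"
  unfolding relspace_def by (rule pm.span_base) (unfold relgens_def, blast)

lemma relspace_antisym:
  "C \<in> fctx \<Longrightarrow> sng (C (Node c S T)) + sng (C (Node c T S)) \<in> relspace X r"
  unfolding relspace_def by (rule pm.span_base) (unfold relgens_def, blast)

lemma relspace_jacobi: "C \<in> fctx \<Longrightarrow> jac c c C x y z \<in> relspace X r"
  unfolding relspace_def by (rule pm.span_base) (unfold relgens_def, blast)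

lemma relspace_mixed:
  "C \<in> fctx \<Longrightarrow> jac Blue Red C x y z + jac Red Blue C x y z \<in> relspace X r"
  unfolding relspace_def by (rule pm.span_base) (unfold relgens_def, blast)

text \<open>Passing over one further tree \<open>U\<close> adds two adjacent exchanges, so the total
  number of sign changes stays odd.\<close>

lemma relspace_swap_far:
  "(sng (P @ S # G @ T # Q) + sng (P @ T # G @ S # Q) :: _ \<Rightarrow>\<^sub>0 'k::field) \<in> relspace X r"
proof (induction G arbitrary: P)
  case Nil
  then show ?case using relspace_swap[of P S T Q] by simp
next
  case (Cons U G)
  let ?a = "sng (P @ S # U # G @ T # Q) :: _ \<Rightarrow>\<^sub>0 'k" and ?b = "sng (P @ U # S # G @ T # Q) :: _ \<Rightarrow>\<^sub>0 'k"
    and ?c = "sng (P @ U # T # G @ S # Q) :: _ \<Rightarrow>\<^sub>0 'k" and ?d = "sng (P @ T # U # G @ S # Q) :: _ \<Rightarrow>\<^sub>0 'k"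
  have "?a + ?b \<in> relspace X r" "?c + ?d \<in> relspace X r"
    by (rule relspace_swap)+
  moreover have "?b + ?c \<in> relspace X r" using Cons[of "P @ [U]"] by simp
  ultimately have "(?a + ?b) - (?b + ?c) + (?c + ?d) \<in> relspace X r"
    using pm.subspace_add[OF subspace_relspace] pm.subspace_diff[OF subspace_relspace] by blast
  then show ?case by (simp add: algebra_simps)
qed

section \<open>Multilinear expansion\<close>

lemma sub_diff3:
  "pm.subspace V \<Longrightarrow> a \<in> V \<Longrightarrow> b \<in> V \<Longrightarrow> c \<in> V \<Longrightarrow> a - b - c \<in> V"
  by (simp add: pm.subspace_diff)

lemma bilin_in_subspace:
  assumes "\<And>y. lin (\<lambda>x. B x y)" "\<And>x. lin (B x)" "pm.subspace V"
    "\<And>S T. S \<in> Poly_Mapping.keys x \<Longrightarrow> T \<in> Poly_Mapping.keys y \<Longrightarrow> B (sng S) (sng T) \<in> V"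
  shows "B x y \<in> V"
proof (rule lin_in_subspace[of "\<lambda>x. B x y"])
  fix S assume "S \<in> Poly_Mapping.keys x"
  then show "B (sng S) y \<in> V" using assms by (auto intro: lin_in_subspace[of "B (sng S)"])
qed (use assms in auto)

text \<open>Expanding along a basis leaves squares and symmetrised mixed terms. The squares of basis
  vectors form a separate assumption because in characteristic 2 they do not follow from the mixed
  terms.\<close>

lemma quad_in_subspace:
  assumes B: "\<And>y. lin (\<lambda>x. B x y)" "\<And>x. lin (B x)" and V: "pm.subspace V"
    and "\<And>S T. B (sng S) (sng T) + B (sng T) (sng S) \<in> V" "\<And>S. B (sng S) (sng S) \<in> V"
  shows "B x x \<in> V"
proof -
  have sym: "B x y + B y x \<in> V" for x y
    using assms by (rule_tac bilin_in_subspace[of "\<lambda>x y. B x y + B y x"]) (auto intro: lin_plus)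
  have "finite A \<Longrightarrow> B (\<Sum>S\<in>A. scale (c S) (sng S)) (\<Sum>S\<in>A. scale (c S) (sng S)) \<in> V" for A c
  proof (induction rule: finite_induct)
    case empty
    then show ?case using lin_0[OF B(2)] V by (simp add: pm.subspace_0)
  next
    case (insert S A)
    let ?x = "\<Sum>S\<in>A. scale (c S) (sng S)" and ?s = "scale (c S) (sng S)"
    have "B (?s + ?x) (?s + ?x) = B ?s ?s + (B ?s ?x + B ?x ?s) + B ?x ?x"
      using lin_add[OF B(1)] lin_add[OF B(2)] by (simp add: algebra_simps del: scale_single)
    moreover have "B ?s ?s = scale (c S) (scale (c S) (B (sng S) (sng S)))"
      using lin_scale[OF B(1)] lin_scale[OF B(2)] by metis
    then have "B ?s ?s \<in> V" using assms by (simp add: pm.subspace_scale)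
    ultimately show ?case using insert sym[of ?s ?x] V
      by (simp add: pm.subspace_add del: scale_single)
  qed
  from this[OF finite_keys[of x], of "Poly_Mapping.lookup x"] show ?thesis
    unfolding pm_eq_sum[symmetric] .
qed

text \<open>The tensor product of the entries, expanded in the basis of forests.\<close>

primrec mexp :: "('a btree \<Rightarrow>\<^sub>0 'k::field) list \<Rightarrow> ('a btree list \<Rightarrow>\<^sub>0 'k)" where
  "mexp [] = sng []"
| "mexp (x # xs) = lin_ext (\<lambda>T. push ((#) T) (mexp xs)) x"

lemma lin_mexp: "lin (\<lambda>x. mexp (l1 @ x # l2))"
  by (induction l1) (auto intro!: lin_lin_ext_fun intro: lin_comp)

lemma push_append_Nil: "push ((@) []) f = f"
  by (rule lin_eqI) (auto simp: lin_id)

lemma mexp_append: "mexp (l1 @ l2) = lin_ext (\<lambda>G. push ((@) G) (mexp l2)) (mexp l1)"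
proof (induction l1)
  case Nil
  then show ?case by (simp add: push_append_Nil)
next
  case (Cons x l1)
  have "push ((#) T) (lin_ext (\<lambda>G. push ((@) G) (mexp l2)) (mexp l1)) =
    lin_ext (\<lambda>G. push ((@) G) (mexp l2)) (push ((#) T) (mexp l1))" for T
    using append_Cons[abs_def, of T] by (simp add: push_lin_ext lin_ext_push push_push o_def)
  then show ?case using Cons
    by (simp, rule_tac lin_eqI) (auto intro: lin_comp)
qed

text \<open>Elements that vanish modulo \<open>relspace\<close> at every position of every forest.
  This is large enough to contain the Lie ideal, and \<open>mexp\<close> kills it in each
  slot.\<close>

definition fideal :: "'a set \<Rightarrow> nat \<Rightarrow> ('a btree \<Rightarrow>\<^sub>0 'k::field) set" where
  "fideal X r = {f. \<forall>C\<in>fctx. push C f \<in> relspace X r}"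

lemma subspace_fideal [simp]: "pm.subspace (fideal X r)"
  by (auto simp: pm.subspace_def fideal_def lin_0 lin_add lin_scale)
    (simp_all add: pm.subspace_0 pm.subspace_add pm.subspace_scale)

text \<open>Once all other slots are expanded into trees, \<open>x\<close> fills the hole of a
  forest context. The prefix \<open>P\<close> collects the trees already chosen on the left.\<close>

lemma mexp_fideal:
  assumes "x \<in> fideal X r"
  shows "mexp (l1 @ x # l2) \<in> relspace X r"
proof -
  have "push ((@) P) (mexp (l1 @ x # l2)) \<in> relspace X r" for P
  proof (induction l1 arbitrary: P)
    case Nil
    have "push ((@) P) (lin_ext (\<lambda>T. push ((#) T) h) x) \<in> relspace X r" for h
    proof (rule lin_in_subspace[of "\<lambda>h. push ((@) P) (lin_ext (\<lambda>T. push ((#) T) h) x)"])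
      show "lin (\<lambda>h. push ((@) P) (lin_ext (\<lambda>T. push ((#) T) h) x))"
        by (intro lin_comp[OF lin_push] lin_lin_ext_fun lin_push)
      fix G
      have "push ((@) P) (lin_ext (\<lambda>T. push ((#) T) (sng G)) x) = push (\<lambda>T. P @ T # G) x"
        unfolding push_lin_ext by (simp add: push_def)
      then show "push ((@) P) (lin_ext (\<lambda>T. push ((#) T) (sng G)) x) \<in> relspace X r"
        using assms fctxI[OF tctx_id, of P G] by (auto simp: fideal_def)
    qed simp
    then show ?case by simp
  next
    case (Cons y l1)
    have "((@) P \<circ> (#) T) = (@) (P @ [T])" for T by auto
    then have "push ((@) P) (mexp ((y # l1) @ x # l2)) =
      lin_ext (\<lambda>T. push ((@) (P @ [T])) (mexp (l1 @ x # l2))) y"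
      by (simp add: push_lin_ext push_push)
    also have "\<dots> \<in> relspace X r"
      by (rule lin_in_subspace) (auto simp: Cons simp del: append_assoc)
    finally show ?case .
  qed
  from this[of "[]"] show ?thesis by (simp add: push_append_Nil)
qed

text \<open>A tree occurring twice repeats its labels, which is a non-multilinear relator; mixed
  terms cancel by exchanging two distant trees. In this way antisymmetry yields the alternating law
  in every characteristic.\<close>

lemma mexp_eq_entries: "mexp (l1 @ x # l2 @ x # l3) \<in> relspace X r"
proof -
  have two: "mexp (sng S # l2 @ sng T # l3) =
      lin_ext (\<lambda>G2. lin_ext (\<lambda>G3. sng (S # G2 @ T # G3)) (mexp l3)) (mexp l2)" for S T
    unfolding mexp.simps mexp_append
    by (simp add: push_lin_ext push_push o_def) (simp add: push_def)
  have "mexp (l1 @ x # l2 @ y # l3) = lin_ext (\<lambda>P. push ((@) P) (mexp (x # l2 @ y # l3))) (mexp l1)" for y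
    by (rule mexp_append)
  moreover have "push ((@) P) (mexp (x # l2 @ x # l3)) \<in> relspace X r" for P
  proof (rule quad_in_subspace[of "\<lambda>x y. push ((@) P) (mexp (x # l2 @ y # l3))"])
    show "lin (\<lambda>x. push ((@) P) (mexp (x # l2 @ y # l3)))" for y
      using lin_mexp[of "[]"] by (intro lin_comp[OF lin_push]) auto
    show "lin (\<lambda>y. push ((@) P) (mexp (x # l2 @ y # l3)))" for x
      using lin_mexp[of "x # l2"] by (intro lin_comp[OF lin_push]) auto
    show "push ((@) P) (mexp (sng S # l2 @ sng T # l3)) +
      push ((@) P) (mexp (sng T # l2 @ sng S # l3)) \<in> relspace X r" for S T
    proof -
      have "lin_ext (\<lambda>G2. lin_ext (\<lambda>G3. sng (P @ S # G2 @ T # G3)) h3) h2 +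
        lin_ext (\<lambda>G2. lin_ext (\<lambda>G3. sng (P @ T # G2 @ S # G3)) h3) h2 \<in> relspace X r" for h2 h3
        by (rule bilin_in_subspace[where B = "\<lambda>h2 h3. lin_ext (\<lambda>G2. lin_ext (\<lambda>G3. sng (P @ S # G2 @ T # G3)) h3) h2 +
        lin_ext (\<lambda>G2. lin_ext (\<lambda>G3. sng (P @ T # G2 @ S # G3)) h3) h2"])
          (auto intro!: lin_plus lin_lin_ext_fun relspace_swap_far)
      then show ?thesis unfolding two push_lin_ext by simp
    qed
    show "push ((@) P) (mexp (sng S # l2 @ sng S # l3)) \<in> relspace X r" for S
    proof -
      have "P @ S # G2 @ S # G3 \<notin> MF X r" for G2 G3
        by (cases "leaf_word S") (auto simp: MF_def)
      then have "lin_ext (\<lambda>G2. lin_ext (\<lambda>G3. sng (P @ S # G2 @ S # G3)) h3) h2 \<in> relspace X r" for h2 h3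
        by (rule_tac bilin_in_subspace[where B = "\<lambda>h2 h3. lin_ext (\<lambda>G2. lin_ext (\<lambda>G3. sng (P @ S # G2 @ S # G3)) h3) h2"])
          (auto intro!: lin_lin_ext_fun relspace_nonMF)
      then show ?thesis unfolding two push_lin_ext by simp
    qed
  qed simp
  ultimately show ?thesis
    using lin_in_subspace[OF lin_lin_ext, of "relspace X r" _ "\<lambda>P. push ((@) P) (mexp (x # l2 @ x # l3))"]
    by simp
qed

lemma mexp_cong_fideal:
  assumes "list_all2 (\<lambda>x y. x - y \<in> fideal X r) xs ys"
  shows "mexp (l @ xs) - mexp (l @ ys) \<in> relspace X r"
  using assms
proof (induction arbitrary: l rule: list_all2_induct)
  case Nil
  then show ?case by (simp add: pm.subspace_0)
next
  case (Cons x xs y ys)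
  have "mexp (l @ x # xs) - mexp (l @ y # xs) \<in> relspace X r"
    using mexp_fideal[OF Cons(1), of l xs] lin_diff[OF lin_mexp] by metis
  moreover have "mexp (l @ y # xs) - mexp (l @ y # ys) \<in> relspace X r"
    using Cons.IH[of "l @ [y]"] by simp
  ultimately show ?case by (rule sub_trans[rotated]) simp
qed

lemma mexp_sng: "mexp (map sng G) = sng G"
  by (induction G) auto


section \<open>The free compatible Lie algebra\<close>

lemma lin_free_bracket_left: "lin (\<lambda>f. free_bracket c f g)"
  by (simp add: free_bracket_def)

lemma lin_free_bracket_right: "lin (free_bracket c f)"
  unfolding free_bracket_def by (intro lin_lin_ext_fun lin_push)

lemma free_bracket_sng [simp]: "free_bracket c (sng S) (sng T) = sng (Node c S T)"
  by (simp add: free_bracket_def)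

lemma free_bracket_sng_left: "free_bracket c (sng S) g = push (Node c S) g"
  by (simp add: free_bracket_def)

lemma free_bracket_sng_right: "free_bracket c f (sng T) = push (\<lambda>S. Node c S T) f"
  by (simp add: free_bracket_def push_def)

lemma carrier_free_alg: "carrier (free_alg X) = {f. Poly_Mapping.keys f \<subseteq> {T. set (leaf_word T) \<subseteq> X}}"
  by (simp add: free_alg_def carrier_free)

lemma pm_module_free_alg [simp]: "pm_module (free_alg X)"
  by (simp add: free_alg_def)

lemma sng_free_alg: "set (leaf_word T) \<subseteq> X \<Longrightarrow> sng T \<in> carrier (free_alg X)"
  by (simp add: carrier_free_alg)

lemma free_bracket_closed:
  assumes "x \<in> carrier (free_alg X)" "y \<in> carrier (free_alg X)"
  shows "free_bracket c x y \<in> carrier (free_alg X)"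
proof (rule bilin_in_subspace[where B = "free_bracket c"])
  fix S T assume "S \<in> Poly_Mapping.keys x" "T \<in> Poly_Mapping.keys y"
  then show "free_bracket c (sng S) (sng T) \<in> carrier (free_alg X)"
    using assms by (auto simp: carrier_free_alg)
qed (auto intro: lin_free_bracket_left lin_free_bracket_right)

definition closed_ideal :: "'a set \<Rightarrow> ('a btree \<Rightarrow>\<^sub>0 'k::field) set \<Rightarrow> bool" where
  "closed_ideal X J \<longleftrightarrow> pm.subspace J \<and> J \<subseteq> carrier (free_alg X) \<and> lie_relations X \<subseteq> J \<and>
     (\<forall>c. \<forall>x\<in>carrier (free_alg X). \<forall>y\<in>J. free_bracket c x y \<in> J \<and> free_bracket c y x \<in> J)"

lemma lie_ideal_eq: "lie_ideal X = \<Inter>{J. closed_ideal X J}"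
  unfolding lie_ideal_def closed_ideal_def submodule_field_iff[OF pm_module_free_alg]
  by (simp add: conj_assoc)

lemma lie_relations_subset: "lie_relations X \<subseteq> carrier (free_alg X)"
  unfolding lie_relations_def
  by (auto intro!: pm.subspace_add[OF pm_moduleD(4)] free_bracket_closed)

text \<open>Shows that the family intersected in \<open>lie_ideal\<close> is nonempty, which places
  the intersection inside the carrier.\<close>

lemma closed_ideal_carrier: "closed_ideal X (carrier (free_alg X))"
  by (auto simp: closed_ideal_def free_bracket_closed dest: subsetD[OF lie_relations_subset])

lemma closed_ideal_lie_ideal: "closed_ideal X (lie_ideal X)"
proof -
  have "lie_ideal X \<subseteq> carrier (free_alg X)"
    using closed_ideal_carrier by (auto simp: lie_ideal_eq)
  then show ?thesis
    unfolding closed_ideal_def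
    by (auto simp: lie_ideal_eq closed_ideal_def intro!: pm.subspace_Inter)
qed

lemma subspace_lie_ideal [simp]: "pm.subspace (lie_ideal X)"
  and lie_ideal_carrier: "lie_ideal X \<subseteq> carrier (free_alg X)"
  and lie_ideal_relations: "lie_relations X \<subseteq> lie_ideal X"
  and lie_ideal_bracket:
    "x \<in> carrier (free_alg X) \<Longrightarrow> y \<in> lie_ideal X \<Longrightarrow> free_bracket c x y \<in> lie_ideal X"
    "x \<in> carrier (free_alg X) \<Longrightarrow> y \<in> lie_ideal X \<Longrightarrow> free_bracket c y x \<in> lie_ideal X"
  using closed_ideal_lie_ideal[of X] by (auto simp: closed_ideal_def)

lemma lie_ideal_minimal: "closed_ideal X J \<Longrightarrow> lie_ideal X \<subseteq> J"
  by (auto simp: lie_ideal_eq)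

lemma fideal_relation:
  assumes "\<And>C. C \<in> fctx \<Longrightarrow> push C f \<in> relspace X r"
  shows "f \<in> fideal X r"
  using assms by (auto simp: fideal_def)

lemma trilin_in_subspace:
  assumes "\<And>y z. lin (\<lambda>x. B x y z)" "\<And>x z. lin (\<lambda>y. B x y z)" "\<And>x y. lin (B x y)" "pm.subspace V"
    "\<And>S T U. B (sng S) (sng T) (sng U) \<in> V"
  shows "B x y z \<in> V"
proof (rule lin_in_subspace[of "\<lambda>x. B x y z"])
  show "B (sng S) y z \<in> V" for S
    using assms by (rule_tac bilin_in_subspace[of "B (sng S)"]) auto
qed (use assms in auto)

lemma lie_relations_fideal: "lie_relations Y \<subseteq> fideal X r"
proof -
  note lins = lin_plus lin_comp[OF lin_free_bracket_left] lin_comp[OF lin_free_bracket_right]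
    lin_free_bracket_left lin_free_bracket_right
  have 1: "free_bracket c x y + free_bracket c y x \<in> fideal X r" for c and x y :: "'a btree \<Rightarrow>\<^sub>0 'b"
    by (rule bilin_in_subspace[where B = "\<lambda>x y. free_bracket c x y + free_bracket c y x"])
      (auto intro!: lins fideal_relation simp: lin_add[OF lin_push] relspace_antisym)
  have 2: "free_bracket c x (free_bracket c y z) + free_bracket c z (free_bracket c x y)
        + free_bracket c y (free_bracket c z x) \<in> fideal X r" for c and x y z :: "'a btree \<Rightarrow>\<^sub>0 'b"
    by (rule trilin_in_subspace[where B = "\<lambda>x y z. free_bracket c x (free_bracket c y z)
        + free_bracket c z (free_bracket c x y) + free_bracket c y (free_bracket c z x)"])
      (auto intro!: lins fideal_relation simp: lin_add[OF lin_push] relspace_jacobi[unfolded jac_def])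
  have 3: "free_bracket Blue x (free_bracket Red y z) + free_bracket Blue z (free_bracket Red x y)
        + free_bracket Blue y (free_bracket Red z x) + free_bracket Red x (free_bracket Blue y z)
        + free_bracket Red z (free_bracket Blue x y) + free_bracket Red y (free_bracket Blue z x)
        \<in> fideal X r" for x y z :: "'a btree \<Rightarrow>\<^sub>0 'b"
    using relspace_mixed[of _ _ _ _ X r]
    by (rule_tac trilin_in_subspace[where B = "\<lambda>x y z. free_bracket Blue x (free_bracket Red y z)
        + free_bracket Blue z (free_bracket Red x y) + free_bracket Blue y (free_bracket Red z x)
        + free_bracket Red x (free_bracket Blue y z)
        + free_bracket Red z (free_bracket Blue x y) + free_bracket Red y (free_bracket Blue z x)"])
      (auto intro!: lins fideal_relation simp: lin_add[OF lin_push] jac_def add.assoc)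
  show ?thesis unfolding lie_relations_def using 1 2 3 by auto
qed

text \<open>Bracketing with a tree is absorbed into the context around the hole. Hence the part of
  \<open>fideal\<close> inside the carrier is an ideal containing the relations, and
  \<open>lie_ideal\<close> is the least such ideal.\<close>

lemma lie_ideal_fideal:
  fixes X Y :: "'a set"
  shows "lie_ideal Y \<subseteq> (fideal X r :: ('a btree \<Rightarrow>\<^sub>0 'k::field) set)"
proof -
  have br: "free_bracket c x y \<in> fideal X r" "free_bracket c y x \<in> fideal X r"
    if y: "y \<in> fideal X r" for c and x y :: "'a btree \<Rightarrow>\<^sub>0 'k"
  proof -
    have "push C (free_bracket c (sng S) y) \<in> relspace X r"
      "push C (free_bracket c y (sng S)) \<in> relspace X r" if "C \<in> fctx" for C S
      using y fctx_inner[OF that, of c S]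
      by (auto simp: free_bracket_sng_left free_bracket_sng_right push_push o_def fideal_def)
    then have *: "free_bracket c (sng S) y \<in> fideal X r" "free_bracket c y (sng S) \<in> fideal X r" for S
      by (auto simp: fideal_def)
    show "free_bracket c x y \<in> fideal X r"
      by (rule lin_in_subspace[OF lin_free_bracket_left subspace_fideal]) (rule *)
    show "free_bracket c y x \<in> fideal X r"
      by (rule lin_in_subspace[OF lin_free_bracket_right subspace_fideal]) (rule *)
  qed
  have "closed_ideal Y (carrier (free_alg Y) \<inter> (fideal X r :: ('a btree \<Rightarrow>\<^sub>0 'k) set))"
    unfolding closed_ideal_def
  proof (intro conjI allI ballI)
    show "lie_relations Y \<subseteq> carrier (free_alg Y) \<inter> (fideal X r :: ('a btree \<Rightarrow>\<^sub>0 'k) set)"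
      using lie_relations_fideal lie_relations_subset by (rule Int_greatest[rotated])
    show "pm.subspace (carrier (free_alg Y) \<inter> (fideal X r :: ('a btree \<Rightarrow>\<^sub>0 'k) set))"
      by (rule pm.subspace_inter) simp_all
    fix c and x y :: "'a btree \<Rightarrow>\<^sub>0 'k"
    assume xy: "x \<in> carrier (free_alg Y)" "y \<in> carrier (free_alg Y) \<inter> fideal X r"
    then show "free_bracket c x y \<in> carrier (free_alg Y) \<inter> fideal X r"
      by (intro IntI br free_bracket_closed) simp_all
    show "free_bracket c y x \<in> carrier (free_alg Y) \<inter> fideal X r"
      using xy by (intro IntI br free_bracket_closed) simp_all
  qed simp
  then have "lie_ideal Y \<subseteq> carrier (free_alg Y) \<inter> (fideal X r :: ('a btree \<Rightarrow>\<^sub>0 'k) set)"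
    by (rule lie_ideal_minimal)
  then show ?thesis by blast
qed

lemma add_free_alg: "add (free_alg X) = (+)" and smult_free_alg: "smult (free_alg X) = scale"
  using pm_module_free_alg[of X] unfolding pm_module_def by blast+

lemma carrier_lie2: "carrier (lie2 X) = cos (lie_ideal X) ` carrier (free_alg X)"
  by (simp add: lie2_def carrier_quotient add_free_alg)

lemma add_lie2: "cos (lie_ideal X) x \<oplus>\<^bsub>lie2 X\<^esub> cos (lie_ideal X) y = cos (lie_ideal X) (x + y)"
  by (simp add: lie2_def add_quotient add_free_alg)

lemma smult_lie2: "a \<odot>\<^bsub>lie2 X\<^esub> cos (lie_ideal X) x = cos (lie_ideal X) (scale a x)"
  by (simp add: lie2_def smult_quotient add_free_alg smult_free_alg)

text \<open>Changing either factor by an element of the ideal changes the bracket by an element of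
  the ideal, so the union in \<open>lie_bracket\<close> consists of a single coset.\<close>

lemma lie_bracket_cos:
  assumes "x \<in> carrier (free_alg X)" "y \<in> carrier (free_alg X)"
  shows "lie_bracket X c (cos (lie_ideal X) x) (cos (lie_ideal X) y) = cos (lie_ideal X) (free_bracket c x y)"
proof -
  have "cos (lie_ideal X) (free_bracket c a b) = cos (lie_ideal X) (free_bracket c x y)"
    if "a \<in> cos (lie_ideal X) x" "b \<in> cos (lie_ideal X) y" for a b
  proof -
    have "free_bracket c a b - free_bracket c x y = free_bracket c (a - x) b + free_bracket c x (b - y)"
      by (simp add: lin_diff[OF lin_free_bracket_left] lin_diff[OF lin_free_bracket_right])
    moreover have "b \<in> carrier (free_alg X)"
      using that assms lie_ideal_carrier[of X] pm.subspace_add[of "carrier (free_alg X)" "b - y" y]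
      by (auto simp: mem_cos)
    ultimately show ?thesis
      using that assms lie_ideal_bracket by (auto simp: cos_eq_iff mem_cos intro!: pm.subspace_add)
  qed
  then show ?thesis
    unfolding lie_bracket_def a_r_coset_pm[OF add_free_alg]
    using self_mem_cos[OF subspace_lie_ideal[of X], of x] self_mem_cos[OF subspace_lie_ideal[of X], of y]
    by blast
qed

lemma bracketing_eq:
  "set (leaf_word T) \<subseteq> X \<Longrightarrow> bracketing X T = cos (lie_ideal X) (sng T)"
  by (induction T) (auto simp: a_r_coset_pm add_free_alg lie_bracket_cos sng_free_alg)


section \<open>The exterior power\<close>

lemma lie2_closed:
  assumes "A \<in> carrier (lie2 X)" "B \<in> carrier (lie2 X)"
  shows "A \<oplus>\<^bsub>lie2 X\<^esub> B \<in> carrier (lie2 X)" "a \<odot>\<^bsub>lie2 X\<^esub> A \<in> carrier (lie2 X)"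
  using assms
  by (auto simp: carrier_lie2 add_lie2 smult_lie2 intro!: imageI pm.subspace_add pm.subspace_scale)

lemma tuple_module_carrier:
  "carrier (tuple_module r V) = {f. Poly_Mapping.keys f \<subseteq> {xs. length xs = r \<and> set xs \<subseteq> carrier V}}"
  by (simp add: tuple_module_def carrier_free)

lemma pm_module_tuple [simp]: "pm_module (tuple_module r V)"
  by (simp add: tuple_module_def)

lemma add_tuple: "add (tuple_module r V) = (+)" and smult_tuple: "smult (tuple_module r V) = scale"
  using pm_module_tuple[of r V] unfolding pm_module_def by blast+

lemma sng_tuple: "length xs = r \<Longrightarrow> set xs \<subseteq> carrier V \<Longrightarrow> Poly_Mapping.single xs a \<in> carrier (tuple_module r V)"
  by (simp add: tuple_module_carrier)

lemma ext_relations_carrier: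
  "ext_relations r (lie2 X) \<subseteq> carrier (tuple_module r (lie2 X))"
  unfolding ext_relations_def
  by (auto intro!: pm.subspace_diff[OF pm_moduleD(4)] sng_tuple lie2_closed
      dest!: subsetD[OF set_update_subset_insert])

lemma ext_kernel_eq: "ext_kernel r (lie2 X) = pm.span (ext_relations r (lie2 X))"
  unfolding ext_kernel_def by (rule module_span_pm) (auto simp: subsetD[OF ext_relations_carrier])

lemma subspace_ext_kernel [simp]: "pm.subspace (ext_kernel r (lie2 X))"
  by (simp add: ext_kernel_eq)

section \<open>Linearity in a single slot modulo the kernel of the exterior power\<close>

context
  fixes X :: "'a set" and r :: nat and l1 l2 :: "('a btree \<Rightarrow>\<^sub>0 'k::field) set list"
  assumes len: "Suc (length l1 + length l2) = r"
    and l12: "set l1 \<subseteq> carrier (lie2 X)" "set l2 \<subseteq> carrier (lie2 X)"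
begin

lemma ext_kernel_add:
  assumes "x \<in> carrier (free_alg X)" "y \<in> carrier (free_alg X)"
  shows "sng (l1 @ cos (lie_ideal X) (x + y) # l2) - sng (l1 @ cos (lie_ideal X) x # l2)
    - sng (l1 @ cos (lie_ideal X) y # l2) \<in> ext_kernel r (lie2 X)"
proof -
  let ?xs = "l1 @ cos (lie_ideal X) x # l2" and ?i = "length l1"
  have "sng (?xs[?i := cos (lie_ideal X) x \<oplus>\<^bsub>lie2 X\<^esub> cos (lie_ideal X) y])
    - sng (?xs[?i := cos (lie_ideal X) x]) - sng (?xs[?i := cos (lie_ideal X) y]) \<in> ext_relations r (lie2 X)"
    unfolding ext_relations_def using assms len l12
    by (intro UnI1 CollectI exI[of _ ?xs] exI[of _ ?i] exI) (auto simp: carrier_lie2)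
  then show ?thesis by (simp add: add_lie2 ext_kernel_eq pm.span_base)
qed

lemma ext_kernel_scale:
  assumes "x \<in> carrier (free_alg X)"
  shows "sng (l1 @ cos (lie_ideal X) (scale a x) # l2) - scale a (sng (l1 @ cos (lie_ideal X) x # l2))
    \<in> ext_kernel r (lie2 X)"
proof -
  let ?xs = "l1 @ cos (lie_ideal X) x # l2" and ?i = "length l1"
  have "sng (?xs[?i := a \<odot>\<^bsub>lie2 X\<^esub> cos (lie_ideal X) x])
    - Poly_Mapping.single (?xs[?i := cos (lie_ideal X) x]) a \<in> ext_relations r (lie2 X)"
    unfolding ext_relations_def using assms len l12
    by (intro UnI1 UnI2 CollectI exI[of _ ?xs] exI[of _ ?i] exI) (auto simp: carrier_lie2)
  then show ?thesis by (simp add: smult_lie2 ext_kernel_eq pm.span_base)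
qed

lemma ext_kernel_zero: "sng (l1 @ lie_ideal X # l2) \<in> ext_kernel r (lie2 X)"
  using ext_kernel_scale[of 0 0] by (simp add: carrier_free_alg)

text \<open>The relators give binary additivity and homogeneity only; induction over the support
  extends them to the expansion of a whole slot into trees.\<close>

lemma ext_kernel_lin_ext:
  assumes f: "f \<in> carrier (free_alg X)"
  shows "lin_ext (\<lambda>T. sng (l1 @ cos (lie_ideal X) (sng T) # l2)) f - sng (l1 @ cos (lie_ideal X) f # l2)
    \<in> ext_kernel r (lie2 X)"
proof -
  let ?s = "\<lambda>f. sng (l1 @ cos (lie_ideal X) f # l2)" and ?V = "ext_kernel r (lie2 X)"
  have "finite A \<Longrightarrow> A \<subseteq> {T. set (leaf_word T) \<subseteq> X} \<Longrightarrow>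
    (\<Sum>S\<in>A. scale (c S) (sng S)) \<in> carrier (free_alg X) \<and>
    lin_ext (\<lambda>T. ?s (sng T)) (\<Sum>S\<in>A. scale (c S) (sng S)) - ?s (\<Sum>S\<in>A. scale (c S) (sng S)) \<in> ?V" for A c
  proof (induction rule: finite_induct)
    case empty
    then show ?case using ext_kernel_zero pm.subspace_neg[OF subspace_ext_kernel]
      by (simp add: carrier_free_alg lin_0[OF lin_lin_ext] del: pm.subspace_neg)
  next
    case (insert S A)
    let ?x = "\<Sum>S\<in>A. scale (c S) (sng S)" and ?y = "scale (c S) (sng S)"
    have S: "sng S \<in> carrier (free_alg X)" using insert by (auto intro: sng_free_alg)
    have y: "?y \<in> carrier (free_alg X)" using S by (intro pm.subspace_scale) auto
    have x: "?x \<in> carrier (free_alg X)" "lin_ext (\<lambda>T. ?s (sng T)) ?x - ?s ?x \<in> ?V"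
      using insert by auto
    have "lin_ext (\<lambda>T. ?s (sng T)) (?y + ?x) - ?s (?y + ?x) =
      (lin_ext (\<lambda>T. ?s (sng T)) ?x - ?s ?x) - (?s ?y - scale (c S) (?s (sng S)))
      - (?s (?y + ?x) - ?s ?y - ?s ?x)"
      by (simp add: lin_add[OF lin_lin_ext] lin_scale[OF lin_lin_ext] del: scale_single)
    also have "\<dots> \<in> ?V"
      by (rule sub_diff3[OF subspace_ext_kernel x(2) ext_kernel_scale[OF S] ext_kernel_add[OF y x(1)]])
    finally show ?case using insert x y by (simp add: pm.subspace_add del: scale_single)
  qed
  from this[OF finite_keys[of f], of "Poly_Mapping.lookup f"] f show ?thesis
    unfolding pm_eq_sum[symmetric] by (simp add: carrier_free_alg)
qed

text \<open>The class of \<open>f\<close> is zero, hence so is the tuple with it in the slot, and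
  expanding the slot changes nothing modulo the kernel.\<close>

lemma ext_kernel_ideal:
  assumes "f \<in> lie_ideal X"
  shows "lin_ext (\<lambda>T. sng (l1 @ cos (lie_ideal X) (sng T) # l2)) f \<in> ext_kernel r (lie2 X)"
proof -
  have "cos (lie_ideal X) f = cos (lie_ideal X) 0" using assms by (subst cos_eq_iff) auto
  then have "sng (l1 @ cos (lie_ideal X) f # l2) \<in> ext_kernel r (lie2 X)"
    using ext_kernel_zero by simp
  moreover have "f \<in> carrier (free_alg X)" using assms lie_ideal_carrier[of X] by blast
  ultimately show ?thesis using pm.subspace_add[OF subspace_ext_kernel ext_kernel_lin_ext, of f] by fastforce
qed

end

lemma ext_kernel_eq_entries:
  assumes "set (l1 @ A # l2 @ A # l3) \<subseteq> carrier (lie2 X)" "length (l1 @ A # l2 @ A # l3) = r"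
  shows "sng (l1 @ A # l2 @ A # l3) \<in> ext_kernel r (lie2 X)"
  unfolding ext_kernel_eq
proof (rule pm.span_base)
  let ?xs = "l1 @ A # l2 @ A # l3" and ?j = "Suc (length l1 + length l2)"
  have "?xs ! length l1 = ?xs ! ?j" by (simp add: nth_append)
  moreover have "length l1 < ?j" "?j < r" using assms(2) by auto
  ultimately show "sng ?xs \<in> ext_relations r (lie2 X)"
    unfolding ext_relations_def using assms by (intro UnI2 CollectI exI[of _ ?xs]) blast
qed

lemma ext_kernel_swap:
  assumes "set (l1 @ A # B # l2) \<subseteq> carrier (lie2 X)" "length (l1 @ A # B # l2) = r"
  shows "sng (l1 @ A # B # l2) + sng (l1 @ B # A # l2) \<in> ext_kernel r (lie2 X)"
proof -
  obtain x y where x: "A = cos (lie_ideal X) x" "x \<in> carrier (free_alg X)"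
    and y: "B = cos (lie_ideal X) y" "y \<in> carrier (free_alg X)"
    using assms by (auto simp: carrier_lie2)
  \<comment> \<open>Polarisation: expanding the vanishing tuple with both entries equal to the sum
    of \<open>A\<close> and \<open>B\<close> leaves the two mixed terms.\<close>
  define D where "D = cos (lie_ideal X) (x + y)"
  have D: "D \<in> carrier (lie2 X)" using x y by (auto simp: D_def carrier_lie2 intro!: pm.subspace_add)
  have 1: "sng (l1 @ D # D # l2) - sng (l1 @ A # D # l2) - sng (l1 @ B # D # l2) \<in> ext_kernel r (lie2 X)"
    using assms x(2) y(2) D unfolding x(1) y(1) D_def by (intro ext_kernel_add) auto
  have 2: "sng ((l1 @ [E]) @ D # l2) - sng ((l1 @ [E]) @ A # l2) - sng ((l1 @ [E]) @ B # l2) \<in> ext_kernel r (lie2 X)"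
    if "E \<in> carrier (lie2 X)" for E
    using assms x(2) y(2) that unfolding x(1) y(1) D_def by (intro ext_kernel_add) auto
  have AB: "A \<in> carrier (lie2 X)" "B \<in> carrier (lie2 X)" using assms by auto
  have E: "sng (l1 @ E # E # l2) \<in> ext_kernel r (lie2 X)" if "E \<in> carrier (lie2 X)" for E
    using ext_kernel_eq_entries[of l1 E "[]" l2] that assms by auto
  have "sng (l1 @ A # B # l2) + sng (l1 @ B # A # l2) =
    sng (l1 @ D # D # l2) - sng (l1 @ A # A # l2) - sng (l1 @ B # B # l2)
    - (sng (l1 @ D # D # l2) - sng (l1 @ A # D # l2) - sng (l1 @ B # D # l2))
    - (sng (l1 @ A # D # l2) - sng (l1 @ A # A # l2) - sng (l1 @ A # B # l2))
    - (sng (l1 @ B # D # l2) - sng (l1 @ B # A # l2) - sng (l1 @ B # B # l2))"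
    by simp
  also have "\<dots> \<in> ext_kernel r (lie2 X)"
    using 2[OF AB(1)] 2[OF AB(2)]
    by (intro sub_diff3[OF subspace_ext_kernel pm.subspace_diff[OF subspace_ext_kernel
      sub_diff3[OF subspace_ext_kernel E[OF D] E[OF AB(1)] E[OF AB(2)]] 1]]) simp_all
  finally show ?thesis .
qed

text \<open>Sending non-multilinear forests to 0 makes this a linear map on all forests that is
  compatible with every generator of \<open>relspace\<close>.\<close>

definition tup :: "'a set \<Rightarrow> nat \<Rightarrow> ('a btree list \<Rightarrow>\<^sub>0 'k::field) \<Rightarrow> (('a btree \<Rightarrow>\<^sub>0 'k) set list \<Rightarrow>\<^sub>0 'k)" where
  "tup X r = lin_ext (\<lambda>G. if G \<in> MF X r then sng (map (bracketing X) G) else 0)"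

lemma lin_tup [simp]: "lin (tup X r)"
  by (simp add: tup_def)

lemma tup_sng: "tup X r (sng G) = (if G \<in> MF X r then sng (map (bracketing X) G) else 0)"
  by (simp add: tup_def)

lemma MF_leaf_word: "G \<in> MF X r \<Longrightarrow> T \<in> set G \<Longrightarrow> set (leaf_word T) \<subseteq> X"
  by (auto simp: MF_def)

lemma bracketing_carrier: "set (leaf_word T) \<subseteq> X \<Longrightarrow> bracketing X T \<in> carrier (lie2 X)"
  by (auto simp: bracketing_eq carrier_lie2 sng_free_alg)

lemma MF_map_bracketing:
  "G \<in> MF X r \<Longrightarrow> set (map (bracketing X) G) \<subseteq> carrier (lie2 X) \<and> length (map (bracketing X) G) = r"
  using MF_leaf_word by (fastforce simp: MF_def intro!: bracketing_carrier)

text \<open>A context is an iterated bracket with fixed trees; the condition on \<open>H t\<close>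
  keeps these trees inside the alphabet \<open>X\<close>.\<close>

lemma push_tctx_ideal:
  assumes "H \<in> tctx" "f \<in> lie_ideal X" "set (leaf_word (H t)) \<subseteq> X"
  shows "push H f \<in> lie_ideal X"
  using assms
proof (induction)
  case tctx_id
  then show ?case by simp
next
  case (tctx_left H c S)
  have "push (\<lambda>t. Node c (H t) S) f = free_bracket c (push H f) (sng S)"
    by (simp add: free_bracket_sng_right push_push o_def)
  then show ?case using tctx_left by (simp add: lie_ideal_bracket sng_free_alg)
next
  case (tctx_right H c S)
  have "push (\<lambda>t. Node c S (H t)) f = free_bracket c (sng S) (push H f)"
    by (simp add: free_bracket_sng_left push_push o_def)
  then show ?case using tctx_right by (simp add: lie_ideal_bracket sng_free_alg)
qed

lemma tctx_leaves: "H \<in> tctx \<Longrightarrow> set (leaf_word t) \<subseteq> set (leaf_word (H t))"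
  by (induction rule: tctx.induct) auto

lemma fctx_leaves: "C \<in> fctx \<Longrightarrow> set (leaf_word t) \<subseteq> set (forest_word (C t))"
  by (auto elim!: fctxE dest: subsetD[OF tctx_leaves])

lemma tup_fctx_ideal:
  assumes C: "C \<in> fctx" and f: "f \<in> lie_ideal X" and t: "C t \<in> MF X r"
    and keys: "\<And>t'. t' \<in> Poly_Mapping.keys f \<Longrightarrow> mset (leaf_word t') = mset (leaf_word t)"
  shows "tup X r (push C f) \<in> ext_kernel r (lie2 X)"
proof -
  obtain G1 H G2 where H: "C = (\<lambda>t. G1 @ H t # G2)" "H \<in> tctx" using C by (rule fctxE)
  have MFk: "C t' \<in> MF X r" if "t' \<in> Poly_Mapping.keys f" for t'
    using MF_fctx[OF C keys[OF that]] t by blast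
  have "tup X r (push C f) =
    lin_ext (\<lambda>T. sng (map (bracketing X) G1 @ cos (lie_ideal X) (sng T) # map (bracketing X) G2)) (push H f)"
  proof (rule lin_eqI[of "\<lambda>f. tup X r (push C f)"])
    fix t' assume "t' \<in> Poly_Mapping.keys f"
    from MFk[OF this] MF_leaf_word[OF MFk[OF this], of "H t'"] show "tup X r (push C (sng t')) =
      lin_ext (\<lambda>T. sng (map (bracketing X) G1 @ cos (lie_ideal X) (sng T) # map (bracketing X) G2)) (push H (sng t'))"
      by (simp add: tup_sng H(1) bracketing_eq)
  qed (auto intro: lin_comp)
  also have "\<dots> \<in> ext_kernel r (lie2 X)"
    using t MF_map_bracketing[OF t] MF_leaf_word[OF t, of "H t"]
    by (intro ext_kernel_ideal push_tctx_ideal[OF H(2) f, of t]) (auto simp: H(1))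
  finally show ?thesis .
qed

lemma tup_relspace:
  fixes f :: "'a btree list \<Rightarrow>\<^sub>0 'k::field"
  assumes "f \<in> relspace X r"
  shows "tup X r f \<in> ext_kernel r (lie2 X)"
proof (rule lin_span_subset[OF lin_tup subspace_ext_kernel _ assms[unfolded relspace_def]])
  let ?K = "ext_kernel r (lie2 X) :: (('a btree \<Rightarrow>\<^sub>0 'k) set list \<Rightarrow>\<^sub>0 'k) set"
  fix g :: "'a btree list \<Rightarrow>\<^sub>0 'k" assume "g \<in> relgens X r"
  \<comment> \<open>The keys of \<open>f\<close> share one multiset of leaves. Either all fillings
    of \<open>C\<close> are multilinear, and an element of the ideal sits in one slot, or none is,
    and everything goes to 0.\<close>
  moreover have ideal: "tup X r (push C f) \<in> ?K"
    if C: "C \<in> fctx" and f: "set (leaf_word t) \<subseteq> X \<Longrightarrow> f \<in> lie_ideal X"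
      and keys: "Poly_Mapping.keys f \<subseteq> {t'. mset (leaf_word t') = mset (leaf_word t)}"
    for C t and f :: "'a btree \<Rightarrow>\<^sub>0 'k"
  proof (cases "C t \<in> MF X r")
    case True
    then have "set (leaf_word t) \<subseteq> X" using fctx_leaves[OF C, of t] by (auto simp: MF_def)
    then show ?thesis using tup_fctx_ideal[OF C f True] keys by auto
  next
    case False
    have "tup X r (push C f) = 0"
    proof (rule lin_eqI[of "\<lambda>f. tup X r (push C f)" "\<lambda>f. 0"])
      fix t' assume "t' \<in> Poly_Mapping.keys f"
      then have "C t' \<notin> MF X r" using MF_fctx[OF C, of t' t] keys False by auto
      then show "tup X r (push C (sng t')) = 0" by (simp add: tup_sng)
    qed (auto intro: lin_comp lin_zero)
    then show ?thesis by (simp add: pm.subspace_0)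
  qed
  moreover have keysI: "Poly_Mapping.keys f \<subseteq> B \<Longrightarrow> Poly_Mapping.keys g \<subseteq> B \<Longrightarrow> Poly_Mapping.keys (f + g) \<subseteq> B"
    for f g :: "'a btree \<Rightarrow>\<^sub>0 'k" and B
    using Poly_Mapping.keys_add[of f g] by auto
  moreover have rel: "x \<in> lie_relations X \<Longrightarrow> x \<in> lie_ideal X" for x :: "'a btree \<Rightarrow>\<^sub>0 'k"
    using lie_ideal_relations by auto
  moreover have "tup X r (sng (C (Node c S T)) + sng (C (Node c T S))) \<in> ?K"
    if "C \<in> fctx" for C :: "'a btree \<Rightarrow> _" and c S T
  proof -
    have *: "sng (Node c S T) + sng (Node c T S) \<in> (lie_relations X :: ('a btree \<Rightarrow>\<^sub>0 'k) set)"
      if "set (leaf_word (Node c S T)) \<subseteq> X"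
      using that unfolding lie_relations_def
      by (intro UnI1 CollectI exI[of _ c] exI[of _ "sng S"] exI[of _ "sng T"]) (simp add: sng_free_alg)
    have "tup X r (push C (sng (Node c S T) + sng (Node c T S))) \<in> ?K"
      by (rule ideal[OF that, of "Node c S T"], rule rel, erule *, (unfold jac_def)?, (intro keysI; simp))
    then show ?thesis by (simp add: jac_def lin_add[OF lin_push])
  qed
  moreover have "tup X r (jac c c C x y z) \<in> ?K"
    if "C \<in> fctx" for C :: "'a btree \<Rightarrow> _" and c x y z
  proof -
    have *: "jac c c (\<lambda>t. t) x y z \<in> (lie_relations X :: ('a btree \<Rightarrow>\<^sub>0 'k) set)"
      if "set (leaf_word (Node c x (Node c y z))) \<subseteq> X"
      using that unfolding lie_relations_def
      by (intro UnI1[OF UnI2] CollectI exI[of _ c] exI[of _ "sng x"] exI[of _ "sng y"] exI[of _ "sng z"])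
        (simp add: sng_free_alg jac_def)
    have "tup X r (push C (jac c c (\<lambda>t. t) x y z)) \<in> ?K"
      by (rule ideal[OF that, of "Node c x (Node c y z)"], rule rel, erule *, (unfold jac_def)?, (intro keysI; simp))
    then show ?thesis by (simp add: jac_def lin_add[OF lin_push])
  qed
  moreover have "tup X r (jac Blue Red C x y z + jac Red Blue C x y z) \<in> ?K"
    if "C \<in> fctx" for C :: "'a btree \<Rightarrow> _" and x y z
  proof -
    have *: "jac Blue Red (\<lambda>t. t) x y z + jac Red Blue (\<lambda>t. t) x y z \<in> (lie_relations X :: ('a btree \<Rightarrow>\<^sub>0 'k) set)"
      if "set (leaf_word (Node Blue x (Node Red y z))) \<subseteq> X"
      using that unfolding lie_relations_def
      by (intro UnI2 CollectI exI[of _ "sng x"] exI[of _ "sng y"] exI[of _ "sng z"])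
        (simp add: sng_free_alg jac_def add.assoc)
    have "tup X r (push C (jac Blue Red (\<lambda>t. t) x y z + jac Red Blue (\<lambda>t. t) x y z)) \<in> ?K"
      by (rule ideal[OF that, of "Node Blue x (Node Red y z)"], rule rel, erule *, (unfold jac_def)?, (intro keysI; simp))
    then show ?thesis by (simp add: jac_def lin_add[OF lin_push])
  qed
  moreover have "tup X r (sng (G1 @ S # T # G2) + sng (G1 @ T # S # G2)) \<in> ?K"
    for G1 G2 :: "'a btree list" and S T
  proof (cases "G1 @ S # T # G2 \<in> MF X r")
    case True
    have "sng (map (bracketing X) G1 @ bracketing X S # bracketing X T # map (bracketing X) G2) +
      sng (map (bracketing X) G1 @ bracketing X T # bracketing X S # map (bracketing X) G2) \<in> ?K"
      using MF_map_bracketing[OF True, where ?'b = 'k] by (intro ext_kernel_swap) simp_all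
    then show ?thesis using True MF_swap[of G1 S T G2 X r] by (simp add: lin_add tup_sng)
  next
    case False
    then show ?thesis using MF_swap[of G1 S T G2 X r]
      by (simp add: lin_add tup_sng pm.subspace_0)
  qed
  ultimately show "tup X r g \<in> ?K"
    unfolding relgens_def by (auto simp: tup_sng pm.subspace_0)
qed

section \<open>From tuples of Lie elements back to forests\<close>

definition rep :: "'v set \<Rightarrow> 'v" where
  "rep A = (SOME x. x \<in> A)"

lemma rep_cos: "rep (cos (lie_ideal X) x) - x \<in> lie_ideal X"
  unfolding rep_def mem_cos[symmetric] by (rule someI[of _ x]) (simp add: self_mem_cos)

lemma mexp_slot_cong:
  assumes "x - y \<in> fideal X r"
  shows "mexp (l1 @ x # l2) - mexp (l1 @ y # l2) \<in> relspace X r"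
  using mexp_fideal[OF assms, of l1 l2] lin_diff[OF lin_mexp] by metis

text \<open>Chosen representatives are expanded multilinearly. The choice is not linear, but it
  fails to be so only by elements of the Lie ideal, which the expansion sends into
  \<open>relspace\<close>.\<close>

definition unwedge :: "(('a btree \<Rightarrow>\<^sub>0 'k) set list \<Rightarrow>\<^sub>0 'k::field) \<Rightarrow> ('a btree list \<Rightarrow>\<^sub>0 'k)" where
  "unwedge = lin_ext (\<lambda>As. mexp (map rep As))"

lemma lin_unwedge [simp]: "lin unwedge"
  by (simp add: unwedge_def)

lemma unwedge_ext_kernel:
  assumes "f \<in> ext_kernel r (lie2 X)"
  shows "unwedge f \<in> relspace X r"
proof (rule lin_span_subset[OF lin_unwedge subspace_relspace _ assms[unfolded ext_kernel_eq]])
  let ?J = "lie_ideal X :: ('a btree \<Rightarrow>\<^sub>0 'b) set"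
  fix g assume "g \<in> ext_relations r (lie2 X :: ('b, ('a btree \<Rightarrow>\<^sub>0 'b) set) module)"
  then consider
    (add) xs i x y where "g = sng (xs[i := x \<oplus>\<^bsub>lie2 X\<^esub> y]) - sng (xs[i := x]) - sng (xs[i := y])"
      "i < length xs" "x \<in> carrier (lie2 X)" "y \<in> carrier (lie2 X)"
  | (scale) xs i a x where "g = sng (xs[i := a \<odot>\<^bsub>lie2 X\<^esub> x]) - Poly_Mapping.single (xs[i := x]) a"
      "i < length xs" "x \<in> carrier (lie2 X)"
  | (eq) xs i j where "g = sng xs" "i < j" "j < length xs" "xs ! i = xs ! j"
    unfolding ext_relations_def by blast
  then show "unwedge g \<in> relspace X r"
  proof cases
    case add
    obtain a b where ab: "x = cos ?J a" "y = cos ?J b" using add by (auto simp: carrier_lie2)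
    let ?l1 = "map rep (take i xs)" and ?l2 = "map rep (drop (Suc i) xs)"
    let ?d = "rep (cos ?J (a + b)) - (rep x + rep y)"
    have "?d = (rep (cos ?J (a + b)) - (a + b)) - (rep (cos ?J a) - a) - (rep (cos ?J b) - b)"
      by (simp add: ab)
    also have "\<dots> \<in> ?J" by (rule sub_diff3[OF subspace_lie_ideal rep_cos rep_cos rep_cos])
    finally have "?d \<in> fideal X r" using lie_ideal_fideal[of X X r] by auto
    from mexp_slot_cong[OF this, of ?l1 ?l2] show ?thesis
      using add by (simp add: unwedge_def lin_diff ab add_lie2 upd_conv_take_nth_drop
          lin_add[OF lin_mexp] lin_add[OF lin_lin_ext] diff_diff_eq)
  next
    case (scale xs i a x)
    obtain b where b: "x = cos ?J b" using scale by (auto simp: carrier_lie2)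
    let ?l1 = "map rep (take i xs)" and ?l2 = "map rep (drop (Suc i) xs)"
    let ?d = "rep (cos ?J (Defs.scale a b)) - Defs.scale a (rep x)"
    have "?d = (rep (cos ?J (Defs.scale a b)) - Defs.scale a b) - Defs.scale a (rep (cos ?J b) - b)"
      by (simp add: b pm.scale_right_diff_distrib)
    also have "\<dots> \<in> ?J"
      by (rule pm.subspace_diff[OF subspace_lie_ideal rep_cos pm.subspace_scale[OF subspace_lie_ideal rep_cos]])
    finally have "?d \<in> fideal X r" using lie_ideal_fideal[of X X r] by auto
    from mexp_slot_cong[OF this, of ?l1 ?l2] show ?thesis
      using scale by (simp add: unwedge_def lin_diff b smult_lie2 upd_conv_take_nth_drop
          lin_scale[OF lin_mexp])
  next
    case eq
    have "xs = take i xs @ xs ! i # take (j - Suc i) (drop (Suc i) xs) @ xs ! j # drop (Suc j) xs"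
    proof -
      have "drop (Suc i) xs = take (j - Suc i) (drop (Suc i) xs) @ drop j xs"
        using eq(2) append_take_drop_id[of "j - Suc i" "drop (Suc i) xs"] by simp
      moreover have "drop j xs = xs ! j # drop (Suc j) xs" using eq(3) by (rule Cons_nth_drop_Suc[symmetric])
      moreover have "xs = take i xs @ xs ! i # drop (Suc i) xs"
        using eq(2,3) by (intro id_take_nth_drop) simp
      ultimately show ?thesis by metis
    qed
    then obtain l1 l2 l3 A where "xs = l1 @ A # l2 @ A # l3" using eq(4) by metis
    then show ?thesis using eq(1) mexp_eq_entries by (simp add: unwedge_def)
  qed
qed

lemma unwedge_tup_sng:
  assumes "G \<in> MF X r"
  shows "unwedge (tup X r (sng G)) - sng G \<in> relspace X r"
proof -
  have "list_all2 (\<lambda>x y. x - y \<in> fideal X r) (map rep (map (bracketing X) G)) (map sng G)"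
  proof (unfold list_all2_conv_all_nth, intro conjI allI impI)
    fix i assume "i < length (map rep (map (bracketing X) G))"
    then have "i < length G" by simp
    moreover from this have "set (leaf_word (G ! i)) \<subseteq> X" by (intro MF_leaf_word[OF assms] nth_mem)
    ultimately show "map rep (map (bracketing X) G) ! i - map sng G ! i \<in> fideal X r"
      using subsetD[OF lie_ideal_fideal rep_cos] by (simp add: bracketing_eq)
  qed simp
  from mexp_cong_fideal[OF this, of "[]"] show ?thesis
    using assms by (simp add: tup_sng unwedge_def mexp_sng)
qed

text \<open>\<open>unwedge\<close> is a left inverse of \<open>tup\<close> modulo relations; this
  yields injectivity without a basis of the free Lie algebra.\<close>

theorem tup_kernel:
  assumes "Poly_Mapping.keys f \<subseteq> MF X r"
  shows "tup X r f \<in> ext_kernel r (lie2 X) \<longleftrightarrow> f \<in> relspace X r"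
proof
  assume "tup X r f \<in> ext_kernel r (lie2 X)"
  then have "unwedge (tup X r f) \<in> relspace X r" by (rule unwedge_ext_kernel)
  moreover have "unwedge (tup X r f) - f \<in> relspace X r"
  proof (rule lin_in_subspace[of "\<lambda>f. unwedge (tup X r f) - f"])
    show "lin (\<lambda>f. unwedge (tup X r f) - f)"
      by (rule lin_sub[OF lin_comp[OF lin_unwedge lin_tup] lin_id])
    show "unwedge (tup X r (sng G)) - sng G \<in> relspace X r" if "G \<in> Poly_Mapping.keys f" for G
      using that assms by (intro unwedge_tup_sng) auto
  qed simp
  ultimately have "unwedge (tup X r f) - (unwedge (tup X r f) - f) \<in> relspace X r"
    by (rule pm.subspace_diff[OF subspace_relspace])
  then show "f \<in> relspace X r" by simp
qed (rule tup_relspace)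

section \<open>The poset of weighted partitions\<close>

definition below :: "wpartition \<Rightarrow> nat set \<Rightarrow> wpartition" where
  "below p D = {x\<in>p. fst x \<subseteq> D}"

definition wsum :: "wpartition \<Rightarrow> nat set \<Rightarrow> nat" where
  "wsum p D = (\<Sum>x\<in>below p D. snd x)"

abbreviation cnt :: "wpartition \<Rightarrow> nat set \<Rightarrow> nat" where
  "cnt p D \<equiv> card (below p D)"

text \<open>The excess of the weight of a block over the weights of the blocks of \<open>p\<close>
  inside it. The order requires this excess to be at least 0 and smaller than the number of those
  blocks.\<close>

definition slack :: "wpartition \<Rightarrow> nat set \<times> nat \<Rightarrow> int" where
  "slack p y = int (snd y) - int (wsum p (fst y))"

lemma wp_le_iff:
  "wp_le p q \<longleftrightarrow> (\<forall>x\<in>p. \<exists>y\<in>q. fst x \<subseteq> fst y) \<and>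
    (\<forall>y\<in>q. 0 \<le> slack p y \<and> slack p y < int (cnt p (fst y)))"
proof -
  have "{(A, w). (A, w) \<in> p \<and> A \<subseteq> B} = below p B" for B by (auto simp: below_def)
  moreover have "(\<Sum>(A, w)\<in>S. int w) = (\<Sum>x\<in>S. int (snd x))" for S :: wpartition
    by (simp add: case_prod_beta)
  ultimately show ?thesis
    by (auto simp: wp_le_def Let_def slack_def wsum_def case_prod_beta)
qed

lemma wp_leD:
  assumes "wp_le p q"
  shows "x \<in> p \<Longrightarrow> \<exists>y\<in>q. fst x \<subseteq> fst y" "y \<in> q \<Longrightarrow> 0 \<le> slack p y"
    "y \<in> q \<Longrightarrow> slack p y < int (cnt p (fst y))"
  using assms by (auto simp: wp_le_iff)

lemma wpartitionsD:
  assumes "p \<in> wpartitions n"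
  shows "finite p" "x \<in> p \<Longrightarrow> fst x \<noteq> {}" "x \<in> p \<Longrightarrow> finite (fst x)" "x \<in> p \<Longrightarrow> fst x \<subseteq> {1..n}"
    "x \<in> p \<Longrightarrow> y \<in> p \<Longrightarrow> i \<in> fst x \<Longrightarrow> i \<in> fst y \<Longrightarrow> x = y"
    "i \<in> {1..n} \<Longrightarrow> \<exists>x\<in>p. i \<in> fst x" "x \<in> p \<Longrightarrow> snd x < card (fst x)"
proof -
  have part: "partition_on {1..n} (fst ` p)" and inj: "inj_on fst p"
    and v: "\<And>B v. (B, v) \<in> p \<Longrightarrow> v \<le> card B - 1"
    using assms by (auto simp: wpartitions_def)
  have "finite (fst ` p)"
    using part finite_elements by blast
  then show "finite p" using inj by (rule finite_imageD)
  show ne: "fst x \<noteq> {}" if "x \<in> p" for x using part that by (auto simp: partition_on_def)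
  show sub: "fst x \<subseteq> {1..n}" if "x \<in> p" for x using part that by (auto simp: partition_on_def)
  then show fin: "finite (fst x)" if "x \<in> p" for x using that finite_subset by blast
  show "x = y" if "x \<in> p" "y \<in> p" "i \<in> fst x" "i \<in> fst y" for x y i
  proof (rule inj_onD[OF inj _ that(1,2)])
    have "fst x \<in> fst ` p" "fst y \<in> fst ` p" using that by auto
    then show "fst x = fst y" using part that(3,4) unfolding partition_on_def disjoint_def by blast
  qed
  show "\<exists>x\<in>p. i \<in> fst x" if "i \<in> {1..n}" for i using part that by (auto simp: partition_on_def)
  show "snd x < card (fst x)" if "x \<in> p" for x
    using v[of "fst x" "snd x"] that ne[OF that] fin[OF that] by (simp add: card_gt_0_iff) (metis One_nat_def Suc_pred card_gt_0_iff less_Suc_eq_le)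
qed

lemma wpartitionsI:
  assumes "\<And>x. x \<in> p \<Longrightarrow> fst x \<noteq> {}" "\<And>x. x \<in> p \<Longrightarrow> fst x \<subseteq> {1..n}"
    "\<And>x y i. x \<in> p \<Longrightarrow> y \<in> p \<Longrightarrow> i \<in> fst x \<Longrightarrow> i \<in> fst y \<Longrightarrow> x = y"
    "\<And>i. i \<in> {1..n} \<Longrightarrow> \<exists>x\<in>p. i \<in> fst x" "\<And>x. x \<in> p \<Longrightarrow> snd x < card (fst x)"
  shows "p \<in> wpartitions n"
proof -
  have "partition_on {1..n} (fst ` p)"
    unfolding partition_on_def disjoint_def
  proof (intro conjI ballI impI)
    show "\<Union> (fst ` p) = {1..n}" using assms(2,4) by blast
    show "a \<inter> b = {}" if "a \<in> fst ` p" "b \<in> fst ` p" "a \<noteq> b" for a b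
      using that assms(3) by blast
    show "{} \<notin> fst ` p" using assms(1) by blast
  qed
  moreover have "inj_on fst p"
    by (rule inj_onI) (metis assms(1,3) ex_in_conv)
  ultimately show ?thesis using assms(5) by (fastforce simp: wpartitions_def)
qed

lemma wp_bot_in: "wp_bot n \<in> wpartitions n"
  by (rule wpartitionsI) (auto simp: wp_bot_def)

lemma card_wp_bot: "card (wp_bot n) = n"
  unfolding wp_bot_def by (subst card_image) (auto simp: inj_on_def)

lemma finite_wpartitions: "finite (wpartitions n)"
proof -
  have "wpartitions n \<subseteq> Pow (Pow {1..n} \<times> {..n})"
  proof (intro subsetI, rule PowI, rule subsetI)
    fix p x assume p: "p \<in> wpartitions n" and x: "x \<in> p"
    have "card (fst x) \<le> n" using card_mono[OF _ wpartitionsD(4)[OF p x]] by simp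
    then show "x \<in> Pow {1..n} \<times> {..n}"
      using wpartitionsD(4)[OF p x] wpartitionsD(7)[OF p x] by (cases x) auto
  qed
  then show ?thesis by (rule finite_subset) auto
qed

lemma finite_below: "p \<in> wpartitions n \<Longrightarrow> finite (below p D)"
  by (auto simp: below_def wpartitionsD)

lemma below_block: "p \<in> wpartitions n \<Longrightarrow> x \<in> p \<Longrightarrow> below p (fst x) = {x}"
  unfolding below_def using wpartitionsD(2)[of p n] wpartitionsD(5)[of p n x] by blast

lemma wp_le_refl: "p \<in> wpartitions n \<Longrightarrow> wp_le p p"
  by (auto simp: wp_le_iff slack_def wsum_def below_block)

text \<open>The blocks are given together with their weights, so that no description operator
  intervenes as it does in \<open>merge\<close>.\<close>

definition mrg :: "nat \<Rightarrow> nat set \<times> nat \<Rightarrow> nat set \<times> nat \<Rightarrow> wpartition \<Rightarrow> wpartition" where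
  "mrg u x y p = insert (fst x \<union> fst y, snd x + snd y + u) (p - {x, y})"

lemma block_inj: "p \<in> wpartitions n \<Longrightarrow> x \<in> p \<Longrightarrow> y \<in> p \<Longrightarrow> fst x = fst y \<Longrightarrow> x = y"
  using wpartitionsD(2)[of p n x] wpartitionsD(5)[of p n x y] by blast

lemma wt_eq: "p \<in> wpartitions n \<Longrightarrow> x \<in> p \<Longrightarrow> wt p (fst x) = snd x"
  unfolding wt_def
proof (rule the_equality)
  fix v assume "p \<in> wpartitions n" "x \<in> p" "(fst x, v) \<in> p"
  then have "(fst x, v) = x" using block_inj[of p n "(fst x, v)" x] by simp
  from arg_cong[OF this, of snd] show "v = snd x" by simp
qed simp

lemma merge_eq_mrg:
  assumes p: "p \<in> wpartitions n" and "x \<in> p" "y \<in> p"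
  shows "merge u (fst x) (fst y) p = mrg u x y p"
proof -
  have e: "fst c \<noteq> fst x \<longleftrightarrow> c \<noteq> x" "fst c \<noteq> fst y \<longleftrightarrow> c \<noteq> y" if "c \<in> p" for c
    using block_inj[OF p that assms(2)] block_inj[OF p that assms(3)] by blast+
  have "{(C, v). (C, v) \<in> p \<and> C \<noteq> fst x \<and> C \<noteq> fst y} =
    {c \<in> p. fst c \<noteq> fst x \<and> fst c \<noteq> fst y}" by auto
  also have "\<dots> = p - {x, y}" using e by blast
  finally have "{(C, v). (C, v) \<in> p \<and> C \<noteq> fst x \<and> C \<noteq> fst y} = p - {x, y}" .
  then show ?thesis using assms by (simp add: merge_def mrg_def wt_eq)
qed

lemma mrg_commute: "mrg u x y p = mrg u y x p"
  by (simp add: mrg_def Un_commute add.commute insert_commute)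

context
  fixes p n x y u
  assumes p: "p \<in> wpartitions n" and xy: "x \<in> p" "y \<in> p" "x \<noteq> y" and u: "u \<le> (1::nat)"
begin

lemma blocks_disj: "fst x \<inter> fst y = {}"
  using wpartitionsD(5)[OF p xy(1,2)] xy(3) by auto

lemma mrg_new: "(fst x \<union> fst y, v) \<notin> p"
proof
  assume *: "(fst x \<union> fst y, v) \<in> p"
  obtain i j where "i \<in> fst x" "j \<in> fst y" using wpartitionsD(2)[OF p] xy by blast
  then have "x = (fst x \<union> fst y, v)"
    using wpartitionsD(5)[OF p xy(1) *, of i] by simp
  also have "\<dots> = y"
    using wpartitionsD(5)[OF p xy(2) *, of j] \<open>j \<in> fst y\<close> by simp
  finally show False using xy(3) by simp
qed

lemma mrg_in: "mrg u x y p \<in> wpartitions n"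
proof (rule wpartitionsI)
  have "card (fst x \<union> fst y) = card (fst x) + card (fst y)"
    using blocks_disj wpartitionsD(3)[OF p] xy by (simp add: card_Un_disjoint)
  then show "snd z < card (fst z)" if "z \<in> mrg u x y p" for z
    using that wpartitionsD(7)[OF p, of z] wpartitionsD(7)[OF p xy(1)] wpartitionsD(7)[OF p xy(2)] u
    unfolding mrg_def by (elim insertE) simp_all
  show "z = w" if "z \<in> mrg u x y p" "w \<in> mrg u x y p" "i \<in> fst z" "i \<in> fst w" for z w i
  proof -
    have d: "i \<in> fst w \<Longrightarrow> i \<notin> fst x \<union> fst y" if "w \<in> p - {x, y}" for w
      using that wpartitionsD(5)[OF p, of w x i] wpartitionsD(5)[OF p, of w y i] xy by blast
    have "z = (fst x \<union> fst y, snd x + snd y + u) \<or> z \<in> p - {x, y}"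
      "w = (fst x \<union> fst y, snd x + snd y + u) \<or> w \<in> p - {x, y}"
      using that(1,2) unfolding mrg_def by blast+
    then show ?thesis
      using d[of z] d[of w] wpartitionsD(5)[OF p, of z w i] that(3,4) by (elim disjE) simp_all
  qed
  show "\<exists>z\<in>mrg u x y p. i \<in> fst z" if "i \<in> {1..n}" for i
    using wpartitionsD(6)[OF p that] by (auto simp: mrg_def)
  fix z assume "z \<in> mrg u x y p"
  then have "z = (fst x \<union> fst y, snd x + snd y + u) \<or> z \<in> p" by (auto simp: mrg_def)
  then show "fst z \<noteq> {}" "fst z \<subseteq> {1..n}"
    using wpartitionsD(2,4)[OF p xy(1)] wpartitionsD(2,4)[OF p, of z] wpartitionsD(4)[OF p xy(2)]
    by (elim disjE; simp)+
qed

lemma card_mrg: "card p = Suc (card (mrg u x y p))"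
proof -
  have "card (p - {x, y}) = card p - 2" "2 \<le> card p"
    using xy wpartitionsD(1)[OF p] card_mono[of p "{x, y}"] by (auto simp: card_Diff_subset)
  then show ?thesis using mrg_new wpartitionsD(1)[OF p] by (simp add: mrg_def)
qed

lemma below_mrg_in:
  assumes "fst x \<subseteq> D" "fst y \<subseteq> D"
  shows "wsum (mrg u x y p) D = wsum p D + u" "cnt p D = Suc (cnt (mrg u x y p) D)"
    "2 \<le> cnt p D"
proof -
  let ?z = "(fst x \<union> fst y, snd x + snd y + u)"
  have b: "below (mrg u x y p) D = insert ?z (below p D - {x, y})"
    using assms by (auto simp: below_def mrg_def)
  have xyD: "{x, y} \<subseteq> below p D" using xy assms by (auto simp: below_def)
  have z: "?z \<notin> below p D - {x, y}" using mrg_new by (auto simp: below_def)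
  have fin: "finite (below p D)" by (rule finite_below[OF p])
  have "wsum p D = (snd x + snd y) + (\<Sum>x\<in>below p D - {x, y}. snd x)"
    using sum.subset_diff[OF xyD fin, of snd] xy(3) by (simp add: wsum_def)
  then show "wsum (mrg u x y p) D = wsum p D + u"
    using z fin by (simp add: wsum_def b)
  have "card (below p D - {x, y}) = cnt p D - 2" using xyD xy(3) by (simp add: card_Diff_subset)
  moreover show c: "2 \<le> cnt p D" using card_mono[OF fin xyD] xy(3) by simp
  ultimately show "cnt p D = Suc (cnt (mrg u x y p) D)" using z fin by (simp add: b)
qed

lemma below_mrg_out:
  assumes "\<not> fst x \<subseteq> D" "\<not> fst y \<subseteq> D"
  shows "below (mrg u x y p) D = below p D"
  using assms by (auto simp: below_def mrg_def)

text \<open>A merge consumes \<open>u\<close> of the slack and one of the count of the block of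
  \<open>q\<close> that contains both parts; for all other blocks of \<open>q\<close> slack and
  count are unchanged.\<close>

lemma mrg_le_iff:
  assumes q: "q \<in> wpartitions n"
  shows "wp_le (mrg u x y p) q \<longleftrightarrow> wp_le p q \<and>
    (\<exists>z\<in>q. fst x \<subseteq> fst z \<and> fst y \<subseteq> fst z \<and> int u \<le> slack p z \<and> slack p z - int u < int (cnt p (fst z)) - 1)"
proof -
  let ?m = "mrg u x y p"
  have disj: "\<not> fst x \<subseteq> fst z' \<and> \<not> fst y \<subseteq> fst z'" if "z \<in> q" "fst x \<subseteq> fst z" "fst y \<subseteq> fst z" "z' \<in> q" "z' \<noteq> z" for z z'
  proof -
    obtain i j where "i \<in> fst x" "j \<in> fst y" using wpartitionsD(2)[OF p] xy by blast
    then show ?thesis using that wpartitionsD(5)[OF q] by blast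
  qed
  have out: "slack ?m z' = slack p z' \<and> cnt ?m (fst z') = cnt p (fst z')"
    if "z \<in> q" "fst x \<subseteq> fst z" "fst y \<subseteq> fst z" "z' \<in> q" "z' \<noteq> z" for z z'
    using disj[OF that] below_mrg_out[of "fst z'"] by (simp add: slack_def wsum_def)
  have in_m: "slack ?m z = slack p z - int u \<and> int (cnt ?m (fst z)) = int (cnt p (fst z)) - 1"
    if "fst x \<subseteq> fst z" "fst y \<subseteq> fst z" for z
    using below_mrg_in[OF that] by (simp add: slack_def)
  show ?thesis
  proof
    assume le: "wp_le ?m q"
    then obtain z where z: "z \<in> q" "fst x \<subseteq> fst z" "fst y \<subseteq> fst z"
      using wp_leD(1)[OF le, of "(fst x \<union> fst y, snd x + snd y + u)"] by (auto simp: mrg_def)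
    have sl: "int u \<le> slack p z" "slack p z - int u < int (cnt p (fst z)) - 1"
      using wp_leD(2,3)[OF le z(1)] in_m[OF z(2,3)] by auto
    moreover have "wp_le p q"
      unfolding wp_le_iff
    proof (intro conjI ballI)
      fix w assume "w \<in> p"
      then show "\<exists>y\<in>q. fst w \<subseteq> fst y"
        using wp_leD(1)[OF le, of w] z by (cases "w \<in> {x, y}") (auto simp: mrg_def)
    next
      fix z' assume z': "z' \<in> q"
      show "0 \<le> slack p z'"
        using sl wp_leD(2)[OF le z'] out[OF z z'] by (cases "z' = z") auto
      show "slack p z' < int (cnt p (fst z'))"
        using sl u wp_leD(3)[OF le z'] out[OF z z'] by (cases "z' = z") auto
    qed
    ultimately show "wp_le p q \<and> (\<exists>z\<in>q. fst x \<subseteq> fst z \<and> fst y \<subseteq> fst z \<and> int u \<le> slack p z \<and>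
      slack p z - int u < int (cnt p (fst z)) - 1)" using z by blast
  next
    assume "wp_le p q \<and> (\<exists>z\<in>q. fst x \<subseteq> fst z \<and> fst y \<subseteq> fst z \<and> int u \<le> slack p z \<and>
      slack p z - int u < int (cnt p (fst z)) - 1)"
    then obtain z where le: "wp_le p q" and z: "z \<in> q" "fst x \<subseteq> fst z" "fst y \<subseteq> fst z"
      and sl: "int u \<le> slack p z" "slack p z - int u < int (cnt p (fst z)) - 1" by blast
    show "wp_le ?m q"
      unfolding wp_le_iff
    proof (intro conjI ballI)
      fix w assume "w \<in> ?m"
      then consider "fst w = fst x \<union> fst y" | "w \<in> p" by (auto simp: mrg_def)
      then show "\<exists>y\<in>q. fst w \<subseteq> fst y"
      proof cases
        case 1
        then have "fst w \<subseteq> fst z" using z by simp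
        then show ?thesis using z(1) by blast
      qed (rule wp_leD(1)[OF le])
    next
      fix z' assume z': "z' \<in> q"
      show "0 \<le> slack ?m z'"
        using sl wp_leD(2)[OF le z'] out[OF z z'] in_m[OF z(2,3)] by (cases "z' = z") auto
      show "slack ?m z' < int (cnt ?m (fst z'))"
        using sl wp_leD(3)[OF le z'] out[OF z z'] in_m[OF z(2,3)] by (cases "z' = z") auto
    qed
  qed
qed

lemma le_mrg:
  assumes r: "r \<in> wpartitions n" and le: "wp_le r p"
  shows "wp_le r (mrg u x y p)"
  unfolding wp_le_iff
proof (intro conjI ballI)
  fix w assume "w \<in> r"
  then obtain z where "z \<in> p" "fst w \<subseteq> fst z" using wp_leD(1)[OF le] by blast
  then show "\<exists>y\<in>mrg u x y p. fst w \<subseteq> fst y"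
    by (cases "z \<in> {x, y}") (auto simp: mrg_def)
next
  let ?z = "(fst x \<union> fst y, snd x + snd y + u)"
  have "below r (fst x \<union> fst y) = below r (fst x) \<union> below r (fst y)"
  proof -
    have "fst w \<subseteq> fst x \<or> fst w \<subseteq> fst y" if w: "w \<in> r" "fst w \<subseteq> fst x \<union> fst y" for w
    proof -
      obtain z where z: "z \<in> p" "fst w \<subseteq> fst z" using wp_leD(1)[OF le w(1)] by blast
      obtain i where "i \<in> fst w" using wpartitionsD(2)[OF r w(1)] by blast
      then have "z = x \<or> z = y" using z w(2) wpartitionsD(5)[OF p z(1)] xy by blast
      then show ?thesis using z by auto
    qed
    then show ?thesis by (auto simp: below_def)
  qed
  moreover have "below r (fst x) \<inter> below r (fst y) = {}"
    using blocks_disj wpartitionsD(2)[OF r] by (auto simp: below_def) (metis Int_greatest subset_empty fst_conv)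
  ultimately have "wsum r (fst x \<union> fst y) = wsum r (fst x) + wsum r (fst y)"
    "cnt r (fst x \<union> fst y) = cnt r (fst x) + cnt r (fst y)"
    using finite_below[OF r] by (auto simp: wsum_def sum.union_disjoint card_Un_disjoint)
  \<comment> \<open>The two old slacks add up to at most the total count minus 2, which leaves room
    for \<open>u\<close>.\<close>
  then have "slack r ?z = slack r x + slack r y + int u"
    "cnt r (fst ?z) = cnt r (fst x) + cnt r (fst y)" by (auto simp: slack_def)
  note new = this wp_leD(2,3)[OF le xy(1)] wp_leD(2,3)[OF le xy(2)]
  fix z assume "z \<in> mrg u x y p"
  then consider "z = ?z" | "z \<in> p" by (auto simp: mrg_def)
  then show "0 \<le> slack r z" "slack r z < int (cnt r (fst z))"
    using new u wp_leD(2,3)[OF le, of z] by (cases; simp)+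
qed

end

lemma cnt_pos: "wp_le p q \<Longrightarrow> z \<in> q \<Longrightarrow> 0 < cnt p (fst z)"
  using wp_leD(2,3)[of p q z] by force

lemma below_exI:
  assumes p: "p \<in> wpartitions n" and q: "q \<in> wpartitions n" and le: "wp_le p q"
    and z: "z \<in> q" and i: "i \<in> fst z"
  shows "\<exists>x\<in>below p (fst z). i \<in> fst x"
proof -
  have "i \<in> {1..n}" using wpartitionsD(4)[OF q z] i by blast
  then obtain x where x: "x \<in> p" "i \<in> fst x" using wpartitionsD(6)[OF p] by blast
  obtain z' where z': "z' \<in> q" "fst x \<subseteq> fst z'" using wp_leD(1)[OF le x(1)] by blast
  then have "z' = z" using wpartitionsD(5)[OF q z'(1) z _ i] x by blast
  then show ?thesis using x z'(2) unfolding below_def by blast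
qed

text \<open>If every block of \<open>q\<close> held just one block of \<open>p\<close>, the two
  partitions would coincide, and so would the weights, because a nonnegative slack below 1 is
  0.\<close>

lemma ex_cnt_ge2:
  assumes p: "p \<in> wpartitions n" and q: "q \<in> wpartitions n" and le: "wp_le p q" and ne: "p \<noteq> q"
  shows "\<exists>z\<in>q. 2 \<le> cnt p (fst z)"
proof (rule ccontr)
  assume "\<not> ?thesis"
  then have one: "cnt p (fst z) = 1" if "z \<in> q" for z
    using cnt_pos[OF le that] that by force
  have blk: "below p (fst z) = {z}" if z: "z \<in> q" for z
  proof -
    obtain x where x: "below p (fst z) = {x}" using one[OF z] card_1_singletonE by blast
    have "fst x \<subseteq> fst z" using x unfolding below_def by blast
    moreover have "fst z \<subseteq> fst x"
    proof
      fix i assume "i \<in> fst z"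
      from below_exI[OF p q le z this] show "i \<in> fst x" unfolding x by simp
    qed
    ultimately have "fst x = fst z" by simp
    moreover have "snd x = snd z" using wp_leD(2,3)[OF le z] x by (simp add: slack_def wsum_def)
    ultimately show ?thesis using x by (simp add: prod_eq_iff)
  qed
  have "q \<subseteq> p" using blk by (auto simp: below_def)
  moreover have "p \<subseteq> q"
  proof
    fix x assume x: "x \<in> p"
    then obtain z where z: "z \<in> q" "fst x \<subseteq> fst z" using wp_leD(1)[OF le] by blast
    then show "x \<in> q" using blk[OF z(1)] x by (auto simp: below_def)
  qed
  ultimately show False using ne by simp
qed

lemma ex_mrg_le:
  assumes p: "p \<in> wpartitions n" and q: "q \<in> wpartitions n" and le: "wp_le p q"
    and z: "z \<in> q" and xy: "x \<in> below p (fst z)" "y \<in> below p (fst z)" "x \<noteq> y"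
  shows "\<exists>u\<le>1. wp_le (mrg u x y p) q"
proof -
  \<comment> \<open>Weight 1 is forced only when the slack has its maximal value, which the count
    lowered by one would no longer allow.\<close>
  let ?u = "if slack p z = int (cnt p (fst z)) - 1 then 1 else 0 :: nat"
  have x: "x \<in> p" "y \<in> p" "fst x \<subseteq> fst z" "fst y \<subseteq> fst z" using xy by (auto simp: below_def)
  have "wp_le (mrg ?u x y p) q"
    using wp_leD(2,3)[OF le z] le z x below_mrg_in(3)[OF p x(1,2) xy(3) _ x(3,4), of 0]
    by (subst mrg_le_iff[OF p x(1,2) xy(3) _ q]) (auto intro!: bexI[of _ z])
  then show ?thesis by (intro exI[of _ ?u]) auto
qed

section \<open>Covers are merges; transitivity and ranks\<close>

definition wstep :: "wpartition \<Rightarrow> wpartition \<Rightarrow> bool" where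
  "wstep p q \<longleftrightarrow> (\<exists>x\<in>p. \<exists>y\<in>p. \<exists>u\<le>1. x \<noteq> y \<and> q = mrg u x y p)"

lemma wstep_in: "p \<in> wpartitions n \<Longrightarrow> wstep p q \<Longrightarrow> q \<in> wpartitions n"
  unfolding wstep_def using mrg_in by blast

lemma wstep_card: "p \<in> wpartitions n \<Longrightarrow> wstep p q \<Longrightarrow> card p = Suc (card q)"
  unfolding wstep_def using card_mrg by blast

lemma le_imp_steps:
  assumes "p \<in> wpartitions n" "q \<in> wpartitions n" "wp_le p q"
  shows "wstep\<^sup>*\<^sup>* p q"
  using assms
proof (induction "card p" arbitrary: p)
  case 0
  then show ?case using ex_cnt_ge2[of p n q] wpartitionsD(1)[of p n] by (cases "p = q") (auto simp: below_def)
next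
  case (Suc k)
  show ?case
  proof (cases "p = q")
    case False
    then obtain z where z: "z \<in> q" "2 \<le> cnt p (fst z)" using ex_cnt_ge2 Suc.prems by blast
    then obtain x y where xy: "x \<in> below p (fst z)" "y \<in> below p (fst z)" "x \<noteq> y"
      using card_le_Suc0_iff_eq[OF finite_below[OF Suc.prems(1)], of "fst z"] by force
    then obtain u where u: "u \<le> 1" "wp_le (mrg u x y p) q"
      using ex_mrg_le[OF Suc.prems z(1)] by blast
    have st: "wstep p (mrg u x y p)" using xy u by (auto simp: wstep_def below_def)
    then show ?thesis
      using Suc.hyps(1)[of "mrg u x y p"] Suc.hyps(2) Suc.prems wstep_card[OF _ st] wstep_in[OF _ st] u(2)
      by (metis Suc_inject converse_rtranclp_into_rtranclp)
  qed simp
qed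

lemma steps_imp_le:
  assumes "wstep\<^sup>*\<^sup>* q t" "p \<in> wpartitions n" "q \<in> wpartitions n" "wp_le p q"
  shows "t \<in> wpartitions n \<and> wp_le p t \<and> card t \<le> card q \<and> (t \<noteq> q \<longrightarrow> card t < card q)"
  using assms(1)
proof (induction rule: rtranclp_induct)
  case base
  then show ?case using assms by auto
next
  case (step y z)
  then show ?case
    using wstep_in[of y n z] wstep_card[of y n z] assms by (auto simp: wstep_def intro!: le_mrg)
qed

text \<open>The upper relation is decomposed into single merges, each of which preserves being above
  \<open>p\<close> by \<open>le_mrg\<close>; this replaces a comparison of nested weight
  sums.\<close>

lemma wp_le_trans:
  assumes "p \<in> wpartitions n" "q \<in> wpartitions n" "t \<in> wpartitions n" "wp_le p q" "wp_le q t"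
  shows "wp_le p t"
  using steps_imp_le[OF le_imp_steps[OF assms(2,3,5)] assms(1,2,4)] by blast

lemma wp_le_card:
  assumes "p \<in> wpartitions n" "q \<in> wpartitions n" "wp_le p q"
  shows "card q \<le> card p" "p \<noteq> q \<Longrightarrow> card q < card p"
  using steps_imp_le[OF le_imp_steps[OF assms] assms(1,1) wp_le_refl[OF assms(1)]] by auto

abbreviation wlt :: "wpartition \<Rightarrow> wpartition \<Rightarrow> bool" where
  "wlt \<equiv> strict wp_le"

lemma wlt_card: "p \<in> wpartitions n \<Longrightarrow> q \<in> wpartitions n \<Longrightarrow> wlt p q \<Longrightarrow> card q < card p"
  by (simp add: strict_def wp_le_card)

lemma wlt_trans:
  assumes "p \<in> wpartitions n" "q \<in> wpartitions n" "t \<in> wpartitions n" "wlt p q" "wlt q t"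
  shows "wlt p t"
  using assms wlt_card[OF assms(1,2)] wlt_card[OF assms(2,3)] wp_le_trans[OF assms(1-3)]
  by (auto simp: strict_def)

lemma wlt_mrg:
  assumes "p \<in> wpartitions n" "x \<in> p" "y \<in> p" "x \<noteq> y" "u \<le> 1"
  shows "wlt p (mrg u x y p)"
  using le_mrg[OF assms assms(1) wp_le_refl[OF assms(1)]] card_mrg[OF assms] by (auto simp: strict_def)

lemma wlt_ex_mrg:
  assumes p: "p \<in> wpartitions n" and q: "q \<in> wpartitions n" and lt: "wlt p q"
  obtains x y u where "x \<in> p" "y \<in> p" "x \<noteq> y" "u \<le> 1" "wp_le (mrg u x y p) q"
proof -
  have le: "wp_le p q" "p \<noteq> q" using lt by (simp_all add: strict_def)
  obtain r where r: "wstep p r" "wstep\<^sup>*\<^sup>* r q"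
    using le_imp_steps[OF p q le(1)] le(2) by (cases rule: converse_rtranclpE) blast+
  have rin: "r \<in> wpartitions n" by (rule wstep_in[OF p r(1)])
  have "wp_le r q" using steps_imp_le[OF r(2) rin rin wp_le_refl[OF rin]] by blast
  then show ?thesis using r(1) that unfolding wstep_def by blast
qed

lemma wlt_cover:
  assumes p: "p \<in> wpartitions n" and q: "q \<in> wpartitions n" and lt: "wlt p q" and c: "card p = Suc (card q)"
  obtains x y u where "x \<in> p" "y \<in> p" "x \<noteq> y" "u \<le> 1" "q = mrg u x y p"
proof -
  obtain x y u where xy: "x \<in> p" "y \<in> p" "x \<noteq> y" "u \<le> 1" "wp_le (mrg u x y p) q"
    using wlt_ex_mrg[OF p q lt] .
  have "mrg u x y p = q"
    using wp_le_card(2)[OF mrg_in[OF p xy(1-4)] q xy(5)] card_mrg[OF p xy(1-4)] c by auto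
  then show ?thesis using that xy by blast
qed

text \<open>Counting blocks shows that an interior element covers \<open>p\<close>, hence is a
  single merge.\<close>

lemma rank2_interval:
  assumes p: "p \<in> wpartitions n" and q: "q \<in> wpartitions n" and c: "card p = card q + 2"
  shows "{a \<in> wpartitions n. wlt p a \<and> wlt a q} =
    {mrg u x y p | u x y. x \<in> p \<and> y \<in> p \<and> x \<noteq> y \<and> u \<le> 1 \<and> wp_le (mrg u x y p) q}"
proof (intro equalityI subsetI)
  fix a assume "a \<in> {a \<in> wpartitions n. wlt p a \<and> wlt a q}"
  then have a: "a \<in> wpartitions n" "wlt p a" "wlt a q" by auto
  have "card p = Suc (card a)" using wlt_card[OF p a(1,2)] wlt_card[OF a(1) q a(3)] c by simp
  then obtain x y u where "x \<in> p" "y \<in> p" "x \<noteq> y" "u \<le> 1" "a = mrg u x y p"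
    using wlt_cover[OF p a(1,2)] by blast
  moreover have "wp_le a q" using a(3) by (simp add: strict_def)
  ultimately show "a \<in> {mrg u x y p | u x y. x \<in> p \<and> y \<in> p \<and> x \<noteq> y \<and> u \<le> 1 \<and> wp_le (mrg u x y p) q}"
    by blast
next
  fix a assume "a \<in> {mrg u x y p | u x y. x \<in> p \<and> y \<in> p \<and> x \<noteq> y \<and> u \<le> 1 \<and> wp_le (mrg u x y p) q}"
  then obtain x y u where a: "a = mrg u x y p" "x \<in> p" "y \<in> p" "x \<noteq> y" "u \<le> 1" "wp_le a q" by blast
  have "card p = Suc (card a)" using card_mrg[OF p a(2-5)] a(1) by simp
  then have "a \<noteq> q" using c by auto
  then show "a \<in> {a \<in> wpartitions n. wlt p a \<and> wlt a q}"
    using a mrg_in[OF p a(2-5)] wlt_mrg[OF p a(2-5)] by (auto simp: strict_def)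
qed

lemma wp_bot_le: "p \<in> wpartitions n \<Longrightarrow> wp_le (wp_bot n) p"
  unfolding wp_le_iff
proof (intro conjI ballI)
  assume p: "p \<in> wpartitions n"
  fix x assume "x \<in> wp_bot n"
  then show "\<exists>y\<in>p. fst x \<subseteq> fst y" using wpartitionsD(6)[OF p] by (auto simp: wp_bot_def)
next
  assume p: "p \<in> wpartitions n"
  fix y assume y: "y \<in> p"
  have b: "below (wp_bot n) (fst y) = (\<lambda>i. ({i}, 0)) ` fst y"
    using wpartitionsD(4)[OF p y] by (auto simp: below_def wp_bot_def)
  then have "cnt (wp_bot n) (fst y) = card (fst y)" by (simp add: card_image inj_on_def)
  moreover have "wsum (wp_bot n) (fst y) = 0" by (simp add: wsum_def b sum.reindex inj_on_def)
  ultimately show "0 \<le> slack (wp_bot n) y" "slack (wp_bot n) y < int (cnt (wp_bot n) (fst y))"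
    using wpartitionsD(7)[OF p y] by (auto simp: slack_def)
qed

lemma wp_bot_wlt: "p \<in> wpartitions n \<Longrightarrow> p \<noteq> wp_bot n \<Longrightarrow> wlt (wp_bot n) p"
  by (simp add: strict_def wp_bot_le)

text \<open>The interiors of the two kinds of intervals of length two: their sums of chains are the
  commutation of disjoint merges and the (mixed) Jacobi relations.\<close>

lemma rank2_disjoint:
  assumes p: "p \<in> wpartitions n" and xs: "x \<in> p" "y \<in> p" "z \<in> p" "w \<in> p" "distinct [x, y, z, w]"
    and u: "u \<le> 1" "v \<le> 1"
  defines "xy \<equiv> (fst x \<union> fst y, snd x + snd y + u)" and "zw \<equiv> (fst z \<union> fst w, snd z + snd w + v)"
  defines "q \<equiv> mrg v z w (mrg u x y p)"
  shows "{a \<in> wpartitions n. wlt p a \<and> wlt a q} = {mrg u x y p, mrg v z w p}"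
    "q = mrg u x y (mrg v z w p)" "mrg u x y p \<noteq> mrg v z w p"
proof -
  have d: "x \<noteq> y" "z \<noteq> w" using xs by auto
  have p1: "mrg u x y p \<in> wpartitions n" by (rule mrg_in[OF p xs(1,2) d(1) u(1)])
  have zw1: "z \<in> mrg u x y p" "w \<in> mrg u x y p" using xs by (auto simp: mrg_def)
  have qin: "q \<in> wpartitions n" unfolding q_def by (rule mrg_in[OF p1 zw1 d(2) u(2)])
  have c: "card p = card q + 2"
    using card_mrg[OF p xs(1,2) d(1) u(1)] card_mrg[OF p1 zw1 d(2) u(2)] by (simp add: q_def)
  have new: "xy \<notin> p" "zw \<notin> p"
    using mrg_new[OF p xs(1,2) d(1)] mrg_new[OF p xs(3,4) d(2)] by (auto simp: xy_def zw_def)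
  have ne: "xy \<noteq> z" "xy \<noteq> w" "zw \<noteq> x" "zw \<noteq> y" using new xs by auto
  have qeq: "q = insert zw (insert xy (p - {x, y, z, w}))"
    using ne by (auto simp: q_def mrg_def xy_def zw_def)
  moreover have "mrg u x y (mrg v z w p) = insert xy (insert zw (p - {x, y, z, w}))"
    using ne by (auto simp: mrg_def xy_def zw_def)
  ultimately show qe: "q = mrg u x y (mrg v z w p)" by (simp add: insert_commute)
  show "mrg u x y p \<noteq> mrg v z w p"
  proof
    assume "mrg u x y p = mrg v z w p"
    moreover have "z \<in> mrg u x y p" using zw1 by simp
    ultimately have "z = zw" by (auto simp: mrg_def zw_def)
    then show False using new xs by simp
  qed
  have le: "wp_le p q" "wp_le (mrg u x y p) q" "wp_le (mrg v z w p) q"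
  proof -
    show "wp_le (mrg u x y p) q" unfolding q_def by (rule le_mrg[OF p1 zw1 d(2) u(2) p1 wp_le_refl[OF p1]])
    have p2: "mrg v z w p \<in> wpartitions n" by (rule mrg_in[OF p xs(3,4) d(2) u(2)])
    have "x \<in> mrg v z w p" "y \<in> mrg v z w p" using xs by (auto simp: mrg_def)
    then show "wp_le (mrg v z w p) q" unfolding qe by (rule le_mrg[OF p2 _ _ d(1) u(1) p2 wp_le_refl[OF p2]])
    show "wp_le p q"
      using wp_le_trans[OF p p1 qin _ \<open>wp_le (mrg u x y p) q\<close>] wlt_mrg[OF p xs(1,2) d(1) u(1)]
      by (simp add: strict_def)
  qed
  have bq: "below p (fst t) = {t}" if "t \<in> q" "t \<noteq> xy" "t \<noteq> zw" for t
    using that below_block[OF p, of t] by (auto simp: qeq)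
  have two: "below p (fst a \<union> fst b) = {a, b}" if ab: "a \<in> p" "b \<in> p" "a \<noteq> b" for a b
  proof -
    have "t = a \<or> t = b" if t: "t \<in> p" "fst t \<subseteq> fst a \<union> fst b" for t
      using wpartitionsD(2)[OF p t(1)] wpartitionsD(5)[OF p t(1)] ab t(2) by blast
    then show ?thesis using ab by (auto simp: below_def)
  qed
  have bxy: "below p (fst xy) = {x, y}" "below p (fst zw) = {z, w}"
    using two xs d by (auto simp: xy_def zw_def)
  \<comment> \<open>With only two blocks inside, the order condition forces the weight of a first
    merge to equal this slack.\<close>
  have sl: "slack p xy = int u" "slack p zw = int v"
    using d by (simp_all add: slack_def wsum_def bxy) (simp_all add: xy_def zw_def)
  have "b \<in> {mrg u x y p, mrg v z w p}"
    if ab: "s \<in> p" "t \<in> p" "s \<noteq> t" "k \<le> 1" "wp_le (mrg k s t p) q" "b = mrg k s t p" for s t k b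
  proof -
    obtain D where D: "D \<in> q" "fst s \<subseteq> fst D" "fst t \<subseteq> fst D"
      and k: "int k \<le> slack p D" "slack p D - int k < int (cnt p (fst D)) - 1"
      using ab(5) unfolding mrg_le_iff[OF p ab(1-4) qin] by blast
    have st: "s \<in> below p (fst D)" "t \<in> below p (fst D)" using ab D by (auto simp: below_def)
    then have "D = xy \<or> D = zw" using bq[OF D(1)] ab(3) by (metis singletonD)
    then show ?thesis
    proof
      assume D: "D = xy"
      then have "{s, t} = {x, y}" "k = u" using st ab(3) k sl d by (auto simp: bxy)
      then have "mrg k s t p = mrg u x y p"
        using mrg_commute[of u x y p] by (auto simp: doubleton_eq_iff)
      then show ?thesis using ab(6) by simp
    next
      assume D: "D = zw"
      then have "{s, t} = {z, w}" "k = v" using st ab(3) k sl d by (auto simp: bxy)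
      then have "mrg k s t p = mrg v z w p"
        using mrg_commute[of v z w p] by (auto simp: doubleton_eq_iff)
      then show ?thesis using ab(6) by simp
    qed
  qed
  then show "{a \<in> wpartitions n. wlt p a \<and> wlt a q} = {mrg u x y p, mrg v z w p}"
    unfolding rank2_interval[OF p qin c] using le xs d u by blast
qed

text \<open>The set differences between \<open>p\<close> and its merge recover the merged pair and
  the new block; the weight of the latter gives \<open>u\<close>.\<close>

lemma mrg_inj:
  assumes p: "p \<in> wpartitions n" and xs: "x \<in> p" "y \<in> p" "x \<noteq> y" "z \<in> p" "w \<in> p" "z \<noteq> w"
    and eq: "mrg u x y p = mrg v z w p"
  shows "{x, y} = {z, w}" "u = v"
proof -
  have "p - mrg u x y p = {x, y}" "p - mrg v z w p = {z, w}"
    using mrg_new[OF p xs(1-3), of 0] mrg_new[OF p xs(4-6), of 0] xs by (auto simp: mrg_def)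
  then show *: "{x, y} = {z, w}" using eq by simp
  have "mrg u x y p - p = {(fst x \<union> fst y, snd x + snd y + u)}"
    "mrg v z w p - p = {(fst z \<union> fst w, snd z + snd w + v)}"
    using mrg_new[OF p xs(1-3), of 0] mrg_new[OF p xs(4-6), of 0] by (auto simp: mrg_def)
  then have "snd x + snd y + u = snd z + snd w + v" using eq by simp
  then show "u = v" using * by (auto simp: doubleton_eq_iff)
qed

lemma mrg_twice:
  assumes p: "p \<in> wpartitions n" and xs: "x \<in> p" "y \<in> p" "z \<in> p" "distinct [x, y, z]"
  shows "mrg v (fst x \<union> fst y, snd x + snd y + u) z (mrg u x y p) =
    insert (fst x \<union> fst y \<union> fst z, snd x + snd y + snd z + (u + v)) (p - {x, y, z})"
proof -
  have "(fst x \<union> fst y, snd x + snd y + u) \<notin> p" by (rule mrg_new[OF p, of _ _ 0]) (use xs in auto)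
  then have "insert (fst x \<union> fst y, snd x + snd y + u) (p - {x, y}) - {(fst x \<union> fst y, snd x + snd y + u), z}
    = p - {x, y, z}" by auto
  then show ?thesis by (simp add: mrg_def ac_simps)
qed

text \<open>The total added weight \<open>e\<close> splits into \<open>k\<close> for the first merge
  and \<open>e - k\<close> for the second, both at most 1. So \<open>e\<close> equal to 0 or 2
  leaves one \<open>k\<close> and three elements, while \<open>e\<close> equal to 1 leaves two
  values and six elements.\<close>

lemma rank2_triple:
  assumes p: "p \<in> wpartitions n" and xs: "x \<in> p" "y \<in> p" "z \<in> p" "distinct [x, y, z]" and e: "e \<le> (2::nat)"
  defines "q \<equiv> insert (fst x \<union> fst y \<union> fst z, snd x + snd y + snd z + e) (p - {x, y, z})"
  shows "{a \<in> wpartitions n. wlt p a \<and> wlt a q} =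
    {mrg k s t p | k s t. (s, t) \<in> {(x, y), (y, z), (z, x)} \<and> k \<le> 1 \<and> k \<le> e \<and> e \<le> k + 1}"
    (is "_ = ?R")
proof -
  have d: "x \<noteq> y" "y \<noteq> z" "z \<noteq> x" using xs by auto
  have sub: "mrg k s t p \<in> wpartitions n \<and> wp_le (mrg k s t p) q \<and> wp_le p q \<and> q \<in> wpartitions n \<and> card p = card q + 2"
    if st: "(s, t) \<in> {(x, y), (y, z), (z, x)}" and k: "k \<le> 1" "k \<le> e" "e \<le> k + 1" for k s t
  proof -
    define r where "r = (if (s, t) = (x, y) then z else if (s, t) = (y, z) then x else y)"
    have str: "s \<in> p" "t \<in> p" "r \<in> p" "distinct [s, t, r]" using st xs by (auto simp: r_def)
    have stne: "s \<noteq> t" using str by simp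
    have m: "mrg k s t p \<in> wpartitions n" by (rule mrg_in[OF p str(1,2) stne k(1)])
    let ?b = "(fst s \<union> fst t, snd s + snd t + k)"
    have b: "?b \<in> mrg k s t p" "r \<in> mrg k s t p" "?b \<noteq> r"
      using str mrg_new[OF p str(1,2) stne, of 0] by (auto simp: mrg_def)
    have ek: "e - k \<le> 1" using k by simp
    have q: "q = mrg (e - k) ?b r (mrg k s t p)"
      unfolding mrg_twice[OF p str] q_def using st d k by (auto simp: r_def ac_simps)
    have 1: "wp_le (mrg k s t p) q" unfolding q by (rule le_mrg[OF m b ek m wp_le_refl[OF m]])
    have 2: "wp_le p (mrg k s t p)" using wlt_mrg[OF p str(1,2) stne k(1)] by (simp add: strict_def)
    have 3: "q \<in> wpartitions n" unfolding q by (rule mrg_in[OF m b ek])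
    have 4: "card p = card q + 2" unfolding q
      using card_mrg[OF p str(1,2) stne k(1)] card_mrg[OF m b ek] by simp
    show ?thesis using m 1 3 4 wp_le_trans[OF p m 3 2 1] by blast
  qed
  \<comment> \<open>Some admissible weight; it serves to instantiate \<open>sub\<close> for the
    facts about \<open>p\<close> and \<open>q\<close> alone.\<close>
  define k0 where "k0 = (if e = 0 then 0 else 1::nat)"
  have k0: "k0 \<le> 1" "k0 \<le> e" "e \<le> k0 + 1" using e by (auto simp: k0_def)
  have qin: "q \<in> wpartitions n" and le: "wp_le p q" and c: "card p = card q + 2"
    using sub[of x y k0] k0 by auto
  define D0 where "D0 = (fst x \<union> fst y \<union> fst z, snd x + snd y + snd z + e)"
  have qeq: "q = insert D0 (p - {x, y, z})" by (simp add: q_def D0_def)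
  have bD: "below p (fst D0) = {x, y, z}"
  proof -
    have "t \<in> {x, y, z}" if t: "t \<in> p" "fst t \<subseteq> fst D0" for t
    proof -
      obtain i where "i \<in> fst t" using wpartitionsD(2)[OF p t(1)] by blast
      moreover from this have "i \<in> fst x \<or> i \<in> fst y \<or> i \<in> fst z" using t(2) by (auto simp: D0_def)
      ultimately show ?thesis
        using wpartitionsD(5)[OF p t(1) xs(1)] wpartitionsD(5)[OF p t(1) xs(2)]
          wpartitionsD(5)[OF p t(1) xs(3)] by blast
    qed
    moreover have "x \<in> below p (fst D0)" "y \<in> below p (fst D0)" "z \<in> below p (fst D0)"
      using xs(1-3) by (auto simp: below_def D0_def)
    ultimately show ?thesis by (auto simp: below_def)
  qed
  have sl: "slack p D0 = int e" using d by (simp add: slack_def wsum_def bD) (simp add: D0_def)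
  have "b \<in> ?R" if ab: "s \<in> p" "t \<in> p" "s \<noteq> t" "k \<le> 1" "wp_le (mrg k s t p) q" "b = mrg k s t p" for s t k b
  proof -
    obtain D where D: "D \<in> q" "fst s \<subseteq> fst D" "fst t \<subseteq> fst D"
      and k: "int k \<le> slack p D" "slack p D - int k < int (cnt p (fst D)) - 1"
      using ab(5) unfolding mrg_le_iff[OF p ab(1-4) qin] by blast
    have st: "s \<in> below p (fst D)" "t \<in> below p (fst D)" using ab D by (auto simp: below_def)
    have "D = D0"
    proof (rule ccontr)
      assume "D \<noteq> D0"
      then have "D \<in> p" using D(1) by (auto simp: qeq)
      from below_block[OF p this] show False using st ab(3) by (metis singletonD)
    qed
    then have s: "s \<in> {x, y, z}" "t \<in> {x, y, z}" and k': "k \<le> e" "e \<le> k + 1"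
      using st k sl d by (auto simp: bD)
    then have "(s, t) \<in> {(x, y), (y, z), (z, x)} \<or> (t, s) \<in> {(x, y), (y, z), (z, x)}"
      using ab(3) by auto
    then show ?thesis
      using k' ab(4,6) mrg_commute[of k s t p] by blast
  qed
  then have 1: "{mrg k s t p | k s t. s \<in> p \<and> t \<in> p \<and> s \<noteq> t \<and> k \<le> 1 \<and> wp_le (mrg k s t p) q} \<subseteq> ?R"
    by blast
  have 2: "?R \<subseteq> {mrg k s t p | k s t. s \<in> p \<and> t \<in> p \<and> s \<noteq> t \<and> k \<le> 1 \<and> wp_le (mrg k s t p) q}"
  proof
    fix b assume "b \<in> ?R"
    then obtain k s t where b: "b = mrg k s t p" "(s, t) \<in> {(x, y), (y, z), (z, x)}" "k \<le> 1" "k \<le> e" "e \<le> k + 1"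
      by blast
    have "wp_le (mrg k s t p) q" using sub[OF b(2-5)] by blast
    moreover have "s \<in> p \<and> t \<in> p \<and> s \<noteq> t" using b(2) xs d by auto
    ultimately show "b \<in> {mrg k s t p | k s t. s \<in> p \<and> t \<in> p \<and> s \<noteq> t \<and> k \<le> 1 \<and> wp_le (mrg k s t p) q}"
      using b(1,3) by blast
  qed
  show ?thesis unfolding rank2_interval[OF p qin c] using 1 2 by (rule equalityI)
qed

section \<open>Signs\<close>

text \<open>The parity of the number of inversions. It is defined for words over any set of numbers,
  since it is applied both to leaf words of forests and to lists of least leaves.\<close>

primrec isgn :: "nat list \<Rightarrow> int" where
  "isgn [] = 1"
| "isgn (a # w) = (-1) ^ length (filter (\<lambda>b. b < a) w) * isgn w"

lemma isgn_swap: "a \<noteq> b \<Longrightarrow> isgn (u @ a # b # v) = - isgn (u @ b # a # v)"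
  by (induction u) auto

lemma isgn_move: "a \<notin> set xs \<Longrightarrow> isgn (u @ xs @ a # v) = (-1) ^ length xs * isgn (u @ a # xs @ v)"
proof (induction xs arbitrary: u)
  case (Cons x xs)
  then show ?case using Cons.IH[of "u @ [x]"] isgn_swap[of x a u "xs @ v"] by simp
qed simp

lemma isgn_block:
  "set xs \<inter> set ys = {} \<Longrightarrow> isgn (u @ xs @ ys @ v) = (-1) ^ (length xs * length ys) * isgn (u @ ys @ xs @ v)"
proof (induction ys arbitrary: u)
  case (Cons y ys)
  then have "isgn (u @ xs @ y # ys @ v) = (-1) ^ length xs * isgn ((u @ [y]) @ xs @ ys @ v)"
    using isgn_move[of y xs u "ys @ v"] by simp
  also have "isgn ((u @ [y]) @ xs @ ys @ v) = (-1) ^ (length xs * length ys) * isgn ((u @ [y]) @ ys @ xs @ v)"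
    by (rule Cons.IH) (use Cons.prems in auto)
  finally show ?case by (simp add: power_add)
qed simp

lemma isgn_far:
  assumes "distinct (u @ a # v @ b # w)"
  shows "isgn (u @ a # v @ b # w) = - isgn (u @ b # v @ a # w)"
proof -
  have "isgn (u @ (a # v) @ b # w) = (-1) ^ length (a # v) * isgn (u @ b # (a # v) @ w)"
    by (rule isgn_move) (use assms in auto)
  moreover have "isgn ((u @ [b]) @ v @ a # w) = (-1) ^ length v * isgn ((u @ [b]) @ a # v @ w)"
    by (rule isgn_move) (use assms in auto)
  ultimately show ?thesis by simp
qed

lemma isgn_sorted: "sorted_wrt (<) w \<Longrightarrow> isgn w = 1"
proof (induction w)
  case (Cons a w)
  then have "filter (\<lambda>b. b < a) w = []" by (auto simp: filter_empty_conv)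
  then show ?case using Cons by simp
qed simp

lemma isgn_unit: "isgn w = 1 \<or> isgn w = -1"
  by (induction w) (auto simp: minus_one_power_iff)

text \<open>A transposition of values exchanges two entries of the word, wherever they stand, and so
  reverses the inversion parity; a permutation is composed of transpositions.\<close>

lemma isgn_map_permutes:
  assumes "p permutes {1..n}" "distinct w" "set w = {1..n}"
  shows "isgn (map p w) = sign p * isgn w"
  using assms(1) finite_atLeastAtMost
proof (induction rule: permutes_induct)
  case id
  then show ?case by simp
next
  case (swap a b p)
  let ?L = "map p w" and ?t = "Transposition.transpose a b"
  have L: "distinct ?L" "set ?L = {1..n}"
    using assms(2,3) swap permutes_inj_on[OF swap.hyps(4)] permutes_image[OF swap.hyps(4)] by (auto simp: distinct_map)
  have main: "isgn (map ?t l) = - isgn l" if l: "distinct l" "l = u @ x # v @ y # z" "{x, y} = {a, b}" for l u v z x y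
  proof -
    have "map ?t u = u" "map ?t v = v" "map ?t z = z"
      using l by (auto intro!: map_idI simp: Transposition.transpose_def doubleton_eq_iff)
    moreover have "?t x = y" "?t y = x" using l(3) by (auto simp: doubleton_eq_iff)
    ultimately have "map ?t l = u @ y # v @ x # z" using l(2) by simp
    then show ?thesis using isgn_far[of u x v y z] l by simp
  qed
  have "a \<in> set ?L" "b \<in> set ?L" using swap L by auto
  then obtain u z where u: "?L = u @ a # z" by (meson split_list)
  have "isgn (map ?t ?L) = - isgn ?L"
  proof (cases "b \<in> set z")
    case True
    then obtain v y where "z = v @ b # y" by (meson split_list)
    then show ?thesis using main[OF L(1), of u a v b y] u by simp
  next
    case False
    then have "b \<in> set u" using \<open>b \<in> set ?L\<close> u swap by auto
    then obtain v y where "u = v @ b # y" by (meson split_list)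
    then show ?thesis using main[OF L(1), of v b y a z] u by auto
  qed
  moreover have "sign (?t \<circ> p) = - sign p"
  proof -
    have "permutation p" using swap.hyps(4) finite_atLeastAtMost permutation_permutes by blast
    then show ?thesis using swap.hyps(3) by (simp add: sign_compose permutation_swap_id sign_swap_id)
  qed
  ultimately show ?case by (metis map_map mult_minus_left swap.IH)
qed

text \<open>Prepending a tree turns the odd positions of \<open>F\<close> into the even ones, and
  the sum over odd positions has the parity of the total plus the sum over even positions.\<close>

lemma forest_sgn_Cons:
  "forest_sgn (T # F) = tree_sgn T * (-1) ^ (\<Sum>t\<leftarrow>F. ninternal t) * forest_sgn F"
proof -
  let ?f = "\<lambda>i. ninternal (F ! (i - 1))"
  let ?e = "\<Sum>i | i \<in> {1..length F} \<and> even i. ?f i" and ?o = "\<Sum>i | i \<in> {1..length F} \<and> odd i. ?f i"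
  have "(\<Sum>i | i \<in> {1..length (T # F)} \<and> even i. ninternal ((T # F) ! (i - 1))) = ?o"
    by (rule sum.reindex_bij_witness[where i = Suc and j = "\<lambda>i. i - 1"])
      (auto simp: nth_Cons' elim: oddE)
  moreover have "(\<Sum>t\<leftarrow>F. ninternal t) = ?o + ?e"
  proof -
    have "(\<Sum>t\<leftarrow>F. ninternal t) = (\<Sum>i<length F. ninternal (F ! i))"
      by (simp add: sum_list_sum_nth atLeast0LessThan)
    also have "\<dots> = (\<Sum>i\<in>{1..length F}. ?f i)"
      by (rule sum.reindex_bij_witness[where i = "\<lambda>i. i - 1" and j = Suc]) auto
    also have "\<dots> = sum ?f ({i. i \<in> {1..length F} \<and> odd i} \<union> {i. i \<in> {1..length F} \<and> even i})"
      by (rule sum.cong) auto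
    also have "\<dots> = ?o + ?e" by (rule sum.union_disjoint) auto
    finally show ?thesis .
  qed
  moreover have "(-1 :: int) ^ ?o = (-1) ^ (?o + ?e) * (-1) ^ ?e"
    by (simp add: power_add flip: power_mult_distrib)
  ultimately show ?thesis by (simp add: forest_sgn_def mult_ac)
qed

lemma forest_sgn_Nil: "forest_sgn [] = 1"
  by (simp add: forest_sgn_def)

definition isum :: "'a btree list \<Rightarrow> nat" where
  "isum F = (\<Sum>t\<leftarrow>F. ninternal t)"

lemma isum_simps [simp]: "isum [] = 0" "isum (t # F) = ninternal t + isum F" "isum (F @ F') = isum F + isum F'"
  by (simp_all add: isum_def)

lemma forest_sgn_append:
  "forest_sgn (F @ F') = forest_sgn F * (-1) ^ (length F * isum F') * forest_sgn F'"
  by (induction F) (simp_all add: forest_sgn_Nil forest_sgn_Cons power_add mult_ac flip: isum_def)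

lemma nleaves_ninternal: "nleaves t = Suc (ninternal t)"
  by (induction t) auto

text \<open>The product sgn(sigma) sgn(F) of the statement, as a function of the labelled
  forest.\<close>

definition gsgn :: "nat btree list \<Rightarrow> int" where
  "gsgn G = isgn (forest_word G) * forest_sgn G"

lemma tree_sgn_unit: "tree_sgn t = 1 \<or> tree_sgn t = -1"
  by (induction t) (auto simp: minus_one_power_iff)

lemma forest_sgn_unit: "forest_sgn F = 1 \<or> forest_sgn F = -1"
proof (induction F)
  case (Cons t F)
  then show ?case using tree_sgn_unit[of t] by (auto simp: forest_sgn_Cons minus_one_power_iff)
qed (simp add: forest_sgn_Nil)

lemma gsgn_unit: "gsgn G = 1 \<or> gsgn G = -1"
  using isgn_unit[of "forest_word G"] forest_sgn_unit[of G] by (auto simp: gsgn_def)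

text \<open>With i and j internal nodes the leaf words have i+1 and j+1 letters. Exchanging them
  changes the inversion parity by (i+1)(j+1) and the forest sign by i+j, together ij+1 modulo 2. The
  part ij will cancel against reordering the merges of the two trees; the 1 is the sign of the wedge
  product.\<close>

lemma gsgn_swap:
  assumes "distinct (forest_word (G1 @ S # T # G2))"
  shows "gsgn (G1 @ S # T # G2) = - ((-1) ^ (ninternal S * ninternal T)) * gsgn (G1 @ T # S # G2)"
proof -
  have "set (leaf_word S) \<inter> set (leaf_word T) = {}" using assms by auto
  then have "isgn (forest_word (G1 @ S # T # G2)) =
    (-1) ^ (Suc (ninternal S) * Suc (ninternal T)) * isgn (forest_word (G1 @ T # S # G2))"
    using isgn_block[of "leaf_word S" "leaf_word T" "forest_word G1" "forest_word G2"]
    by (simp add: nleaves_ninternal)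
  moreover have "forest_sgn (G1 @ S # T # G2) =
    (-1) ^ (ninternal S + ninternal T) * forest_sgn (G1 @ T # S # G2)"
    by (simp add: forest_sgn_append forest_sgn_Cons power_add mult_ac add.left_commute power_mult_distrib flip: isum_def)
  moreover have "(-1 :: int) ^ (Suc (ninternal S) * Suc (ninternal T)) * (-1) ^ (ninternal S + ninternal T) =
    - ((-1) ^ (ninternal S * ninternal T))"
    by (simp add: minus_one_power_iff)
  ultimately show ?thesis unfolding gsgn_def by (simp only: mult_ac) (simp add: mult_ac)
qed

text \<open>The exponent accounts for moving the merge at the new root from behind the merges of
  \<open>G\<close> to its postorder place before them.\<close>

lemma gsgn_Node: "gsgn (Node c S T # G) = (-1) ^ isum G * gsgn (S # T # G)"
  by (simp add: gsgn_def forest_sgn_Cons power_add mult_ac flip: isum_def)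

section \<open>Merge sequences realising signed forests\<close>

abbreviation lv :: "nat btree \<Rightarrow> nat set" where
  "lv t \<equiv> set (leaf_word t)"

primrec reds :: "'a btree \<Rightarrow> nat" where
  "reds (Leaf a) = 0"
| "reds (Node c l r) = reds l + reds r + col_weight c"

abbreviation blk :: "nat btree \<Rightarrow> nat set \<times> nat" where
  "blk t \<equiv> (lv t, reds t)"

text \<open>A red merge adds 1 to the weight and a blue one adds 0, so the weight of a block is the
  number of red nodes of its tree.\<close>

definition wpf :: "nat btree list \<Rightarrow> wpartition" where
  "wpf G = blk ` set G"

abbreviation mlin :: "nat \<Rightarrow> nat btree list \<Rightarrow> bool" where
  "mlin n G \<equiv> G \<in> MF {1..n} (length G)"

lemma col_weight_le: "col_weight c \<le> 1"
  by (cases c) auto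

lemma col_weight_inj: "col_weight c = col_weight c' \<longleftrightarrow> c = c'"
  by (cases c; cases c') auto

lemma reds_less: "reds t < nleaves t"
proof (induction t)
  case (Node c l r)
  then show ?case using col_weight_le[of c] by simp
qed simp

lemma mlin_disjoint:
  assumes "mlin n G" "t \<in> set G" "t' \<in> set G" "i \<in> lv t" "i \<in> lv t'"
  shows "t = t'"
proof (rule ccontr)
  assume "t \<noteq> t'"
  obtain G1 G2 where G: "G = G1 @ t # G2" using assms(2) by (meson split_list)
  then have "t' \<in> set G1 \<or> t' \<in> set G2" using \<open>t \<noteq> t'\<close> assms(3) by auto
  then show False using assms(1,4,5) G by (auto simp: MF_def)
qed

lemma mlin_distinct: "mlin n G \<Longrightarrow> distinct G"
proof (induction G rule: rev_induct)
  case (snoc t G)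
  have "t \<notin> set G"
  proof
    assume "t \<in> set G"
    moreover obtain i where "i \<in> lv t" using leaf_word_neq_Nil[of t] by (cases "leaf_word t") auto
    ultimately show False using snoc.prems by (auto simp: MF_def)
  qed
  moreover have "distinct (map leaf_word G) \<or> True" by simp
  moreover have "distinct G"
  proof -
    have *: "distinct (forest_word G) \<Longrightarrow> distinct G" for G :: "nat btree list"
    proof (induction G)
      case (Cons t G)
      moreover have "t \<notin> set G"
      proof
        assume "t \<in> set G"
        then show False using Cons.prems by (cases "leaf_word t") auto
      qed
      ultimately show ?case by simp
    qed simp
    show ?thesis using * snoc.prems by (auto simp: MF_def)
  qed
  ultimately show ?case by simp
qed simp

lemma mlin_card_lv:
  assumes "mlin n G" "t \<in> set G"
  shows "card (lv t) = nleaves t"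
proof -
  obtain G1 G2 where "G = G1 @ t # G2" using assms(2) by (meson split_list)
  then have "distinct (leaf_word t)" using assms(1) by (auto simp: MF_def)
  then show ?thesis by (rule distinct_card)
qed

lemma wpf_in:
  assumes "mlin n G"
  shows "wpf G \<in> wpartitions n"
proof (rule wpartitionsI)
  have cover: "(\<Union>t\<in>set G. lv t) = {1..n}" using assms by (auto simp: MF_def)
  show "\<exists>x\<in>wpf G. i \<in> fst x" if i: "i \<in> {1..n}" for i
  proof -
    obtain t where "t \<in> set G" "i \<in> lv t" using i cover by blast
    then show ?thesis by (intro bexI[of _ "blk t"]) (simp_all add: wpf_def)
  qed
  fix x assume "x \<in> wpf G"
  then obtain t where t: "t \<in> set G" "x = blk t" by (auto simp: wpf_def)
  show "fst x \<noteq> {}" using t by simp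
  show "fst x \<subseteq> {1..n}" using t cover by auto
  show "snd x < card (fst x)" using t reds_less[of t] mlin_card_lv[OF assms t(1)] by simp
  show "x = y" if y: "y \<in> wpf G" "i \<in> fst x" "i \<in> fst y" for y i
  proof -
    obtain t' where t': "t' \<in> set G" "y = blk t'" using y(1) by (auto simp: wpf_def)
    have "t = t'" using mlin_disjoint[OF assms t(1) t'(1), of i] y t t' by simp
    then show ?thesis using t t' by simp
  qed
qed

lemma blk_inj:
  assumes "mlin n G" "t \<in> set G" "t' \<in> set G" "lv t = lv t'"
  shows "t = t'"
proof -
  obtain i where "i \<in> lv t" using leaf_word_neq_Nil[of t] by (cases "leaf_word t") auto
  then show ?thesis using mlin_disjoint[OF assms(1-3)] assms(4) by blast
qed

lemma card_wpf: "mlin n G \<Longrightarrow> card (wpf G) = length G"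
proof -
  assume m: "mlin n G"
  have "inj_on blk (set G)"
    by (rule inj_onI, rule blk_inj[OF m]) simp_all
  then show ?thesis unfolding wpf_def using mlin_distinct[OF m] by (simp add: card_image distinct_card)
qed

lemma wpf_mrg:
  assumes "mlin n (S # T # G)"
  shows "blk S \<in> wpf (S # T # G)" "blk T \<in> wpf (S # T # G)" "blk S \<noteq> blk T"
    "mrg (col_weight c) (blk S) (blk T) (wpf (S # T # G)) = wpf (Node c S T # G)"
    "wpf (S # T # G) - {blk S, blk T} = wpf G"
proof -
  note d = mlin_distinct[OF assms] and inj = blk_inj[OF assms]
  show 1: "blk S \<in> wpf (S # T # G)" "blk T \<in> wpf (S # T # G)" by (auto simp: wpf_def)
  show 2: "blk S \<noteq> blk T" using inj[of S T] d by auto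
  have "blk X \<notin> wpf G" if "X \<in> {S, T}" for X
  proof
    assume "blk X \<in> wpf G"
    then obtain t where "t \<in> set G" "lv X = lv t" by (auto simp: wpf_def)
    then show False using inj[of X t] that d by auto
  qed
  then have "blk S \<notin> wpf G" "blk T \<notin> wpf G" by auto
  then show 3: "wpf (S # T # G) - {blk S, blk T} = wpf G" by (auto simp: wpf_def)
  show "mrg (col_weight c) (blk S) (blk T) (wpf (S # T # G)) = wpf (Node c S T # G)"
    unfolding mrg_def 3 by (simp add: wpf_def)
qed

lemma mlin_cong: "mset G = mset G' \<Longrightarrow> mlin n G \<longleftrightarrow> mlin n G'"
proof -
  assume *: "mset G = mset G'"
  have "mset (forest_word H) = (\<Sum>t\<in>#mset H. mset (leaf_word t))" for H :: "nat btree list"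
    by (induction H) auto
  then show ?thesis
    using MF_cong[of G G' "{1..n}" "length G"] * by (metis size_mset)
qed

lemma mlin_Node: "mlin n (S # T # G) \<longleftrightarrow> mlin n (Node c S T # G)"
  by (simp add: MF_def Un_assoc)

text \<open>A sequence \<open>w\<close> of merges, starting from the sorted leaves, produces the
  list \<open>G\<close> of trees with sign \<open>e\<close>. Exchanging neighbours reverses the
  sign, and only the first two trees are merged, at no sign. Any other merge thus receives its sign
  from the moves that bring its trees to the front.\<close>

inductive real :: "nat \<Rightarrow> (color \<times> nat set \<times> nat set) list \<Rightarrow> int \<Rightarrow> nat btree list \<Rightarrow> bool" for n where
  real_init: "real n [] 1 (map Leaf [1..<Suc n])"
| real_swap: "real n w e (G1 @ S # T # G2) \<Longrightarrow> real n w (- e) (G1 @ T # S # G2)"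
| real_step: "real n w e (S # T # G) \<Longrightarrow> real n (w @ [(c, lv S, lv T)]) e (Node c S T # G)"

abbreviation wchain :: "nat \<Rightarrow> (color \<times> nat set \<times> nat set) list \<Rightarrow> wpartition list" where
  "wchain n w \<equiv> merge_chain (wp_bot n) w"

definition do_step :: "color \<times> nat set \<times> nat set \<Rightarrow> wpartition \<Rightarrow> wpartition" where
  "do_step s p = (case s of (c, A, B) \<Rightarrow> merge (col_weight c) A B p)"

lemma merge_chain_neq_Nil [simp]: "merge_chain p w \<noteq> []"
  by (cases w) auto

lemma hd_merge_chain [simp]: "hd (merge_chain p w) = p"
  by (cases w) auto

lemma length_merge_chain [simp]: "length (merge_chain p w) = Suc (length w)"
  by (induction w arbitrary: p) auto

lemma merge_chain_append:
  "merge_chain p (w @ w') = butlast (merge_chain p w) @ merge_chain (last (merge_chain p w)) w'"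
  by (induction w arbitrary: p) auto

lemma merge_chain_snoc:
  "merge_chain p (w @ [s]) = merge_chain p w @ [do_step s (last (merge_chain p w))]"
proof -
  have "merge_chain p w = butlast (merge_chain p w) @ [last (merge_chain p w)]" by simp
  then show ?thesis unfolding merge_chain_append by (simp add: do_step_def)
qed

lemma do_step_mrg:
  assumes "p \<in> wpartitions n" "x \<in> p" "y \<in> p"
  shows "do_step (c, fst x, fst y) p = mrg (col_weight c) x y p"
  by (simp add: do_step_def merge_eq_mrg[OF assms])

lemma real_mlin: "real n w e G \<Longrightarrow> mlin n G"
proof (induction rule: real.induct)
  case real_init
  have "forest_word (map Leaf xs) = xs" for xs :: "nat list" by (induction xs) auto
  then show ?case by (auto simp: MF_def simp del: upt_Suc)
next
  case (real_swap w e G1 S T G2)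
  then show ?case using mlin_cong[of "G1 @ S # T # G2" "G1 @ T # S # G2" n] by simp
next
  case (real_step w e S T G c)
  then show ?case using mlin_Node by blast
qed

lemma real_unit: "real n w e G \<Longrightarrow> e = 1 \<or> e = -1"
  by (induction rule: real.induct) auto

lemma do_step_wpf:
  assumes "mlin n (S # T # G)"
  shows "do_step (c, lv S, lv T) (wpf (S # T # G)) = wpf (Node c S T # G)"
  using do_step_mrg[OF wpf_in[OF assms] wpf_mrg(1,2)[OF assms], of c] wpf_mrg(4)[OF assms] by simp

lemma wpf_cong: "set G = set G' \<Longrightarrow> wpf G = wpf G'"
  by (simp add: wpf_def)

lemma real_last: "real n w e G \<Longrightarrow> last (wchain n w) = wpf G"
proof (induction rule: real.induct)
  case real_init
  then show ?case by (auto simp: wpf_def wp_bot_def image_iff simp del: upt_Suc)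
next
  case (real_swap w e G1 S T G2)
  have "set (G1 @ S # T # G2) = set (G1 @ T # S # G2)" by auto
  from wpf_cong[OF this] show ?case using real_swap by simp
next
  case (real_step w e S T G c)
  then show ?case using do_step_wpf[OF real_mlin[OF real_step(1)]] by (simp add: merge_chain_snoc)
qed

lemma wlt_wpf_Node:
  assumes "mlin n (S # T # G)"
  shows "wlt (wpf (S # T # G)) (wpf (Node c S T # G))"
  using wlt_mrg[OF wpf_in[OF assms] wpf_mrg(1-3)[OF assms] col_weight_le, of c] wpf_mrg(4)[OF assms] by simp

text \<open>The length condition forces every rank to occur, so these are the saturated chains from
  the minimum to \<open>y\<close>.\<close>

definition fchains :: "nat \<Rightarrow> wpartition \<Rightarrow> wpartition list set" where
  "fchains n y = {c. sorted_wrt wlt c \<and> set c \<subseteq> wpartitions n \<and> c \<noteq> [] \<and> hd c = wp_bot n \<and> last c = y \<and>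
    length c + card y = Suc n}"

lemma sorted_wrt_snoc:
  assumes c: "sorted_wrt wlt c" "set c \<subseteq> wpartitions n" "c \<noteq> []" and y: "y \<in> wpartitions n" "wlt (last c) y"
  shows "sorted_wrt wlt (c @ [y])"
proof -
  obtain c0 where c0: "c = c0 @ [last c]" using c(3) by (metis append_butlast_last_id)
  have "\<forall>a\<in>set c0. wlt a (last c)" using c(1) by (subst (asm) c0) (simp add: sorted_wrt_append)
  then have "wlt a y" if "a \<in> set c" for a
  proof (cases "a = last c")
    case False
    have "set c = insert (last c) (set c0)" by (subst c0) simp
    then have "wlt a (last c)" using that False \<open>\<forall>a\<in>set c0. wlt a (last c)\<close> by blast
    then show ?thesis using wlt_trans[of a n "last c" y] c y that last_in_set[OF c(3)] by blast
  qed (use y in simp)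
  then show ?thesis using c by (auto simp: sorted_wrt_append)
qed

lemma fchains_snoc:
  assumes "c \<in> fchains n p" "y \<in> wpartitions n" "wlt p y" "card p = Suc (card y)"
  shows "c @ [y] \<in> fchains n y"
  using assms sorted_wrt_snoc[of c n y] by (auto simp: fchains_def)

lemma real_fchains: "real n w e G \<Longrightarrow> wchain n w \<in> fchains n (wpf G)"
proof (induction rule: real.induct)
  case real_init
  have "real n [] 1 (map Leaf [1..<Suc n])" by (rule real.real_init)
  from real_last[OF this, symmetric] show ?case by (auto simp: fchains_def wp_bot_in card_wp_bot simp del: upt_Suc)
next
  case (real_swap w e G1 S T G2)
  have "set (G1 @ S # T # G2) = set (G1 @ T # S # G2)" by auto
  from wpf_cong[OF this] show ?case using real_swap by simp
next
  case (real_step w e S T G c)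
  note m = real_mlin[OF real_step(1)]
  have m': "mlin n (Node c S T # G)" using m mlin_Node by blast
  have "wchain n w @ [wpf (Node c S T # G)] \<in> fchains n (wpf (Node c S T # G))"
    by (rule fchains_snoc[OF real_step(2) wpf_in[OF m'] wlt_wpf_Node[OF m]])
      (simp add: card_wpf[OF m] card_wpf[OF m'])
  then show ?case by (simp add: merge_chain_snoc real_last[OF real_step(1)] do_step_wpf[OF m])
qed

section \<open>Reordering trees, and building a forest in postorder\<close>

lemma real_front: "real n w e (G1 @ T # G2) \<Longrightarrow> real n w ((-1) ^ length G1 * e) (T # G1 @ G2)"
proof (induction G1 arbitrary: e G2 rule: rev_induct)
  case (snoc S G1)
  have "real n w (- e) (G1 @ T # S # G2)" using real_swap[of n w e G1 S T G2] snoc.prems by simp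
  from snoc.IH[OF this] show ?case by simp
qed simp

lemma real_unfront: "real n w e (T # G1 @ G2) \<Longrightarrow> real n w ((-1) ^ length G1 * e) (G1 @ T # G2)"
proof (induction G1 arbitrary: e G2 rule: rev_induct)
  case (snoc S G1)
  have "real n w ((-1) ^ length G1 * e) (G1 @ T # S # G2)" using snoc.IH[of e "S # G2"] snoc.prems by simp
  from real_swap[OF this] show ?case by simp
qed simp

lemma real_pick:
  assumes "real n w e G" "T \<in> set G"
  obtains e' G' where "real n w e' (T # G')" "set G = insert T (set G')" "mset G = add_mset T (mset G')"
proof -
  obtain G1 G2 where "G = G1 @ T # G2" using assms(2) by (meson split_list)
  then show ?thesis using that[OF real_front[of n w e G1 T G2]] assms(1) by auto
qed

lemma insort_key_filter:
  "sorted (map k xs) \<Longrightarrow> insort_key k a xs = filter (\<lambda>b. k b < k a) xs @ a # filter (\<lambda>b. \<not> k b < k a) xs"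
  for k :: "'t \<Rightarrow> nat"
proof (induction xs)
  case (Cons x xs)
  show ?case
  proof (cases "k a \<le> k x")
    case True
    then have "\<forall>b\<in>set xs. \<not> k b < k a" using Cons.prems by auto
    then have "filter (\<lambda>b. k b < k a) xs = []" "filter (\<lambda>b. \<not> k b < k a) xs = xs"
      by (auto simp: filter_empty_conv filter_id_conv)
    then show ?thesis using True by simp
  qed (use Cons in auto)
qed simp

text \<open>The predicate \<open>R\<close> is left abstract because the argument serves twice: for
  \<open>real\<close> on lists of leaves and for congruence of forests modulo
  \<open>relspace\<close>.\<close>

lemma sort_by_swaps:
  fixes k :: "'t \<Rightarrow> nat"
  assumes swap: "\<And>e G1 S T G2. R e (G1 @ S # T # G2) \<Longrightarrow> R (- e) (G1 @ T # S # G2)"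
    and "R e (pre @ sort_key k G)"
  shows "R (e * isgn (map k G) :: int) (pre @ G)"
  using assms(2)
proof (induction G arbitrary: e pre)
  case (Cons a G)
  have front: "R e (pre @ G1 @ T # G2) \<Longrightarrow> R ((-1) ^ length G1 * e) (pre @ T # G1 @ G2)" for G1 T G2 e
  proof (induction G1 arbitrary: e G2 rule: rev_induct)
    case (snoc S G1)
    have "R (- e) ((pre @ G1) @ T # S # G2)" by (rule swap) (use snoc.prems in simp)
    from snoc.IH[of "- e" "S # G2"] this show ?case by simp
  qed simp
  let ?s = "sort_key k G"
  have ins: "sort_key k (a # G) = filter (\<lambda>b. k b < k a) ?s @ a # filter (\<lambda>b. \<not> k b < k a) ?s"
    using insort_key_filter[of k ?s a] by simp
  have "R e (pre @ filter (\<lambda>b. k b < k a) ?s @ a # filter (\<lambda>b. \<not> k b < k a) ?s)"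
    using Cons.prems ins by simp
  from front[OF this]
  have 1: "R ((-1) ^ length (filter (\<lambda>b. k b < k a) ?s) * e)
    (pre @ a # filter (\<lambda>b. k b < k a) ?s @ filter (\<lambda>b. \<not> k b < k a) ?s)" .
  have "filter (\<lambda>b. k b < k a) ?s @ filter (\<lambda>b. \<not> k b < k a) ?s = ?s"
  proof -
    have "sorted (map k xs) \<Longrightarrow> filter (\<lambda>b. k b < m) xs @ filter (\<lambda>b. \<not> k b < m) xs = xs" for xs :: "'t list" and m
    proof (induction xs)
      case (Cons x xs)
      show ?case
      proof (cases "k x < m")
        case False
        then have "\<forall>b\<in>set xs. \<not> k b < m" using Cons.prems by auto
        then have "filter (\<lambda>b. k b < m) xs = []" "filter (\<lambda>b. \<not> k b < m) xs = xs"
          by (auto simp: filter_empty_conv filter_id_conv)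
        then show ?thesis using False by simp
      qed (use Cons in simp)
    qed simp
    then show ?thesis by simp
  qed
  moreover have "length (filter (\<lambda>b. k b < k a) ?s) = length (filter (\<lambda>b. b < k a) (map k G))"
  proof -
    have "mset (filter (\<lambda>b. k b < k a) ?s) = mset (filter (\<lambda>b. k b < k a) G)" by simp
    then have "length (filter (\<lambda>b. k b < k a) ?s) = length (filter (\<lambda>b. k b < k a) G)"
      by (metis size_mset)
    then show ?thesis by (simp add: filter_map o_def)
  qed
  ultimately have "R ((-1) ^ length (filter (\<lambda>b. b < k a) (map k G)) * e) ((pre @ [a]) @ ?s)"
    using 1 by simp
  from Cons.IH[OF this] show ?case by (simp add: mult_ac)
qed simp

lemma real_leaves:
  assumes "distinct w" "set w = {1..n}"
  shows "real n [] (isgn w) (map Leaf w)"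
proof -
  have "sort_key (\<lambda>x. x) w = [1..<Suc n]"
    by (rule sorted_distinct_set_unique)
      (simp_all add: assms atLeastLessThanSuc_atLeastAtMost del: upt_Suc)
  then have "real n [] 1 (map Leaf (sort_key (\<lambda>x. x) w))" using real_init by simp
  moreover have "real n [] (- e) (map Leaf (G1 @ S # T # G2))" if "real n [] e (map Leaf (G1 @ T # S # G2))"
    for e and G1 :: "nat list" and S T G2
    using that real_swap[of n "[]" e "map Leaf G1"] by simp
  ultimately show ?thesis
    using sort_by_swaps[where R = "\<lambda>e G. real n [] e (map Leaf G)" and pre = "[]" and e = 1 and k = "\<lambda>x. x" and G = w]
    by simp
qed

text \<open>Moving a pair past the same trees incurs every sign twice, so the pair arrives in front
  with its order and sign kept.\<close>

lemma real_front2: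
  assumes "real n w e (G1 @ S # T # G2)"
  shows "real n w e (S # T # G1 @ G2)"
proof -
  have "(-1) ^ length (S # G1) * ((-1) ^ length G1 * e) = - e"
    by (cases "even (length G1)") auto
  moreover have "real n w ((-1) ^ length (S # G1) * ((-1) ^ length G1 * e)) (T # (S # G1) @ G2)"
    by (rule real_front) (use real_front[OF assms] in simp)
  ultimately have "real n w (- e) ([] @ T # S # G1 @ G2)" by simp
  from real_swap[OF this] show ?thesis by simp
qed

text \<open>This is the origin of \<open>tree_sgn\<close>. A freshly merged tree is moved back over
  the trees standing before it, with one sign for each of them. The right subtree is built behind
  the left one, which contributes -1 for each of its nodes.\<close>

lemma real_postorder_tree:
  "real n w e (G1 @ map Leaf (leaf_word t) @ G2) \<Longrightarrow>
    real n (w @ postorder t) ((-1) ^ (length G1 * ninternal t) * tree_sgn t * e) (G1 @ t # G2)"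
proof (induction t arbitrary: w e G1 G2)
  case (Node c l r)
  have "real n (w @ postorder l) ((-1) ^ (length G1 * ninternal l) * tree_sgn l * e)
    ((G1 @ [l]) @ map Leaf (leaf_word r) @ G2)"
    using Node.IH(1)[of w e G1 "map Leaf (leaf_word r) @ G2"] Node.prems by simp
  from Node.IH(2)[OF this]
  have 1: "real n (w @ postorder l @ postorder r) ((-1) ^ (length (G1 @ [l]) * ninternal r) * tree_sgn r *
    ((-1) ^ (length G1 * ninternal l) * tree_sgn l * e)) (G1 @ l # r # G2)" (is "real n ?w ?e _") by simp
  from real_front2[OF 1] have "real n ?w ?e (l # r # G1 @ G2)" .
  from real_unfront[OF real_step[OF this, of c]]
  show ?case by (simp add: power_add distrib_left mult_ac)
qed simp

text \<open>The i-th tree is built behind i-1 finished ones, so each of its nodes contributes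
  (-1)^(i-1); this is why \<open>forest_sgn\<close> counts the nodes of trees at even
  positions.\<close>

lemma real_postorder_forest:
  "real n w e (G1 @ map Leaf (forest_word F)) \<Longrightarrow>
    real n (w @ concat (map postorder F)) ((-1) ^ (length G1 * isum F) * forest_sgn F * e) (G1 @ F)"
proof (induction F arbitrary: w e G1)
  case (Cons t F)
  have "real n (w @ postorder t) ((-1) ^ (length G1 * ninternal t) * tree_sgn t * e) ((G1 @ [t]) @ map Leaf (forest_word F))"
    using real_postorder_tree[of n w e G1 t "map Leaf (forest_word F)"] Cons.prems by simp
  from Cons.IH[OF this] show ?case
    by (simp add: forest_sgn_Cons power_add distrib_left mult_ac flip: isum_def)
qed (simp add: forest_sgn_Nil)

abbreviation po :: "nat btree list \<Rightarrow> (color \<times> nat set \<times> nat set) list" where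
  "po G \<equiv> concat (map postorder G)"

theorem real_postorder:
  assumes "mlin n G"
  shows "real n (po G) (gsgn G) G"
  using real_postorder_forest[of n "[]" "isgn (forest_word G)" "[]" G]
    real_leaves[of "forest_word G" n] assms
  by (simp add: MF_def gsgn_def mult.commute)

section \<open>Chains modulo coboundaries\<close>

definition wint :: "nat \<Rightarrow> wpartition \<Rightarrow> wpartition \<Rightarrow> wpartition set" where
  "wint n p q = {a \<in> wpartitions n. wlt p a \<and> wlt a q}"

text \<open>Chains ending in \<open>y\<close> with exactly one rank missing; summing over all ways to fill the gap
  gives, up to sign, the coboundary.\<close>

definition gapped :: "nat \<Rightarrow> wpartition \<Rightarrow> wpartition list \<Rightarrow> wpartition \<Rightarrow> wpartition \<Rightarrow> wpartition list \<Rightarrow> bool" where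
  "gapped n y c1 p q c2 \<longleftrightarrow> sorted_wrt wlt (c1 @ p # q # c2) \<and> set (c1 @ p # q # c2) \<subseteq> wpartitions n \<and>
    hd (c1 @ [p]) = wp_bot n \<and> last (q # c2) = y \<and> length (c1 @ p # q # c2) + card y = n"

text \<open>The chains keep their end points, so that they can be prolonged beyond \<open>y\<close>;
  these are the coboundary relations of the open interval with both ends attached.\<close>

definition Zs :: "nat \<Rightarrow> wpartition \<Rightarrow> (wpartition list \<Rightarrow>\<^sub>0 'k::field) set" where
  "Zs n y = pm.span {\<Sum>a\<in>wint n p q. sng (c1 @ p # a # q # c2) | c1 p q c2. gapped n y c1 p q c2}"

lemma subspace_Zs [simp]: "pm.subspace (Zs n y)"
  by (simp add: Zs_def)

lemma Zs_gen: "gapped n y c1 p q c2 \<Longrightarrow> (\<Sum>a\<in>wint n p q. sng (c1 @ p # a # q # c2)) \<in> Zs n y"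
  unfolding Zs_def by (rule pm.span_base) blast

lemma Zs_append:
  fixes f :: "wpartition list \<Rightarrow>\<^sub>0 'k::field"
  assumes "f \<in> Zs n y" and r: "r \<in> wpartitions n" "wlt y r" "card y = Suc (card r)"
  shows "push (\<lambda>c. c @ [r]) f \<in> Zs n r"
proof (rule lin_span_subset[OF lin_push subspace_Zs _ assms(1)[unfolded Zs_def]])
  fix g :: "wpartition list \<Rightarrow>\<^sub>0 'k"
  assume "g \<in> {\<Sum>a\<in>wint n p q. sng (c1 @ p # a # q # c2) | c1 p q c2. gapped n y c1 p q c2}"
  then obtain c1 p q c2 where g: "g = (\<Sum>a\<in>wint n p q. sng (c1 @ p # a # q # c2))" "gapped n y c1 p q c2"
    by blast
  have "sorted_wrt wlt ((c1 @ p # q # c2) @ [r])"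
    by (rule sorted_wrt_snoc[of _ n]) (use g(2) r in \<open>auto simp: gapped_def\<close>)
  then have "gapped n r c1 p q (c2 @ [r])"
    using g(2) r by (simp add: gapped_def)
  from Zs_gen[OF this] show "push (\<lambda>c. c @ [r]) g \<in> Zs n r"
    unfolding g(1) by (simp add: lin_sum[OF lin_push])
qed

text \<open>Legality of a merge formulated on partitions, not on forests: a reordered sequence of
  merges must be known to run before its chain can be compared with the original one.\<close>

definition step_ok :: "color \<times> nat set \<times> nat set \<Rightarrow> wpartition \<Rightarrow> bool" where
  "step_ok s p \<longleftrightarrow> (\<exists>c a b. s = (c, fst a, fst b) \<and> a \<in> p \<and> b \<in> p \<and> a \<noteq> b)"

primrec ok :: "wpartition \<Rightarrow> (color \<times> nat set \<times> nat set) list \<Rightarrow> bool" where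
  "ok p [] = True"
| "ok p (s # w) = (step_ok s p \<and> ok (do_step s p) w)"

abbreviation st :: "wpartition \<Rightarrow> (color \<times> nat set \<times> nat set) list \<Rightarrow> wpartition" where
  "st p w \<equiv> last (merge_chain p w)"

lemma merge_chain_Cons: "merge_chain p (s # w) = p # merge_chain (do_step s p) w"
  by (simp add: do_step_def)

declare merge_chain.simps(2) [simp del] merge_chain_Cons [simp]

lemma st_append: "st p (w @ w') = st (st p w) w'"
  by (simp add: merge_chain_append)

lemma ok_append: "ok p (w @ w') \<longleftrightarrow> ok p w \<and> ok (st p w) w'"
  by (induction w arbitrary: p) auto

lemma step_okE:
  assumes "step_ok s p" "p \<in> wpartitions n"
  obtains c a b where "s = (c, fst a, fst b)" "a \<in> p" "b \<in> p" "a \<noteq> b" "do_step s p = mrg (col_weight c) a b p"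
  using assms do_step_mrg[OF assms(2)] unfolding step_ok_def by blast

lemma do_step_props:
  assumes "step_ok s p" "p \<in> wpartitions n"
  shows "do_step s p \<in> wpartitions n" "wlt p (do_step s p)" "card p = Suc (card (do_step s p))"
  using assms(1,2)
  by (rule step_okE, simp add: mrg_in[OF assms(2) _ _ _ col_weight_le] wlt_mrg[OF assms(2) _ _ _ col_weight_le]
      card_mrg[OF assms(2) _ _ _ col_weight_le])+

lemma ok_chain:
  "ok p w \<Longrightarrow> p \<in> wpartitions n \<Longrightarrow> sorted_wrt wlt (merge_chain p w) \<and> set (merge_chain p w) \<subseteq> wpartitions n
    \<and> card p = card (st p w) + length w"
proof (induction w arbitrary: p)
  case (Cons s w)
  let ?r = "do_step s p"
  have s: "step_ok s p" using Cons.prems(1) by simp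
  note r = do_step_props[OF s Cons.prems(2)]
  have IH: "sorted_wrt wlt (merge_chain ?r w)" "set (merge_chain ?r w) \<subseteq> wpartitions n"
    "card ?r = card (st ?r w) + length w" using Cons.IH[of ?r] Cons.prems r by auto
  obtain c where c: "merge_chain ?r w = ?r # c" by (cases w) auto
  have "wlt p a" if "a \<in> set (merge_chain ?r w)" for a
  proof (cases "a = ?r")
    case False
    then have "wlt ?r a" using that IH(1) by (simp add: c)
    then show ?thesis using wlt_trans[OF Cons.prems(2) r(1) _ r(2)] that IH(2) by blast
  qed (use r in simp)
  then show ?case using IH Cons.prems r by simp
qed simp

lemma ok_fchains: "ok (wp_bot n) w \<Longrightarrow> wchain n w \<in> fchains n (st (wp_bot n) w)"
  using ok_chain[of "wp_bot n" w n] by (simp add: fchains_def wp_bot_in card_wp_bot)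

lemma step_ok_wpf: "mlin n (S # T # G) \<Longrightarrow> step_ok (c, lv S, lv T) (wpf (S # T # G))"
  unfolding step_ok_def using wpf_mrg(1-3)[of S T G n]
  by (intro exI[of _ c] exI[of _ "blk S"] exI[of _ "blk T"]) simp

lemma real_ok: "real n w e G \<Longrightarrow> ok (wp_bot n) w"
proof (induction rule: real.induct)
  case (real_step w e S T G c)
  then show ?case using step_ok_wpf[OF real_mlin[OF real_step(1)]] by (simp add: ok_append real_last)
qed auto

definition supp :: "color \<times> nat set \<times> nat set \<Rightarrow> nat set" where
  "supp s = fst (snd s) \<union> snd (snd s)"

text \<open>Disjointness of supports means that the blocks merged by \<open>x\<close> exist already
  before \<open>y\<close> is performed. The two chains are then the two fillings of one rank two
  gap, and their sum is a generator of \<open>Zs\<close>.\<close>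

lemma swap_steps:
  assumes ok: "ok (wp_bot n) (w1 @ y # x # w2)" and disj: "supp x \<inter> supp y = {}"
  shows "ok (wp_bot n) (w1 @ x # y # w2) \<and> st (wp_bot n) (w1 @ x # y # w2) = st (wp_bot n) (w1 @ y # x # w2) \<and>
    (sng (wchain n (w1 @ y # x # w2)) + sng (wchain n (w1 @ x # y # w2)) :: wpartition list \<Rightarrow>\<^sub>0 'k::field)
      \<in> Zs n (st (wp_bot n) (w1 @ y # x # w2))"
proof -
  define p where "p = st (wp_bot n) w1"
  have ok1: "ok (wp_bot n) w1" "step_ok y p" "step_ok x (do_step y p)" "ok (do_step x (do_step y p)) w2"
    using ok by (auto simp: ok_append p_def)
  have p: "p \<in> wpartitions n"
    using ok_chain[OF ok1(1) wp_bot_in] last_in_set[OF merge_chain_neq_Nil] unfolding p_def by blast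
  obtain d a b where y: "y = (d, fst a, fst b)" "a \<in> p" "b \<in> p" "a \<noteq> b" "do_step y p = mrg (col_weight d) a b p"
    using step_okE[OF ok1(2) p] .
  let ?p1 = "mrg (col_weight d) a b p"
  have p1: "?p1 \<in> wpartitions n" using mrg_in[OF p y(2-4) col_weight_le] .
  obtain c a' b' where x: "x = (c, fst a', fst b')" "a' \<in> ?p1" "b' \<in> ?p1" "a' \<noteq> b'"
    "do_step x ?p1 = mrg (col_weight c) a' b' ?p1"
    using step_okE[OF ok1(3)[unfolded y(5)] p1] .
  have inp: "z \<in> p \<and> z \<noteq> a \<and> z \<noteq> b" if z: "z \<in> ?p1" "fst z \<subseteq> supp x" for z
  proof -
    have "fst z \<noteq> {}" using wpartitionsD(2)[OF p1 z(1)] .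
    then have "\<not> fst z \<subseteq> fst a \<union> fst b" using z(2) disj by (auto simp: supp_def y(1))
    then show ?thesis using z(1) by (auto simp: mrg_def)
  qed
  have sx: "fst a' \<subseteq> supp x" "fst b' \<subseteq> supp x" by (auto simp: supp_def x(1))
  have xs: "a' \<in> p" "b' \<in> p" "distinct [a, b, a', b']"
    using inp[OF x(2) sx(1)] inp[OF x(3) sx(2)] y(4) x(4) by auto
  note R = rank2_disjoint[OF p y(2,3) xs, where u = "col_weight d" and v = "col_weight c", OF col_weight_le col_weight_le]
  let ?q = "mrg (col_weight c) a' b' ?p1"
  let ?p2 = "mrg (col_weight c) a' b' p"
  have x2: "step_ok x p" "do_step x p = ?p2"
  proof -
    show "step_ok x p" unfolding step_ok_def x(1) using xs(1,2) x(4) by blast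
    show "do_step x p = ?p2" unfolding x(1) by (rule do_step_mrg[OF p xs(1,2)])
  qed
  have ab2: "a \<in> ?p2" "b \<in> ?p2" using y(2,3) xs(3) by (auto simp: mrg_def)
  have p2: "?p2 \<in> wpartitions n" using mrg_in[OF p xs(1,2) x(4) col_weight_le] .
  have y2: "step_ok y ?p2" "do_step y ?p2 = ?q"
  proof -
    show "step_ok y ?p2" unfolding step_ok_def y(1) using ab2 y(4) by blast
    show "do_step y ?p2 = ?q" unfolding y(1) by (rule trans[OF do_step_mrg[OF p2 ab2] R(2)[symmetric]])
  qed
  obtain rest where rest: "merge_chain ?q w2 = ?q # rest" by (cases w2) auto
  have ok2: "ok (wp_bot n) (w1 @ x # y # w2)"
    using ok1 x2 y2 y(5) x(5) by (auto simp: ok_append p_def[symmetric])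
  have st: "st (wp_bot n) (w1 @ x # y # w2) = last (?q # rest)" "st (wp_bot n) (w1 @ y # x # w2) = last (?q # rest)"
    using x2 y2 y(5) x(5) rest by (auto simp: st_append p_def[symmetric])
  let ?c1 = "butlast (wchain n w1)"
  have ch: "wchain n (w1 @ y # x # w2) = ?c1 @ p # ?p1 # ?q # rest"
    "wchain n (w1 @ x # y # w2) = ?c1 @ p # ?p2 # ?q # rest"
    using x2 y2 y(5) x(5) rest by (auto simp: merge_chain_append p_def[symmetric])
  have F: "?c1 @ p # ?p1 # ?q # rest \<in> fchains n (last (?q # rest))"
    using ok_fchains[OF ok] ch st by simp
  then have "gapped n (last (?q # rest)) ?c1 p ?q rest"
    by (cases ?c1) (auto simp: gapped_def fchains_def sorted_wrt_append)
  from Zs_gen[OF this] have "(sng (?c1 @ p # ?p1 # ?q # rest) + sng (?c1 @ p # ?p2 # ?q # rest) :: wpartition list \<Rightarrow>\<^sub>0 'k)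
    \<in> Zs n (last (?q # rest))"
    using R(1,3) by (simp add: wint_def)
  then show ?thesis using ok2 st ch by simp
qed

lemma swap_one:
  assumes "ok (wp_bot n) (w1 @ b @ x # w2)" "\<And>s. s \<in> set b \<Longrightarrow> supp x \<inter> supp s = {}"
  shows "ok (wp_bot n) (w1 @ x # b @ w2) \<and> st (wp_bot n) (w1 @ x # b @ w2) = st (wp_bot n) (w1 @ b @ x # w2) \<and>
    (sng (wchain n (w1 @ b @ x # w2)) - scale ((-1) ^ length b) (sng (wchain n (w1 @ x # b @ w2))) :: wpartition list \<Rightarrow>\<^sub>0 'k::field)
      \<in> Zs n (st (wp_bot n) (w1 @ b @ x # w2))"
  using assms
proof (induction b arbitrary: w2 rule: rev_induct)
  case Nil
  then show ?case by (simp add: pm.subspace_0)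
next
  case (snoc y b)
  have "ok (wp_bot n) ((w1 @ b) @ y # x # w2)" using snoc.prems(1) by simp
  from swap_steps[OF this] have 1: "ok (wp_bot n) (w1 @ b @ x # y # w2)"
    "st (wp_bot n) (w1 @ b @ x # y # w2) = st (wp_bot n) (w1 @ b @ y # x # w2)"
    "(sng (wchain n (w1 @ b @ y # x # w2)) + sng (wchain n (w1 @ b @ x # y # w2)) :: wpartition list \<Rightarrow>\<^sub>0 'k) \<in> Zs n (st (wp_bot n) (w1 @ b @ y # x # w2))"
    using snoc.prems(2)[of y] by auto
  have IH: "ok (wp_bot n) (w1 @ x # b @ y # w2)"
    "st (wp_bot n) (w1 @ x # b @ y # w2) = st (wp_bot n) (w1 @ b @ x # y # w2)"
    "(sng (wchain n (w1 @ b @ x # y # w2)) - scale ((-1) ^ length b) (sng (wchain n (w1 @ x # b @ y # w2))) :: wpartition list \<Rightarrow>\<^sub>0 'k)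
      \<in> Zs n (st (wp_bot n) (w1 @ b @ x # y # w2))"
    using snoc.IH[OF 1(1) snoc.prems(2)] by simp_all
  from pm.subspace_diff[OF subspace_Zs 1(3) IH(3)[unfolded 1(2)]] show ?case
    using IH(1,2) 1(2) by (simp add: single_uminus)
qed

lemma swap_block:
  assumes "ok (wp_bot n) (w1 @ a @ b @ w2)" "\<And>s t. s \<in> set a \<Longrightarrow> t \<in> set b \<Longrightarrow> supp t \<inter> supp s = {}"
  shows "ok (wp_bot n) (w1 @ b @ a @ w2) \<and> st (wp_bot n) (w1 @ b @ a @ w2) = st (wp_bot n) (w1 @ a @ b @ w2) \<and>
    (sng (wchain n (w1 @ a @ b @ w2)) - scale ((-1) ^ (length a * length b)) (sng (wchain n (w1 @ b @ a @ w2))) :: wpartition list \<Rightarrow>\<^sub>0 'k::field)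
      \<in> Zs n (st (wp_bot n) (w1 @ a @ b @ w2))"
  using assms
proof (induction b arbitrary: w1)
  case Nil
  then show ?case by (simp add: pm.subspace_0)
next
  case (Cons x b)
  let ?A = "sng (wchain n (w1 @ a @ x # b @ w2)) :: wpartition list \<Rightarrow>\<^sub>0 'k" and ?B = "sng (wchain n (w1 @ x # a @ b @ w2)) :: wpartition list \<Rightarrow>\<^sub>0 'k"
    and ?C = "sng (wchain n (w1 @ x # b @ a @ w2)) :: wpartition list \<Rightarrow>\<^sub>0 'k" and ?y = "st (wp_bot n) (w1 @ a @ x # b @ w2)"
  have 1: "ok (wp_bot n) (w1 @ x # a @ b @ w2)" "st (wp_bot n) (w1 @ x # a @ b @ w2) = ?y"
    "?A - scale ((-1) ^ length a) ?B \<in> Zs n ?y"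
    using swap_one[where ?'k = 'k, of n w1 a x "b @ w2"] Cons.prems by auto
  have 2: "ok (wp_bot n) (w1 @ x # b @ a @ w2)" "st (wp_bot n) (w1 @ x # b @ a @ w2) = ?y"
    "?B - scale ((-1) ^ (length a * length b)) ?C \<in> Zs n ?y"
    using Cons.IH[of "w1 @ [x]", OF _ Cons.prems(2)] 1(1,2) by simp_all
  have "?A - scale ((-1) ^ length a * (-1) ^ (length a * length b)) ?C =
    (?A - scale ((-1) ^ length a) ?B) + scale ((-1) ^ length a) (?B - scale ((-1) ^ (length a * length b)) ?C)"
    by (simp add: pm.scale_right_diff_distrib del: scale_single)
  also have "\<dots> \<in> Zs n ?y"
    using 1(3) 2(3) by (intro pm.subspace_add pm.subspace_scale) auto
  finally show ?case using 2(1,2) by (simp add: power_add)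
qed

lemma supp_postorder: "s \<in> set (postorder t) \<Longrightarrow> supp s \<subseteq> lv t"
  by (induction t) (auto simp: supp_def)

lemma length_postorder: "length (postorder t) = ninternal t"
  by (induction t) auto

lemma length_po: "length (po G) = isum G"
  by (induction G) (auto simp: length_postorder)

lemma supp_po: "s \<in> set (po G) \<Longrightarrow> supp s \<subseteq> set (forest_word G)"
  using supp_postorder by fastforce

text \<open>The prescribed value on a labelled forest, before passing to cohomology classes and with
  end points attached.\<close>

definition bet :: "nat \<Rightarrow> nat btree list \<Rightarrow> (wpartition list \<Rightarrow>\<^sub>0 'k::field)" where
  "bet n G = scale (of_int (gsgn G)) (sng (wchain n (po G)))"

lemma of_int_minus_one_power: "(of_int ((-1) ^ k) :: 'k::field) = (-1) ^ k"
  by simp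

text \<open>Exchanging the merges of \<open>S\<close> with those of \<open>T\<close> gives (-1)^(ij)
  for their numbers i and j; against \<open>gsgn_swap\<close> only -1 remains.\<close>

lemma bet_swap:
  assumes "mlin n (G1 @ S # T # G2)"
  shows "(bet n (G1 @ S # T # G2) + bet n (G1 @ T # S # G2) :: wpartition list \<Rightarrow>\<^sub>0 'k::field) \<in> Zs n (wpf (G1 @ S # T # G2))"
proof -
  have r: "real n (po (G1 @ S # T # G2)) (gsgn (G1 @ S # T # G2)) (G1 @ S # T # G2)"
    by (rule real_postorder[OF assms])
  have "supp t \<inter> supp s = {}" if "s \<in> set (postorder S)" "t \<in> set (postorder T)" for s t
    using supp_postorder[OF that(1)] supp_postorder[OF that(2)] assms by (fastforce simp: MF_def)
  then have "(sng (wchain n (po G1 @ postorder S @ postorder T @ po G2)) -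
      scale ((-1) ^ (ninternal S * ninternal T)) (sng (wchain n (po G1 @ postorder T @ postorder S @ po G2))) :: wpartition list \<Rightarrow>\<^sub>0 'k)
      \<in> Zs n (wpf (G1 @ S # T # G2))"
    using swap_block[where ?'k = 'k, of n "po G1" "postorder S" "postorder T" "po G2"] real_ok[OF r] real_last[OF r]
    by (simp add: length_postorder del: scale_single)
  then have "scale (of_int (gsgn (G1 @ S # T # G2))) (sng (wchain n (po G1 @ postorder S @ postorder T @ po G2)) -
      scale ((-1) ^ (ninternal S * ninternal T)) (sng (wchain n (po G1 @ postorder T @ postorder S @ po G2))) :: wpartition list \<Rightarrow>\<^sub>0 'k)
      \<in> Zs n (wpf (G1 @ S # T # G2))" by (rule pm.subspace_scale[OF subspace_Zs])
  moreover have "gsgn (G1 @ S # T # G2) * ((-1) ^ (ninternal S * ninternal T)) = - gsgn (G1 @ T # S # G2)"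
  proof -
    have "distinct (forest_word (G1 @ S # T # G2))" using assms by (simp add: MF_def)
    from gsgn_swap[OF this] show ?thesis by (simp add: mult_ac flip: power_mult_distrib)
  qed
  then have "(of_int (gsgn (G1 @ S # T # G2)) * ((-1) ^ (ninternal S * ninternal T)) :: 'k) = - of_int (gsgn (G1 @ T # S # G2))"
    by (metis (no_types, lifting) of_int_minus_one_power of_int_mult of_int_minus)
  ultimately show ?thesis
    by (simp add: bet_def pm.scale_right_diff_distrib single_uminus)
qed

text \<open>The class of a chain, with its sign, does not depend on the order in which the forest
  was built. In the merging step the last merge is moved before those of \<open>G\<close>, and the
  resulting sign is the one of \<open>gsgn_Node\<close>.\<close>

theorem real_class:
  "real n w e G \<Longrightarrow> sng (wchain n w) - scale (of_int e) (bet n G :: _ \<Rightarrow>\<^sub>0 'k::field) \<in> Zs n (wpf G)"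
proof (induction rule: real.induct)
  case real_init
  have "isum (map Leaf xs) = 0" for xs :: "nat list" by (induction xs) auto
  then have "forest_sgn (map Leaf xs) = 1" for xs :: "nat list"
    by (induction xs) (simp_all add: forest_sgn_Nil forest_sgn_Cons flip: isum_def map_map)
  moreover have po0: "po (map Leaf xs) = []" and "forest_word (map Leaf xs) = xs" for xs :: "nat list"
    by (induction xs) auto
  moreover have "isgn [1..<Suc n] = 1" by (rule isgn_sorted) (simp del: upt_Suc)
  ultimately show ?case by (simp add: bet_def gsgn_def pm.subspace_0 po0 del: upt_Suc map_map concat_eq_Nil_conv)
next
  case (real_swap w e G1 S T G2)
  have m: "mlin n (G1 @ S # T # G2)" by (rule real_mlin[OF real_swap(1)])
  have "wpf (G1 @ S # T # G2) = wpf (G1 @ T # S # G2)" by (rule wpf_cong) auto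
  moreover have "scale (of_int e) (bet n (G1 @ S # T # G2) + bet n (G1 @ T # S # G2) :: wpartition list \<Rightarrow>\<^sub>0 'k) \<in> Zs n (wpf (G1 @ S # T # G2))"
    by (rule pm.subspace_scale[OF subspace_Zs bet_swap[OF m]])
  ultimately have "(sng (wchain n w) - scale (of_int e) (bet n (G1 @ S # T # G2))) +
      scale (of_int e) (bet n (G1 @ S # T # G2) + bet n (G1 @ T # S # G2) :: wpartition list \<Rightarrow>\<^sub>0 'k) \<in> Zs n (wpf (G1 @ T # S # G2))"
    using pm.subspace_add[OF subspace_Zs real_swap.IH] by simp
  then show ?case by (simp add: pm.scale_right_distrib)
next
  case (real_step w e S T G c)
  have m: "mlin n (S # T # G)" by (rule real_mlin[OF real_step(1)])
  have m': "mlin n (Node c S T # G)" using m mlin_Node by blast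
  let ?r = "wpf (Node c S T # G)" and ?x = "(c, lv S, lv T)"
  note rp = real_postorder[OF m]
  have "push (\<lambda>c. c @ [?r]) (sng (wchain n w) - scale (of_int e) (bet n (S # T # G)) :: wpartition list \<Rightarrow>\<^sub>0 'k) \<in> Zs n ?r"
    by (rule Zs_append[OF real_step.IH wpf_in[OF m'] wlt_wpf_Node[OF m]])
      (simp add: card_wpf[OF m] card_wpf[OF m'])
  moreover have "wchain n w @ [?r] = wchain n (w @ [?x])"
    by (simp add: merge_chain_snoc real_last[OF real_step(1)] do_step_wpf[OF m])
  moreover have "wchain n (po (S # T # G)) @ [?r] = wchain n (po (S # T # G) @ [?x])"
    by (simp only: merge_chain_snoc real_last[OF rp] do_step_wpf[OF m])
  ultimately have 1: "(sng (wchain n (w @ [?x])) -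
      scale (of_int (e * gsgn (S # T # G))) (sng (wchain n (po (S # T # G) @ [?x]))) :: wpartition list \<Rightarrow>\<^sub>0 'k) \<in> Zs n ?r"
    by (simp add: bet_def lin_diff[OF lin_push])
  have rs: "real n (po (S # T # G) @ [?x]) (gsgn (S # T # G)) (Node c S T # G)"
    by (rule real.real_step[OF rp])
  have "supp ?x \<inter> supp s = {}" if "s \<in> set (po G)" for s
    using supp_po[OF that] m by (fastforce simp: MF_def supp_def)
  then have "(sng (wchain n (po (S # T # G) @ [?x])) - scale ((-1) ^ isum G) (sng (wchain n (po (Node c S T # G)))) :: wpartition list \<Rightarrow>\<^sub>0 'k) \<in> Zs n ?r"
    using swap_one[where ?'k = 'k, of n "postorder S @ postorder T" "po G" ?x "[]"] real_ok[OF rs] real_last[OF rs]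
    by (simp add: length_po del: scale_single)
  then have 2: "scale (of_int (e * gsgn (S # T # G))) (sng (wchain n (po (S # T # G) @ [?x])) -
      scale ((-1) ^ isum G) (sng (wchain n (po (Node c S T # G)))) :: wpartition list \<Rightarrow>\<^sub>0 'k) \<in> Zs n ?r"
    by (rule pm.subspace_scale[OF subspace_Zs])
  have "(of_int (gsgn (S # T # G)) * (-1) ^ isum G :: 'k) = of_int (gsgn (Node c S T # G))"
    by (simp add: gsgn_Node mult_ac)
  with pm.subspace_add[OF subspace_Zs 1 2] show ?case
    by (simp add: bet_def pm.scale_right_diff_distrib mult.assoc)
qed

section \<open>The forest is determined by the chain up to sign\<close>

abbreviation mn :: "nat btree \<Rightarrow> nat" where
  "mn t \<equiv> Min (lv t)"

text \<open>Children are ordered by least leaf, a criterion visible in the blocks of a chain;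
  \<open>sg\<close> records the parity of the exchanges this takes.\<close>

primrec nf :: "nat btree \<Rightarrow> nat btree" where
  "nf (Leaf a) = Leaf a"
| "nf (Node c l r) = (if mn l < mn r then Node c (nf l) (nf r) else Node c (nf r) (nf l))"

primrec sg :: "nat btree \<Rightarrow> int" where
  "sg (Leaf a) = 1"
| "sg (Node c l r) = sg l * sg r * (if mn l < mn r then 1 else -1)"

text \<open>The sign between a forest and its canonical form \<open>can G\<close>: the exchanges at
  the nodes, and the sorting of the trees by least leaf.\<close>

definition csg :: "nat btree list \<Rightarrow> int" where
  "csg G = prod_list (map sg G) * isgn (map mn G)"

definition can :: "nat btree list \<Rightarrow> nat btree list" where
  "can G = sort_key mn (map nf G)"

lemma lv_nf [simp]: "lv (nf t) = lv t"
  by (induction t) auto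

lemma nf_relspace:
  "C \<in> fctx \<Longrightarrow> sng (C t) - scale (of_int (sg t)) (sng (C (nf t))) \<in> (relspace X m :: (_ \<Rightarrow>\<^sub>0 'k::field) set)"
proof (induction t arbitrary: C)
  case (Leaf a)
  then show ?case by (simp add: pm.subspace_0)
next
  case (Node c l r)
  let ?s = "\<lambda>t. sng (C t) :: _ \<Rightarrow>\<^sub>0 'k"
  have 1: "?s (Node c l r) - scale (of_int (sg l)) (?s (Node c (nf l) r)) \<in> relspace X m"
    using Node.IH(1)[OF fctx_inner(1)[OF Node.prems]] .
  have 2: "?s (Node c (nf l) r) - scale (of_int (sg r)) (?s (Node c (nf l) (nf r))) \<in> relspace X m"
    using Node.IH(2)[OF fctx_inner(2)[OF Node.prems]] .
  have 3: "?s (Node c l r) - scale (of_int (sg l * sg r)) (?s (Node c (nf l) (nf r))) \<in> relspace X m"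
    using pm.subspace_add[OF subspace_relspace 1 pm.subspace_scale[OF subspace_relspace 2, of "of_int (sg l)"]]
    by (simp add: pm.scale_right_diff_distrib)
  show ?case
  proof (cases "mn l < mn r")
    case False
    have "?s (Node c (nf l) (nf r)) + ?s (Node c (nf r) (nf l)) \<in> relspace X m"
      by (rule relspace_antisym[OF Node.prems])
    from pm.subspace_add[OF subspace_relspace 3 pm.subspace_scale[OF subspace_relspace this, of "of_int (sg l * sg r)"]]
    show ?thesis unfolding nf.simps sg.simps if_not_P[OF False]
      by (simp add: pm.scale_right_distrib single_uminus)
  next
    case True
    show ?thesis using 3 unfolding nf.simps sg.simps if_P[OF True] by simp
  qed
qed

lemma nf_forest_relspace:
  "sng (P @ G) - scale (of_int (prod_list (map sg G))) (sng (P @ map nf G)) \<in> (relspace X r :: (_ \<Rightarrow>\<^sub>0 'k::field) set)"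
proof (induction G arbitrary: P)
  case Nil
  then show ?case by (simp add: pm.subspace_0)
next
  case (Cons t G)
  have 1: "sng (P @ t # G) - scale (of_int (sg t)) (sng (P @ nf t # G)) \<in> (relspace X r :: (_ \<Rightarrow>\<^sub>0 'k) set)"
    using nf_relspace[OF fctxI[OF tctx_id], of P t G] .
  have 2: "sng (P @ nf t # G) - scale (of_int (prod_list (map sg G))) (sng (P @ nf t # map nf G)) \<in> (relspace X r :: (_ \<Rightarrow>\<^sub>0 'k) set)"
    using Cons.IH[of "P @ [nf t]"] by simp
  show ?case
    using pm.subspace_add[OF subspace_relspace 1 pm.subspace_scale[OF subspace_relspace 2, of "of_int (sg t)"]]
    by (simp add: pm.scale_right_diff_distrib)
qed

lemma can_relspace:
  "sng G - scale (of_int (csg G)) (sng (can G)) \<in> (relspace X r :: (_ \<Rightarrow>\<^sub>0 'k::field) set)"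
proof -
  let ?N = "relspace X r :: (_ \<Rightarrow>\<^sub>0 'k) set"
  have "sng (can G) - scale (of_int (1 * isgn (map mn (map nf G)))) (sng ([] @ map nf G)) \<in> ?N"
  proof (rule sort_by_swaps[where R = "\<lambda>e H. sng (can G) - scale (of_int e) (sng H) \<in> ?N"])
    fix e :: int and G1 S T G2
    assume "sng (can G) - scale (of_int e) (sng (G1 @ S # T # G2)) \<in> ?N"
    from pm.subspace_add[OF subspace_relspace this
        pm.subspace_scale[OF subspace_relspace relspace_swap[of G1 S T G2], of "of_int e"]]
    show "sng (can G) - scale (of_int (- e)) (sng (G1 @ T # S # G2)) \<in> ?N"
      by (simp add: pm.scale_right_distrib single_uminus)
  qed (simp add: can_def pm.subspace_0)
  moreover have "map mn (map nf G) = map mn G" by simp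
  ultimately have 1: "sng (can G) - scale (of_int (isgn (map mn G))) (sng (map nf G)) \<in> ?N" by (simp only: append_Nil mult_1)
  have "(of_int (isgn (map mn G)) * of_int (isgn (map mn G)) :: 'k) = 1"
    using isgn_unit[of "map mn G"] by auto
  then have "sng (map nf G) - scale (of_int (isgn (map mn G))) (sng (can G)) \<in> ?N"
    using pm.subspace_scale[OF subspace_relspace 1, of "- of_int (isgn (map mn G))"]
    by (simp add: pm.scale_right_diff_distrib single_uminus)
  from pm.subspace_scale[OF subspace_relspace this, of "of_int (prod_list (map sg G))"]
    nf_forest_relspace[of "[]" G X r]
  show ?thesis
    using pm.subspace_add[OF subspace_relspace] by (fastforce simp: csg_def pm.scale_right_diff_distrib)
qed

lemma mn_neq:
  assumes "mlin n G" "S \<in> set G" "T \<in> set G" "S \<noteq> T"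
  shows "mn S \<noteq> mn T"
proof
  assume "mn S = mn T"
  moreover have "mn S \<in> lv S" "mn T \<in> lv T" by (simp_all add: Min_in)
  ultimately show False using mlin_disjoint[OF assms(1-3), of "mn S"] assms(4) by simp
qed

lemma mn_Node: "mn (Node c S T) = min (mn S) (mn T)"
  by (simp add: Min_Un)

text \<open>Deleting the larger of the two leading entries removes its inversions with the rest; the
  conditional on the left accounts for the inversion between the two.\<close>

lemma isgn_min_max:
  assumes "a \<noteq> b"
  shows "isgn (min a b # L) * (if a < b then 1 else -1) =
    (-1) ^ length (filter (\<lambda>x. x < max a b) L) * isgn (a # b # L)"
proof -
  have "(-1 :: int) ^ k * ((-1) ^ k * z) = z" for k z by (simp flip: mult.assoc power_mult_distrib)
  then show ?thesis using assms by (cases "a < b") (auto simp: min_def max_def mult.left_commute)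
qed

text \<open>The exponent involves only the partition of the remaining trees and the two minima. It
  can therefore be read off from the chain and is common to all forests realising it.\<close>

lemma csg_Node:
  assumes m: "mlin n (S # T # G)"
  shows "csg (Node c S T # G) =
    (-1) ^ card {A \<in> fst ` wpf G. Min A < max (mn S) (mn T)} * csg (S # T # G)"
proof -
  let ?k = "max (mn S) (mn T)"
  have d: "distinct (S # T # G)" by (rule mlin_distinct[OF m])
  have ne: "mn S \<noteq> mn T" by (rule mn_neq[OF m]) (use d in auto)
  have "fst ` wpf G = lv ` set G" by (simp add: wpf_def image_image)
  then have "{A \<in> fst ` wpf G. Min A < ?k} = lv ` {t \<in> set G. mn t < ?k}" by auto
  moreover have "inj_on lv {t \<in> set G. mn t < ?k}"
    by (rule inj_onI, rule blk_inj[OF m]) auto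
  ultimately have "card {A \<in> fst ` wpf G. Min A < ?k} = card (set (filter (\<lambda>t. mn t < ?k) G))"
    by (simp add: card_image)
  also have "\<dots> = length (filter (\<lambda>t. mn t < ?k) G)" using d by (simp add: distinct_card del: set_filter)
  also have "\<dots> = length (filter (\<lambda>x. x < ?k) (map mn G))" by (simp add: filter_map o_def)
  finally have c: "card {A \<in> fst ` wpf G. Min A < ?k} = length (filter (\<lambda>x. x < ?k) (map mn G))" .
  have "csg (Node c S T # G) = sg S * sg T * prod_list (map sg G) *
      (isgn (min (mn S) (mn T) # map mn G) * (if mn S < mn T then 1 else -1))"
    unfolding csg_def list.map mn_Node sg.simps prod_list.Cons by (simp only: mult_ac)
  also have "\<dots> = (-1) ^ length (filter (\<lambda>x. x < ?k) (map mn G)) * csg (S # T # G)"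
    unfolding isgn_min_max[OF ne] csg_def list.map prod_list.Cons by (simp only: mult_ac)
  finally show ?thesis unfolding c .
qed

lemma csg_swap:
  assumes "mlin n (G1 @ S # T # G2)"
  shows "csg (G1 @ T # S # G2) = - csg (G1 @ S # T # G2)"
proof -
  have "distinct (G1 @ S # T # G2)" by (rule mlin_distinct[OF assms])
  then have "mn T \<noteq> mn S" by (intro mn_neq[OF assms]) auto
  from isgn_swap[OF this, of "map mn G1" "map mn G2"] show ?thesis by (simp add: csg_def mult_ac)
qed

text \<open>The last rule applied may be an exchange. It reverses \<open>e\<close> and
  \<open>csg\<close> together, so their product survives and the last merge can be exposed whatever
  exchanges follow it.\<close>

lemma real_last_step:
  "real n w e G \<Longrightarrow> (w = [] \<and> e * csg G = csg (map Leaf [1..<Suc n]) \<and> nf ` set G = nf ` set (map Leaf [1..<Suc n])) \<or>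
    (\<exists>w0 c S T G0 e0. w = w0 @ [(c, lv S, lv T)] \<and> real n w0 e0 (S # T # G0) \<and>
      e * csg G = e0 * csg (Node c S T # G0) \<and> nf ` set G = nf ` set (Node c S T # G0))"
proof (induction rule: real.induct)
  case real_init
  then show ?case by simp
next
  case (real_swap w e G1 S T G2)
  have "(- e) * csg (G1 @ T # S # G2) = e * csg (G1 @ S # T # G2)"
    using csg_swap[OF real_mlin[OF real_swap(1)]] by simp
  moreover have "set (G1 @ T # S # G2) = set (G1 @ S # T # G2)" by auto
  ultimately show ?case using real_swap.IH by (simp only:)
next
  case (real_step w e S T G c)
  then show ?case
    by (intro disjI2 exI[of _ w] exI[of _ c] exI[of _ S] exI[of _ T] exI[of _ G] exI[of _ e]) simp
qed

lemma nf_eq_lv: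
  assumes m: "mlin n G'" and eq: "nf ` set G = nf ` set G'" and t: "t \<in> set G" "t' \<in> set G'" "lv t = lv t'"
  shows "nf t = nf t'"
proof -
  obtain s where s: "s \<in> set G'" "nf t = nf s" using eq t(1) by blast
  then have "lv s = lv t'" using t(3) lv_nf by metis
  then have "s = t'" using blk_inj[OF m s(1) t(2)] by simp
  then show ?thesis using s by simp
qed

text \<open>Induction along the chain: consecutive elements determine the merged pair of blocks and
  the colour, and by \<open>csg_Node\<close> the product changes by a factor depending only on that
  pair and the rest of the partition.\<close>

theorem real_unique:
  "real n w e G \<Longrightarrow> real n w' e' G' \<Longrightarrow> wchain n w = wchain n w' \<Longrightarrow>
    e * csg G = e' * csg G' \<and> nf ` set G = nf ` set G'"
proof (induction "length w" arbitrary: w e G w' e' G')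
  case 0
  then have "length w' = 0" using length_merge_chain by (metis Suc_inject)
  then show ?case using real_last_step[OF 0(2)] real_last_step[OF 0(3)] 0(1) by simp
next
  case (Suc k)
  have len: "length w' = length w" using Suc.prems(3) length_merge_chain by (metis Suc_inject)
  obtain w0 c S T G0 e0 where w: "w = w0 @ [(c, lv S, lv T)]" "real n w0 e0 (S # T # G0)"
    "e * csg G = e0 * csg (Node c S T # G0)" "nf ` set G = nf ` set (Node c S T # G0)"
    using real_last_step[OF Suc.prems(1)] Suc.hyps(2) by auto
  obtain w0' c' S' T' G0' e0' where w': "w' = w0' @ [(c', lv S', lv T')]" "real n w0' e0' (S' # T' # G0')"
    "e' * csg G' = e0' * csg (Node c' S' T' # G0')" "nf ` set G' = nf ` set (Node c' S' T' # G0')"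
    using real_last_step[OF Suc.prems(2)] Suc.hyps(2) len by auto
  have m: "mlin n (S # T # G0)" and m': "mlin n (S' # T' # G0')"
    by (rule real_mlin[OF w(2)], rule real_mlin[OF w'(2)])
  have "wchain n w0 @ [wpf (Node c S T # G0)] = wchain n w0' @ [wpf (Node c' S' T' # G0')]"
    using Suc.prems(3) unfolding w(1) w'(1) merge_chain_snoc real_last[OF w(2)] real_last[OF w'(2)]
      do_step_wpf[OF m] do_step_wpf[OF m'] .
  then have ch: "wchain n w0 = wchain n w0'" and top: "wpf (Node c S T # G0) = wpf (Node c' S' T' # G0')" by auto
  have IH: "e0 * csg (S # T # G0) = e0' * csg (S' # T' # G0')" "nf ` set (S # T # G0) = nf ` set (S' # T' # G0')"
    using Suc.hyps(1)[OF _ w(2) w'(2) ch] w(1) Suc.hyps(2) by auto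
  define p where "p = wpf (S # T # G0)"
  have p': "p = wpf (S' # T' # G0')"
    using real_last[OF w(2)] real_last[OF w'(2)] ch by (simp add: p_def)
  note M = wpf_mrg[OF m, folded p_def] and M' = wpf_mrg[OF m', folded p']
  have pin: "p \<in> wpartitions n" using wpf_in[OF m] by (simp add: p_def)
  have eq: "mrg (col_weight c) (blk S) (blk T) p = mrg (col_weight c') (blk S') (blk T') p"
    using top M(4) M'(4) by simp
  have ST: "{blk S, blk T} = {blk S', blk T'}" and "col_weight c = col_weight c'"
    using mrg_inj[OF pin M(1-3) M'(1-3) eq] by auto
  then have c: "c = c'" by (simp add: col_weight_inj)
  have G0: "wpf G0 = wpf G0'" using M(5) M'(5) ST by simp
  have nfe: "lv X = lv X' \<Longrightarrow> nf X = nf X'" if "X \<in> {S, T}" "X' \<in> {S', T'}" for X X'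
    by (rule nf_eq_lv[OF m' IH(2)]) (use that in auto)
  have rest: "nf ` set G0 = nf ` set G0'"
  proof -
    have sub: "nf ` set H \<subseteq> nf ` set H'" if h: "mlin n (A # B # H)" "mlin n (A' # B' # H')"
      "nf ` set (A # B # H) = nf ` set (A' # B' # H')" "{lv A, lv B} = {lv A', lv B'}" for A B H A' B' H'
    proof
      fix z assume "z \<in> nf ` set H"
      then obtain t where t: "t \<in> set H" "z = nf t" by blast
      then obtain t' where t': "t' \<in> set (A' # B' # H')" "nf t = nf t'" using h(3) by force
      have "lv t = lv t'" using t'(2) lv_nf by metis
      moreover have "t \<noteq> A" "t \<noteq> B" using mlin_distinct[OF h(1)] t(1) by auto
      then have "lv t \<noteq> lv A" "lv t \<noteq> lv B"
        using blk_inj[OF h(1), of t A] blk_inj[OF h(1), of t B] t(1) by auto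
      ultimately have "lv t' \<noteq> lv A'" "lv t' \<noteq> lv B'" using h(4) by (auto simp: doubleton_eq_iff)
      then show "z \<in> nf ` set H'" using t' t(2) by auto
    qed
    have "{lv S, lv T} = {lv S', lv T'}" using ST by (auto simp: doubleton_eq_iff)
    then show ?thesis using sub[OF m m' IH(2)] sub[OF m' m IH(2)[symmetric]] by blast
  qed
  have nn: "nf (Node c S T) = nf (Node c' S' T')" and mx: "max (mn S) (mn T) = max (mn S') (mn T')"
  proof -
    \<comment> \<open>The chain determines the merged blocks only as an unordered pair; ordering by
      least leaf makes both readings agree.\<close>
    consider "lv S = lv S'" "lv T = lv T'" | "lv S = lv T'" "lv T = lv S'"
      using ST by (auto simp: doubleton_eq_iff)
    then have "nf (Node c S T) = nf (Node c' S' T') \<and> max (mn S) (mn T) = max (mn S') (mn T')"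
    proof cases
      case 1
      then show ?thesis using nfe[of S S'] nfe[of T T'] c by simp
    next
      case 2
      have "S' \<noteq> T'" using mlin_distinct[OF m'] by auto
      then have "mn S' \<noteq> mn T'" by (intro mn_neq[OF m']) auto
      then consider "mn S' < mn T'" "\<not> mn T' < mn S'" | "mn T' < mn S'" "\<not> mn S' < mn T'" by linarith
      then have "nf (Node c S T) = nf (Node c' S' T')"
        unfolding nf.simps 2 nfe[of S T', simplified, OF 2(1)] nfe[of T S', simplified, OF 2(2)] c
        by cases (simp_all only: if_True if_False)
      then show ?thesis using 2 by (simp add: max.commute)
    qed
    then show "nf (Node c S T) = nf (Node c' S' T')" "max (mn S) (mn T) = max (mn S') (mn T')" by auto
  qed
  have "e0 * csg (Node c S T # G0) = e0' * csg (Node c' S' T' # G0')"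
    unfolding csg_Node[OF m] csg_Node[OF m'] mx G0 using IH(1) by (simp add: mult.left_commute)
  moreover have "nf ` set (Node c S T # G0) = nf ` set (Node c' S' T' # G0')"
    using nn rest by (simp del: nf.simps)
  ultimately show ?case using w(3,4) w'(3,4) by simp
qed

lemma can_eq:
  assumes "mlin n G" "mlin n G'" "nf ` set G = nf ` set G'"
  shows "can G = can G'"
proof -
  have inj: "inj_on mn (set G)" if "mlin n G" for G
    using mn_neq[OF that] by (auto intro: inj_onI)
  have d: "distinct (map mn (sort_key mn (map nf G)))" if "mlin n G" for G
  proof -
    have "mset (map mn (sort_key mn (map nf G))) = mset (map mn G)"
      by (simp add: image_mset.compositionality o_def)
    from mset_eq_imp_distinct_iff[OF this] show ?thesis
      using inj[OF that] mlin_distinct[OF that] unfolding distinct_map[of mn G] by blast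
  qed
  show ?thesis unfolding can_def
  proof (rule map_sorted_distinct_set_unique[of mn])
    have "inj_on mn (nf ` set G)" using inj[OF assms(1)] by (auto simp: inj_on_def)
    then show "inj_on mn (set (sort_key mn (map nf G)) \<union> set (sort_key mn (map nf G')))"
      using assms(3) by simp
  qed (use assms d in simp_all)
qed

text \<open>Both forests are congruent to multiples of the same canonical forest, and
  \<open>real_unique\<close> equates the coefficients \<open>e * csg G\<close> and
  \<open>e' * csg G'\<close>.\<close>

theorem real_congruent:
  assumes "real n w e G" "real n w' e' G'" "wchain n w = wchain n w'"
  shows "scale (of_int e) (sng G) - scale (of_int e') (sng G') \<in> (relspace X r :: (_ \<Rightarrow>\<^sub>0 'k::field) set)"
proof -
  let ?N = "relspace X r :: (_ \<Rightarrow>\<^sub>0 'k) set"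
  note U = real_unique[OF assms]
  have can: "can G = can G'" by (rule can_eq[OF real_mlin[OF assms(1)] real_mlin[OF assms(2)] conjunct2[OF U]])
  have "scale (of_int e) (sng G - scale (of_int (csg G)) (sng (can G))) \<in> ?N"
    "scale (of_int e') (sng G' - scale (of_int (csg G')) (sng (can G'))) \<in> ?N"
    by (intro pm.subspace_scale subspace_relspace can_relspace)+
  from pm.subspace_diff[OF subspace_relspace this]
  have "scale (of_int e) (sng G) - scale (of_int (e * csg G)) (sng (can G)) -
    (scale (of_int e') (sng G') - scale (of_int (e' * csg G')) (sng (can G'))) \<in> ?N"
    by (simp add: pm.scale_right_diff_distrib)
  then show ?thesis using U can by simp
qed

section \<open>Contexts and continuations\<close>

lemma tctx_lv: "H \<in> tctx \<Longrightarrow> lv t = lv t' \<Longrightarrow> lv (H t) = lv (H t')"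
  by (induction rule: tctx.induct) auto

lemma fctx_lv: "F \<in> fctx \<Longrightarrow> lv t = lv t' \<Longrightarrow> i < length (F t) \<Longrightarrow> lv (F t ! i) = lv (F t' ! i)"
proof -
  assume F: "F \<in> fctx" and eq: "lv t = lv t'"
  obtain G1 H G2 where "F = (\<lambda>t. G1 @ H t # G2)" "H \<in> tctx" using F by (rule fctxE)
  then show ?thesis using tctx_lv[of H t t'] eq by (simp add: nth_append nth_Cons')
qed

text \<open>This move and the merge \<open>joint\<close> are described by positions, so that they
  apply to all fillings of a forest context at once.\<close>

definition frontt :: "nat \<Rightarrow> 'a list \<Rightarrow> 'a list" where
  "frontt i G = G ! i # take i G @ drop (Suc i) G"

definition joint :: "color \<Rightarrow> 'a btree list \<Rightarrow> 'a btree list" where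
  "joint c G = Node c (G ! 0) (G ! 1) # drop 2 G"

lemma fctx_frontt:
  assumes "F \<in> fctx" "i < length (F t0)"
  shows "(\<lambda>t. frontt i (F t)) \<in> fctx"
proof -
  obtain G1 H G2 where F: "F = (\<lambda>t. G1 @ H t # G2)" "H \<in> tctx" using assms(1) by (rule fctxE)
  consider "i < length G1" | "i = length G1" | j where "i = Suc (length G1 + j)" "j < length G2"
  proof -
    have "j < length G2" if "i = Suc (length G1 + j)" for j using assms(2) that by (simp add: F)
    moreover have "i < length G1 \<or> i = length G1 \<or> i = Suc (length G1 + (i - Suc (length G1)))" by linarith
    ultimately show thesis using that by blast
  qed
  then show ?thesis
  proof cases
    case 1
    then have "(\<lambda>t. frontt i (F t)) = (\<lambda>t. (G1 ! i # take i G1 @ drop (Suc i) G1) @ H t # G2)"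
      by (auto simp: F frontt_def nth_append)
    then show ?thesis using fctxI[OF F(2)] by metis
  next
    case 2
    then have "(\<lambda>t. frontt i (F t)) = (\<lambda>t. [] @ H t # (G1 @ G2))"
      by (auto simp: F frontt_def nth_append)
    then show ?thesis using fctxI[OF F(2)] by metis
  next
    case 3
    then have "(\<lambda>t. frontt i (F t)) = (\<lambda>t. (G2 ! j # G1) @ H t # (take j G2 @ drop (Suc j) G2))"
      by (auto simp: F frontt_def nth_append)
    then show ?thesis using fctxI[OF F(2)] by metis
  qed
qed

lemma fctx_joint:
  assumes "F \<in> fctx" "2 \<le> length (F t0)"
  shows "(\<lambda>t. joint c (F t)) \<in> fctx"
proof -
  obtain G1 H G2 where F: "F = (\<lambda>t. G1 @ H t # G2)" "H \<in> tctx" using assms(1) by (rule fctxE)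
  consider "G1 = []" | A where "G1 = [A]" | A B G1' where "G1 = A # B # G1'"
    by (metis neq_Nil_conv)
  then show ?thesis
  proof cases
    case 1
    then obtain B G2' where "G2 = B # G2'" using assms(2) F by (cases G2) auto
    then have "(\<lambda>t. joint c (F t)) = (\<lambda>t. [] @ Node c (H t) B # G2')"
      by (auto simp: F joint_def 1)
    then show ?thesis using fctxI[OF tctx_left[OF F(2)]] by metis
  next
    case 2
    then have "(\<lambda>t. joint c (F t)) = (\<lambda>t. [] @ Node c A (H t) # G2)"
      by (auto simp: F joint_def)
    then show ?thesis using fctxI[OF tctx_right[OF F(2)]] by metis
  next
    case 3
    then have "(\<lambda>t. joint c (F t)) = (\<lambda>t. (Node c A B # G1') @ H t # G2)"
      by (auto simp: F joint_def)
    then show ?thesis using fctxI[OF F(2)] by metis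
  qed
qed

lemma set_frontt: "i < length G \<Longrightarrow> set (frontt i G) = set G"
  unfolding frontt_def by (subst (4) id_take_nth_drop[of i G]) auto

lemma real_frontt: "real n w e G \<Longrightarrow> i < length G \<Longrightarrow> real n w ((-1) ^ i * e) (frontt i G)"
  using real_front[of n w e "take i G" "G ! i" "drop (Suc i) G"] id_take_nth_drop[of i G]
  by (simp add: frontt_def min_def)

lemma real_joint:
  assumes "real n w e G" "2 \<le> length G"
  shows "real n (w @ [(c, lv (G ! 0), lv (G ! 1))]) e (joint c G)"
proof -
  obtain S T G' where "G = S # T # G'" using assms(2) by (metis One_nat_def Suc_1 Suc_le_length_iff)
  then show ?thesis using real_step[of n w e S T G' c] assms(1) by (simp add: joint_def)
qed

lemma chain_card:
  "sorted_wrt wlt (p # c) \<Longrightarrow> set (p # c) \<subseteq> wpartitions n \<Longrightarrow> card (last (p # c)) + length c \<le> card p"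
proof (induction c arbitrary: p)
  case (Cons q c)
  have "card q < card p" using Cons.prems by (intro wlt_card[of p n q]) auto
  moreover have "card (last (q # c)) + length c \<le> card q" using Cons.IH[of q] Cons.prems by simp
  ultimately show ?case by simp
qed simp

text \<open>Moves refer to positions and merges to leaf sets, never to the shape of the tree in the
  hole. One sequence, one sign and one resulting context therefore serve all trees with the same
  leaves, which is what transports a relation up a chain.\<close>

theorem continuation:
  assumes "F \<in> fctx" "mlin n (F t)" "sorted_wrt wlt (wpf (F t) # c)" "set c \<subseteq> wpartitions n"
    "card (last (wpf (F t) # c)) + length c = card (wpf (F t))"
  shows "\<exists>s \<epsilon> F'. F' \<in> fctx \<and> (\<epsilon> = 1 \<or> \<epsilon> = -1) \<and> merge_chain (wpf (F t)) s = wpf (F t) # c \<and>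
    (\<forall>w \<eta> t'. lv t' = lv t \<longrightarrow> real n w \<eta> (F t') \<longrightarrow> real n (w @ s) (\<epsilon> * \<eta>) (F' t'))"
  using assms
proof (induction c arbitrary: F)
  case Nil
  then show ?case by (intro exI[of _ "[]"] exI[of _ 1] exI[of _ F]) simp
next
  case (Cons r c)
  let ?q = "wpf (F t)"
  have qin: "?q \<in> wpartitions n" by (rule wpf_in[OF Cons.prems(2)])
  have rin: "r \<in> wpartitions n" and lt: "wlt ?q r" using Cons.prems by auto
  have cr: "card (last (r # c)) + length c \<le> card r" using chain_card[of r c n] Cons.prems by simp
  have lts: "card r < card ?q" by (rule wlt_card[OF qin rin lt])
  have eqs: "card ?q = Suc (card r)" "card (last (r # c)) + length c = card r"
    using cr lts Cons.prems(5) by auto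
  obtain x y u where xy: "x \<in> ?q" "y \<in> ?q" "x \<noteq> y" "u \<le> 1" "r = mrg u x y ?q"
    using wlt_cover[OF qin rin lt eqs(1)] .
  obtain i where i: "i < length (F t)" "x = blk (F t ! i)" using xy(1) by (auto simp: wpf_def in_set_conv_nth)
  \<comment> \<open>The two trees to be merged are brought to the front one after the other: first
    the one of \<open>x\<close>, then the one of \<open>y\<close>, which ends up before it.\<close>
  define F1 where "F1 t = frontt i (F t)" for t
  have F1: "F1 \<in> fctx" "set (F1 t) = set (F t)" "length (F1 t) = length (F t)"
    using fctx_frontt[OF Cons.prems(1) i(1)] set_frontt[OF i(1)] i(1) by (auto simp: F1_def[abs_def] frontt_def min_def)
  obtain j where j: "j < length (F1 t)" "y = blk (F1 t ! j)"
    using xy(2) F1(2) by (auto simp: wpf_def in_set_conv_nth) (metis F1(2) in_set_conv_nth nth_mem)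
  have F10: "F1 t ! 0 = F t ! i" by (simp add: F1_def frontt_def)
  have j0: "j \<noteq> 0" using j(2) i(2) xy(3) F10 by (metis)
  define F2 where "F2 t = frontt j (F1 t)" for t
  have F2: "F2 \<in> fctx" "set (F2 t) = set (F t)" "length (F2 t) = length (F t)"
    using fctx_frontt[OF F1(1) j(1)] set_frontt[OF j(1)] F1 j(1) by (auto simp: F2_def[abs_def] frontt_def min_def)
  have F20: "F2 t ! 0 = F1 t ! j" "F2 t ! 1 = F t ! i"
    using j0 j(1) F10 by (auto simp: F2_def frontt_def nth_append)
  have two: "2 \<le> length (F2 t)" using j0 j(1) F1 F2 by linarith
  obtain c0 where c0: "col_weight c0 = u" using xy(4) by (metis col_weight.simps le_Suc_eq le_zero_eq One_nat_def)
  define F3 where "F3 t = joint c0 (F2 t)" for t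
  have F3: "F3 \<in> fctx" using fctx_joint[OF F2(1) two] by (simp add: F3_def[abs_def])
  obtain Y X R where YXR: "F2 t = Y # X # R" using two by (metis One_nat_def Suc_1 Suc_le_length_iff)
  have YX: "y = blk Y" "x = blk X" "F3 t = Node c0 Y X # R"
    using F20 YXR j(2) i(2) by (auto simp: F3_def joint_def)
  have "size (F2 t) = size (F t)" by (simp add: F2)
  have mF: "mset (frontt k G) = mset G" if "k < length G" for k and G :: "nat btree list"
    unfolding frontt_def by (subst (4) id_take_nth_drop[OF that]) simp
  have "mset (F2 t) = mset (F t)" using mF[OF j(1)] mF[OF i(1)] by (simp add: F2_def F1_def)
  then have m2: "mlin n (Y # X # R)" using mlin_cong Cons.prems(2) YXR by metis
  have wq: "wpf (Y # X # R) = ?q" using wpf_cong[OF F2(2)] YXR by simp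
  have r: "wpf (F3 t) = r"
    using wpf_mrg(4)[OF m2, of c0] xy(5) YX wq c0 mrg_commute[of u x y ?q] by simp
  have m3: "mlin n (F3 t)" using m2 mlin_Node YX(3) by metis
  have "\<exists>s \<epsilon> F'. F' \<in> fctx \<and> (\<epsilon> = 1 \<or> \<epsilon> = -1) \<and> merge_chain (wpf (F3 t)) s = wpf (F3 t) # c \<and>
    (\<forall>w \<eta> t'. lv t' = lv t \<longrightarrow> real n w \<eta> (F3 t') \<longrightarrow> real n (w @ s) (\<epsilon> * \<eta>) (F' t'))"
    by (rule Cons.IH[OF F3 m3]) (use Cons.prems eqs r in simp_all)
  then obtain s \<epsilon> F' where s: "F' \<in> fctx" "\<epsilon> = 1 \<or> \<epsilon> = -1" "merge_chain r s = r # c"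
    and cont: "\<And>w \<eta> t'. lv t' = lv t \<Longrightarrow> real n w \<eta> (F3 t') \<Longrightarrow> real n (w @ s) (\<epsilon> * \<eta>) (F' t')"
    unfolding r by blast
  let ?s = "(c0, lv Y, lv X)"
  have 1: "merge_chain ?q (?s # s) = ?q # r # c"
    using do_step_wpf[OF m2, of c0] wq r YX(3) s(3) by simp
  have 2: "real n (w @ ?s # s) (\<epsilon> * ((-1) ^ j * (-1) ^ i) * \<eta>) (F' t')"
    if t': "lv t' = lv t" and re: "real n w \<eta> (F t')" for w \<eta> t'
  proof -
    have l: "length (F t') = length (F t)" "length (F1 t') = length (F1 t)" "length (F2 t') = length (F2 t)"
      using fctx_length Cons.prems(1) F1(1) F2(1) by blast+
    have "real n w ((-1) ^ j * ((-1) ^ i * \<eta>)) (F2 t')"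
      unfolding F2_def F1_def using re i(1) j(1) l by (intro real_frontt) (auto simp: F1_def)
    moreover have "lv (F2 t' ! 0) = lv Y" "lv (F2 t' ! 1) = lv X"
      using fctx_lv[OF F2(1) t', of 0] fctx_lv[OF F2(1) t', of 1] l two YXR by auto
    ultimately have "real n (w @ [?s]) ((-1) ^ j * ((-1) ^ i * \<eta>)) (F3 t')"
      unfolding F3_def using real_joint[of n w _ "F2 t'" c0] two l by metis
    from cont[OF t' this] show ?thesis by (simp add: mult.assoc)
  qed
  have "\<epsilon> * ((-1) ^ j * (-1) ^ i) = 1 \<or> \<epsilon> * ((-1) ^ j * (-1) ^ i) = -1"
    using s(2) by (auto simp: minus_one_power_iff)
  then show ?case using s(1) 1 2
    by (intro exI[of _ "?s # s"] exI[of _ "\<epsilon> * ((-1) ^ j * (-1) ^ i)"] exI[of _ F']) blast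
qed

text \<open>A context is taken apart along the path to its hole: \<open>G0\<close> lists the trees
  hanging off the path together with \<open>G\<close>, and \<open>s\<close> grafts the former from
  the hole outwards.\<close>

lemma tctx_decomp:
  assumes "H \<in> tctx"
  shows "\<exists>G0 s \<epsilon>. (\<epsilon> = 1 \<or> \<epsilon> = -1) \<and> (\<forall>t'. mset (forest_word (t' # G0)) = mset (forest_word (H t' # G))) \<and>
    (\<forall>w \<eta> t'. lv t' = lv t \<longrightarrow> real n w \<eta> (t' # G0) \<longrightarrow> real n (w @ s) (\<epsilon> * \<eta>) (H t' # G))"
  using assms
proof (induction arbitrary: G)
  case tctx_id
  show ?case by (intro exI[of _ G] exI[of _ "[]"] exI[of _ 1]) simp
next
  case (tctx_left H c S)
  obtain G0 s \<epsilon> where IH: "\<epsilon> = 1 \<or> \<epsilon> = -1" "\<And>t'. mset (forest_word (t' # G0)) = mset (forest_word (H t' # S # G))"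
    "\<And>w \<eta> t'. lv t' = lv t \<Longrightarrow> real n w \<eta> (t' # G0) \<Longrightarrow> real n (w @ s) (\<epsilon> * \<eta>) (H t' # S # G)"
    using tctx_left.IH[of "S # G"] by blast
  have "real n (w @ s @ [(c, lv (H t), lv S)]) (\<epsilon> * \<eta>) (Node c (H t') S # G)"
    if "lv t' = lv t" "real n w \<eta> (t' # G0)" for w \<eta> t'
    using real_step[OF IH(3)[OF that], of c] tctx_lv[OF tctx_left.hyps that(1)] by simp
  then show ?case using IH(1,2)
    by (intro exI[of _ G0] exI[of _ "s @ [(c, lv (H t), lv S)]"] exI[of _ \<epsilon>]) simp
next
  case (tctx_right H c S)
  obtain G0 s \<epsilon> where IH: "\<epsilon> = 1 \<or> \<epsilon> = -1" "\<And>t'. mset (forest_word (t' # G0)) = mset (forest_word (H t' # S # G))"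
    "\<And>w \<eta> t'. lv t' = lv t \<Longrightarrow> real n w \<eta> (t' # G0) \<Longrightarrow> real n (w @ s) (\<epsilon> * \<eta>) (H t' # S # G)"
    using tctx_right.IH[of "S # G"] by blast
  \<comment> \<open>A sibling on the left has to be exchanged to the front before grafting, which
    reverses the sign.\<close>
  have "real n (w @ s @ [(c, lv S, lv (H t))]) (- \<epsilon> * \<eta>) (Node c S (H t') # G)"
    if "lv t' = lv t" "real n w \<eta> (t' # G0)" for w \<eta> t'
    using real_step[OF real_swap[of n "w @ s" "\<epsilon> * \<eta>" "[]", simplified, OF IH(3)[OF that]], of c]
      tctx_lv[OF tctx_right.hyps that(1)] by simp
  then show ?case using IH(1,2)
    by (intro exI[of _ G0] exI[of _ "s @ [(c, lv S, lv (H t))]"] exI[of _ "- \<epsilon>"]) (auto simp: union_ac)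
qed

theorem decomposition:
  assumes "F \<in> fctx"
  shows "\<exists>G0 s \<epsilon>. (\<epsilon> = 1 \<or> \<epsilon> = -1) \<and> (\<forall>t'. mset (forest_word (t' # G0)) = mset (forest_word (F t'))) \<and>
    (\<forall>w \<eta> t'. lv t' = lv t \<longrightarrow> real n w \<eta> (t' # G0) \<longrightarrow> real n (w @ s) (\<epsilon> * \<eta>) (F t'))"
proof -
  obtain G1 H G2 where F: "F = (\<lambda>t. G1 @ H t # G2)" "H \<in> tctx" using assms by (rule fctxE)
  obtain G0 s \<epsilon> where D: "\<epsilon> = 1 \<or> \<epsilon> = -1" "\<And>t'. mset (forest_word (t' # G0)) = mset (forest_word (H t' # G1 @ G2))"
    "\<And>w \<eta> t'. lv t' = lv t \<Longrightarrow> real n w \<eta> (t' # G0) \<Longrightarrow> real n (w @ s) (\<epsilon> * \<eta>) (H t' # G1 @ G2)"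
    using tctx_decomp[OF F(2), of "G1 @ G2" t n] by blast
  have "real n (w @ s) ((-1) ^ length G1 * \<epsilon> * \<eta>) (F t')" if "lv t' = lv t" "real n w \<eta> (t' # G0)" for w \<eta> t'
    using real_unfront[OF D(3)[OF that]] by (simp add: F mult.assoc)
  moreover have "(-1) ^ length G1 * \<epsilon> = 1 \<or> (-1) ^ length G1 * \<epsilon> = -1"
    using D(1) by (auto simp: minus_one_power_iff)
  moreover have "mset (forest_word (t' # G0)) = mset (forest_word (F t'))" for t'
    using D(2)[of t'] by (simp add: F union_ac)
  ultimately show ?thesis
    by (intro exI[of _ G0] exI[of _ s] exI[of _ "(-1) ^ length G1 * \<epsilon>"]) blast
qed

section \<open>Forest relations and chain relations agree\<close>

definition betM :: "nat \<Rightarrow> nat \<Rightarrow> (nat btree list \<Rightarrow>\<^sub>0 'k::field) \<Rightarrow> (wpartition list \<Rightarrow>\<^sub>0 'k)" where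
  "betM n r = lin_ext (\<lambda>G. if G \<in> MF {1..n} r then bet n G else 0)"

definition Zall :: "nat \<Rightarrow> nat \<Rightarrow> (wpartition list \<Rightarrow>\<^sub>0 'k::field) set" where
  "Zall n r = pm.span (\<Union>y\<in>{y \<in> wpartitions n. card y = r}. Zs n y)"

lemma subspace_Zall [simp]: "pm.subspace (Zall n r)"
  by (simp add: Zall_def)

lemma Zs_Zall: "y \<in> wpartitions n \<Longrightarrow> card y = r \<Longrightarrow> Zs n y \<subseteq> Zall n r"
  unfolding Zall_def by (rule order_trans[OF _ pm.span_superset]) blast

lemma lin_betM [simp]: "lin (betM n r)"
  by (simp add: betM_def)

lemma betM_sng: "betM n r (sng G) = (if G \<in> MF {1..n} r then bet n G else 0)"
  by (simp add: betM_def)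

lemma MF_mlin: "G \<in> MF {1..n} r \<Longrightarrow> mlin n G \<and> length G = r"
  by (simp add: MF_def)

lemma unit_square: "e = 1 \<or> e = -1 \<Longrightarrow> (of_int e * of_int e :: 'k::field) = 1"
  by auto

lemma real_bet:
  assumes "real n w e G"
  shows "bet n G - scale (of_int e) (sng (wchain n w)) \<in> (Zs n (wpf G) :: (_ \<Rightarrow>\<^sub>0 'k::field) set)"
proof -
  have "scale (- of_int e) (sng (wchain n w) - scale (of_int e) (bet n G)) \<in> (Zs n (wpf G) :: (_ \<Rightarrow>\<^sub>0 'k) set)"
    by (rule pm.subspace_scale[OF subspace_Zs real_class[OF assms]])
  then show ?thesis
    using unit_square[OF real_unit[OF assms], where ?'k = 'k]
    by (simp add: pm.scale_right_diff_distrib single_uminus)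
qed

definition colw :: "nat \<Rightarrow> color" where
  "colw k = (if k = 0 then Blue else Red)"

lemma col_weight_colw: "k \<le> 1 \<Longrightarrow> col_weight (colw k) = k"
  by (auto simp: colw_def)

text \<open>Possible weights of the first of two merges that add \<open>E\<close> in total. There is
  one value for \<open>E\<close> equal to 0 or 2 and two for 1: the Jacobi relations of the blue and
  the red bracket, and the mixed one.\<close>

definition kset :: "nat \<Rightarrow> nat set" where
  "kset E = {k. k \<le> 1 \<and> k \<le> E \<and> E \<le> k + 1}"

lemma finite_kset [simp]: "finite (kset E)"
  by (rule finite_subset[of _ "{..1}"]) (auto simp: kset_def)

lemma kset_simps: "kset 0 = {0}" "kset (Suc 0) = {0, 1}" "kset 2 = {1}"
  by (auto simp: kset_def)

abbreviation cyc :: "'a \<Rightarrow> 'a \<Rightarrow> 'a \<Rightarrow> ('a \<times> 'a \<times> 'a) set" where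
  "cyc S T U \<equiv> {(S, T, U), (T, U, S), (U, S, T)}"

text \<open>The first merge becomes the inner node and stands on the right, to match the terms
  [x,[y,z]] of \<open>jac\<close>; the outer node receives the remaining weight.\<close>

definition ttree :: "nat \<Rightarrow> nat \<Rightarrow> 'a btree \<times> 'a btree \<times> 'a btree \<Rightarrow> 'a btree" where
  "ttree E k x = (case x of (X, Y, V) \<Rightarrow> Node (colw (E - k)) V (Node (colw k) X Y))"

lemma jac_ttree:
  "jac (colw (E - k)) (colw k) F S T U =
    sng (F (ttree E k (S, T, U))) + sng (F (ttree E k (T, U, S))) + sng (F (ttree E k (U, S, T)))"
  by (simp add: jac_def ttree_def add_ac)

text \<open>Rotating three trees is an even permutation, so no sign appears.\<close>

lemma real_cyc:
  assumes r: "real n w e (S # T # U # G)" and c: "(X, Y, V) \<in> cyc S T U"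
  shows "real n w e (X # Y # V # G)"
proof -
  have "real n w e (T # U # S # G)"
    using real_swap[of n w "- e" "[T]" S U G] real_swap[of n w e "[]" S T "U # G"] r by simp
  moreover have "real n w e (U # S # T # G)"
    using real_swap[of n w "- e" "[]" S U "T # G"] real_swap[of n w e "[S]" T U G] r by simp
  ultimately show ?thesis using c r by auto
qed

definition tri_top :: "nat \<Rightarrow> nat btree \<Rightarrow> nat btree \<Rightarrow> nat btree \<Rightarrow> nat btree list \<Rightarrow> wpartition" where
  "tri_top E S T U G = insert (lv S \<union> lv T \<union> lv U, reds S + reds T + reds U + E) (wpf G)"

text \<open>The minus sign comes from the single exchange that puts the inner node behind
  \<open>V\<close>. It is the same for every rotation and every \<open>k\<close>, and so the sum
  over all fillings becomes a multiple of the relator.\<close>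

lemma tri_chain:
  assumes r: "real n w e (S # T # U # G)" and k: "k \<in> kset E" and c: "(X, Y, V) \<in> cyc S T U"
    and cont: "\<And>w \<eta> t'. lv t' = lv S \<union> lv T \<union> lv U \<Longrightarrow> real n w \<eta> (t' # G) \<Longrightarrow> real n (w @ s) (\<epsilon> * \<eta>) (F t')"
  shows "\<exists>w'. real n w' (- (\<epsilon> * e)) (F (ttree E k (X, Y, V))) \<and>
    wchain n w' = butlast (wchain n w) @ wpf (S # T # U # G) # mrg k (blk X) (blk Y) (wpf (S # T # U # G))
      # merge_chain (tri_top E S T U G) s"
proof -
  let ?t = "ttree E k (X, Y, V)" and ?p = "wpf (S # T # U # G)"
  let ?N = "Node (colw k) X Y"
  let ?x1 = "(colw k, lv X, lv Y)" and ?x2 = "(colw (E - k), lv V, lv ?N)"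
  have cw: "col_weight (colw k) = k" "col_weight (colw (E - k)) = E - k" "k \<le> E"
    using k by (auto simp: kset_def intro!: col_weight_colw)
  have t: "?t = Node (colw (E - k)) V ?N" by (simp add: ttree_def)
  have r1: "real n w e (X # Y # V # G)" by (rule real_cyc[OF r c])
  have r2: "real n (w @ [?x1]) (- e) (V # ?N # G)"
    using real_swap[of n "w @ [?x1]" e "[]" ?N V G] real_step[OF r1, of "colw k"] by simp
  have r3: "real n ((w @ [?x1]) @ [?x2]) (- e) (?t # G)"
    unfolding t by (rule real_step[OF r2])
  have lt: "lv ?t = lv S \<union> lv T \<union> lv U" using c by (auto simp: t)
  have r4: "real n (((w @ [?x1]) @ [?x2]) @ s) (\<epsilon> * - e) (F ?t)" by (rule cont[OF lt r3])
  have p: "wpf (X # Y # V # G) = ?p" by (rule wpf_cong) (use c in auto)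
  have p1: "do_step ?x1 ?p = mrg k (blk X) (blk Y) ?p" "do_step ?x1 ?p = wpf (V # ?N # G)"
  proof -
    have "do_step ?x1 ?p = wpf (?N # V # G)" using do_step_wpf[OF real_mlin[OF r1], of "colw k"] p by simp
    moreover have "mrg k (blk X) (blk Y) ?p = wpf (?N # V # G)"
      using wpf_mrg(4)[OF real_mlin[OF r1], of "colw k"] p cw by simp
    moreover have "wpf (?N # V # G) = wpf (V # ?N # G)" by (rule wpf_cong) auto
    ultimately show "do_step ?x1 ?p = mrg k (blk X) (blk Y) ?p" "do_step ?x1 ?p = wpf (V # ?N # G)" by simp_all
  qed
  have q: "do_step ?x2 (wpf (V # ?N # G)) = tri_top E S T U G"
  proof -
    have "do_step ?x2 (wpf (V # ?N # G)) = wpf (?t # G)"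
      unfolding t by (rule do_step_wpf[OF real_mlin[OF r2]])
    moreover have "blk ?t = (lv S \<union> lv T \<union> lv U, reds S + reds T + reds U + E)"
    proof -
      have "reds ?t = reds V + (reds X + reds Y + k) + (E - k)" by (simp add: t cw)
      then show ?thesis using lt c cw(3) by auto
    qed
    ultimately show ?thesis by (simp add: tri_top_def wpf_def)
  qed
  have "wchain n (((w @ [?x1]) @ [?x2]) @ s) = butlast (wchain n w) @ ?p # mrg k (blk X) (blk Y) ?p #
      merge_chain (tri_top E S T U G) s"
    using p1 q by (simp add: merge_chain_append real_last[OF r] butlast_append)
  then show ?thesis using r4 by (intro exI[of _ "((w @ [?x1]) @ [?x2]) @ s"]) simp
qed

lemma wpf_triple:
  assumes "mlin n (S # T # U # G)"
  shows "blk S \<in> wpf (S # T # U # G)" "blk T \<in> wpf (S # T # U # G)" "blk U \<in> wpf (S # T # U # G)"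
    "distinct [blk S, blk T, blk U]" "wpf (S # T # U # G) - {blk S, blk T, blk U} = wpf G"
proof -
  note inj = blk_inj[OF assms] and d = mlin_distinct[OF assms]
  show "blk S \<in> wpf (S # T # U # G)" "blk T \<in> wpf (S # T # U # G)" "blk U \<in> wpf (S # T # U # G)"
    by (simp_all add: wpf_def)
  show "distinct [blk S, blk T, blk U]" using inj[of S T] inj[of S U] inj[of T U] d by auto
  have "blk X \<notin> wpf G" if "X \<in> {S, T, U}" for X
  proof
    assume "blk X \<in> wpf G"
    then obtain t where "t \<in> set G" "lv X = lv t" by (auto simp: wpf_def)
    then show False using inj[of X t] that d by auto
  qed
  then show "wpf (S # T # U # G) - {blk S, blk T, blk U} = wpf G" by (auto simp: wpf_def)
qed

lemma distinct3:
  assumes "distinct [x, y, z]"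
  shows "x \<noteq> y" "y \<noteq> z" "z \<noteq> x"
  using assms by auto

lemma distinct4I:
  "a \<noteq> b \<Longrightarrow> a \<noteq> c \<Longrightarrow> a \<noteq> d \<Longrightarrow> b \<noteq> c \<Longrightarrow> b \<noteq> d \<Longrightarrow> c \<noteq> d \<Longrightarrow> distinct [a, b, c, d]"
  by auto

text \<open>The elements listed in \<open>rank2_triple\<close> are pairwise distinct, since a merge
  determines its pair and its weight.\<close>

lemma wint_triple_sum:
  assumes p: "p \<in> wpartitions n" and x: "x \<in> p" "y \<in> p" "z \<in> p" "x \<noteq> y" "y \<noteq> z" "z \<noteq> x" and E: "E \<le> 2"
    and q: "q = insert (fst x \<union> fst y \<union> fst z, snd x + snd y + snd z + E) (p - {x, y, z})"
  shows "(\<Sum>a\<in>wint n p q. f a) =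
    (\<Sum>k\<in>kset E. f (mrg k x y p) + f (mrg k y z p) + f (mrg k z x p) :: 'v::ab_group_add)"
proof -
  let ?P = "{(x, y), (y, z), (z, x)}" and ?m = "\<lambda>w. mrg (fst w) (fst (snd w)) (snd (snd w)) p"
  have "distinct [x, y, z]" using x by simp
  from rank2_triple[OF p x(1-3) this E] q
  have "wint n p q = {mrg k s t p |k s t. (s, t) \<in> ?P \<and> k \<le> 1 \<and> k \<le> E \<and> E \<le> k + 1}"
    unfolding wint_def by simp
  also have "\<dots> = ?m ` (kset E \<times> ?P)" unfolding kset_def
  proof (rule equalityI; rule subsetI)
    fix a assume "a \<in> {mrg k s t p |k s t. (s, t) \<in> ?P \<and> k \<le> 1 \<and> k \<le> E \<and> E \<le> k + 1}"
    then obtain k s t where "a = mrg k s t p" "(s, t) \<in> ?P" "k \<le> 1" "k \<le> E" "E \<le> k + 1" by blast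
    then show "a \<in> ?m ` ({k. k \<le> 1 \<and> k \<le> E \<and> E \<le> k + 1} \<times> ?P)"
      by (intro image_eqI[of _ _ "(k, s, t)"]) simp_all
  next
    fix a assume "a \<in> ?m ` ({k. k \<le> 1 \<and> k \<le> E \<and> E \<le> k + 1} \<times> ?P)"
    then show "a \<in> {mrg k s t p |k s t. (s, t) \<in> ?P \<and> k \<le> 1 \<and> k \<le> E \<and> E \<le> k + 1}" by fastforce
  qed
  finally have w: "wint n p q = ?m ` (kset E \<times> ?P)" .
  have inj: "inj_on ?m (kset E \<times> ?P)"
  proof (rule inj_onI)
    fix w w' assume w: "w \<in> kset E \<times> ?P" "w' \<in> kset E \<times> ?P" "?m w = ?m w'"
    obtain k s t k' s' t' where ww: "w = (k, s, t)" "w' = (k', s', t')" by (cases w; cases w')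
    have *: "(s, t) \<in> ?P" "(s', t') \<in> ?P" "mrg k s t p = mrg k' s' t' p"
      using w unfolding ww by simp_all
    have in2: "s \<in> p" "t \<in> p" "s \<noteq> t" "s' \<in> p" "t' \<in> p" "s' \<noteq> t'" using *(1,2) x by fastforce+
    from mrg_inj[OF p in2 *(3)] have "{s, t} = {s', t'}" "k = k'" .
    moreover from this(1) have "s = s' \<and> t = t'" using *(1,2) x(4-6) by (fastforce simp: doubleton_eq_iff)
    ultimately show "w = w'" unfolding ww by simp
  qed
  have d: "(x, y) \<noteq> (y, z)" "(x, y) \<noteq> (z, x)" "(y, z) \<noteq> (z, x)" using x(4-6) by auto
  have "(\<Sum>a\<in>wint n p q. f a) = (\<Sum>w\<in>kset E \<times> ?P. f (?m w))"
    unfolding w by (rule sum.reindex[OF inj, unfolded o_def])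
  also have "\<dots> = (\<Sum>k\<in>kset E. \<Sum>w\<in>?P. f (mrg k (fst w) (snd w) p))"
    by (simp add: sum.cartesian_product case_prod_beta)
  also have "\<dots> = (\<Sum>k\<in>kset E. f (mrg k x y p) + f (mrg k y z p) + f (mrg k z x p))"
    using d by (intro sum.cong[OF refl]) (simp add: add_ac)
  finally show ?thesis .
qed

lemma tri_sum:
  assumes m: "mlin n (S # T # U # G)" and E: "E \<le> 2"
  defines "p \<equiv> wpf (S # T # U # G)"
  shows "(\<Sum>a\<in>wint n p (tri_top E S T U G). f a) =
    (\<Sum>k\<in>kset E. f (mrg k (blk S) (blk T) p) + f (mrg k (blk T) (blk U) p) + f (mrg k (blk U) (blk S) p) :: 'v::ab_group_add)"
proof (rule wint_triple_sum[OF _ _ _ _ _ _ _ E])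
  note W = wpf_triple[OF m, folded p_def]
  show "p \<in> wpartitions n" unfolding p_def by (rule wpf_in[OF m])
  show "blk S \<in> p" "blk T \<in> p" "blk U \<in> p" by (fact W)+
  show "blk S \<noteq> blk T" "blk T \<noteq> blk U" "blk U \<noteq> blk S"
    by (fact distinct3[OF W(4)])+
  show "tri_top E S T U G = insert (fst (blk S) \<union> fst (blk T) \<union> fst (blk U), snd (blk S) + snd (blk T) + snd (blk U) + E)
    (p - {blk S, blk T, blk U})"
    unfolding tri_top_def W(5) by (simp only: fst_conv snd_conv)
qed

lemma fchains_gapped:
  assumes "c1 @ p # a # q # c2 \<in> fchains n y"
  shows "gapped n y c1 p q c2"
  using assms by (cases c1) (auto simp: gapped_def fchains_def sorted_wrt_append)

text \<open>The six (or three) ways of filling a gap of three blocks realise, with one common sign, the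
  terms of the (mixed) Jacobi relation.\<close>

lemma tri_congruence:
  fixes g :: "wpartition list \<Rightarrow> ('x \<Rightarrow>\<^sub>0 'k::field)" and h :: "nat btree list \<Rightarrow> ('x \<Rightarrow>\<^sub>0 'k)"
  assumes r: "real n w e (S # T # U # G)" and E: "E \<le> 2" and V: "pm.subspace V"
    and cont: "\<And>w \<eta> t'. lv t' = lv S \<union> lv T \<union> lv U \<Longrightarrow> real n w \<eta> (t' # G) \<Longrightarrow> real n (w @ s) (\<epsilon> * \<eta>) (F t')"
    and gh: "\<And>w' \<eta> X. real n w' \<eta> (F X) \<Longrightarrow> wpf (F X) = st (tri_top E S T U G) s \<Longrightarrow>
      g (wchain n w') - scale (of_int \<eta>) (h (F X)) \<in> V"
    and c: "merge_chain (tri_top E S T U G) s = tri_top E S T U G # c2"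
  shows "(\<Sum>a\<in>wint n (wpf (S # T # U # G)) (tri_top E S T U G).
      g (butlast (wchain n w) @ wpf (S # T # U # G) # a # tri_top E S T U G # c2)) -
    scale (of_int (- (\<epsilon> * e))) (\<Sum>k\<in>kset E. h (F (ttree E k (S, T, U))) + h (F (ttree E k (T, U, S))) + h (F (ttree E k (U, S, T))))
    \<in> V"
proof -
  let ?p = "wpf (S # T # U # G)"
  let ?c = "\<lambda>a. g (butlast (wchain n w) @ ?p # a # tri_top E S T U G # c2)"
  let ?e = "of_int (- (\<epsilon> * e)) :: 'k"
  have one: "?c (mrg k (blk X) (blk Y) ?p) - scale ?e (h (F (ttree E k (X, Y, Z)))) \<in> V"
    if k: "k \<in> kset E" and X: "(X, Y, Z) \<in> cyc S T U" for k X Y Z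
  proof -
    have "\<exists>w'. real n w' (- (\<epsilon> * e)) (F (ttree E k (X, Y, Z))) \<and>
      wchain n w' = butlast (wchain n w) @ ?p # mrg k (blk X) (blk Y) ?p # merge_chain (tri_top E S T U G) s"
      by (rule tri_chain[OF r k X]) (erule (1) cont)
    then obtain w' where w': "real n w' (- (\<epsilon> * e)) (F (ttree E k (X, Y, Z)))"
      "wchain n w' = butlast (wchain n w) @ ?p # mrg k (blk X) (blk Y) ?p # tri_top E S T U G # c2"
      unfolding c by (elim exE conjE) (rule that)
    have "wpf (F (ttree E k (X, Y, Z))) = st (tri_top E S T U G) s"
      using real_last[OF w'(1)] unfolding w'(2) c by simp
    from gh[OF w'(1) this] show ?thesis unfolding w'(2) .
  qed
  have three: "(?c (mrg k (blk S) (blk T) ?p) + ?c (mrg k (blk T) (blk U) ?p) + ?c (mrg k (blk U) (blk S) ?p)) -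
    scale ?e (h (F (ttree E k (S, T, U))) + h (F (ttree E k (T, U, S))) + h (F (ttree E k (U, S, T)))) \<in> V"
    if k: "k \<in> kset E" for k
    using pm.subspace_add[OF V pm.subspace_add[OF V one[OF k, of S T U] one[OF k, of T U S]] one[OF k, of U S T]]
    by (simp add: pm.scale_right_distrib algebra_simps)
  have "(\<Sum>k\<in>kset E. (?c (mrg k (blk S) (blk T) ?p) + ?c (mrg k (blk T) (blk U) ?p) + ?c (mrg k (blk U) (blk S) ?p)) -
    scale ?e (h (F (ttree E k (S, T, U))) + h (F (ttree E k (T, U, S))) + h (F (ttree E k (U, S, T))))) \<in> V"
    by (rule pm.subspace_sum[OF V three])
  then show ?thesis
    unfolding tri_sum[OF real_mlin[OF r] E] sum_subtractf pm.scale_sum_right[symmetric] .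
qed

lemma mlin_expand: "mlin n (Node c x (Node c' y z) # G) \<longleftrightarrow> mlin n (x # y # z # G)"
  by (simp add: MF_def Un_assoc)

lemma mlin_mset:
  assumes "mset (forest_word G) = mset (forest_word G')"
  shows "mlin n G \<longleftrightarrow> mlin n G'"
  using mset_eq_imp_distinct_iff[OF assms] mset_eq_setD[OF assms] by (simp add: MF_def)

text \<open>The context is taken apart until the three trees lie side by side. The fillings of the
  gap above them, continued by the merges of the context, form one generator of \<open>Zs\<close>
  whose terms are, up to a common sign, those of the relator.\<close>

lemma betM_tri:
  assumes F: "F \<in> fctx" and E: "E \<le> 2"
  shows "(\<Sum>k\<in>kset E. betM n r (jac (colw (E - k)) (colw k) F S T U)) \<in> (Zall n r :: (_ \<Rightarrow>\<^sub>0 'k::field) set)"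
proof -
  let ?t = "Node Blue S (Node Blue T U)"
  have ms: "mset (leaf_word (ttree E k x)) = mset (leaf_word ?t)" if "x \<in> cyc S T U" for k x
    using that by (auto simp: ttree_def)
  have MFk: "F (ttree E k x) \<in> MF {1..n} r \<longleftrightarrow> F ?t \<in> MF {1..n} r" if "x \<in> cyc S T U" for k x
    by (rule MF_fctx[OF F ms[OF that]])
  show ?thesis
  proof (cases "F ?t \<in> MF {1..n} r")
    case False
    then show ?thesis
      using MFk by (simp add: jac_ttree lin_add betM_sng pm.subspace_0)
  next
    case True
    obtain G0 s \<epsilon> where D: "\<And>t'. mset (forest_word (t' # G0)) = mset (forest_word (F t'))"
      "\<And>w \<eta> t'. lv t' = lv ?t \<Longrightarrow> real n w \<eta> (t' # G0) \<Longrightarrow> real n (w @ s) (\<epsilon> * \<eta>) (F t')"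
      using decomposition[OF F, where n=n and t="?t"] by blast
    have "mlin n (?t # G0)" using mlin_mset[OF D(1)[of ?t]] MF_mlin[OF True] by blast
    then have m: "mlin n (S # T # U # G0)" using mlin_expand by blast
    define w e where "w = po (S # T # U # G0)" and "e = gsgn (S # T # U # G0)"
    have r0: "real n w e (S # T # U # G0)" unfolding w_def e_def by (rule real_postorder[OF m])
    have cont: "real n (w @ s) (\<epsilon> * \<eta>) (F t')" if "lv t' = lv S \<union> lv T \<union> lv U" "real n w \<eta> (t' # G0)" for w \<eta> t'
      using D(2)[OF _ that(2)] that(1) by (simp add: Un_assoc)
    obtain c2 where c2: "merge_chain (tri_top E S T U G0) s = tri_top E S T U G0 # c2" by (cases s) auto
    let ?y = "st (tri_top E S T U G0) s"
    \<comment> \<open>One admissible filling supplies the saturated chain out of which the gap is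
      cut.\<close>
    define k0 where "k0 = (if E = 2 then 1 else 0 :: nat)"
    have k0: "k0 \<in> kset E" using E by (auto simp: k0_def kset_def)
    have "\<exists>w'. real n w' (- (\<epsilon> * e)) (F (ttree E k0 (S, T, U))) \<and>
      wchain n w' = butlast (wchain n w) @ wpf (S # T # U # G0) # mrg k0 (blk S) (blk T) (wpf (S # T # U # G0))
        # merge_chain (tri_top E S T U G0) s"
      by (rule tri_chain[OF r0 k0 insertI1]) (erule (1) cont)
    then obtain w' where w': "real n w' (- (\<epsilon> * e)) (F (ttree E k0 (S, T, U)))"
      "wchain n w' = butlast (wchain n w) @ wpf (S # T # U # G0) # mrg k0 (blk S) (blk T) (wpf (S # T # U # G0))
        # tri_top E S T U G0 # c2"
      unfolding c2 by (elim exE conjE) (rule that)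
    have y: "wpf (F (ttree E k0 (S, T, U))) = ?y" using real_last[OF w'(1)] unfolding w'(2) c2 by simp
    have "gapped n ?y (butlast (wchain n w)) (wpf (S # T # U # G0)) (tri_top E S T U G0) c2"
      using real_fchains[OF w'(1)] unfolding w'(2) y by (rule fchains_gapped)
    from Zs_gen[OF this] have gen: "(\<Sum>a\<in>wint n (wpf (S # T # U # G0)) (tri_top E S T U G0).
      sng (butlast (wchain n w) @ wpf (S # T # U # G0) # a # tri_top E S T U G0 # c2)) \<in> (Zs n ?y :: (_ \<Rightarrow>\<^sub>0 'k) set)" .
    have gh: "sng (wchain n w') - scale (of_int \<eta>) (bet n (F X)) \<in> (Zs n ?y :: (_ \<Rightarrow>\<^sub>0 'k) set)"
      if re: "real n w' \<eta> (F X)" and y': "wpf (F X) = ?y" for w' \<eta> X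
      using real_class[OF re, where ?'k = 'k] unfolding y' .
    have "(\<Sum>a\<in>wint n (wpf (S # T # U # G0)) (tri_top E S T U G0).
        sng (butlast (wchain n w) @ wpf (S # T # U # G0) # a # tri_top E S T U G0 # c2)) -
      scale (of_int (- (\<epsilon> * e))) (\<Sum>k\<in>kset E. bet n (F (ttree E k (S, T, U))) + bet n (F (ttree E k (T, U, S))) + bet n (F (ttree E k (U, S, T))))
      \<in> (Zs n ?y :: (_ \<Rightarrow>\<^sub>0 'k) set)"
      by (rule tri_congruence[OF r0 E subspace_Zs _ _ c2]) (erule (1) cont, erule (1) gh)
    from pm.subspace_diff[OF subspace_Zs gen this]
    have "scale (of_int (- (\<epsilon> * e))) (\<Sum>k\<in>kset E. bet n (F (ttree E k (S, T, U))) + bet n (F (ttree E k (T, U, S))) + bet n (F (ttree E k (U, S, T))))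
      \<in> (Zs n ?y :: (_ \<Rightarrow>\<^sub>0 'k) set)" by simp
    from pm.subspace_scale[OF subspace_Zs this, of "of_int (- (\<epsilon> * e))"]
    have "(\<Sum>k\<in>kset E. bet n (F (ttree E k (S, T, U))) + bet n (F (ttree E k (T, U, S))) + bet n (F (ttree E k (U, S, T))))
      \<in> (Zs n ?y :: (_ \<Rightarrow>\<^sub>0 'k) set)"
      using unit_square[OF real_unit[OF w'(1)], where ?'k = 'k] by simp
    moreover have "Zs n ?y \<subseteq> (Zall n r :: (_ \<Rightarrow>\<^sub>0 'k) set)"
    proof (rule Zs_Zall)
      have "mlin n (F (ttree E k0 (S, T, U)))" "length (F (ttree E k0 (S, T, U))) = r"
        using MFk[of "(S, T, U)" k0] True MF_mlin by blast+
      then show "?y \<in> wpartitions n" "card ?y = r" using wpf_in card_wpf y by metis+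
    qed
    ultimately show ?thesis using MFk True by (auto simp: jac_ttree lin_add betM_sng)
  qed
qed

text \<open>Merging two blocks forgets their order, so both trees are realised by the same chain,
  with opposite signs.\<close>

lemma betM_antisym:
  assumes F: "F \<in> fctx"
  shows "betM n r (sng (F (Node c S T)) + sng (F (Node c T S))) \<in> (Zall n r :: (_ \<Rightarrow>\<^sub>0 'k::field) set)"
proof -
  let ?t = "Node c S T" and ?t' = "Node c T S"
  have MFk: "F ?t' \<in> MF {1..n} r \<longleftrightarrow> F ?t \<in> MF {1..n} r"
    by (rule MF_fctx[OF F]) (simp add: union_ac)
  show ?thesis
  proof (cases "F ?t \<in> MF {1..n} r")
    case False
    then show ?thesis using MFk by (simp add: lin_add betM_sng pm.subspace_0)
  next
    case True
    obtain G0 s \<epsilon> where D: "\<And>t'. mset (forest_word (t' # G0)) = mset (forest_word (F t'))"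
      "\<And>w \<eta> t'. lv t' = lv ?t \<Longrightarrow> real n w \<eta> (t' # G0) \<Longrightarrow> real n (w @ s) (\<epsilon> * \<eta>) (F t')"
      using decomposition[OF F, where n=n and t="?t"] by blast
    have "mlin n (?t # G0)" using mlin_mset[OF D(1)[of ?t]] MF_mlin[OF True] by blast
    then have m: "mlin n (S # T # G0)" using mlin_Node by blast
    define w e where "w = po (S # T # G0)" and "e = gsgn (S # T # G0)"
    have r0: "real n w e (S # T # G0)" unfolding w_def e_def by (rule real_postorder[OF m])
    have r0': "real n w (- e) (T # S # G0)" using real_swap[of n w e "[]" S T G0] r0 by simp
    have r1: "real n ((w @ [(c, lv S, lv T)]) @ s) (\<epsilon> * e) (F ?t)" by (rule D(2)[OF refl real_step[OF r0]])
    have r2: "real n ((w @ [(c, lv T, lv S)]) @ s) (\<epsilon> * - e) (F ?t')" by (rule D(2)[OF _ real_step[OF r0']]) auto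
    have "wpf (?t # G0) = wpf (?t' # G0)" by (auto simp: wpf_def Un_commute add.commute)
    moreover have "do_step (c, lv T, lv S) (wpf (S # T # G0)) = wpf (?t' # G0)"
      using do_step_wpf[OF real_mlin[OF r0'], of c] wpf_cong[of "S # T # G0" "T # S # G0"] by (simp add: insert_commute)
    ultimately have ch: "wchain n ((w @ [(c, lv S, lv T)]) @ s) = wchain n ((w @ [(c, lv T, lv S)]) @ s)"
      using do_step_wpf[OF m, of c] by (simp add: merge_chain_append real_last[OF r0])
    have y: "wpf (F ?t) = wpf (F ?t')" using real_last[OF r1] real_last[OF r2] ch by simp
    have "bet n (F ?t) + bet n (F ?t') \<in> (Zs n (wpf (F ?t)) :: (_ \<Rightarrow>\<^sub>0 'k) set)"
      using pm.subspace_add[OF subspace_Zs real_bet[OF r1] real_bet[OF r2, folded y]] ch by (simp add: single_uminus)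
    moreover have "Zs n (wpf (F ?t)) \<subseteq> (Zall n r :: (_ \<Rightarrow>\<^sub>0 'k) set)"
      using MF_mlin[OF True] wpf_in card_wpf by (intro Zs_Zall) metis+
    ultimately show ?thesis using MFk True by (auto simp: lin_add betM_sng)
  qed
qed

lemma betM_swap:
  "betM n r (sng (G1 @ S # T # G2) + sng (G1 @ T # S # G2)) \<in> (Zall n r :: (_ \<Rightarrow>\<^sub>0 'k::field) set)"
proof (cases "G1 @ S # T # G2 \<in> MF {1..n} r")
  case True
  note m = MF_mlin[OF True]
  have "Zs n (wpf (G1 @ S # T # G2)) \<subseteq> (Zall n r :: (_ \<Rightarrow>\<^sub>0 'k) set)"
    using m wpf_in card_wpf by (intro Zs_Zall) metis+
  then show ?thesis using bet_swap[where n=n and ?G1.0=G1 and S=S and T=T and ?G2.0=G2] m True MF_swap[of G1 S T G2 "{1..n}" r]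
    by (auto simp: lin_add betM_sng)
next
  case False
  then show ?thesis using MF_swap[of G1 S T G2 "{1..n}" r] by (simp add: lin_add betM_sng pm.subspace_0)
qed

theorem betM_relspace:
  assumes "f \<in> relspace {1..n} r"
  shows "betM n r f \<in> (Zall n r :: (_ \<Rightarrow>\<^sub>0 'k::field) set)"
proof (rule lin_span_subset[OF lin_betM subspace_Zall _ assms[unfolded relspace_def]])
  fix g :: "nat btree list \<Rightarrow>\<^sub>0 'k" assume "g \<in> relgens {1..n} r"
  then consider (non) G where "g = sng G" "G \<notin> MF {1..n} r"
    | (swap) G1 S T G2 where "g = sng (G1 @ S # T # G2) + sng (G1 @ T # S # G2)"
    | (anti) F c S T where "g = sng (F (Node c S T)) + sng (F (Node c T S))" "F \<in> fctx"
    | (jac) F c x y z where "g = jac c c F x y z" "F \<in> fctx"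
    | (mix) F x y z where "g = jac Blue Red F x y z + jac Red Blue F x y z" "F \<in> fctx"
    unfolding relgens_def by blast
  then show "betM n r g \<in> Zall n r"
  proof cases
    case non
    then show ?thesis by (simp add: betM_sng pm.subspace_0)
  next
    case swap
    show ?thesis unfolding swap by (rule betM_swap)
  next
    case anti
    show ?thesis unfolding anti(1) by (rule betM_antisym[OF anti(2)])
  next
    case jac
    show ?thesis
    proof (cases c)
      case Blue
      then show ?thesis using betM_tri[OF jac(2), of 0 n r x y z] jac(1) by (simp add: kset_simps colw_def)
    next
      case Red
      then show ?thesis using betM_tri[OF jac(2), of 2 n r x y z] jac(1) by (simp add: kset_simps colw_def)
    qed
  next
    case mix
    then show ?thesis using betM_tri[OF mix(2), of 1 n r x y z]
      by (simp add: kset_simps colw_def lin_add add.commute)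
  qed
qed

section \<open>From chains back to forests\<close>

text \<open>An arbitrary realisation is chosen; by \<open>real_congruent\<close> two choices differ
  by an element of \<open>relspace\<close>.\<close>

definition psi :: "nat \<Rightarrow> wpartition list \<Rightarrow> (nat btree list \<Rightarrow>\<^sub>0 'k::field)" where
  "psi n c = (SOME v. \<exists>w e G. real n w e G \<and> wchain n w = c \<and> v = scale (of_int e) (sng G))"

lemma psi_real:
  assumes "real n w e G"
  shows "psi n (wchain n w) - scale (of_int e) (sng G) \<in> (relspace X r :: (_ \<Rightarrow>\<^sub>0 'k::field) set)"
proof -
  have "\<exists>w' e' G'. real n w' e' G' \<and> wchain n w' = wchain n w \<and>
    (psi n (wchain n w) :: _ \<Rightarrow>\<^sub>0 'k) = scale (of_int e') (sng G')"
    unfolding psi_def by (rule someI_ex) (use assms in blast)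
  then obtain w' e' G' where "real n w' e' G'" "wchain n w' = wchain n w"
    and eq: "(psi n (wchain n w) :: _ \<Rightarrow>\<^sub>0 'k) = scale (of_int e') (sng G')" by blast
  from real_congruent[OF this(1) assms this(2)] show ?thesis unfolding eq .
qed

lemma jac_relspace:
  assumes F: "F \<in> fctx" and E: "E \<le> 2"
  shows "(\<Sum>k\<in>kset E. sng (F (ttree E k (S, T, U))) + sng (F (ttree E k (T, U, S))) + sng (F (ttree E k (U, S, T))))
    \<in> (relspace X r :: (_ \<Rightarrow>\<^sub>0 'k::field) set)"
proof -
  have "(\<Sum>k\<in>kset E. jac (colw (E - k)) (colw k) F S T U) \<in> (relspace X r :: (_ \<Rightarrow>\<^sub>0 'k) set)"
  proof -
    consider "E = 0" | "E = 1" | "E = 2" using E by linarith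
    then show ?thesis
      using relspace_jacobi[OF F, of Blue S T U X r] relspace_jacobi[OF F, of Red S T U X r]
        relspace_mixed[OF F, of S T U X r]
      by cases (simp_all add: kset_simps colw_def add.commute)
  qed
  then show ?thesis by (simp only: jac_ttree)
qed

lemma real_pick2:
  assumes r: "real n w e G" and XY: "X \<in> set G" "Y \<in> set G" "X \<noteq> Y"
  obtains e' G' where "real n w e' (X # Y # G')" "set G = insert X (insert Y (set G'))"
proof -
  obtain e1 G1 where 1: "real n w e1 (X # G1)" "set G = insert X (set G1)"
    using real_pick[OF r XY(1)] by metis
  then have "Y \<in> set G1" using XY by auto
  then obtain H1 H2 where H: "G1 = H1 @ Y # H2" by (meson split_list)
  have "real n w ((-1) ^ length (X # H1) * e1) (Y # (X # H1) @ H2)"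
    using real_front[of n w e1 "X # H1" Y H2] 1 H by simp
  from real_swap[of n w _ "[]" Y X "H1 @ H2", unfolded append_Nil, OF this[unfolded append_Cons]]
  have "real n w (- ((-1) ^ length (X # H1) * e1)) (X # Y # H1 @ H2)" .
  then show ?thesis using that[of _ "H1 @ H2"] 1(2) H by (simp add: insert_commute)
qed

lemma real_pick3:
  assumes r: "real n w e (X # Y # G)" and V: "V \<in> set G"
  obtains e' G' where "real n w e' (X # Y # V # G')" "set G = insert V (set G')"
proof -
  obtain H1 H2 where H: "G = H1 @ V # H2" using V by (meson split_list)
  have "real n w e (X # (Y # H1) @ V # H2)" using r H by simp
  then have "real n w e ((X # Y # H1) @ V # H2)" by simp
  then obtain e1 where "real n w e1 (V # (X # Y # H1) @ H2)" using real_front by blast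
  then have "real n w (- e1) ([] @ X # V # Y # H1 @ H2)" using real_swap[of n w e1 "[]"] by simp
  then have "real n w e1 ([X] @ Y # V # H1 @ H2)" using real_swap[of n w "- e1" "[X]" V Y "H1 @ H2"] by simp
  then show ?thesis using that[of e1 "H1 @ H2"] H by auto
qed

text \<open>\<open>continuation\<close> starts from a context with a hole, and the leaf 1 is taken
  as the hole; it exists because \<open>n \<ge> 1\<close>.\<close>

lemma realise_chain:
  assumes n: "n \<ge> 1" and c: "c \<in> fchains n y"
  obtains w e G where "real n w e G" "wchain n w = c" "wpf G = y"
proof -
  let ?F = "\<lambda>t. [] @ t # map Leaf [2..<Suc n]"
  have F0: "?F (Leaf 1) = map Leaf [1..<Suc n]" using n by (simp add: upt_conv_Cons numeral_2_eq_2 del: upt_Suc)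
  have r0: "real n [] 1 (?F (Leaf 1))" unfolding F0 by (rule real_init)
  have bot: "wpf (?F (Leaf 1)) = wp_bot n" using real_last[OF r0] by simp
  obtain c' where c': "c = wp_bot n # c'" using c by (cases c) (auto simp: fchains_def)
  have fctx: "?F \<in> fctx" by (rule fctxI[OF tctx_id])
  have "\<exists>s \<epsilon> F'. F' \<in> fctx \<and> (\<epsilon> = 1 \<or> \<epsilon> = -1) \<and> merge_chain (wpf (?F (Leaf 1))) s = wpf (?F (Leaf 1)) # c' \<and>
    (\<forall>w \<eta> t'. lv t' = lv (Leaf 1) \<longrightarrow> real n w \<eta> (?F t') \<longrightarrow> real n (w @ s) (\<epsilon> * \<eta>) (F' t'))"
    by (rule continuation[OF fctx real_mlin[OF r0]], unfold bot)
      (use c in \<open>simp_all add: c' fchains_def card_wp_bot\<close>)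
  then obtain s \<epsilon> F' where s: "merge_chain (wp_bot n) s = c"
    and "\<And>w \<eta> t'. lv t' = lv (Leaf 1) \<Longrightarrow> real n w \<eta> (?F t') \<Longrightarrow> real n (w @ s) (\<epsilon> * \<eta>) (F' t')"
    unfolding bot c' by blast
  from this(2)[OF refl r0] have s2: "real n ([] @ s) (\<epsilon> * 1) (F' (Leaf 1))" .
  have "wpf (F' (Leaf 1)) = y" using real_last[OF s2] s c by (simp add: fchains_def)
  then show ?thesis using that[OF s2] s by simp
qed

text \<open>The chain above the gap is turned into merges that act on one context \<open>F'\<close>;
  the fillings then become the terms of a Jacobi or mixed Jacobi relator inside
  \<open>F'\<close>.\<close>

lemma psi_gap_triple:
  assumes r: "real n w e (S # T # U # G)" and E: "E \<le> 2"
    and t: "lv t = lv S \<union> lv T \<union> lv U" "reds t = reds S + reds T + reds U + E" "mlin n (t # G)"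
    and q: "q = tri_top E S T U G"
    and c2: "sorted_wrt wlt (q # c2)" "set c2 \<subseteq> wpartitions n" "card (last (q # c2)) + length c2 = card q"
  shows "(\<Sum>a\<in>wint n (wpf (S # T # U # G)) q. psi n (butlast (wchain n w) @ wpf (S # T # U # G) # a # q # c2))
    \<in> (relspace X k :: (_ \<Rightarrow>\<^sub>0 'k::field) set)"
proof -
  let ?F = "\<lambda>t. [] @ t # G" and ?N = "relspace X k :: (_ \<Rightarrow>\<^sub>0 'k) set"
  have wq: "wpf (?F t) = q" using t(1,2) by (simp add: q tri_top_def wpf_def)
  have "\<exists>s \<epsilon> F'. F' \<in> fctx \<and> (\<epsilon> = 1 \<or> \<epsilon> = -1) \<and> merge_chain (wpf (?F t)) s = wpf (?F t) # c2 \<and>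
    (\<forall>w \<eta> t'. lv t' = lv t \<longrightarrow> real n w \<eta> (?F t') \<longrightarrow> real n (w @ s) (\<epsilon> * \<eta>) (F' t'))"
    by (rule continuation[OF fctxI[OF tctx_id]]) (use t(3) c2 wq in simp_all)
  then obtain s \<epsilon> F' where s: "F' \<in> fctx" "merge_chain q s = q # c2"
    "\<And>w \<eta> t'. lv t' = lv t \<Longrightarrow> real n w \<eta> (t' # G) \<Longrightarrow> real n (w @ s) (\<epsilon> * \<eta>) (F' t')"
    unfolding wq by auto
  have "(\<Sum>a\<in>wint n (wpf (S # T # U # G)) q. psi n (butlast (wchain n w) @ wpf (S # T # U # G) # a # q # c2)) -
    scale (of_int (- (\<epsilon> * e))) (\<Sum>k\<in>kset E. sng (F' (ttree E k (S, T, U))) + sng (F' (ttree E k (T, U, S))) + sng (F' (ttree E k (U, S, T))))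
    \<in> ?N"
    unfolding q
    by (rule tri_congruence[OF r E subspace_relspace _ _ s(2)[unfolded q]])
      (use s(3) t(1) psi_real in \<open>simp_all\<close>)
  moreover have "scale (of_int (- (\<epsilon> * e))) (\<Sum>k\<in>kset E. sng (F' (ttree E k (S, T, U))) + sng (F' (ttree E k (T, U, S))) + sng (F' (ttree E k (U, S, T))))
    \<in> ?N"
    by (rule pm.subspace_scale[OF subspace_relspace jac_relspace[OF s(1) E]])
  ultimately show ?thesis using pm.subspace_add[OF subspace_relspace] by fastforce
qed

text \<open>Both orders of two independent merges build the same forest, but the second leaves the
  two new trees in exchanged order, so the contributions cancel.\<close>

lemma psi_gap_disjoint:
  assumes r: "real n w e (S # T # U # V # G)"
    and q: "q = wpf (Node d U V # Node c S T # G)"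
    and c2: "sorted_wrt wlt (q # c2)" "set c2 \<subseteq> wpartitions n" "card (last (q # c2)) + length c2 = card q"
  shows "(\<Sum>a\<in>wint n (wpf (S # T # U # V # G)) q. psi n (butlast (wchain n w) @ wpf (S # T # U # V # G) # a # q # c2))
    \<in> (relspace X k :: (_ \<Rightarrow>\<^sub>0 'k::field) set)"
proof -
  let ?N = "relspace X k :: (_ \<Rightarrow>\<^sub>0 'k) set" and ?p = "wpf (S # T # U # V # G)"
  let ?A = "Node c S T" and ?B = "Node d U V"
  let ?x = "(c, lv S, lv T)" and ?y = "(d, lv U, lv V)"
  note m = real_mlin[OF r]
  have r1: "real n (w @ [?x]) e (U # V # ?A # G)"
    using real_front2[of n "w @ [?x]" e "[?A]" U V G] real_step[OF r, of c] by simp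
  have r2: "real n ((w @ [?x]) @ [?y]) e (?B # ?A # G)" by (rule real_step[OF r1])
  have r3: "real n w e (U # V # S # T # G)" using real_front2[of n w e "[S, T]" U V G] r by simp
  have r4: "real n (w @ [?y]) e (S # T # ?B # G)"
    using real_front2[of n "w @ [?y]" e "[?B]" S T G] real_step[OF r3, of d] by simp
  have r5: "real n ((w @ [?y]) @ [?x]) (- e) (?B # ?A # G)"
    using real_swap[of n _ e "[]" ?A ?B G] real_step[OF r4, of c] by simp
  let ?F = "\<lambda>t. [] @ t # ?A # G"
  have wq: "wpf (?F ?B) = q" by (simp add: q)
  have "\<exists>s \<epsilon> F'. F' \<in> fctx \<and> (\<epsilon> = 1 \<or> \<epsilon> = -1) \<and> merge_chain (wpf (?F ?B)) s = wpf (?F ?B) # c2 \<and>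
    (\<forall>w \<eta> t'. lv t' = lv ?B \<longrightarrow> real n w \<eta> (?F t') \<longrightarrow> real n (w @ s) (\<epsilon> * \<eta>) (F' t'))"
    by (rule continuation[OF fctxI[OF tctx_id]]) (use real_mlin[OF r2] c2 wq in simp_all)
  then obtain s \<epsilon> F' where s: "merge_chain q s = q # c2"
    "\<And>w \<eta> t'. lv t' = lv ?B \<Longrightarrow> real n w \<eta> (t' # ?A # G) \<Longrightarrow> real n (w @ s) (\<epsilon> * \<eta>) (F' t')"
    unfolding wq by auto
  have p3: "wpf (U # V # S # T # G) = ?p" by (rule wpf_cong) auto
  have a1: "do_step ?x ?p = wpf (U # V # ?A # G)" "mrg (col_weight c) (blk S) (blk T) ?p = wpf (U # V # ?A # G)"
    using do_step_wpf[OF m, of c] wpf_mrg(4)[OF m, of c] wpf_cong[of "?A # U # V # G" "U # V # ?A # G"]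
    by (auto simp: insert_commute)
  have a2: "do_step ?y ?p = wpf (S # T # ?B # G)" "mrg (col_weight d) (blk U) (blk V) ?p = wpf (S # T # ?B # G)"
    using do_step_wpf[OF real_mlin[OF r3], of d] wpf_mrg(4)[OF real_mlin[OF r3], of d]
      wpf_cong[of "?B # S # T # G" "S # T # ?B # G"] unfolding p3
    by (auto simp: insert_commute)
  have q1: "do_step ?y (wpf (U # V # ?A # G)) = q" using do_step_wpf[OF real_mlin[OF r1], of d] by (simp add: q)
  have q2: "do_step ?x (wpf (S # T # ?B # G)) = q"
    using do_step_wpf[OF real_mlin[OF r4], of c] wpf_cong[of "?A # ?B # G" "?B # ?A # G"] by (simp add: q insert_commute)
  let ?ch = "\<lambda>a. butlast (wchain n w) @ ?p # a # q # c2"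
  have c1: "wchain n (((w @ [?x]) @ [?y]) @ s) = ?ch (wpf (U # V # ?A # G))"
    using a1 q1 s(1) by (simp add: merge_chain_append real_last[OF r] butlast_append)
  have c2': "wchain n (((w @ [?y]) @ [?x]) @ s) = ?ch (wpf (S # T # ?B # G))"
    using a2 q2 s(1) by (simp add: merge_chain_append real_last[OF r] butlast_append)
  have "psi n (?ch (wpf (U # V # ?A # G))) - scale (of_int (\<epsilon> * e)) (sng (F' ?B)) \<in> ?N"
    using psi_real[OF s(2)[OF refl r2]] unfolding c1 .
  moreover have "psi n (?ch (wpf (S # T # ?B # G))) - scale (of_int (\<epsilon> * - e)) (sng (F' ?B)) \<in> ?N"
    using psi_real[OF s(2)[OF refl r5]] unfolding c2' .
  ultimately have sum: "psi n (?ch (wpf (U # V # ?A # G))) + psi n (?ch (wpf (S # T # ?B # G))) \<in> ?N"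
    using pm.subspace_add[OF subspace_relspace] by (fastforce simp: single_uminus)
  have pin: "?p \<in> wpartitions n" by (rule wpf_in[OF m])
  have ins: "blk S \<in> ?p" "blk T \<in> ?p" "blk U \<in> ?p" "blk V \<in> ?p" by (simp_all add: wpf_def)
  have d: "distinct [blk S, blk T, blk U, blk V]"
  proof -
    have ne: "blk X \<noteq> blk Y" if "X \<in> {S, T, U, V}" "Y \<in> {S, T, U, V}" "X \<noteq> Y" for X Y
    proof
      assume "blk X = blk Y"
      with blk_inj[OF m, of X Y] that show False by auto
    qed
    show ?thesis
      by (rule distinct4I; rule ne) (use mlin_distinct[OF m] in auto)
  qed
  have qm: "mrg (col_weight d) (blk U) (blk V) (wpf (U # V # ?A # G)) = q"
    using wpf_mrg(4)[OF real_mlin[OF r1], of d] by (simp add: q)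
  note R = rank2_disjoint[OF pin ins d, where u = "col_weight c" and v = "col_weight d", OF col_weight_le col_weight_le,
      unfolded a1(2) a2(2) qm]
  show ?thesis unfolding wint_def R(1) using R(3) sum by simp
qed

text \<open>One filling exhibits a first merged pair. The second merge then either involves the new
  block or two other blocks, and these are the two types of gap.\<close>

lemma psi_gap:
  assumes n: "n \<ge> 1" and gap: "gapped n y c1 p q c2"
  shows "(\<Sum>a\<in>wint n p q. psi n (c1 @ p # a # q # c2)) \<in> (relspace X k :: (_ \<Rightarrow>\<^sub>0 'k::field) set)"
proof (cases "wint n p q = {}")
  case True
  then show ?thesis by (simp add: pm.subspace_0)
next
  case False
  then obtain a where a: "a \<in> wpartitions n" "wlt p a" "wlt a q" by (auto simp: wint_def)
  have so: "sorted_wrt wlt (c1 @ [p])" "sorted_wrt wlt (q # c2)" and W: "set (c1 @ [p]) \<subseteq> wpartitions n" "set (q # c2) \<subseteq> wpartitions n"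
    and hd: "hd (c1 @ [p]) = wp_bot n" and last: "last (q # c2) = y" and len: "length c1 + 2 + length c2 + card y = n"
    using gap by (auto simp: gapped_def sorted_wrt_append)
  have pin: "p \<in> wpartitions n" and qin: "q \<in> wpartitions n" using W by auto
  obtain c0 where c0: "c1 @ [p] = wp_bot n # c0" using hd by (cases "c1 @ [p]") auto
  have lc: "length c0 = length c1" using arg_cong[OF c0, of length] by simp
  have lp: "last (wp_bot n # c0) = p" using arg_cong[OF c0, of last] by simp
  have "card p + length c1 \<le> n"
    using chain_card[of "wp_bot n" c0 n] so(1) W(1) lp lc unfolding c0 card_wp_bot by simp
  moreover have "card y + length c2 \<le> card q" using chain_card[OF so(2) W(2)] last by simp
  moreover have "card q < card a" "card a < card p" using wlt_card pin qin a by blast+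
  \<comment> \<open>The chain is one element short of maximal, and the filler \<open>a\<close> shows
    that the missing rank lies between \<open>p\<close> and \<open>q\<close>; all inequalities
    become equalities.\<close>
  ultimately have tight: "card p + length c1 = n" "card y + length c2 = card q" "card p = card a + 1" "card a = card q + 1"
    using len by linarith+
  have "c1 @ [p] \<in> fchains n p" using so(1) W(1) hd tight(1) by (simp add: fchains_def)
  then obtain w e G where r: "real n w e G" "wchain n w = c1 @ [p]" "wpf G = p"
    using realise_chain[OF n] by blast
  have c1: "c1 = butlast (wchain n w)" by (simp add: r(2))
  have cc: "sorted_wrt wlt (q # c2)" "set c2 \<subseteq> wpartitions n" "card (last (q # c2)) + length c2 = card q"
    using so(2) W(2) tight(2) last by auto
  obtain x z u where x: "x \<in> p" "z \<in> p" "x \<noteq> z" "u \<le> 1" "a = mrg u x z p"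
    using wlt_cover[OF pin a(1,2) tight(3)[unfolded Suc_eq_plus1[symmetric]]] by blast
  obtain S T where ST: "S \<in> set G" "T \<in> set G" "x = blk S" "z = blk T"
    using x(1,2) unfolding r(3)[symmetric] wpf_def by blast
  obtain e1 G1 where r1: "real n w e1 (S # T # G1)" "set G = insert S (insert T (set G1))"
    using real_pick2[OF r(1) ST(1,2)] ST(3,4) x(3) by metis
  have p1: "wpf (S # T # G1) = p" using wpf_cong[of G "S # T # G1"] r1(2) r(3) by simp
  have m1: "mlin n (S # T # G1)" by (rule real_mlin[OF r1(1)])
  define c where "c = colw u"
  have cu: "col_weight c = u" using x(4) by (simp add: c_def col_weight_colw)
  let ?A = "Node c S T"
  have aw: "a = wpf (?A # G1)" using wpf_mrg(4)[OF m1, of c] x(5) ST cu p1 by simp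
  have mA: "mlin n (?A # G1)" using m1 mlin_Node by blast
  obtain x' z' v where x': "x' \<in> a" "z' \<in> a" "x' \<noteq> z'" "v \<le> 1" "q = mrg v x' z' a"
    using wlt_cover[OF a(1) qin a(3) tight(4)[unfolded Suc_eq_plus1[symmetric]]] by blast
  have dA: "blk ?A \<notin> wpf G1"
  proof
    assume "blk ?A \<in> wpf G1"
    then obtain t where "t \<in> set G1" "lv ?A = lv t" by (auto simp: wpf_def)
    then have "?A = t" using blk_inj[OF mA, of ?A t] by simp
    then show False using mlin_distinct[OF mA] \<open>t \<in> set G1\<close> by simp
  qed
  have triple: ?thesis if U: "U \<in> set G1" and qU: "q = mrg v (blk ?A) (blk U) a" for U
  proof -
    obtain e2 G2 where r2: "real n w e2 (S # T # U # G2)" "set G1 = insert U (set G2)"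
      using real_pick3[OF r1(1) U] by metis
    have p2: "wpf (S # T # U # G2) = p" using wpf_cong[of "S # T # G1" "S # T # U # G2"] r2(2) p1 by simp
    note m2 = real_mlin[OF r2(1)]
    note W2 = wpf_triple[OF m2, unfolded p2]
    let ?t = "Node (colw v) ?A U"
    have q': "q = tri_top (u + v) S T U G2"
      using mrg_twice[OF pin W2(1-4), of v u] unfolding W2(5) tri_top_def
      using qU x(5) ST(3,4) cu by simp
    have mt: "mlin n (?t # G2)" using m2 by (simp add: MF_def Un_assoc)
    show ?thesis unfolding c1 p2[symmetric]
      by (rule psi_gap_triple[OF r2(1), of "u + v" ?t])
        (use x(4) x'(4) cu col_weight_colw[OF x'(4)] mt q' cc in \<open>auto simp: p2\<close>)
  qed
  have disj: ?thesis if UV: "U \<in> set G1" "V \<in> set G1" "U \<noteq> V" and qU: "q = mrg v (blk U) (blk V) a" for U V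
  proof -
    obtain e2 G2 where r2: "real n w e2 (S # T # U # G2)" "set G1 = insert U (set G2)"
      using real_pick3[OF r1(1) UV(1)] by metis
    have "V \<in> set (U # G2)" "V \<in> set G2" using UV r2(2) by auto
    then obtain H1 H2 where H: "G2 = H1 @ V # H2" by (meson split_list)
    obtain e3 where "real n w e3 (V # (S # T # U # H1) @ H2)"
      using real_front[of n w e2 "S # T # U # H1" V H2] r2(1) H by auto
    then have "real n w (- e3) ([S] @ V # T # U # H1 @ H2)" using real_swap[of n w e3 "[]"] by simp
    then have "real n w e3 ([S, T] @ V # U # H1 @ H2)" using real_swap[of n w "- e3" "[S]"] by simp
    then have r3: "real n w (- e3) (S # T # U # V # H1 @ H2)" using real_swap[of n w e3 "[S, T]"] by simp
    let ?G = "H1 @ H2"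
    have sG1: "set G1 = insert U (insert V (set ?G))" using r2(2) H by auto
    have p3: "wpf (S # T # U # V # ?G) = p" using wpf_cong[of "S # T # G1" "S # T # U # V # ?G"] sG1 p1 by simp
    have a3: "wpf (U # V # ?A # ?G) = a" using wpf_cong[of "?A # G1" "U # V # ?A # ?G"] sG1 aw by (simp add: insert_commute)
    have m3: "mlin n (U # V # ?A # ?G)" using real_mlin[OF r3] by (auto simp: MF_def)
    have q': "q = wpf (Node (colw v) U V # ?A # ?G)"
      using wpf_mrg(4)[OF m3, of "colw v"] a3 qU col_weight_colw[OF x'(4)] by simp
    show ?thesis unfolding c1 p3[symmetric]
      by (rule psi_gap_disjoint[OF r3 q' cc])
  qed
  have "x' = blk ?A \<or> (\<exists>U\<in>set G1. x' = blk U)" "z' = blk ?A \<or> (\<exists>U\<in>set G1. z' = blk U)"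
    using x'(1,2) unfolding aw by (auto simp: wpf_def)
  then consider U where "U \<in> set G1" "x' = blk ?A" "z' = blk U" | U where "U \<in> set G1" "z' = blk ?A" "x' = blk U"
    | U V where "U \<in> set G1" "V \<in> set G1" "x' = blk U" "z' = blk V"
    using x'(3) by blast
  then show ?thesis
  proof cases
    case 1
    then show ?thesis using triple[OF 1(1)] x'(5) by blast
  next
    case 2
    then show ?thesis using triple[OF 2(1)] x'(5) mrg_commute[of v x' z' a] by simp
  next
    case 3
    moreover from this have "U \<noteq> V" using x'(3) by auto
    ultimately show ?thesis using disj[OF 3(1,2)] x'(5) by blast
  qed
qed

text \<open>\<open>psi\<close> respects the chain relations by \<open>psi_gap\<close>, and it undoes
  \<open>betM\<close> modulo \<open>relspace\<close> because the sign \<open>gsgn G\<close> occurs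
  twice.\<close>

theorem betM_kernel:
  fixes f :: "nat btree list \<Rightarrow>\<^sub>0 'k::field"
  assumes n: "n \<ge> 1" and f: "Poly_Mapping.keys f \<subseteq> MF {1..n} r"
  shows "betM n r f \<in> Zall n r \<longleftrightarrow> f \<in> relspace {1..n} r"
proof
  let ?N = "relspace {1..n} r :: (nat btree list \<Rightarrow>\<^sub>0 'k) set"
  assume "betM n r f \<in> Zall n r"
  moreover have "Zall n r \<subseteq> {g. lin_ext (psi n) g \<in> ?N}"
    unfolding Zall_def
  proof (rule pm.span_minimal[OF _ subspace_lin_vimage[OF lin_lin_ext subspace_relspace]])
    show "(\<Union>y\<in>{y \<in> wpartitions n. card y = r}. Zs n y) \<subseteq> {g. lin_ext (psi n) g \<in> ?N}"
    proof (rule UN_least)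
      fix y
      show "Zs n y \<subseteq> {g. lin_ext (psi n) g \<in> ?N}"
        unfolding Zs_def
      proof (rule pm.span_minimal[OF _ subspace_lin_vimage[OF lin_lin_ext subspace_relspace]], safe)
        fix c1 p q c2 assume "gapped n y c1 p q c2"
        from psi_gap[OF n this] show "lin_ext (psi n) (\<Sum>a\<in>wint n p q. sng (c1 @ p # a # q # c2)) \<in> ?N"
          by (simp add: lin_sum[OF lin_lin_ext])
      qed
    qed
  qed
  ultimately have 1: "lin_ext (psi n) (betM n r f) \<in> ?N" by blast
  have "lin_ext (psi n) (betM n r f) - f \<in> ?N"
  proof (rule lin_in_subspace[where h = "\<lambda>f. lin_ext (psi n) (betM n r f) - f"])
    show "lin (\<lambda>f. lin_ext (psi n) (betM n r f) - f)"
      by (rule lin_sub[OF lin_comp[OF lin_lin_ext lin_betM] lin_id])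
    fix G assume "G \<in> Poly_Mapping.keys f"
    then have G: "G \<in> MF {1..n} r" using f by auto
    note re = real_postorder[OF conjunct1[OF MF_mlin[OF G]]]
    have "scale (of_int (gsgn G)) (psi n (wchain n (po G)) - scale (of_int (gsgn G)) (sng G)) \<in> ?N"
      by (rule pm.subspace_scale[OF subspace_relspace psi_real[OF re]])
    then show "lin_ext (psi n) (betM n r (sng G)) - sng G \<in> ?N"
      using G unit_square[OF gsgn_unit[of G], where ?'k = 'k]
      by (simp add: betM_sng bet_def pm.scale_right_diff_distrib)
  qed simp
  from pm.subspace_diff[OF subspace_relspace 1 this] show "f \<in> ?N" by simp
qed (rule betM_relspace)

theorem chain_is_bet:
  assumes n: "n \<ge> 1" and c: "c \<in> fchains n y"
  shows "\<exists>G e. G \<in> MF {1..n} (card y) \<and> wpf G = y \<and>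
    sng c - scale (of_int e) (bet n G) \<in> (Zs n y :: (_ \<Rightarrow>\<^sub>0 'k::field) set)"
proof -
  obtain w e G where r: "real n w e G" "wchain n w = c" "wpf G = y" using realise_chain[OF assms] .
  have "G \<in> MF {1..n} (card y)" using real_mlin[OF r(1)] card_wpf[OF real_mlin[OF r(1)]] r(3) by simp
  then show ?thesis using real_class[OF r(1)] r(2,3) by blast
qed

section \<open>Vanishing below the top degree for lexicographically labelled posets\<close>

text \<open>The hypothesis \<open>el\<close> is the edge-lexicographic condition in recursive-atom-ordering form: an
  atom of \<open>[x, y]\<close> that is not the least one stays non-least when \<open>y\<close> is replaced by the least
  atom above it. Every chain can be refined by least atoms to a maximal one; toggling the first
  ascent of that refinement is an acyclic matching on the chains, and only the maximal chains are
  unmatched.\<close>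

locale el_poset =
  fixes P :: "'p set" and leq :: "'p \<Rightarrow> 'p \<Rightarrow> bool" and rk :: "'p \<Rightarrow> nat"
    and lab :: "'p \<Rightarrow> 'p \<Rightarrow> 'l::wellorder" and atoms :: "'p \<Rightarrow> 'p \<Rightarrow> 'p set"
  defines "atoms x y \<equiv> {z \<in> P. rk z = Suc (rk x) \<and> strict leq x z \<and> (z = y \<or> strict leq z y)}"
  assumes finP: "finite P"
    and lt_trans: "\<lbrakk>x \<in> P; y \<in> P; z \<in> P; strict leq x y; strict leq y z\<rbrakk> \<Longrightarrow> strict leq x z"
    and lt_rk: "\<lbrakk>x \<in> P; y \<in> P; strict leq x y\<rbrakk> \<Longrightarrow> rk x < rk y"
    and ex_atom: "\<lbrakk>x \<in> P; y \<in> P; strict leq x y\<rbrakk> \<Longrightarrow> atoms x y \<noteq> {}"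
    and lab_inj: "\<lbrakk>x \<in> P; z \<in> atoms x y; w \<in> atoms x y; lab x z = lab x w\<rbrakk> \<Longrightarrow> z = w"
    and el: "\<lbrakk>x \<in> P; y \<in> P; z \<in> atoms x y; w \<in> atoms x y; lab x w < lab x z; z' \<in> atoms z y;
      \<And>w'. w' \<in> atoms z y \<Longrightarrow> lab z z' \<le> lab z w'\<rbrakk> \<Longrightarrow> \<exists>w\<in>atoms x z'. lab x w < lab x z"
begin

section \<open>Least atoms and greedy refinements\<close>

abbreviation lt (infix "\<prec>" 50) where "x \<prec> y \<equiv> strict leq x y"

definition latom :: "'p \<Rightarrow> 'p \<Rightarrow> 'p" where
  "latom x y = arg_min_on (lab x) (atoms x y)"

lemma finite_atoms: "finite (atoms x y)"
  using finP by (auto simp: atoms_def)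

lemma latom:
  assumes "x \<in> P" "y \<in> P" "x \<prec> y"
  shows "latom x y \<in> atoms x y" "z \<in> atoms x y \<Longrightarrow> lab x (latom x y) \<le> lab x z"
  unfolding latom_def
  using arg_min_if_finite(1)[OF finite_atoms ex_atom[OF assms]]
    arg_min_least[OF finite_atoms ex_atom[OF assms]] by auto

lemma latomD:
  assumes "x \<in> P" "y \<in> P" "x \<prec> y"
  shows "latom x y \<in> P" "rk (latom x y) = Suc (rk x)" "x \<prec> latom x y"
    "latom x y \<noteq> y \<Longrightarrow> latom x y \<prec> y"
  using latom(1)[OF assms] by (auto simp: atoms_def)

lemma atoms_mono: "\<lbrakk>x \<in> P; z \<in> P; y \<in> P; z \<prec> y\<rbrakk> \<Longrightarrow> atoms x z \<subseteq> atoms x y"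
  by (auto simp: atoms_def intro: lt_trans)

lemma latom_eqI:
  assumes "x \<in> P" "z \<in> P" "y \<in> P" "x \<prec> z" "z \<prec> y" "latom x y \<in> atoms x z"
  shows "latom x z = latom x y"
proof -
  have xy: "x \<prec> y" using assms lt_trans by blast
  have "lab x (latom x z) \<le> lab x (latom x y)" using latom(2)[OF assms(1,2,4)] assms(6) .
  moreover have "lab x (latom x y) \<le> lab x (latom x z)"
    using latom(2)[OF assms(1,3) xy] latom(1)[OF assms(1,2,4)] atoms_mono[OF assms(1-3,5)] by blast
  ultimately show ?thesis using lab_inj[OF assms(1) latom(1)[OF assms(1,2,4)] assms(6)] by simp
qed

text \<open>A non-least atom stays non-least in a shorter interval whose next greedy step is the
  same. Hence a position passed over by the matching is still passed over after an insertion further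
  up.\<close>

lemma el_latom:
  assumes "x \<in> P" "y \<in> P" "z \<in> atoms x y" "z \<noteq> latom x y" "w \<in> P" "w = y \<or> w \<prec> y" "z \<prec> w"
    "latom z w = latom z y"
  shows "z \<noteq> latom x w"
proof
  assume eq: "z = latom x w"
  have zP: "z \<in> P" and xz: "x \<prec> z" using assms(3) by (auto simp: atoms_def)
  have zy: "z \<prec> y" using assms lt_trans[OF zP assms(5,2)] by auto
  have xy: "x \<prec> y" using lt_trans[OF assms(1) zP assms(2) xz zy] .
  have xw: "x \<prec> w" using lt_trans[OF assms(1) zP assms(5) xz assms(7)] .
  have "lab x (latom x y) < lab x z"
    using latom(2)[OF assms(1,2) xy assms(3)] lab_inj[OF assms(1) latom(1)[OF assms(1,2) xy] assms(3)] assms(4)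
    by fastforce
  from el[OF assms(1-3) latom(1)[OF assms(1,2) xy] this latom[OF zP assms(2) zy]]
  obtain v where v: "v \<in> atoms x (latom z y)" "lab x v < lab x z" by blast
  have "latom z y \<in> atoms z w" using latom(1)[OF zP assms(5,7)] assms(8) by simp
  then have "atoms x (latom z y) \<subseteq> atoms x w"
    using atoms_mono[OF assms(1) _ assms(5)] by (auto simp: atoms_def)
  then have "lab x z \<le> lab x v" using v latom(2)[OF assms(1,5) xw] eq by blast
  then show False using v by simp
qed

text \<open>Labels of the chain that always takes the least atom. The number counts the remaining
  steps; \<open>gl\<close> sets it to the rank difference.\<close>

primrec glf :: "nat \<Rightarrow> 'p \<Rightarrow> 'p \<Rightarrow> 'l list" where
  "glf 0 x y = []"
| "glf (Suc k) x y = lab x (latom x y) # glf k (latom x y) y"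

definition gl :: "'p \<Rightarrow> 'p \<Rightarrow> 'l list" where
  "gl x y = glf (rk y - rk x) x y"

lemma length_glf [simp]: "length (glf k x y) = k"
  by (induction k arbitrary: x) auto

lemma length_gl [simp]: "length (gl x y) = rk y - rk x"
  by (simp add: gl_def)

lemma gl_same [simp]: "gl x x = []"
  by (simp add: gl_def)

lemma gl_step:
  assumes "x \<in> P" "y \<in> P" "x \<prec> y"
  shows "gl x y = lab x (latom x y) # gl (latom x y) y"
proof -
  have "rk y - rk x = Suc (rk y - rk (latom x y))"
    using lt_rk[OF assms] latomD(2)[OF assms] by simp
  then show ?thesis by (simp add: gl_def)
qed

text \<open>\<open>lex\<close> relates only lists of equal length and so inherits well-foundedness.
  The words compared label saturated chains between the same end points and do have equal
  length.\<close>

abbreviation ll_less :: "('l list \<times> 'l list) set" where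
  "ll_less \<equiv> lex {(a, b). a < b}"

text \<open>At the first place where the greedy chain to \<open>y\<close> differs from the one
  forced through \<open>z\<close>, the forced label is larger; without such a place the greedy chain
  runs through \<open>z\<close> by itself.\<close>

lemma gl_split:
  assumes "x \<in> P" "z \<in> P" "y \<in> P" "x \<prec> z" "z \<prec> y"
  shows "(gl x y, gl x z @ gl z y) \<in> ll_less \<or> gl x y = gl x z @ gl z y \<and> latom x z = latom x y"
  using assms
proof (induction "rk z - rk x" arbitrary: x rule: less_induct)
  case less
  have xy: "x \<prec> y" using less.prems lt_trans by blast
  let ?a = "latom x y" and ?b = "latom x z"
  have b: "?b \<in> atoms x y" using latom(1)[OF less.prems(1,2,4)] atoms_mono[OF less.prems(1-3,5)] by blast
  have rk: "rk z < rk y" "rk x < rk z" using lt_rk less.prems by auto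
  note stepy = gl_step[OF less.prems(1,3) xy] and stepz = gl_step[OF less.prems(1,2,4)]
  have rka: "rk ?a = Suc (rk x)" "rk ?b = Suc (rk x)"
    using latomD(2)[OF less.prems(1,3) xy] latomD(2)[OF less.prems(1,2,4)] by auto
  consider "lab x ?a < lab x ?b" | "lab x ?a = lab x ?b"
    using latom(2)[OF less.prems(1,3) xy b] by fastforce
  then show ?case
  proof cases
    case 1
    then show ?thesis using rk rka by (simp add: stepy stepz)
  next
    case 2
    then have ab: "?b = ?a" using lab_inj[OF less.prems(1) latom(1)[OF less.prems(1,3) xy] b] by simp
    show ?thesis
    proof (cases "?b = z")
      case True
      then show ?thesis using ab by (simp add: stepy stepz)
    next
      case False
      note bD = latomD[OF less.prems(1,2,4)]
      have "(gl ?b y, gl ?b z @ gl z y) \<in> ll_less \<or> gl ?b y = gl ?b z @ gl z y \<and> latom ?b z = latom ?b y"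
        using less.hyps[of ?b] bD(1) bD(4)[OF False] rk rka less.prems by simp
      then show ?thesis using ab by (auto simp: stepy stepz)
    qed
  qed
qed

end

locale el_interval = el_poset +
  fixes top
  assumes top: "top \<in> P"
begin

section \<open>The matching on chains and its triangularity\<close>

abbreviation nxt :: "'a list \<Rightarrow> 'a" where
  "nxt c \<equiv> (case c of [] \<Rightarrow> top | z # _ \<Rightarrow> z)"

primrec ch :: "'a \<Rightarrow> 'a list \<Rightarrow> bool" where
  "ch x [] = (x \<prec> top)"
| "ch x (z # c) = (z \<in> P \<and> x \<prec> z \<and> ch z c)"

text \<open>The label word of the maximal chain obtained by filling each gap greedily. Matched
  chains share this word.\<close>

primrec ll :: "'a \<Rightarrow> 'a list \<Rightarrow> 'b list" where
  "ll x [] = gl x top"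
| "ll x (z # c) = gl x z @ ll z c"

definition ivl :: "'a \<Rightarrow> 'a \<Rightarrow> 'a set" where
  "ivl x z = {a \<in> P. x \<prec> a \<and> a \<prec> z}"

lemma finite_ivl [simp]: "finite (ivl x z)"
  using finP by (auto simp: ivl_def)

text \<open>The coboundary of the open interval from \<open>x\<close> to \<open>top\<close>,
  recursive in the first element so as to be comparable with the recursive matching. Prepending an
  element shifts all insertion positions by one, whence the minus sign.\<close>

primrec d :: "'a \<Rightarrow> 'a list \<Rightarrow> ('a list \<Rightarrow>\<^sub>0 'k::field)" where
  "d x [] = (\<Sum>a\<in>ivl x top. sng [a])"
| "d x (z # c) = (\<Sum>a\<in>ivl x z. sng (a # z # c)) - push ((#) z) (d z c)"

text \<open>The least atom is toggled at the first place that allows it. A missing least atom is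
  inserted; an element that the greedy filling of the gap left by its removal would restore is
  deleted by \<open>upT\<close>. Any other element is kept, and the search moves up.\<close>

primrec lowT :: "'a \<Rightarrow> 'a list \<Rightarrow> 'a list option" where
  "lowT x [] = (if latom x top = top then None else Some [latom x top])"
| "lowT x (z # c) = (if latom x z \<noteq> z then Some (latom x z # z # c)
     else if latom x (nxt c) = z then None else map_option ((#) z) (lowT z c))"

primrec upT :: "'a \<Rightarrow> 'a list \<Rightarrow> 'a list option" where
  "upT x [] = None"
| "upT x (z # c) = (if latom x z \<noteq> z then None
     else if latom x (nxt c) = z then Some c else map_option ((#) z) (upT z c))"

lemma ch_nxt: "x \<in> P \<Longrightarrow> ch x c \<Longrightarrow> x \<prec> nxt c \<and> nxt c \<in> P \<and> x \<prec> top"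
proof (induction c arbitrary: x)
  case (Cons z c)
  then show ?case using lt_trans[of x z top] top by auto
qed (use top in simp)

lemma ch_iff:
  assumes "x \<in> P"
  shows "ch x c \<longleftrightarrow> x \<prec> top \<and> sorted_wrt (strict leq) c \<and> set c \<subseteq> ivl x top"
  using assms
proof (induction c arbitrary: x)
  case (Cons z c)
  show ?case
  proof
    assume *: "ch x (z # c)"
    then have z: "z \<in> P" "x \<prec> z" "ch z c" by auto
    then have **: "z \<prec> top" "sorted_wrt (strict leq) c" "set c \<subseteq> ivl z top"
      using Cons.IH by auto
    moreover have "ivl z top \<subseteq> ivl x top" using z Cons.prems by (auto simp: ivl_def intro: lt_trans)
    ultimately show "x \<prec> top \<and> sorted_wrt (strict leq) (z # c) \<and> set (z # c) \<subseteq> ivl x top"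
      using z lt_trans[OF Cons.prems z(1) top z(2)] by (auto simp: ivl_def)
  next
    assume "x \<prec> top \<and> sorted_wrt (strict leq) (z # c) \<and> set (z # c) \<subseteq> ivl x top"
    then show "ch x (z # c)" using Cons.IH[of z] by (auto simp: ivl_def)
  qed
qed simp

text \<open>Without a partner every step of the chain must be a cover, so the chain has maximal
  length.\<close>

lemma critical_length:
  "x \<in> P \<Longrightarrow> ch x c \<Longrightarrow> lowT x c = None \<Longrightarrow> upT x c = None \<Longrightarrow> rk top = rk x + length c + 1"
proof (induction c arbitrary: x)
  case Nil
  then show ?case using latomD(2)[of x top] top by (auto split: if_splits)
next
  case (Cons z c)
  then have "rk z = Suc (rk x)" using latomD(2)[of x z] by (auto split: if_splits)
  moreover have "rk top = rk z + length c + 1" using Cons by (auto split: if_splits)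
  ultimately show ?case by simp
qed

lemma lookup_push_Cons: "Poly_Mapping.lookup (push ((#) z) f) b =
    (case b of [] \<Rightarrow> 0 | w # b' \<Rightarrow> if w = z then Poly_Mapping.lookup f b' else 0)"
proof -
  let ?h = "\<lambda>f. Poly_Mapping.lookup (push ((#) z) f) b"
  have "?h f = (\<Sum>x\<in>Poly_Mapping.keys f. Poly_Mapping.lookup f x * Poly_Mapping.lookup (sng (z # x)) b)"
    by (simp add: push_def lin_ext_def lookup_sum del: scale_single)
  also have "\<dots> = (\<Sum>x\<in>Poly_Mapping.keys f. if z # x = b then Poly_Mapping.lookup f x else 0)"
    by (intro sum.cong) (auto simp: lookup_single when_def)
  also have "\<dots> = (case b of [] \<Rightarrow> 0 | w # b' \<Rightarrow> if w = z then Poly_Mapping.lookup f b' else 0)"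
    by (cases b) (auto simp: in_keys_iff)
  finally show ?thesis .
qed

lemma lookup_sum_sng: "finite A \<Longrightarrow> inj_on g A \<Longrightarrow>
    Poly_Mapping.lookup (\<Sum>a\<in>A. sng (g a)) b = (if b \<in> g ` A then 1 else 0)"
proof -
  assume A: "finite A" "inj_on g A"
  have "Poly_Mapping.lookup (\<Sum>a\<in>A. sng (g a)) b = (\<Sum>a\<in>A. if g a = b then 1 else 0)"
    by (simp add: lookup_sum lookup_single when_def)
  also have "\<dots> = of_nat (card {a\<in>A. g a = b})" using A by (simp add: sum.If_cases Int_def)
  also have "\<dots> = (if b \<in> g ` A then 1 else 0)"
  proof (cases "b \<in> g ` A")
    case True
    then obtain a where "a \<in> A" "b = g a" by blast
    then have "{a'\<in>A. g a' = b} = {a}" using A by (auto dest: inj_onD)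
    then show ?thesis using True by simp
  next
    case False
    then have "{a\<in>A. g a = b} = {}" by auto
    then show ?thesis using False by (metis card.empty of_nat_0)
  qed
  finally show ?thesis .
qed

lemma lookup_d_Nil: "Poly_Mapping.lookup (d x []) b = (if \<exists>a\<in>ivl x top. b = [a] then 1 else 0)"
  by (simp add: lookup_sum_sng inj_on_def image_iff)

lemma lookup_d_Cons: "Poly_Mapping.lookup (d x (z # c)) b =
    (if \<exists>a\<in>ivl x z. b = a # z # c then 1 else 0) -
    (case b of [] \<Rightarrow> 0 | w # b' \<Rightarrow> if w = z then Poly_Mapping.lookup (d z c) b' else 0)"
  by (simp add: lookup_sum_sng inj_on_def image_iff lookup_minus lookup_push_Cons)

lemma lt_irrefl: "\<not> x \<prec> x"
  by (simp add: strict_def)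

declare d.simps [simp del]

lemma d_cases:
  assumes "Poly_Mapping.lookup (d x c) b \<noteq> (0::'k::field)"
  obtains a where "a \<in> ivl x (nxt c)" "b = a # c"
  | z c' b' where "c = z # c'" "b = z # b'" "Poly_Mapping.lookup (d z c') b' \<noteq> (0::'k)"
proof (cases c)
  case Nil
  then have "\<exists>a\<in>ivl x top. b = [a]" using assms unfolding Nil lookup_d_Nil by presburger
  then show ?thesis using that(1) Nil by auto
next
  case (Cons z c')
  show ?thesis
  proof (cases "\<exists>a\<in>ivl x z. b = a # z # c'")
    case True
    then show ?thesis using that(1) Cons by auto
  next
    case False
    have eq: "Poly_Mapping.lookup (d x (z # c')) b =
      - (case b of [] \<Rightarrow> 0 | w # b' \<Rightarrow> if w = z then Poly_Mapping.lookup (d z c') b' else (0::'k))"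
      unfolding lookup_d_Cons if_not_P[OF False] by (rule diff_0)
    show ?thesis
    proof (cases b)
      case Nil
      then show ?thesis using assms eq unfolding Cons by simp
    next
      case b: (Cons w b')
      then have "w = z \<and> Poly_Mapping.lookup (d z c') b' \<noteq> (0::'k)"
        using assms eq unfolding Cons by (simp split: if_splits)
      then show ?thesis using that(2)[OF Cons, of b'] b by simp
    qed
  qed
qed

text \<open>By \<open>gl_split\<close> an insertion never lowers the label word. If it keeps the
  word, then a chain with an upper partner can produce a chain with a lower partner only as that
  partner. The clauses about \<open>nxt\<close> are carried along for
  \<open>el_latom\<close>.\<close>

lemma d_triangular:
  assumes "x \<in> P" "ch x c" "Poly_Mapping.lookup (d x c) b \<noteq> (0::'k::field)"
  shows "ch x b \<and> length b = Suc (length c) \<and>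
    ((ll x c, ll x b) \<in> ll_less \<or> ll x c = ll x b \<and> latom x (nxt b) = latom x (nxt c) \<and>
      (lowT x c \<noteq> None \<longrightarrow> upT x b \<noteq> None \<longrightarrow> lowT x c = Some b))
    \<and> (nxt b = nxt c \<or> nxt b \<prec> nxt c)"
  using assms
proof (induction c arbitrary: x b)
  case Nil
  from Nil.prems(3) obtain a where a: "a \<in> ivl x top" "b = [a]" by (rule d_cases) auto
  then have "a \<in> P" "x \<prec> a" "a \<prec> top" by (auto simp: ivl_def)
  note aP = this
  have nx: "nxt b = a" "nxt [] = top" "ll x b = gl x a @ gl a top" "ll x [] = gl x top" "ch x b"
    using a aP by simp_all
  have low: "lowT x [] = Some b" if "lowT x [] \<noteq> None" "upT x b \<noteq> None" "latom x a = latom x top"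
    using that a(2) by (simp split: if_splits)
  show ?case
    unfolding nx using gl_split[OF Nil.prems(1) aP(1) top aP(2,3)] aP(3) low nx(5) a(2)
    by (metis length_Cons)
next
  case (Cons z c)
  have z: "z \<in> P" "x \<prec> z" "ch z c" using Cons.prems(2) by auto
  from Cons.prems(3) show ?case
  proof (rule d_cases)
    fix a assume a: "a \<in> ivl x (nxt (z # c))" "b = a # z # c"
    then have aP: "a \<in> P" "x \<prec> a" "a \<prec> z" by (auto simp: ivl_def)
    have "(gl x z, gl x a @ gl a z) \<in> ll_less \<or> gl x z = gl x a @ gl a z \<and> latom x a = latom x z"
      using gl_split[OF Cons.prems(1) aP(1) z(1) aP(2,3)] .
    then show ?thesis
    proof
      assume "(gl x z, gl x a @ gl a z) \<in> ll_less"
      then have "(ll x (z # c), ll x b) \<in> ll_less"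
        using lex_append_rightI[of "gl x z" "gl x a @ gl a z" _ "ll z c" "ll z c"] a by simp
      then show ?thesis using a aP z by simp
    next
      assume *: "gl x z = gl x a @ gl a z \<and> latom x a = latom x z"
      have "z \<noteq> a" using aP lt_irrefl by auto
      then show ?thesis using a aP z * by (auto split: if_splits)
    qed
  next
    fix z' c' b' assume "z # c = z' # c'" "b = z' # b'" "Poly_Mapping.lookup (d z' c') b' \<noteq> (0::'k)"
    then have b: "b = z # b'" "Poly_Mapping.lookup (d z c) b' \<noteq> (0::'k)" by auto
    note IH = Cons.IH[OF z(1,3) b(2)]
    have chb: "ch z b'" using IH by blast
    have "nxt b' = nxt c \<or> nxt b' \<prec> nxt c" using IH by blast
    have nb: "z \<prec> nxt b'" "nxt b' \<in> P" using ch_nxt[OF z(1) chb] by auto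
    have nc: "z \<prec> nxt c" "nxt c \<in> P" using ch_nxt[OF z(1,3)] by auto
    show ?thesis
    proof (cases "(ll z c, ll z b') \<in> ll_less")
      case True
      then have "(ll x (z # c), ll x b) \<in> ll_less"
        using lex_append_leftI[of "ll z c" "ll z b'"] b by simp
      then show ?thesis using b IH z by simp
    next
      case False
      then have eq: "ll z c = ll z b'" "latom z (nxt b') = latom z (nxt c)"
        "lowT z c \<noteq> None \<longrightarrow> upT z b' \<noteq> None \<longrightarrow> lowT z c = Some b'" using IH by auto
      have "lowT x (z # c) = Some b" if l: "lowT x (z # c) \<noteq> None" and u: "upT x b \<noteq> None"
      proof -
        have xz: "latom x z = z" using u b by (auto split: if_splits)
        then have ne: "latom x (nxt c) \<noteq> z" and low: "lowT z c \<noteq> None" using l by (auto split: if_splits)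
        have "z \<in> atoms x (nxt c)" using z nc latomD(2)[OF Cons.prems(1) z(1,2)] xz
          by (simp add: atoms_def)
        \<comment> \<open>The matching passed over \<open>z\<close> in \<open>z # c\<close>; it
          still does so although the element after \<open>z\<close> may have been lowered.\<close>
        then have "z \<noteq> latom x (nxt b')"
          using el_latom[OF Cons.prems(1) nc(2) _ ne[symmetric] nb(2) _ nb(1) eq(2)]
            \<open>nxt b' = nxt c \<or> nxt b' \<prec> nxt c\<close> by blast
        then have "upT z b' \<noteq> None" using u b xz by (auto split: if_splits)
        then show ?thesis using eq(3) low xz ne b by auto
      qed
      then show ?thesis using b IH z eq by simp
    qed
  qed
qed

text \<open>The inserted least atom is the one the greedy refinement contains anyway, so the word is
  kept; the incidence coefficient is 1 or -1 and can be cancelled over any field.\<close>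

lemma lowT:
  assumes "x \<in> P" "ch x c" "lowT x c = Some b"
  shows "ch x b \<and> upT x b = Some c \<and> ll x b = ll x c \<and> length b = Suc (length c) \<and>
    Poly_Mapping.lookup (d x c) b \<in> {1, -1::'k::field} \<and> latom x (nxt b) = latom x (nxt c)"
  using assms
proof (induction c arbitrary: x b)
  case Nil
  let ?a = "latom x top"
  have a: "?a \<in> P" "x \<prec> ?a" "?a \<prec> top" "b = [?a]" "?a \<noteq> top"
    using Nil latomD[of x top] top by (auto split: if_splits)
  have aa: "latom x ?a = ?a"
    using latom_eqI[OF Nil.prems(1) a(1) top a(2,3)] latom(1)[of x top] Nil top a
    by (auto simp: atoms_def)
  have "gl x top = gl x ?a @ gl ?a top"
    using gl_step[of x top] gl_step[of x ?a] aa Nil top a by simp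
  then show ?case using a aa by (auto simp: lookup_d_Nil ivl_def)
next
  case (Cons z c)
  have z: "z \<in> P" "x \<prec> z" "ch z c" using Cons.prems(2) by auto
  let ?a = "latom x z"
  show ?case
  proof (cases "?a = z")
    case False
    have a: "?a \<in> P" "x \<prec> ?a" "?a \<prec> z" "b = ?a # z # c"
      using latomD[OF Cons.prems(1) z(1,2)] False Cons.prems(3) by auto
    have aa: "latom x ?a = ?a"
      using latom_eqI[OF Cons.prems(1) a(1) z(1) a(2,3)] latom(1)[OF Cons.prems(1) z(1,2)] a
      by (auto simp: atoms_def)
    have "gl x z = gl x ?a @ gl ?a z"
      using gl_step[OF Cons.prems(1) z(1,2)] gl_step[OF Cons.prems(1) a(1,2)] aa by simp
    then show ?thesis using a aa z False by (auto simp: lookup_d_Cons ivl_def)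
  next
    case True
    then have ne: "latom x (nxt c) \<noteq> z" and low: "lowT z c \<noteq> None"
      using Cons.prems(3) by (auto split: if_splits)
    then obtain b' where b': "lowT z c = Some b'" "b = z # b'" using Cons.prems(3) True by auto
    note IH = Cons.IH[OF z(1,3) b'(1)]
    have dz: "Poly_Mapping.lookup (d z c) b' \<noteq> (0::'k)" using IH by auto
    note tri = d_triangular[OF z(1,3) dz]
    have nb: "z \<prec> nxt b'" "nxt b' \<in> P" using ch_nxt[OF z(1)] tri by auto
    have nc: "z \<prec> nxt c" "nxt c \<in> P" using ch_nxt[OF z(1,3)] by auto
    have "z \<in> atoms x (nxt c)" using z nc latomD(2)[OF Cons.prems(1) z(1,2)] True
      by (simp add: atoms_def)
    then have "z \<noteq> latom x (nxt b')"
      using el_latom[OF Cons.prems(1) nc(2) _ ne[symmetric] nb(2) _ nb(1)] tri IH by blast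
    moreover have "\<nexists>a. a \<in> ivl x z \<and> b = a # z # c" using b'(2) lt_irrefl by (auto simp: ivl_def)
    ultimately show ?thesis using IH b' True z by (auto simp: lookup_d_Cons)
  qed
qed

lemma upT:
  assumes "x \<in> P" "ch x b" "upT x b = Some c"
  shows "ch x c \<and> lowT x c = Some b"
  using assms
proof (induction b arbitrary: x c)
  case (Cons z b)
  have z: "z \<in> P" "x \<prec> z" "ch z b" using Cons.prems by auto
  have xz: "latom x z = z" using Cons.prems(3) by (auto split: if_splits)
  have nb: "z \<prec> nxt b" "nxt b \<in> P" using ch_nxt[OF z(1,3)] by auto
  show ?case
  proof (cases "latom x (nxt b) = z")
    case True
    have "c = b" using Cons.prems(3) True xz by simp
    moreover have "ch x b" using z Cons.prems(1) lt_trans[OF Cons.prems(1) z(1) nb(2) z(2) nb(1)]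
      by (cases b) auto
    moreover have "nxt b \<noteq> z" using nb lt_irrefl by auto
    ultimately show ?thesis using True by (cases b) auto
  next
    case False
    then obtain c' where c': "upT z b = Some c'" "c = z # c'" using Cons.prems(3) xz by auto
    have IH: "ch z c'" "lowT z c' = Some b" using Cons.IH[OF z(1,3) c'(1)] by auto
    \<comment> \<open>Any field can be taken for these order statements; \<open>rat\<close> fixes
      the coefficient type of \<open>lowT\<close>.\<close>
    have "latom z (nxt b) = latom z (nxt c')" and dz: "Poly_Mapping.lookup (d z c') b \<noteq> (0::rat)"
      using lowT[OF z(1) IH, where ?'k = rat] by auto
    have tri: "nxt b = nxt c' \<or> nxt b \<prec> nxt c'" using d_triangular[OF z(1) IH(1) dz] by blast
    have nc: "z \<prec> nxt c'" "nxt c' \<in> P" using ch_nxt[OF z(1) IH(1)] by auto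
    have "latom x (nxt c') \<noteq> z"
    proof
      assume eq: "latom x (nxt c') = z"
      then have "nxt b \<noteq> nxt c'" using False by auto
      then have lt: "nxt b \<prec> nxt c'" using tri by blast
      have "z \<in> atoms x (nxt b)" using z nb latomD(2)[OF Cons.prems(1) z(1,2)] xz
        by (simp add: atoms_def)
      then show False
        using latom_eqI[OF Cons.prems(1) nb(2) nc(2) lt_trans[OF Cons.prems(1) z(1) nb(2) z(2) nb(1)] lt] eq False
        by simp
    qed
    then show ?thesis using c' IH z xz by auto
  qed
qed simp

section \<open>Exactness outside the top degree\<close>

lemma sum_ivl_swap:
  assumes "x \<in> P" "z \<in> P"
  shows "(\<Sum>a\<in>ivl x z. \<Sum>b\<in>ivl x a. g b a) = (\<Sum>a\<in>ivl x z. \<Sum>b\<in>ivl a z. g a b)"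
proof -
  have "(\<Sum>a\<in>ivl x z. \<Sum>b\<in>ivl x a. g b a) = (\<Sum>(a, b)\<in>Sigma (ivl x z) (ivl x). g b a)"
    by (simp add: sum.Sigma)
  also have "\<dots> = (\<Sum>(a, b)\<in>Sigma (ivl x z) (\<lambda>a. ivl a z). g a b)"
    by (rule sum.reindex_bij_witness[where i = prod.swap and j = prod.swap])
      (use assms in \<open>auto simp: ivl_def intro: lt_trans\<close>)
  also have "\<dots> = (\<Sum>a\<in>ivl x z. \<Sum>b\<in>ivl a z. g a b)" by (simp add: sum.Sigma)
  finally show ?thesis .
qed

text \<open>Two insertions before \<open>z\<close> cancel in pairs by \<open>sum_ivl_swap\<close>,
  an insertion before \<open>z\<close> anticommutes with one after \<open>z\<close>, and two after
  \<open>z\<close> are covered by induction.\<close>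

lemma d_d: "x \<in> P \<Longrightarrow> set c \<subseteq> P \<Longrightarrow> lin_ext (d x) (d x c) = (0 :: 'a list \<Rightarrow>\<^sub>0 'k::field)"
proof (induction c arbitrary: x)
  case Nil
  have "(lin_ext (d x) (d x []) :: _ \<Rightarrow>\<^sub>0 'k) = (\<Sum>a\<in>ivl x top. d x [a])"
    by (simp add: d.simps(1) lin_sum[OF lin_lin_ext])
  also have "\<dots> = (\<Sum>a\<in>ivl x top. \<Sum>b\<in>ivl x a. sng [b, a]) - (\<Sum>a\<in>ivl x top. \<Sum>b\<in>ivl a top. sng [a, b])"
    by (simp add: d.simps lin_sum[OF lin_push] sum_subtractf)
  also have "\<dots> = 0" using sum_ivl_swap[OF Nil.prems(1) top, of "\<lambda>a b. sng [a, b]"] by simp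
  finally show ?case .
next
  case (Cons z c)
  have zP: "z \<in> P" using Cons.prems by simp
  let ?E = "push ((#) z) (d z c) :: _ \<Rightarrow>\<^sub>0 'k"
  have "lin_ext (d x) (\<Sum>a\<in>ivl x z. sng (a # z # c)) = (\<Sum>a\<in>ivl x z. d x (a # z # c) :: _ \<Rightarrow>\<^sub>0 'k)"
    by (simp add: lin_sum[OF lin_lin_ext])
  also have "\<dots> = (\<Sum>a\<in>ivl x z. (\<Sum>b\<in>ivl x a. sng (b # a # z # c))
      - ((\<Sum>b\<in>ivl a z. sng (a # b # z # c)) - push ((#) a) ?E))"
    by (simp add: d.simps(2) lin_sum[OF lin_push] lin_diff[OF lin_push])
  also have "\<dots> = (\<Sum>a\<in>ivl x z. \<Sum>b\<in>ivl x a. sng (b # a # z # c))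
      - (\<Sum>a\<in>ivl x z. \<Sum>b\<in>ivl a z. sng (a # b # z # c)) + (\<Sum>a\<in>ivl x z. push ((#) a) ?E)"
    by (simp add: sum_subtractf)
  also have "\<dots> = (\<Sum>a\<in>ivl x z. push ((#) a) ?E)"
    using sum_ivl_swap[OF Cons.prems(1) zP, of "\<lambda>a b. sng (a # b # z # c)"] by simp
  finally have 1: "lin_ext (d x) (\<Sum>a\<in>ivl x z. sng (a # z # c)) = (\<Sum>a\<in>ivl x z. push ((#) a) ?E)" .
  have "lin_ext (d x) ?E = lin_ext (\<lambda>e. (\<Sum>a\<in>ivl x z. sng (a # z # e)) - push ((#) z) (d z e)) (d z c)"
    by (simp add: lin_ext_push o_def d.simps(2))
  also have "\<dots> = (\<Sum>a\<in>ivl x z. push ((#) a) ?E) - push ((#) z) (lin_ext (d z) (d z c))"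
  proof (rule lin_eqI[where h' = "\<lambda>f. (\<Sum>a\<in>ivl x z. push ((#) a) (push ((#) z) f)) - push ((#) z) (lin_ext (d z) f)"])
    show "lin (\<lambda>f. (\<Sum>a\<in>ivl x z. push ((#) a) (push ((#) z) f)) - push ((#) z) (lin_ext (d z) f))"
      by (intro lin_sub lin_sum_fun lin_comp[OF lin_push lin_push] lin_comp[OF lin_push lin_lin_ext])
  qed simp_all
  also have "\<dots> = (\<Sum>a\<in>ivl x z. push ((#) a) ?E)"
    using Cons by (simp add: lin_0[OF lin_push])
  finally show ?case unfolding d.simps(2)[of x z c] lin_diff[OF lin_lin_ext] 1 by simp
qed

lemma finite_chains: "x \<in> P \<Longrightarrow> finite {c. ch x c \<and> length c = N}"
  by (rule finite_subset[OF _ finite_lists_length_eq[OF finP, of N]]) (auto simp: ch_iff ivl_def)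

lemma lookup_lin_ext: "Poly_Mapping.lookup (lin_ext g f) b =
    (\<Sum>c\<in>Poly_Mapping.keys f. Poly_Mapping.lookup f c * Poly_Mapping.lookup (g c) b)"
  by (simp add: lin_ext_def lookup_sum)

text \<open>The terms with the minimal label word \<mu> are removed from a cocycle. Those with a
  lower partner are cancelled by the coboundary of \<open>g\<close>, and triangularity confines new
  terms to larger words or to \<mu> itself. A remaining term with word \<mu> has an upper partner,
  and comparing coefficients there in the vanishing coboundary excludes it.\<close>

lemma vanish_step:
  fixes f :: "'a list \<Rightarrow>\<^sub>0 'k::field"
  assumes x: "x \<in> P" and f: "Poly_Mapping.keys f \<subseteq> {c. ch x c \<and> length c = N}"
    and df: "lin_ext (d x) f = 0" and N: "rk top \<noteq> rk x + N + 1"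
    and min: "\<And>c. c \<in> Poly_Mapping.keys f \<Longrightarrow> (ll x c, \<mu>) \<notin> ll_less"
  shows "\<exists>g. Poly_Mapping.keys g \<subseteq> {c. ch x c \<and> Suc (length c) = N} \<and>
    (\<forall>c\<in>Poly_Mapping.keys (f - lin_ext (d x) g).
      ch x c \<and> length c = N \<and> (c \<in> Poly_Mapping.keys f \<or> (\<mu>, ll x c) \<in> ll_less \<or> ll x c = \<mu>) \<and> ll x c \<noteq> \<mu>)"
proof -
  let ?k = "\<lambda>c b. Poly_Mapping.lookup (d x c) b :: 'k"
  define A where "A = {c \<in> Poly_Mapping.keys f. ll x c = \<mu> \<and> upT x c \<noteq> None}"
  define dn where "dn c = the (upT x c)" for c
  \<comment> \<open>The incidence coefficient squares to 1, so multiplying by it gives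
    \<open>c\<close> the same coefficient in the coboundary of \<open>g\<close> as in
    \<open>f\<close>.\<close>
  define g where "g = (\<Sum>c\<in>A. Poly_Mapping.single (dn c) (Poly_Mapping.lookup f c * ?k (dn c) c))"
  have finA: "finite A" by (simp add: A_def)
  have dn: "ch x (dn c)" "lowT x (dn c) = Some c" "upT x c = Some (dn c)" "ll x (dn c) = ll x c"
    "length c = Suc (length (dn c))" "?k (dn c) c * ?k (dn c) c = 1"
    if c: "ch x c" "upT x c \<noteq> None" for c
  proof -
    show u: "upT x c = Some (dn c)" using c by (auto simp: dn_def)
    have l: "ch x (dn c)" "lowT x (dn c) = Some c" using upT[OF x c(1) u] by auto
    then show "ch x (dn c)" "lowT x (dn c) = Some c" by auto
    have "?k (dn c) c \<in> {1, -1}" using lowT[OF x l, where ?'k = 'k] by blast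
    then show "?k (dn c) c * ?k (dn c) c = 1" by auto
    show "ll x (dn c) = ll x c" "length c = Suc (length (dn c))"
      using lowT[OF x l, where ?'k = 'k] by auto
  qed
  have fch: "ch x c" "length c = N" if "c \<in> Poly_Mapping.keys f" for c using that f by auto
  have Ach: "ch x c" "upT x c \<noteq> None" "c \<in> Poly_Mapping.keys f" "ll x c = \<mu>" if "c \<in> A" for c
    using that fch by (auto simp: A_def)
  have keys_g: "Poly_Mapping.keys g \<subseteq> dn ` A"
    unfolding g_def using finA
    by (induction A) (auto dest!: subsetD[OF Poly_Mapping.keys_add] split: if_splits)
  have gch: "\<exists>c\<in>A. c' = dn c \<and> ch x c' \<and> Suc (length c') = N" if "c' \<in> Poly_Mapping.keys g" for c'
    using that keys_g dn(1,5) Ach fch(2) by (metis imageE subsetD)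
  have lk: "Poly_Mapping.lookup (lin_ext (d x) g) b = (\<Sum>c\<in>A. Poly_Mapping.lookup f c * ?k (dn c) c * ?k (dn c) b)" for b
    by (simp add: g_def lin_sum[OF lin_lin_ext] lookup_sum)
  define h where "h = f - lin_ext (d x) g"
  have dh: "lin_ext (d x) h = 0"
  proof -
    have "lin_ext (d x) (lin_ext (d x) g) = 0"
    proof (rule lin_eqI[where h' = "\<lambda>g. 0", OF lin_comp[OF lin_lin_ext lin_lin_ext] lin_zero])
      fix c assume "c \<in> Poly_Mapping.keys g"
      then have "set c \<subseteq> P" using gch ch_iff[OF x, of c] by (auto simp: ivl_def)
      then show "lin_ext (d x) (lin_ext (d x) (sng c)) = 0" by (simp add: d_d[OF x])
    qed
    then show ?thesis using df by (simp add: h_def lin_diff[OF lin_lin_ext])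
  qed
  have hkeys: "ch x c \<and> length c = N \<and> (c \<in> Poly_Mapping.keys f \<or> (\<mu>, ll x c) \<in> ll_less \<or> ll x c = \<mu>)"
    if c: "c \<in> Poly_Mapping.keys h" for c
  proof (cases "c \<in> Poly_Mapping.keys f")
    case False
    then have "Poly_Mapping.lookup (lin_ext (d x) g) c \<noteq> 0" using c by (auto simp: h_def lookup_minus in_keys_iff)
    then obtain c' where c': "c' \<in> A" "?k (dn c') c \<noteq> 0"
      unfolding lk by (metis (no_types, lifting) mult_zero_right sum.neutral)
    note A = Ach[OF c'(1)]
    from d_triangular[OF x dn(1)[OF A(1,2)] c'(2)] show ?thesis
      using dn(4,5)[OF A(1,2)] A(4) fch(2)[OF A(3)] by auto
  qed (use fch in auto)
  have up0: "Poly_Mapping.lookup h b = 0" if b: "ch x b" "ll x b = \<mu>" "upT x b \<noteq> None" for b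
  proof -
    have "Poly_Mapping.lookup f c * ?k (dn c) c * ?k (dn c) b = (if c = b then Poly_Mapping.lookup f b else 0)"
      if c: "c \<in> A" for c
    proof (cases "?k (dn c) b = 0")
      case True
      then show ?thesis using dn(6)[of b] b by auto
    next
      case False
      note A = Ach[OF c]
      from d_triangular[OF x dn(1)[OF A(1,2)] False] have "lowT x (dn c) = Some b"
        using dn(4)[OF A(1,2)] A(4) b dn(2)[OF A(1,2)] wf_not_refl[OF wf_lex[OF wf]] by auto
      then have "c = b" using dn(2)[OF A(1,2)] by simp
      then show ?thesis using dn(6)[OF A(1,2)] by (simp add: mult.assoc)
    qed
    then have "Poly_Mapping.lookup (lin_ext (d x) g) b = (\<Sum>c\<in>A. if c = b then Poly_Mapping.lookup f b else 0)"
      unfolding lk by (intro sum.cong) auto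
    also have "\<dots> = Poly_Mapping.lookup f b" using b finA by (auto simp: A_def in_keys_iff)
    finally show ?thesis by (simp add: h_def lookup_minus)
  qed
  have "Poly_Mapping.lookup h b = 0" if b: "ch x b" "ll x b = \<mu>" "length b = N" for b
  proof (cases "upT x b = None")
    case True
    then obtain T where T: "lowT x b = Some T"
      using critical_length[OF x b(1)] N b(3) by (cases "lowT x b") auto
    note lowb = lowT[OF x b(1) T, where ?'k = 'k]
    \<comment> \<open>Only \<open>b\<close> contributes to the coefficient of its upper partner
      \<open>T\<close>: another term would need a word below \<mu>, which is excluded, or would
      itself be matched with \<open>T\<close>.\<close>
    have "Poly_Mapping.lookup h c * ?k c T = (if c = b then Poly_Mapping.lookup h b * ?k b T else 0)"
      if c: "c \<in> Poly_Mapping.keys h" for c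
    proof (cases "?k c T = 0")
      case False
      note hc = hkeys[OF c]
      from d_triangular[OF x _ False] hc have tri: "(ll x c, ll x T) \<in> ll_less \<or>
        ll x c = ll x T \<and> (lowT x c \<noteq> None \<longrightarrow> upT x T \<noteq> None \<longrightarrow> lowT x c = Some T)" by blast
      have "(ll x c, \<mu>) \<notin> ll_less"
      proof
        assume l: "(ll x c, \<mu>) \<in> ll_less"
        then have "c \<notin> Poly_Mapping.keys f" using min by blast
        then consider "(\<mu>, ll x c) \<in> ll_less" | "ll x c = \<mu>" using hc by blast
        then show False
          using l wf_not_sym[OF wf_lex[OF wf], of "ll x c" \<mu>] wf_not_refl[OF wf_lex[OF wf]] by cases auto
      qed
      then have eq: "ll x c = \<mu>" "lowT x c \<noteq> None \<longrightarrow> lowT x c = Some T"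
        using tri lowb b(2) by auto
      have "upT x c = None"
      proof (rule ccontr)
        assume "upT x c \<noteq> None"
        then have "Poly_Mapping.lookup h c = 0" using up0[of c] hc eq by blast
        then show False using c by (simp add: in_keys_iff)
      qed
      then have "lowT x c \<noteq> None" using critical_length[OF x, of c] hc N by auto
      then have "lowT x c = Some T" using eq by blast
      then have "upT x T = Some c" using lowT[OF x, of c T] hc by blast
      then show ?thesis using lowb by auto
    qed (use lowb in auto)
    then have "Poly_Mapping.lookup (lin_ext (d x) h) T =
      (\<Sum>c\<in>Poly_Mapping.keys h. if c = b then Poly_Mapping.lookup h b * ?k b T else 0)"
      unfolding lookup_lin_ext by (intro sum.cong) auto
    also have "\<dots> = Poly_Mapping.lookup h b * ?k b T" by (auto simp: in_keys_iff)
    finally have "Poly_Mapping.lookup h b * ?k b T = 0" using dh by simp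
    then show ?thesis using lowb by auto
  qed (use up0 b in auto)
  then have "ll x c \<noteq> \<mu>" if "c \<in> Poly_Mapping.keys h" for c
    using hkeys[OF that] that by (auto simp: in_keys_iff)
  then show ?thesis
    using hkeys gch unfolding h_def by (intro exI[of _ g]) blast
qed

text \<open>Induction over an upward closed set of label words containing those of \<open>f\<close>:
  subtracting a coboundary removes a minimal word and introduces only larger ones, which the set
  contains already.\<close>

theorem vanish:
  fixes f :: "'a list \<Rightarrow>\<^sub>0 'k::field"
  assumes x: "x \<in> P" and "Poly_Mapping.keys f \<subseteq> {c. ch x c \<and> length c = N}"
    and "lin_ext (d x) f = 0" and N: "rk top \<noteq> rk x + N + 1"
  shows "\<exists>g. Poly_Mapping.keys g \<subseteq> {c. ch x c \<and> Suc (length c) = N} \<and> lin_ext (d x) g = f"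
proof -
  let ?V = "ll x ` {c. ch x c \<and> length c = N}"
  have finV: "finite ?V" using finite_chains[OF x] by simp
  have "\<lbrakk>U \<subseteq> ?V; \<forall>u\<in>U. \<forall>v\<in>?V. (u, v) \<in> ll_less \<longrightarrow> v \<in> U;
    Poly_Mapping.keys f \<subseteq> {c. ch x c \<and> length c = N}; ll x ` Poly_Mapping.keys f \<subseteq> U; lin_ext (d x) f = 0\<rbrakk>
    \<Longrightarrow> \<exists>g. Poly_Mapping.keys g \<subseteq> {c. ch x c \<and> Suc (length c) = N} \<and> lin_ext (d x) g = f"
    for U and f :: "'a list \<Rightarrow>\<^sub>0 'k"
  proof (induction "card U" arbitrary: U f)
    case 0
    then have "U = {}" using finite_subset[OF _ finV] by auto
    then have "f = 0" using 0 by auto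
    then show ?case by (intro exI[of _ 0]) (simp add: lin_0[OF lin_lin_ext])
  next
    case (Suc k)
    have finU: "finite U" using finite_subset[OF Suc.prems(1) finV] .
    obtain \<mu> where \<mu>: "\<mu> \<in> U" "\<And>u. (u, \<mu>) \<in> ll_less \<Longrightarrow> u \<notin> U"
      using wfE_min[OF wf_lex[OF wf], of _ U] Suc.hyps(2) by (metis card.empty equals0I nat.distinct(1))
    have min: "(ll x c, \<mu>) \<notin> ll_less" if "c \<in> Poly_Mapping.keys f" for c
      using \<mu>(2) Suc.prems(4) that by blast
    obtain g where g: "Poly_Mapping.keys g \<subseteq> {c. ch x c \<and> Suc (length c) = N}"
      and h: "\<And>c. c \<in> Poly_Mapping.keys (f - lin_ext (d x) g) \<Longrightarrow>
        ch x c \<and> length c = N \<and> (c \<in> Poly_Mapping.keys f \<or> (\<mu>, ll x c) \<in> ll_less \<or> ll x c = \<mu>) \<and> ll x c \<noteq> \<mu>"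
      using vanish_step[OF x Suc.prems(3,5) N min] by blast
    let ?h = "f - lin_ext (d x) g"
    have "\<exists>g'. Poly_Mapping.keys g' \<subseteq> {c. ch x c \<and> Suc (length c) = N} \<and> lin_ext (d x) g' = ?h"
    proof (rule Suc.hyps(1)[of "U - {\<mu>}"])
      show "k = card (U - {\<mu>})" using Suc.hyps(2) \<mu>(1) finU by simp
      show "U - {\<mu>} \<subseteq> ?V" using Suc.prems(1) by blast
      show "\<forall>u\<in>U - {\<mu>}. \<forall>v\<in>?V. (u, v) \<in> ll_less \<longrightarrow> v \<in> U - {\<mu>}"
        using Suc.prems(2) \<mu>(2) by blast
      show "Poly_Mapping.keys ?h \<subseteq> {c. ch x c \<and> length c = N}" using h by blast
      show "ll x ` Poly_Mapping.keys ?h \<subseteq> U - {\<mu>}"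
      proof
        fix v assume "v \<in> ll x ` Poly_Mapping.keys ?h"
        then obtain c where c: "c \<in> Poly_Mapping.keys ?h" "v = ll x c" by blast
        then have v: "v \<in> ?V" "v \<noteq> \<mu>" using h by auto
        have "v \<in> U"
        proof (cases "c \<in> Poly_Mapping.keys f")
          case True
          then show ?thesis using Suc.prems(4) c(2) by blast
        next
          case False
          then have "(\<mu>, v) \<in> ll_less" using h[OF c(1)] c(2) by blast
          then show ?thesis using Suc.prems(2)[rule_format, OF \<mu>(1) v(1)] by blast
        qed
        then show "v \<in> U - {\<mu>}" using v(2) by simp
      qed
      have "lin_ext (d x) (lin_ext (d x) g) = 0"
      proof (rule lin_eqI[where h' = "\<lambda>g. 0", OF lin_comp[OF lin_lin_ext lin_lin_ext] lin_zero])
        fix c assume "c \<in> Poly_Mapping.keys g"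
        then have "set c \<subseteq> P" using g ch_iff[OF x, of c] by (auto simp: ivl_def)
        then show "lin_ext (d x) (lin_ext (d x) (sng c)) = 0" by (simp add: d_d[OF x])
      qed
      then show "lin_ext (d x) ?h = 0" using Suc.prems(5) by (simp add: lin_diff[OF lin_lin_ext])
    qed
    then obtain g' where g': "Poly_Mapping.keys g' \<subseteq> {c. ch x c \<and> Suc (length c) = N}" "lin_ext (d x) g' = ?h"
      by blast
    then have "lin_ext (d x) (g + g') = f" by (simp add: lin_add[OF lin_lin_ext])
    moreover have "Poly_Mapping.keys (g + g') \<subseteq> {c. ch x c \<and> Suc (length c) = N}"
      using g g'(1) Poly_Mapping.keys_add[of g g'] by blast
    ultimately show ?case by blast
  qed
  from this[OF order_refl _ assms(2) image_mono[OF assms(2)] assms(3)] show ?thesis by blast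
qed

text \<open>Position 0 gives the insertions before \<open>z\<close>, the later positions give the
  coboundary of the tail; the bounds \<open>x\<close> and \<open>top\<close> follow from those by
  neighbouring elements.\<close>

lemma coboundary_sum:
  assumes "x \<in> P" "ch x c"
  shows "(\<Sum>i\<le>length c. \<Sum>a | a \<in> ivl x top \<and> (0 < i \<longrightarrow> c ! (i - 1) \<prec> a) \<and> (i < length c \<longrightarrow> a \<prec> c ! i).
    Poly_Mapping.single (take i c @ a # drop i c) ((-1) ^ i)) = (d x c :: _ \<Rightarrow>\<^sub>0 'k::field)"
  using assms
proof (induction c arbitrary: x)
  case Nil
  then show ?case by (simp add: d.simps(1))
next
  case (Cons z c)
  have z: "z \<in> P" "x \<prec> z" "ch z c" using Cons.prems(2) by auto
  have zt: "z \<prec> top" using ch_nxt[OF z(1,3)] by blast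
  have sub: "ivl x z \<subseteq> ivl x top" "ivl z top \<subseteq> ivl x top"
    using Cons.prems(1) z zt top by (auto simp: ivl_def intro: lt_trans)
  have nth: "z \<prec> c ! j \<and> c ! j \<in> P" if "j < length c" for j
    using z(3)[unfolded ch_iff[OF z(1)]] nth_mem[OF that] by (auto simp: ivl_def)
  have i0: "{a. a \<in> ivl x top \<and> a \<prec> z} = ivl x z" using sub by (auto simp: ivl_def)
  have iS: "{a. a \<in> ivl x top \<and> (z # c) ! i \<prec> a \<and> (i < length c \<longrightarrow> a \<prec> c ! i)} =
    {a. a \<in> ivl z top \<and> (0 < i \<longrightarrow> c ! (i - 1) \<prec> a) \<and> (i < length c \<longrightarrow> a \<prec> c ! i)}" if "i \<le> length c" for i
  proof (cases i)
    case 0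
    then show ?thesis using sub by (auto simp: ivl_def)
  next
    case (Suc j)
    then have "z \<prec> c ! j \<and> c ! j \<in> P" using nth that by simp
    then show ?thesis using Suc z(1) sub by (auto simp: ivl_def intro: lt_trans)
  qed
  have "(\<Sum>i\<le>length (z # c). \<Sum>a | a \<in> ivl x top \<and> (0 < i \<longrightarrow> (z # c) ! (i - 1) \<prec> a) \<and> (i < length (z # c) \<longrightarrow> a \<prec> (z # c) ! i).
    Poly_Mapping.single (take i (z # c) @ a # drop i (z # c)) ((-1) ^ i)) =
    (\<Sum>a\<in>ivl x z. sng (a # z # c)) + (\<Sum>i\<le>length c. \<Sum>a | a \<in> ivl z top \<and> (0 < i \<longrightarrow> c ! (i - 1) \<prec> a) \<and> (i < length c \<longrightarrow> a \<prec> c ! i).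
      Poly_Mapping.single (z # take i c @ a # drop i c) (- ((-1) ^ i) :: 'k))"
    by (simp add: sum.atMost_Suc_shift i0 del: sum.atMost_Suc)
      (rule sum.cong[OF refl], rule sum.cong[OF _ refl], use iS in simp)
  also have "(\<Sum>i\<le>length c. \<Sum>a | a \<in> ivl z top \<and> (0 < i \<longrightarrow> c ! (i - 1) \<prec> a) \<and> (i < length c \<longrightarrow> a \<prec> c ! i).
      Poly_Mapping.single (z # take i c @ a # drop i c) (- ((-1) ^ i) :: 'k)) = - push ((#) z) (d z c)"
    unfolding Cons.IH[OF z(1,3), symmetric]
    by (simp add: lin_sum[OF lin_push] single_uminus sum_negf)
  finally show ?case by (simp add: d.simps(2))
qed

lemma open_interval_eq: "open_interval P leq x top = ivl x top"
  by (simp add: open_interval_def ivl_def)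

lemma poset_chains_eq:
  assumes "x \<in> P" "x \<prec> top"
  shows "poset_chains (open_interval P leq x top) leq j = {c. ch x c \<and> int (length c) = j + 1}"
  using assms by (auto simp: poset_chains_def open_interval_eq ch_iff)

lemma coboundary_eq:
  assumes "x \<in> P" "\<And>c. c \<in> Poly_Mapping.keys f \<Longrightarrow> ch x c"
  shows "coboundary (open_interval P leq x top) leq f = lin_ext (d x) (f :: _ \<Rightarrow>\<^sub>0 'k::field)"
  unfolding coboundary_def
  by (rule lin_eqI) (use assms coboundary_sum[OF assms(1), where ?'k = 'k] in \<open>auto simp: open_interval_eq\<close>)

theorem coboundary_vanish:
  fixes f :: "'a list \<Rightarrow>\<^sub>0 'k::field"
  assumes x: "x \<in> P" "x \<prec> top" and f: "f \<in> carrier (cochains (open_interval P leq x top) leq j)"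
    and df: "coboundary (open_interval P leq x top) leq f = 0" and j: "int (rk top) \<noteq> int (rk x) + j + 2"
  shows "f \<in> coboundary (open_interval P leq x top) leq ` carrier (cochains (open_interval P leq x top) leq (j - 1))"
proof -
  have keys: "Poly_Mapping.keys f \<subseteq> {c. ch x c \<and> int (length c) = j + 1}"
    using f by (simp add: cochains_def carrier_free poset_chains_eq[OF x])
  show ?thesis
  proof (cases "j < - 1")
    \<comment> \<open>Below degree -1 there are no cochains, not even one on the empty
      chain.\<close>
    case True
    then have "f = 0" using keys by (auto simp flip: keys_eq_empty)
    then show ?thesis
      by (intro image_eqI[of _ _ 0])
        (auto simp: cochains_def carrier_free coboundary_def lin_0[OF lin_lin_ext])
  next
    case False
    define N where "N = nat (j + 1)"
    have N: "int N = j + 1" using False by (simp add: N_def)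
    have "Poly_Mapping.keys f \<subseteq> {c. ch x c \<and> length c = N}" using keys N by auto
    moreover have "lin_ext (d x) f = 0" using df coboundary_eq[OF x(1), of f] keys by auto
    moreover have "rk top \<noteq> rk x + N + 1" using j N by linarith
    ultimately obtain g where g: "Poly_Mapping.keys g \<subseteq> {c. ch x c \<and> Suc (length c) = N}" "lin_ext (d x) g = f"
      using vanish[OF x(1)] by blast
    have "g \<in> carrier (cochains (open_interval P leq x top) leq (j - 1))"
      using g(1) N by (auto simp: cochains_def carrier_free poset_chains_eq[OF x])
    moreover have "coboundary (open_interval P leq x top) leq g = lin_ext (d x) g"
      by (rule coboundary_eq[OF x(1)]) (use g in auto)
    then have "f = coboundary (open_interval P leq x top) leq g" using g(2) by simp
    ultimately show ?thesis by blast
  qed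
qed

end

section \<open>Weighted partitions form an edge-lexicographically labelled poset\<close>

definition bmin :: "nat set \<times> nat \<Rightarrow> nat" where
  "bmin x = Min (fst x)"

text \<open>The pair is ordered by least elements, so that each atom has exactly one such
  description.\<close>

definition atom_data :: "wpartition \<Rightarrow> wpartition \<Rightarrow> nat set \<times> nat \<Rightarrow> nat set \<times> nat \<Rightarrow> nat \<Rightarrow> bool" where
  "atom_data p y a b u \<longleftrightarrow> a \<in> p \<and> b \<in> p \<and> bmin a < bmin b \<and> u \<le> 1 \<and> wp_le (mrg u a b p) y"

text \<open>Well defined on merges by \<open>mrg_inj\<close>, and compared lexicographically as a
  triple of numbers.\<close>

definition wlab :: "wpartition \<Rightarrow> wpartition \<Rightarrow> nat \<times> nat \<times> nat" where
  "wlab p q = (THE l. \<exists>a\<in>p. \<exists>b\<in>p. \<exists>u\<le>1. bmin a < bmin b \<and> q = mrg u a b p \<and> l = (bmin a, bmin b, u))"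

lemma bmin_inj:
  assumes "p \<in> wpartitions n" "x \<in> p" "y \<in> p" "bmin x = bmin y"
  shows "x = y"
proof -
  have "bmin x \<in> fst x" "bmin y \<in> fst y"
    unfolding bmin_def using wpartitionsD(2,3)[OF assms(1)] assms(2,3) by (auto intro: Min_in)
  then show ?thesis using wpartitionsD(5)[OF assms(1-3)] assms(4) by metis
qed

lemma bmin_mrg:
  assumes "p \<in> wpartitions n" "x \<in> p" "y \<in> p" "bmin x < bmin y"
  shows "bmin (fst x \<union> fst y, v) = bmin x"
  using Min_Un[OF wpartitionsD(3)[OF assms(1,2)] wpartitionsD(2)[OF assms(1,2)]
      wpartitionsD(3)[OF assms(1,3)] wpartitionsD(2)[OF assms(1,3)]] assms(4)
  by (simp add: bmin_def)

lemma wlab_mrg: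
  assumes p: "p \<in> wpartitions n" and ab: "a \<in> p" "b \<in> p" "bmin a < bmin b" and u: "u \<le> 1"
  shows "wlab p (mrg u a b p) = (bmin a, bmin b, u)"
  unfolding wlab_def
proof (rule the_equality)
  show "\<exists>a'\<in>p. \<exists>b'\<in>p. \<exists>u'\<le>1. bmin a' < bmin b' \<and> mrg u a b p = mrg u' a' b' p \<and>
    (bmin a, bmin b, u) = (bmin a', bmin b', u')"
    using ab u by blast
next
  fix l assume "\<exists>a'\<in>p. \<exists>b'\<in>p. \<exists>u'\<le>1. bmin a' < bmin b' \<and> mrg u a b p = mrg u' a' b' p \<and> l = (bmin a', bmin b', u')"
  then obtain a' b' u' where l: "a' \<in> p" "b' \<in> p" "bmin a' < bmin b'" "mrg u a b p = mrg u' a' b' p"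
    "l = (bmin a', bmin b', u')" by blast
  have "a \<noteq> b" "a' \<noteq> b'" using ab l by auto
  from mrg_inj[OF p ab(1,2) this(1) l(1,2) this(2) l(4)]
  have "{a, b} = {a', b'}" "u = u'" by auto
  then have "a = a' \<and> b = b'" using ab(3) l(3) by (metis doubleton_eq_iff less_asym)
  then show "l = (bmin a, bmin b, u)" using l(5) \<open>u = u'\<close> by simp
qed

lemma atom_dataD:
  assumes p: "p \<in> wpartitions n" and a: "atom_data p y a b u"
  shows "a \<in> p" "b \<in> p" "a \<noteq> b" "bmin a < bmin b" "u \<le> 1" "wp_le (mrg u a b p) y"
    "mrg u a b p \<in> wpartitions n" "wlab p (mrg u a b p) = (bmin a, bmin b, u)"
    "wlt p (mrg u a b p)" "card p = Suc (card (mrg u a b p))"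
proof -
  show *: "a \<in> p" "b \<in> p" "bmin a < bmin b" "u \<le> 1" "wp_le (mrg u a b p) y" using a by (auto simp: atom_data_def)
  then show **: "a \<noteq> b" by auto
  show "mrg u a b p \<in> wpartitions n" "card p = Suc (card (mrg u a b p))"
    using mrg_in[OF p *(1,2) ** *(4)] card_mrg[OF p *(1,2) ** *(4)] by auto
  show "wlab p (mrg u a b p) = (bmin a, bmin b, u)" by (rule wlab_mrg[OF p *(1-4)])
  show "wlt p (mrg u a b p)" by (rule wlt_mrg[OF p *(1,2) ** *(4)])
qed

abbreviation wrk :: "nat \<Rightarrow> wpartition \<Rightarrow> nat" where
  "wrk n p \<equiv> n - card p"

definition watoms :: "nat \<Rightarrow> wpartition \<Rightarrow> wpartition \<Rightarrow> wpartition set" where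
  "watoms n x y = {z \<in> wpartitions n. wrk n z = Suc (wrk n x) \<and> wlt x z \<and> (z = y \<or> wlt z y)}"

lemma card_le: "p \<in> wpartitions n \<Longrightarrow> card p \<le> n"
  using wp_le_card(1)[OF wp_bot_in _ wp_bot_le] card_wp_bot by metis

lemma atom_data_atom: "p \<in> wpartitions n \<Longrightarrow> atom_data p y a b u \<Longrightarrow> mrg u a b p \<in> watoms n p y"
  using atom_dataD[of p n y a b u] card_le[of p n] by (auto simp: watoms_def strict_def)

lemma atom_data_total:
  assumes p: "p \<in> wpartitions n" and ab: "a \<in> p" "b \<in> p" "a \<noteq> b" and u: "u \<le> 1" "wp_le (mrg u a b p) y"
  obtains "atom_data p y a b u" | "atom_data p y b a u"
proof -
  have "bmin a \<noteq> bmin b" using bmin_inj[OF p ab(1,2)] ab(3) by blast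
  then show ?thesis using that ab u mrg_commute[of u a b p] by (force simp: atom_data_def)
qed

lemma atomE:
  assumes p: "p \<in> wpartitions n" and z: "z \<in> watoms n p y"
  obtains a b u where "atom_data p y a b u" "z = mrg u a b p"
proof -
  have zp: "z \<in> wpartitions n" "wlt p z" "card p = Suc (card z)" "wp_le z y"
    using z card_le[OF p] wp_le_refl by (auto simp: watoms_def strict_def)
  obtain a b u where *: "a \<in> p" "b \<in> p" "a \<noteq> b" "u \<le> 1" "z = mrg u a b p"
    using wlt_cover[OF p zp(1-3)] .
  show ?thesis
    by (rule atom_data_total[OF p *(1-4), of y]) (use zp(4) *(5) mrg_commute that in \<open>auto\<close>)
qed

lemma ex_merge_atom:
  assumes p: "p \<in> wpartitions n" and y: "y \<in> wpartitions n" and le: "wp_le p y" and D: "D \<in> y"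
    and ab: "a \<in> p" "b \<in> p" "bmin a < bmin b" "fst a \<subseteq> fst D" "fst b \<subseteq> fst D"
  shows "\<exists>k\<le>1. atom_data p y a b k"
proof -
  have "a \<in> below p (fst D)" "b \<in> below p (fst D)" "a \<noteq> b" using ab by (auto simp: below_def)
  from ex_mrg_le[OF p y le D this] ab show ?thesis by (auto simp: atom_data_def)
qed

text \<open>Let \<open>z\<close> merge \<open>x1\<close> and \<open>x2\<close>. If the least label
  above \<open>z\<close> is smaller than the label of \<open>z\<close>, that merge can be brought
  forward, directly or with \<open>x1\<close> in place of the new block. Otherwise the smaller merge
  \<open>w\<close> would give a small label above \<open>z\<close> too, unless it merges the same
  pair with weight 0 instead of 1; then \<open>z'\<close> is also reached by adding that weight
  later, together with a third block.\<close>

lemma watoms_el: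
  assumes p: "p \<in> wpartitions n" and y: "y \<in> wpartitions n"
    and z: "z \<in> watoms n p y" and w: "w \<in> watoms n p y" "wlab p w < wlab p z" and z': "z' \<in> watoms n z y"
    and least: "\<And>w'. w' \<in> watoms n z y \<Longrightarrow> wlab z z' \<le> wlab z w'"
  shows "\<exists>w\<in>watoms n p z'. wlab p w < wlab p z"
proof -
  obtain x1 x2 u where ad: "atom_data p y x1 x2 u" and zeq: "z = mrg u x1 x2 p" using atomE[OF p z] .
  note X = atom_dataD[OF p ad, folded zeq]
  have zin: "z \<in> wpartitions n" by (fact X(7))
  obtain y1 y2 u' where ad': "atom_data z y y1 y2 u'" and zeq': "z' = mrg u' y1 y2 z" using atomE[OF zin z'] .
  note Y = atom_dataD[OF zin ad', folded zeq']
  obtain w1 w2 v where adw: "atom_data p y w1 w2 v" and weq: "w = mrg v w1 w2 p" using atomE[OF p w(1)] .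
  note W = atom_dataD[OF p adw, folded weq]
  define M where "M = (fst x1 \<union> fst x2, snd x1 + snd x2 + u)"
  have zset: "z = insert M (p - {x1, x2})" by (simp add: zeq mrg_def M_def)
  have mM: "bmin M = bmin x1" unfolding M_def by (rule bmin_mrg[OF p X(1,2,4)])
  have py: "wp_le p y" and pz': "wp_le p z'"
    using wp_le_trans[OF p zin y _ X(6)] wp_le_trans[OF p zin Y(7)] X(9) Y(9) by (auto simp: strict_def)
  have result: ?thesis if "atom_data p z' a b k" "(bmin a, bmin b, k) < (bmin x1, bmin x2, u)" for a b k
    using atom_data_atom[OF p that(1)] that(2) atom_dataD(8)[OF p that(1)] X(8) by metis
  have lab_least: "(bmin y1, bmin y2, u') \<le> (bmin a, bmin b, k)" if "atom_data z y a b k" for a b k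
    using least[OF atom_data_atom[OF zin that]] atom_dataD(8)[OF zin that] Y(8) by simp
  have lw: "(bmin w1, bmin w2, v) < (bmin x1, bmin x2, u)" using w(2) W(8) X(8) by simp
  define N where "N = (fst y1 \<union> fst y2, snd y1 + snd y2 + u')"
  have N: "N \<in> z'" by (simp add: zeq' mrg_def N_def)
  obtain D where D: "D \<in> y" "fst x1 \<subseteq> fst D" "fst x2 \<subseteq> fst D" "int u \<le> slack p D"
    "slack p D - int u < int (cnt p (fst D)) - 1"
    using mrg_le_iff[OF p X(1,2,3,5) y] X(6) zeq by auto
  obtain D'' where D'': "D'' \<in> y" "fst w1 \<subseteq> fst D''" "fst w2 \<subseteq> fst D''" "int v \<le> slack p D''"
    "slack p D'' - int v < int (cnt p (fst D'')) - 1"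
    using mrg_le_iff[OF p W(1,2,3,5) y] W(6) weq by auto
  have MD: "fst M \<subseteq> fst D" using D by (simp add: M_def)
  have other: "a \<in> z" if "a \<in> p" "a \<noteq> x1" "a \<noteq> x2" for a using that zset by auto
  have sameD: "D'' = D" if a: "a \<in> {x1, x2}" "fst a \<subseteq> fst D''" for a
  proof -
    have "a \<in> p" using a(1) X(1,2) by auto
    from wpartitionsD(2)[OF p this] obtain i where "i \<in> fst a" by auto
    then show ?thesis using wpartitionsD(5)[OF y D''(1) D(1), of i] a D(2,3) by auto
  qed
  have merge_label: "(bmin y1, bmin y2, u') < (bmin x1, bmin x2, u)"
    if "a \<in> z" "b \<in> z" "bmin a < bmin b" "E \<in> y" "fst a \<subseteq> fst E" "fst b \<subseteq> fst E"
      "bmin a < bmin x1 \<or> bmin a = bmin x1 \<and> bmin b < bmin x2" for a b E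
  proof -
    from ex_merge_atom[OF zin y X(6) that(4,1,2,3,5,6)] obtain k where "atom_data z y a b k" by blast
    from lab_least[OF this] that(7) show ?thesis by auto
  qed
  have triple: "\<exists>k. atom_data p z' a b k"
    if "a \<in> p" "b \<in> p" "bmin a < bmin b" "fst a \<subseteq> fst N" "fst b \<subseteq> fst N" for a b
    using ex_merge_atom[OF p Y(7) pz' N that] by blast
  have Mne: "y1 = M \<or> (y1 \<in> p \<and> y1 \<noteq> x1 \<and> y1 \<noteq> x2)" "y2 = M \<or> (y2 \<in> p \<and> y2 \<noteq> x1 \<and> y2 \<noteq> x2)"
    using Y(1,2) zset by auto
  show ?thesis
  proof (cases "(bmin y1, bmin y2, u') < (bmin x1, bmin x2, u)")
    case True
    consider "y1 \<noteq> M" "y2 \<noteq> M" | "y2 = M" | "y1 = M" "y2 \<noteq> M" by blast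
    then show ?thesis
    proof cases
      case 1
      then have in2: "y1 \<in> p" "y1 \<noteq> x1" "y1 \<noteq> x2" "y2 \<in> p" "y2 \<noteq> x1" "y2 \<noteq> x2"
        using Mne by auto
      then have d: "distinct [x1, x2, y1, y2]" using X(3) Y(3) by auto
      from rank2_disjoint(2)[OF p X(1,2) in2(1,4) d X(5) Y(5)]
      have "z' = mrg u x1 x2 (mrg u' y1 y2 p)" by (simp add: zeq' zeq)
      moreover have "wp_le (mrg u' y1 y2 p) (mrg u x1 x2 (mrg u' y1 y2 p))"
      proof -
        have "mrg u' y1 y2 p \<in> wpartitions n" by (rule mrg_in[OF p in2(1,4) Y(3,5)])
        moreover have "x1 \<in> mrg u' y1 y2 p" "x2 \<in> mrg u' y1 y2 p" using in2 X(1,2) by (auto simp: mrg_def)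
        ultimately show ?thesis using wlt_mrg X(3,5) by (metis strict_def)
      qed
      ultimately have "atom_data p z' y1 y2 u'" using in2 Y(4,5) by (simp add: atom_data_def)
      then show ?thesis using result True by blast
    next
      case 2
      then have y1: "y1 \<in> p" "bmin y1 < bmin x1" using Mne Y(3,4) mM by auto
      obtain k where "atom_data p z' y1 x1 k"
        using triple[OF y1(1) X(1) y1(2)] by (auto simp: N_def 2 M_def)
      then show ?thesis using result y1(2) by auto
    next
      case 3
      then have y2: "y2 \<in> p" "y2 \<noteq> x2" using Mne by auto
      have "bmin y2 \<noteq> bmin x2" using bmin_inj[OF p y2(1) X(2)] y2(2) by blast
      then have m: "bmin y2 < bmin x2" "bmin x1 < bmin y2"
        using True 3(1) mM Y(4) by auto
      obtain k where "atom_data p z' x1 y2 k"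
        using triple[OF X(1) y2(1) m(2)] by (auto simp: N_def 3 M_def)
      then show ?thesis using result m(1) by auto
    qed
  next
    case nless: False
    have no: False if "a \<in> z" "b \<in> z" "bmin a < bmin b" "E \<in> y" "fst a \<subseteq> fst E" "fst b \<subseteq> fst E"
      "bmin a < bmin x1 \<or> bmin a = bmin x1 \<and> bmin b < bmin x2" for a b E
      using merge_label[OF that] nless by blast
    have Mz: "M \<in> z" using zset by simp
    have ow1: "w1 \<in> z" if "w1 \<noteq> x1" "w1 \<noteq> x2" by (rule other[OF W(1) that])
    have ow2: "w2 \<in> z" if "w2 \<noteq> x1" "w2 \<noteq> x2" by (rule other[OF W(2) that])
    have sD1: "D'' = D" if "w1 \<in> {x1, x2}" by (rule sameD[OF that D''(2)])
    have sD2: "D'' = D" if "w2 \<in> {x1, x2}" by (rule sameD[OF that D''(3)])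
    consider "w1 \<noteq> x1" "w1 \<noteq> x2" "w2 \<noteq> x1" "w2 \<noteq> x2" | "w2 = x1" | "w2 = x2" "w1 \<noteq> x1" | "w1 = x1" "w2 \<noteq> x2"
      | "w1 = x2" | "w1 = x1" "w2 = x2" by blast
    then show ?thesis
    proof cases
      case 1
      have "bmin w1 \<noteq> bmin x1" using bmin_inj[OF p W(1) X(1)] 1 by blast
      then have "bmin w1 < bmin x1 \<or> bmin w1 = bmin x1 \<and> bmin w2 < bmin x2" using lw by auto
      from no[OF ow1[OF 1(1,2)] ow2[OF 1(3,4)] W(4) D''(1-3) this] show ?thesis ..
    next
      case 2
      have m: "bmin w1 < bmin x1" "w1 \<noteq> x1" "w1 \<noteq> x2" using W(4) X(4) 2 by auto
      have "D'' = D" using sD2 2 by simp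
      with no[OF ow1[OF m(2,3)] Mz _ D(1) _ MD] D''(2) m(1) mM show ?thesis by simp
    next
      case 3
      have "w1 \<noteq> x2" using W(4) 3 by auto
      moreover have "bmin w1 \<noteq> bmin x1" using bmin_inj[OF p W(1) X(1)] 3 by blast
      then have "bmin w1 < bmin x1" using lw by auto
      moreover have "D'' = D" using sD2 3 by simp
      ultimately show ?thesis using no[OF ow1[OF 3(2)] Mz _ D(1) _ MD] D''(2) mM by simp
    next
      case 4
      have "w2 \<noteq> x1" using W(3) 4 by auto
      moreover have "bmin w2 \<noteq> bmin x2" using bmin_inj[OF p W(2) X(2)] 4 by blast
      then have "bmin w2 < bmin x2" using lw 4 by auto
      moreover have "D'' = D" using sD1 4 by simp
      ultimately show ?thesis using no[OF Mz ow2[OF _ 4(2)] _ D(1) MD] D''(3) mM W(4) 4 by simp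
    next
      case 5
      then show ?thesis using lw X(4) by auto
    next
      \<comment> \<open>The same pair with weight 0 for \<open>w\<close> and 1 for \<open>z\<close>.
        As both are possible below \<open>y\<close>, the block \<open>D\<close> contains at least
        three blocks of \<open>p\<close>.\<close>
      case 6
      then have uv: "v = 0" "u = 1" using lw X(5) by auto
      have DD: "D'' = D" using sD1 6 by simp
      have cn: "3 \<le> cnt p (fst D)" "1 \<le> slack p D" "slack p D \<le> int (cnt p (fst D)) - 2"
        using D(4) D''(5) uv DD by auto
      have below_z: "Suc (cnt z (fst D)) = cnt p (fst D)" "slack z D = slack p D - 1"
        using below_mrg_in[OF p X(1,2,3,5) D(2,3)] uv by (simp_all add: zeq slack_def)
      have atom0: "wp_le (mrg 0 a b z) y" if "a \<in> z" "b \<in> z" "a \<noteq> b" "fst a \<subseteq> fst D" "fst b \<subseteq> fst D" for a b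
        unfolding mrg_le_iff[OF zin that(1-3) _ y, of 0, simplified]
        using X(6) D(1) that(4,5) cn below_z by (auto intro!: bexI[of _ D])
      have "\<not> below p (fst D) \<subseteq> {x1, x2}"
      proof
        assume "below p (fst D) \<subseteq> {x1, x2}"
        from card_mono[OF _ this] cn(1) show False by (simp add: X(3))
      qed
      then obtain w3 where w3: "w3 \<in> p" "fst w3 \<subseteq> fst D" "w3 \<noteq> x1" "w3 \<noteq> x2" by (auto simp: below_def)
      have w3z: "w3 \<in> z" by (rule other[OF w3(1,3,4)])
      have "\<not> bmin w3 < bmin x1"
        using no[OF w3z Mz _ D(1) w3(2) MD] mM by auto
      then have w3m: "bmin x1 < bmin w3" using bmin_inj[OF p w3(1) X(1)] w3(3) by (meson linorder_neqE_nat)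
      have "M \<noteq> w3" using w3m mM by auto
      then have "atom_data z y M w3 0" using atom0[OF Mz w3z _ MD w3(2)] Mz w3z w3m mM by (simp add: atom_data_def)
      from lab_least[OF this] have "bmin y1 \<le> bmin x1" using mM by auto
      moreover have "bmin x1 \<le> bmin y1" using nless by auto
      ultimately have y1: "y1 = M" using bmin_inj[OF zin Y(1) Mz] mM by simp
      then have y2: "y2 \<in> p" "y2 \<noteq> x1" "y2 \<noteq> x2" "y2 \<noteq> M" using Mne(2) Y(3) by auto
      obtain E where E: "E \<in> y" "fst M \<subseteq> fst E" "fst y2 \<subseteq> fst E"
        using mrg_le_iff[OF zin Y(1,2,3,5) y] Y(6) zeq' y1 by auto
      have "E = D"
      proof -
        obtain i where "i \<in> fst x1" using wpartitionsD(2)[OF p X(1)] by auto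
        then show ?thesis using wpartitionsD(5)[OF y E(1) D(1), of i] E(2) D(2) by (auto simp: M_def)
      qed
      then have "atom_data z y M y2 0" using atom0[OF Mz Y(2) _ MD] E(3) Mz Y(2,4) y1 y2(4) by (auto simp: atom_data_def)
      from lab_least[OF this] have u': "u' = 0" using y1 by auto
      have d: "distinct [x1, x2, y2]" using X(3) y2 by auto
      have z'eq: "z' = mrg 1 (fst x1 \<union> fst x2, snd x1 + snd x2 + 0) y2 (mrg 0 x1 x2 p)"
        using mrg_twice[OF p X(1,2) y2(1) d, of 0 1] mrg_twice[OF p X(1,2) y2(1) d, of 1 0]
        by (simp add: zeq' zeq y1 u' uv M_def)
      have "wp_le (mrg 0 x1 x2 p) z'"
      proof -
        have q: "mrg 0 x1 x2 p \<in> wpartitions n" by (rule mrg_in[OF p X(1,2,3)]) simp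
        have "y2 \<in> mrg 0 x1 x2 p" "(fst x1 \<union> fst x2, snd x1 + snd x2 + 0) \<in> mrg 0 x1 x2 p"
          using y2 by (auto simp: mrg_def)
        moreover have "(fst x1 \<union> fst x2, snd x1 + snd x2 + 0) \<noteq> y2"
          using mrg_new[OF p X(1,2,3), of 0] y2(1) by auto
        ultimately show ?thesis unfolding z'eq using wlt_mrg[OF q] by (auto simp: strict_def)
      qed
      then have "atom_data p z' x1 x2 0" using X(1,2,4) by (simp add: atom_data_def)
      then show ?thesis using result uv(2) by auto
    qed
  qed
qed

lemma el_poset_wpartitions: "el_poset (wpartitions n) wp_le (wrk n) wlab"
proof (rule el_poset.intro, unfold watoms_def[symmetric])
  show "finite (wpartitions n)" by (rule finite_wpartitions)
next
  fix x y z assume "x \<in> wpartitions n" "y \<in> wpartitions n" "z \<in> wpartitions n" "wlt x y" "wlt y z"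
  then show "wlt x z" by (rule wlt_trans)
next
  fix x y assume *: "x \<in> wpartitions n" "y \<in> wpartitions n" "wlt x y"
  then show "wrk n x < wrk n y" using wlt_card[OF *] card_le[OF *(1)] by linarith
  obtain a b u where ab: "a \<in> x" "b \<in> x" "a \<noteq> b" "u \<le> 1" "wp_le (mrg u a b x) y" using wlt_ex_mrg[OF *] .
  show "watoms n x y \<noteq> {}"
    by (rule atom_data_total[OF *(1) ab]) (use atom_data_atom[OF *(1)] in \<open>metis empty_iff\<close>)+
next
  fix x y z w assume *: "x \<in> wpartitions n" "z \<in> watoms n x y" "w \<in> watoms n x y" "wlab x z = wlab x w"
  obtain a b u where z: "atom_data x y a b u" "z = mrg u a b x" using atomE[OF *(1,2)] .
  obtain c d v where w: "atom_data x y c d v" "w = mrg v c d x" using atomE[OF *(1,3)] .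
  note Z = atom_dataD[OF *(1) z(1)] and W = atom_dataD[OF *(1) w(1)]
  have "a = c" "b = d" "u = v"
    using bmin_inj[OF *(1) Z(1) W(1)] bmin_inj[OF *(1) Z(2) W(2)] *(4) Z(8) W(8) z(2) w(2) by auto
  then show "z = w" using z(2) w(2) by simp
next
  fix x y z w z'
  assume "x \<in> wpartitions n" "y \<in> wpartitions n" "z \<in> watoms n x y" "w \<in> watoms n x y" "wlab x w < wlab x z"
    "z' \<in> watoms n z y" "\<And>w'. w' \<in> watoms n z y \<Longrightarrow> wlab z z' \<le> wlab z w'"
  then show "\<exists>w\<in>watoms n x z'. wlab x w < wlab x z" by (rule watoms_el)
qed

text \<open>The rank is \<open>n - card y\<close>, so the excluded degree is that of the maximal
  chains of the open interval.\<close>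

theorem wp_coboundary_vanish:
  fixes f :: "wpartition list \<Rightarrow>\<^sub>0 'k::field" and n y
  defines "I \<equiv> open_interval (wpartitions n) wp_le (wp_bot n) y"
  assumes y: "y \<in> wpartitions n" "y \<noteq> wp_bot n" and f: "f \<in> carrier (cochains I wp_le j)"
    and df: "coboundary I wp_le f = 0" and j: "int (card y) + j + 2 \<noteq> int n"
  shows "f \<in> coboundary I wp_le ` carrier (cochains I wp_le (j - 1))"
proof -
  have "el_interval (wpartitions n) wp_le (wrk n) wlab y"
    by (intro el_interval.intro el_poset_wpartitions el_interval_axioms.intro y)
  then interpret el_interval "wpartitions n" wp_le "wrk n" wlab "watoms n" y by (simp_all add: watoms_def)
  show ?thesis unfolding I_def
    by (rule coboundary_vanish[OF wp_bot_in wp_bot_wlt[OF y] f[unfolded I_def] df[unfolded I_def]])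
      (use j card_le[OF y(1)] card_wp_bot in auto)
qed

section \<open>The multilinear part of the exterior power\<close>

definition wcls :: "nat \<Rightarrow> nat \<Rightarrow> (nat btree list \<Rightarrow>\<^sub>0 'k::field) \<Rightarrow> ((nat btree \<Rightarrow>\<^sub>0 'k) set list \<Rightarrow>\<^sub>0 'k) set" where
  "wcls n r f = cos (ext_kernel r (lie2 {1..n})) (tup {1..n} r f)"

abbreviation MFsp :: "nat \<Rightarrow> nat \<Rightarrow> (nat btree list \<Rightarrow>\<^sub>0 'k::field) set" where
  "MFsp n r \<equiv> {f. Poly_Mapping.keys f \<subseteq> MF {1..n} r}"

lemma wcls_eq_iff:
  assumes "f \<in> MFsp n r" "g \<in> MFsp n r"
  shows "wcls n r f = wcls n r g \<longleftrightarrow> f - g \<in> (relspace {1..n} r :: (_ \<Rightarrow>\<^sub>0 'k::field) set)"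
proof -
  have "f - g \<in> MFsp n r" by (rule pm.subspace_diff[OF subspace_keys assms])
  then have "Poly_Mapping.keys (f - g) \<subseteq> MF {1..n} r" by simp
  from tup_kernel[OF this] show ?thesis
    unfolding wcls_def cos_eq_iff[OF subspace_ext_kernel] lin_diff[OF lin_tup, symmetric] .
qed

lemma wcls_ops:
  "wcls n r f \<oplus>\<^bsub>ext_power r (lie2 {1..n})\<^esub> wcls n r g = wcls n r (f + g)"
  "a \<odot>\<^bsub>ext_power r (lie2 {1..n})\<^esub> wcls n r f = wcls n r (scale a f)"
  "\<zero>\<^bsub>ext_power r (lie2 {1..n})\<^esub> = wcls n r 0"
  unfolding ext_power_def wcls_def add_quotient[OF add_tuple subspace_ext_kernel]
    smult_quotient[OF add_tuple smult_tuple subspace_ext_kernel] lin_add[OF lin_tup] lin_scale[OF lin_tup]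
    lin_0[OF lin_tup] cos_0 zero_quotient by (rule refl)+

lemma wedge_bracketing_wcls:
  assumes "G \<in> MF {1..n} r"
  shows "wedge_bracketing {1..n} G = wcls n r (sng G)"
proof -
  have "length G = r" using assms by (simp add: MF_def)
  then show ?thesis
    unfolding wedge_bracketing_def wedge_def wcls_def length_map tup_sng if_P[OF assms] by (simp only: a_r_coset_pm[OF add_tuple])
qed

lemma inv_quotient:
  assumes M: "pm_module M" and U: "pm.subspace U" and x: "x \<in> carrier M"
  shows "m_inv (add_monoid (quotient_module M U)) (cos U x) = cos U (- x)"
proof -
  have a: "add M = (+)" using M unfolding pm_module_def by (elim conjE)
  show ?thesis unfolding m_inv_def
  proof (rule the_equality)
    have "- x \<in> carrier M" using pm.subspace_neg[OF pm_moduleD(4)[OF M] x] .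
    then show "cos U (- x) \<in> carrier (add_monoid (quotient_module M U)) \<and>
      cos U x \<otimes>\<^bsub>add_monoid (quotient_module M U)\<^esub> cos U (- x) = \<one>\<^bsub>add_monoid (quotient_module M U)\<^esub> \<and>
      cos U (- x) \<otimes>\<^bsub>add_monoid (quotient_module M U)\<^esub> cos U x = \<one>\<^bsub>add_monoid (quotient_module M U)\<^esub>"
      by (simp add: carrier_quotient[OF a] add_quotient[OF a U])
  next
    fix y assume y: "y \<in> carrier (add_monoid (quotient_module M U)) \<and>
      cos U x \<otimes>\<^bsub>add_monoid (quotient_module M U)\<^esub> y = \<one>\<^bsub>add_monoid (quotient_module M U)\<^esub> \<and>
      y \<otimes>\<^bsub>add_monoid (quotient_module M U)\<^esub> cos U x = \<one>\<^bsub>add_monoid (quotient_module M U)\<^esub>"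
    then obtain t where t: "y = cos U t" by (auto simp: carrier_quotient[OF a])
    have "cos U (t + x) = cos U 0" using y unfolding t by (simp add: add_quotient[OF a U])
    then show "y = cos U (- x)" unfolding t cos_eq_iff[OF U] by simp
  qed
qed

lemma submodule_cos_image:
  assumes M: "pm_module M" and U: "pm.subspace U" and V: "pm.subspace V" "V \<subseteq> carrier M"
  shows "submodule (cos U ` V) field_ring (quotient_module M U)"
proof -
  have a: "add M = (+)" "smult M = scale" using M unfolding pm_module_def by blast+
  show ?thesis
  proof (intro submodule.intro subgroup.intro submodule_axioms.intro)
    show "cos U ` V \<subseteq> carrier (add_monoid (quotient_module M U))"
      using V(2) by (auto simp: carrier_quotient[OF a(1)])
    show "\<one>\<^bsub>add_monoid (quotient_module M U)\<^esub> \<in> cos U ` V"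
      using pm.subspace_0[OF V(1)] by (auto intro!: image_eqI[of _ _ 0])
  next
    fix A B assume "A \<in> cos U ` V" "B \<in> cos U ` V"
    then show "A \<otimes>\<^bsub>add_monoid (quotient_module M U)\<^esub> B \<in> cos U ` V"
      using pm.subspace_add[OF V(1)] by (auto simp: add_quotient[OF a(1) U])
  next
    fix A assume "A \<in> cos U ` V"
    then obtain x where "x \<in> V" "A = cos U x" by auto
    then show "m_inv (add_monoid (quotient_module M U)) A \<in> cos U ` V"
      using inv_quotient[OF M U] pm.subspace_neg[OF V(1)] V(2) by auto
  next
    fix b A assume "A \<in> cos U ` V"
    then show "b \<odot>\<^bsub>quotient_module M U\<^esub> A \<in> cos U ` V"
      using pm.subspace_scale[OF V(1)] by (auto simp: smult_quotient[OF a U])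
  qed
qed

lemma tup_carrier: "f \<in> MFsp n r \<Longrightarrow> tup {1..n} r f \<in> carrier (tuple_module r (lie2 {1..n}))"
proof (rule lin_in_subspace[OF lin_tup pm_moduleD(4)[OF pm_module_tuple]])
  fix G assume "f \<in> MFsp n r" "G \<in> Poly_Mapping.keys f"
  then have G: "G \<in> MF {1..n} r" by auto
  show "tup {1..n} r (sng G) \<in> carrier (tuple_module r (lie2 {1..n}))"
    unfolding tup_sng if_P[OF G] by (rule sng_tuple) (use MF_map_bracketing[OF G] in blast)+
qed

text \<open>Classes of combinations of multilinear forests already form a submodule, and any
  submodule containing the generators contains them all.\<close>

lemma carrier_wedge:
  "carrier (wedge_lie2 n r) = wcls n r ` (MFsp n r :: (_ \<Rightarrow>\<^sub>0 'k::field) set)"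
proof -
  let ?E = "ext_power r (lie2 {1..n}) :: ('k, ((nat btree \<Rightarrow>\<^sub>0 'k) set list \<Rightarrow>\<^sub>0 'k) set) module"
  let ?S = "{wedge_bracketing {1..n} G | G. length G = r \<and>
    distinct (concat (map leaf_word G)) \<and> set (concat (map leaf_word G)) = {1..n}} :: ((nat btree \<Rightarrow>\<^sub>0 'k) set list \<Rightarrow>\<^sub>0 'k) set set"
  have S: "?S = (\<lambda>G. wcls n r (sng G)) ` MF {1..n} r"
    using wedge_bracketing_wcls[of _ n r] by (auto simp: MF_def image_def)
  have c: "carrier (wedge_lie2 n r) = module_span ?E ?S" by (simp add: wedge_lie2_def)
  have "submodule (wcls n r ` (MFsp n r :: (_ \<Rightarrow>\<^sub>0 'k) set)) field_ring ?E"
  proof -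
    have "wcls n r ` (MFsp n r :: (_ \<Rightarrow>\<^sub>0 'k) set) = cos (ext_kernel r (lie2 {1..n})) ` (tup {1..n} r ` MFsp n r)"
      by (simp add: wcls_def image_image)
    moreover have "pm.subspace (tup {1..n} r ` (MFsp n r :: (_ \<Rightarrow>\<^sub>0 'k) set))"
      by (rule subspace_lin_image[OF lin_tup subspace_keys])
    moreover have "tup {1..n} r ` (MFsp n r :: (_ \<Rightarrow>\<^sub>0 'k) set) \<subseteq> carrier (tuple_module r (lie2 {1..n}))"
      by (rule image_subsetI) (rule tup_carrier)
    ultimately show ?thesis unfolding ext_power_def
      using submodule_cos_image[OF pm_module_tuple subspace_ext_kernel] by metis
  qed
  moreover have "?S \<subseteq> wcls n r ` MFsp n r" unfolding S by auto
  ultimately have 1: "module_span ?E ?S \<subseteq> wcls n r ` MFsp n r" unfolding module_span_def by blast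
  have "wcls n r f \<in> H" if H: "submodule H field_ring ?E" "?S \<subseteq> H" and f: "f \<in> MFsp n r" for H and f :: "_ \<Rightarrow>\<^sub>0 'k"
  proof -
    have sg: "subgroup H (add_monoid ?E)" using H(1) by (rule submodule.axioms(1))
    have V: "pm.subspace {f. wcls n r f \<in> H}"
    proof (rule pm.subspaceI, unfold mem_Collect_eq)
      show "wcls n r 0 \<in> H" using subgroup.one_closed[OF sg] by (simp only: monoid.simps wcls_ops(3))
      fix x y :: "_ \<Rightarrow>\<^sub>0 'k"
      assume x: "wcls n r x \<in> H"
      show "wcls n r (scale c x) \<in> H" for c
        using submodule.smult_closed[OF H(1), of c "wcls n r x"] x unfolding wcls_ops(2) by (simp add: field_ring_def)
      assume y: "wcls n r y \<in> H"
      show "wcls n r (x + y) \<in> H"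
        using subgroup.m_closed[OF sg x y] by (simp only: monoid.simps wcls_ops(1))
    qed
    have "f \<in> {f. wcls n r f \<in> H}"
    proof (rule lin_in_subspace[OF lin_id V])
      fix G assume "G \<in> Poly_Mapping.keys f"
      then have "G \<in> MF {1..n} r" using f by auto
      then show "sng G \<in> {f. wcls n r f \<in> H}" using H(2) unfolding S by auto
    qed
    then show ?thesis by simp
  qed
  then have "wcls n r ` MFsp n r \<subseteq> module_span ?E ?S" unfolding module_span_def by blast
  with 1 c show ?thesis by blast
qed

lemma wedge_ops:
  "wcls n r f \<oplus>\<^bsub>wedge_lie2 n r\<^esub> wcls n r g = wcls n r (f + g)"
  "a \<odot>\<^bsub>wedge_lie2 n r\<^esub> wcls n r f = wcls n r (scale a f)"
  using wcls_ops(1)[where n = n and r = r and f = f and g = g] wcls_ops(2)[where n = n and r = r and a = a and f = f]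
  by (simp_all add: wedge_lie2_def)

section \<open>Substitution of letters\<close>

lemma leaf_word_map_btree: "leaf_word (map_btree g t) = map g (leaf_word t)"
  by (induction t) auto

lemma ninternal_map_btree: "ninternal (map_btree g t) = ninternal t"
  by (induction t) auto

lemma tree_sgn_map_btree: "tree_sgn (map_btree g t) = tree_sgn t"
  by (induction t) (auto simp: ninternal_map_btree)

lemma forest_word_map: "forest_word (map (map_btree g) G) = map g (forest_word G)"
  by (simp add: map_concat leaf_word_map_btree o_def)

lemma forest_sgn_map: "forest_sgn (map (map_btree g) G) = forest_sgn G"
  by (induction G) (simp_all add: forest_sgn_Nil forest_sgn_Cons tree_sgn_map_btree o_def ninternal_map_btree)

lemma MF_map:
  assumes "\<tau> permutes X" "G \<in> MF X r"
  shows "map (map_btree \<tau>) G \<in> MF X r"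
  using assms permutes_inj[OF assms(1)] permutes_image[OF assms(1)]
  unfolding MF_def mem_Collect_eq forest_word_map by (auto simp: distinct_map inj_on_def inj_def)

lemma gsgn_map:
  assumes "\<tau> permutes {1..n}" "G \<in> MF {1..n} r"
  shows "gsgn (map (map_btree \<tau>) G) = sign \<tau> * gsgn G"
  using isgn_map_permutes[OF assms(1), of "forest_word G"] assms(2)
  unfolding gsgn_def forest_word_map forest_sgn_map by (simp add: MF_def)

lemma push_map_inverse:
  assumes "\<tau> permutes X"
  shows "push (map_btree \<tau>) (push (map_btree (Hilbert_Choice.inv \<tau>)) f) = f"
proof -
  have "map_btree \<tau> \<circ> map_btree (Hilbert_Choice.inv \<tau>) = id"
    by (rule ext) (simp add: btree.map_comp permutes_inv_o(1)[OF assms] btree.map_id)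
  then show ?thesis by (simp add: push_push)
qed

lemma push_bracket:
  "push (map_btree \<tau>) (free_bracket c f g) = free_bracket c (push (map_btree \<tau>) f) (push (map_btree \<tau>) g)"
  by (simp add: free_bracket_def push_lin_ext lin_ext_push push_push o_def)

lemma push_free_alg:
  assumes "\<tau> permutes X" "f \<in> carrier (free_alg X)"
  shows "push (map_btree \<tau>) f \<in> carrier (free_alg X)"
proof -
  have "set (leaf_word (map_btree \<tau> T)) \<subseteq> X" if "set (leaf_word T) \<subseteq> X" for T
    using that permutes_in_image[OF assms(1)] by (auto simp: leaf_word_map_btree)
  then show ?thesis using push_keys[of "map_btree \<tau>" f] assms(2) unfolding carrier_free_alg by blast
qed

lemma push_lie_relations:
  assumes t: "\<tau> permutes X" and r: "r \<in> lie_relations X"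
  shows "push (map_btree \<tau>) r \<in> (lie_relations X :: (_ \<Rightarrow>\<^sub>0 'k::field) set)"
proof -
  let ?p = "push (map_btree \<tau>) :: (_ \<Rightarrow>\<^sub>0 'k) \<Rightarrow> _"
  note add = lin_add[OF lin_push] and cl = push_free_alg[OF t]
  consider c x y where "r = free_bracket c x y + free_bracket c y x"
      "x \<in> carrier (free_alg X)" "y \<in> carrier (free_alg X)"
    | c x y z where "r = free_bracket c x (free_bracket c y z) + free_bracket c z (free_bracket c x y)
        + free_bracket c y (free_bracket c z x)"
        "x \<in> carrier (free_alg X)" "y \<in> carrier (free_alg X)" "z \<in> carrier (free_alg X)"
    | x y z where "r = free_bracket Blue x (free_bracket Red y z) + free_bracket Blue z (free_bracket Red x y)
        + free_bracket Blue y (free_bracket Red z x) + free_bracket Red x (free_bracket Blue y z)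
        + free_bracket Red z (free_bracket Blue x y) + free_bracket Red y (free_bracket Blue z x)"
        "x \<in> carrier (free_alg X)" "y \<in> carrier (free_alg X)" "z \<in> carrier (free_alg X)"
    using r unfolding lie_relations_def by blast
  then show ?thesis
  proof cases
    case 1
    show ?thesis unfolding lie_relations_def 1(1) add push_bracket
      by (rule UnI1, rule UnI1, rule CollectI, intro exI conjI, rule refl, (rule cl, fact)+)
  next
    case 2
    show ?thesis unfolding lie_relations_def 2(1) add push_bracket
      by (rule UnI1, rule UnI2, rule CollectI, intro exI conjI, rule refl, (rule cl, fact)+)
  next
    case 3
    show ?thesis unfolding lie_relations_def 3(1) add push_bracket
      by (rule UnI2, rule CollectI, intro exI conjI, rule refl, (rule cl, fact)+)
  qed
qed

text \<open>The preimage of the ideal under a substitution is again a closed ideal and hence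
  contains the least one.\<close>

lemma push_lie_ideal:
  assumes t: "\<tau> permutes X" and f: "f \<in> lie_ideal X"
  shows "push (map_btree \<tau>) f \<in> (lie_ideal X :: (_ \<Rightarrow>\<^sub>0 'k::field) set)"
proof -
  let ?p = "push (map_btree \<tau>) :: (_ \<Rightarrow>\<^sub>0 'k) \<Rightarrow> _"
  let ?J = "carrier (free_alg X) \<inter> {f. ?p f \<in> lie_ideal X}"
  have "closed_ideal X ?J" unfolding closed_ideal_def
  proof (intro conjI allI ballI)
    show "pm.subspace ?J"
      by (intro pm.subspace_inter pm_moduleD(4) pm_module_free_alg subspace_lin_vimage[OF lin_push subspace_lie_ideal])
    show "?J \<subseteq> carrier (free_alg X)" by blast
    show "lie_relations X \<subseteq> ?J" using lie_relations_subset push_lie_relations[OF t] lie_ideal_relations by blast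
    fix c and x y :: "_ \<Rightarrow>\<^sub>0 'k" assume x: "x \<in> carrier (free_alg X)" and y: "y \<in> ?J"
    then have y': "y \<in> carrier (free_alg X)" "?p y \<in> lie_ideal X" by auto
    show "free_bracket c x y \<in> ?J" "free_bracket c y x \<in> ?J"
      using free_bracket_closed[OF x y'(1), of c] free_bracket_closed[OF y'(1) x, of c]
        lie_ideal_bracket[OF push_free_alg[OF t x] y'(2), of c]
      by (auto simp: push_bracket)
  qed
  from lie_ideal_minimal[OF this] f show ?thesis by blast
qed

text \<open>The action takes images of cosets. Equality, obtained with the inverse permutation, is
  what makes the image of a coset a full coset.\<close>

lemma push_lie_ideal_image:
  assumes t: "\<tau> permutes X"
  shows "push (map_btree \<tau>) ` lie_ideal X = (lie_ideal X :: (_ \<Rightarrow>\<^sub>0 'k::field) set)"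
proof (rule subset_antisym)
  show "push (map_btree \<tau>) ` lie_ideal X \<subseteq> (lie_ideal X :: (_ \<Rightarrow>\<^sub>0 'k) set)"
    using push_lie_ideal[OF t] by (rule image_subsetI)
  show "lie_ideal X \<subseteq> push (map_btree \<tau>) ` (lie_ideal X :: (_ \<Rightarrow>\<^sub>0 'k) set)"
  proof
    fix f :: "_ \<Rightarrow>\<^sub>0 'k" assume "f \<in> lie_ideal X"
    from push_lie_ideal[OF permutes_inv[OF t] this]
    show "f \<in> push (map_btree \<tau>) ` lie_ideal X"
      using push_map_inverse[OF t, of f] by (metis imageI)
  qed
qed

lemma lin_cos_image: "lin h \<Longrightarrow> h ` cos U x = cos (h ` U) (h x)"
  by (simp add: cos_def image_image lin_add)

lemma push_lie2_cos:
  assumes "\<tau> permutes X"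
  shows "push (map_btree \<tau>) ` cos (lie_ideal X) x = cos (lie_ideal X) (push (map_btree \<tau>) x :: _ \<Rightarrow>\<^sub>0 'k::field)"
  by (simp add: lin_cos_image push_lie_ideal_image[OF assms])

lemma push_lie2:
  assumes t: "\<tau> permutes X" and A: "A \<in> carrier (lie2 X)" and B: "B \<in> carrier (lie2 X)"
  shows "push (map_btree \<tau>) ` A \<in> carrier (lie2 X)"
    "push (map_btree \<tau>) ` (A \<oplus>\<^bsub>lie2 X\<^esub> B) = push (map_btree \<tau>) ` A \<oplus>\<^bsub>lie2 X\<^esub> push (map_btree \<tau>) ` B"
    "push (map_btree \<tau>) ` (a \<odot>\<^bsub>lie2 X\<^esub> A) = a \<odot>\<^bsub>lie2 X\<^esub> push (map_btree \<tau>) ` (A :: (_ \<Rightarrow>\<^sub>0 'k::field) set)"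
proof -
  obtain x y where x: "x \<in> carrier (free_alg X)" "A = cos (lie_ideal X) x"
    and y: "B = cos (lie_ideal X) y" using A B unfolding carrier_lie2 by blast
  show "push (map_btree \<tau>) ` A \<in> carrier (lie2 X)"
    unfolding x(2) push_lie2_cos[OF t] carrier_lie2 using push_free_alg[OF t x(1)] by blast
  show "push (map_btree \<tau>) ` (A \<oplus>\<^bsub>lie2 X\<^esub> B) = push (map_btree \<tau>) ` A \<oplus>\<^bsub>lie2 X\<^esub> push (map_btree \<tau>) ` B"
    unfolding x(2) y push_lie2_cos[OF t] add_lie2 lin_add[OF lin_push] ..
  show "push (map_btree \<tau>) ` (a \<odot>\<^bsub>lie2 X\<^esub> A) = a \<odot>\<^bsub>lie2 X\<^esub> push (map_btree \<tau>) ` A"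
    unfolding x(2) push_lie2_cos[OF t] smult_lie2 lin_scale[OF lin_push] ..
qed

abbreviation tpush :: "(nat \<Rightarrow> nat) \<Rightarrow> ((nat btree \<Rightarrow>\<^sub>0 'k::field) set list \<Rightarrow>\<^sub>0 'k) \<Rightarrow> ((nat btree \<Rightarrow>\<^sub>0 'k) set list \<Rightarrow>\<^sub>0 'k)" where
  "tpush \<tau> \<equiv> push (map (\<lambda>B. push (map_btree \<tau>) ` B))"

lemma tpush_ext_relations:
  fixes g :: "(nat btree \<Rightarrow>\<^sub>0 'k::field) set list \<Rightarrow>\<^sub>0 'k"
  assumes t: "\<tau> permutes X" and g: "g \<in> ext_relations r (lie2 X)"
  shows "tpush \<tau> g \<in> ext_relations r (lie2 X)"
proof -
  let ?q = "\<lambda>B :: (nat btree \<Rightarrow>\<^sub>0 'k) set. push (map_btree \<tau>) ` B" and ?V = "lie2 X :: ('k, (nat btree \<Rightarrow>\<^sub>0 'k) set) module"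
  have cl: "set (map ?q xs) \<subseteq> carrier ?V" if "set xs \<subseteq> carrier ?V" for xs
    using that push_lie2(1)[OF t] by auto
  consider xs i x y where "g = sng (xs[i := x \<oplus>\<^bsub>?V\<^esub> y]) - sng (xs[i := x]) - sng (xs[i := y])"
      "length xs = r" "set xs \<subseteq> carrier ?V" "i < r" "x \<in> carrier ?V" "y \<in> carrier ?V"
    | xs i a x where "g = sng (xs[i := a \<odot>\<^bsub>?V\<^esub> x]) - Poly_Mapping.single (xs[i := x]) a"
      "length xs = r" "set xs \<subseteq> carrier ?V" "i < r" "x \<in> carrier ?V"
    | xs where "g = sng xs" "length xs = r" "set xs \<subseteq> carrier ?V" "\<exists>i j. i < j \<and> j < r \<and> xs ! i = xs ! j"
    using g unfolding ext_relations_def by blast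
  then show ?thesis
  proof cases
    case 1
    have eq: "tpush \<tau> g = sng ((map ?q xs)[i := ?q x \<oplus>\<^bsub>?V\<^esub> ?q y]) - sng ((map ?q xs)[i := ?q x]) - sng ((map ?q xs)[i := ?q y])"
      unfolding 1(1) lin_diff[OF lin_push] push_single map_update push_lie2(2)[OF t 1(5,6)] ..
    have len: "length (map ?q xs) = r" using 1(2) by simp
    show ?thesis unfolding ext_relations_def
      by (rule UnI1, rule UnI1, rule CollectI, intro exI conjI, rule eq, rule len, rule cl[OF 1(3)], rule 1(4),
          rule push_lie2(1)[OF t 1(5,5)], rule push_lie2(1)[OF t 1(6,6)])
  next
    case 2
    have eq: "tpush \<tau> g = sng ((map ?q xs)[i := a \<odot>\<^bsub>?V\<^esub> ?q x]) - Poly_Mapping.single ((map ?q xs)[i := ?q x]) a"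
      unfolding 2(1) lin_diff[OF lin_push] push_single map_update push_lie2(3)[OF t 2(5,5)] ..
    have len: "length (map ?q xs) = r" using 2(2) by simp
    show ?thesis unfolding ext_relations_def
      by (rule UnI1, rule UnI2, rule CollectI, intro exI conjI, rule eq, rule len, rule cl[OF 2(3)], rule 2(4),
          rule push_lie2(1)[OF t 2(5,5)])
  next
    case 3
    obtain i j where ij: "i < j" "j < r" "xs ! i = xs ! j" using 3(4) by blast
    have e: "map ?q xs ! i = map ?q xs ! j" using ij 3(2) by simp
    have len: "length (map ?q xs) = r" and eq: "tpush \<tau> g = sng (map ?q xs)" using 3(1,2) by simp_all
    show ?thesis unfolding ext_relations_def
      by (rule UnI2, rule CollectI, intro exI conjI, rule eq, rule len, rule cl[OF 3(3)], rule ij(1), rule ij(2), rule e)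
  qed
qed

lemma tpush_inverse:
  assumes "\<tau> permutes X"
  shows "tpush \<tau> (tpush (Hilbert_Choice.inv \<tau>) f) = (f :: _ \<Rightarrow>\<^sub>0 'k::field)"
proof -
  have "map (\<lambda>B. push (map_btree \<tau>) ` B) \<circ> map (\<lambda>B. push (map_btree (Hilbert_Choice.inv \<tau>)) ` B) =
    (id :: (nat btree \<Rightarrow>\<^sub>0 'k) set list \<Rightarrow> _)"
    by (rule ext) (simp add: image_image push_map_inverse[OF assms] o_def)
  then show ?thesis by (simp add: push_push)
qed

lemma tpush_ext_kernel:
  assumes t: "\<tau> permutes X" and f: "f \<in> ext_kernel r (lie2 X)"
  shows "tpush \<tau> f \<in> ext_kernel r (lie2 X :: ('k::field, _) module)"
proof (rule lin_span_subset[OF lin_push subspace_ext_kernel _ f[unfolded ext_kernel_eq]])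
  fix g :: "(nat btree \<Rightarrow>\<^sub>0 'k) set list \<Rightarrow>\<^sub>0 'k" assume "g \<in> ext_relations r (lie2 X)"
  from pm.span_base[OF tpush_ext_relations[OF t this]] show "tpush \<tau> g \<in> ext_kernel r (lie2 X)"
    unfolding ext_kernel_eq .
qed

lemma tpush_ext_kernel_image:
  assumes t: "\<tau> permutes X"
  shows "tpush \<tau> ` ext_kernel r (lie2 X) = ext_kernel r (lie2 X :: ('k::field, _) module)"
proof (rule subset_antisym)
  show "tpush \<tau> ` ext_kernel r (lie2 X) \<subseteq> ext_kernel r (lie2 X :: ('k, _) module)"
    using tpush_ext_kernel[OF t] by (rule image_subsetI)
  show "ext_kernel r (lie2 X) \<subseteq> tpush \<tau> ` ext_kernel r (lie2 X :: ('k, _) module)"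
  proof
    fix f :: "(nat btree \<Rightarrow>\<^sub>0 'k) set list \<Rightarrow>\<^sub>0 'k" assume "f \<in> ext_kernel r (lie2 X)"
    from tpush_ext_kernel[OF permutes_inv[OF t] this]
    show "f \<in> tpush \<tau> ` ext_kernel r (lie2 X)" using tpush_inverse[OF t, of f] by (metis imageI)
  qed
qed

lemma tpush_tup:
  assumes t: "\<tau> permutes {1..n}" and f: "f \<in> MFsp n r"
  shows "tpush \<tau> (tup {1..n} r f) = tup {1..n} r (push (map (map_btree \<tau>)) f :: _ \<Rightarrow>\<^sub>0 'k::field)"
proof (rule lin_eqI[OF lin_comp[OF lin_push lin_tup] lin_comp[OF lin_tup lin_push]])
  fix G assume "G \<in> Poly_Mapping.keys f"
  then have G: "G \<in> MF {1..n} r" using f by auto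
  have "map (\<lambda>B. push (map_btree \<tau>) ` B) (map (bracketing {1..n}) G) =
    map (bracketing {1..n} :: _ \<Rightarrow> (_ \<Rightarrow>\<^sub>0 'k) set) (map (map_btree \<tau>) G)"
  proof (simp, intro ballI)
    fix T assume T: "T \<in> set G"
    have 1: "set (leaf_word T) \<subseteq> {1..n}" by (rule MF_leaf_word[OF G T])
    have 2: "set (leaf_word (map_btree \<tau> T)) \<subseteq> {1..n}"
      by (rule MF_leaf_word[OF MF_map[OF t G]]) (use T in simp)
    show "push (map_btree \<tau>) ` bracketing {Suc 0..n} T = (bracketing {Suc 0..n} (map_btree \<tau> T) :: (_ \<Rightarrow>\<^sub>0 'k) set)"
      using bracketing_eq[OF 1, where ?'b = 'k] bracketing_eq[OF 2, where ?'b = 'k] push_lie2_cos[OF t, of "sng T :: _ \<Rightarrow>\<^sub>0 'k"] by simp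
  qed
  then show "tpush \<tau> (tup {1..n} r (sng G)) = tup {1..n} r (push (map (map_btree \<tau>)) (sng G) :: _ \<Rightarrow>\<^sub>0 'k)"
    using G MF_map[OF t G] by (simp add: tup_sng del: map_map)
qed

lemma wedge_act_wcls:
  assumes t: "\<tau> permutes {1..n}" and f: "f \<in> MFsp n r"
  shows "wedge_lie2_act \<tau> (wcls n r f) = wcls n r (push (map (map_btree \<tau>)) f :: _ \<Rightarrow>\<^sub>0 'k::field)"
  unfolding wedge_lie2_act_def wcls_def lin_cos_image[OF lin_push] tpush_ext_kernel_image[OF t] tpush_tup[OF t f] ..

lemma push_MFsp:
  assumes t: "\<tau> permutes {1..n}" and f: "f \<in> MFsp n r"
  shows "push (map (map_btree \<tau>)) f \<in> (MFsp n r :: (_ \<Rightarrow>\<^sub>0 'k::field) set)"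
  using push_keys[of "map (map_btree \<tau>)" f] f MF_map[OF t] by blast

section \<open>Labelled forests\<close>

lemma leaf_word_label: "length w = nleaves T \<Longrightarrow> leaf_word (label T w) = w"
proof (induction T arbitrary: w)
  case (Leaf a)
  then show ?case by (cases w) auto
next
  case (Node c l r)
  then show ?case by simp
qed

lemma ninternal_label: "ninternal (label T w) = ninternal T"
  by (induction T arbitrary: w) auto

lemma tree_sgn_label: "tree_sgn (label T w) = tree_sgn T"
  by (induction T arbitrary: w) (auto simp: ninternal_label)

lemma length_label_forest: "length (label_forest F w) = length F"
  by (induction F arbitrary: w) auto

lemma forest_word_label: "length w = (\<Sum>T\<leftarrow>F. nleaves T) \<Longrightarrow> forest_word (label_forest F w) = w"
  by (induction F arbitrary: w) (simp_all add: leaf_word_label)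

lemma sum_ninternal_label: "sum_list (map ninternal (label_forest F w)) = sum_list (map ninternal F)"
  by (induction F arbitrary: w) (simp_all add: ninternal_label)

lemma forest_sgn_label: "forest_sgn (label_forest F w) = forest_sgn F"
  by (induction F arbitrary: w) (simp_all add: forest_sgn_Nil forest_sgn_Cons tree_sgn_label sum_ninternal_label)

lemma nleaves_map_btree: "nleaves (map_btree g t) = nleaves t"
  by (simp add: leaf_word_map_btree)

lemma label_erase: "label (map_btree g T) (leaf_word T) = T"
  by (induction T) (simp_all add: nleaves_map_btree)

lemma label_forest_erase: "label_forest (map (map_btree g) G) (forest_word G) = G"
  by (induction G) (simp_all add: nleaves_map_btree label_erase)

text \<open>The leaf word is the one-line notation of \<open>\<sigma>\<close>, so its inversion
  parity is \<open>sign \<sigma>\<close>, and labelling leaves the sign of the forest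
  unchanged.\<close>

lemma labelled_MF:
  assumes "(F, \<sigma>) \<in> BF n r"
  shows "labelled n F \<sigma> \<in> MF {1..n} r" "gsgn (labelled n F \<sigma>) = sign \<sigma> * forest_sgn F"
proof -
  have F: "length F = r" "(\<Sum>T\<leftarrow>F. nleaves T) = n" and s: "\<sigma> permutes {1..n}"
    using assms by (auto simp: BF_def)
  have w: "forest_word (labelled n F \<sigma>) = map \<sigma> [1..<Suc n]"
    unfolding labelled_def by (rule forest_word_label) (simp add: F(2) del: upt_Suc)
  have set: "set [1..<Suc n] = {1..n}" by auto
  have "distinct (map \<sigma> [1..<Suc n])" "set (map \<sigma> [1..<Suc n]) = {1..n}"
    using permutes_inj_on[OF s] permutes_image[OF s] unfolding set_map set by (simp_all add: distinct_map del: upt_Suc)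
  then show "labelled n F \<sigma> \<in> MF {1..n} r"
    unfolding MF_def mem_Collect_eq w by (simp add: labelled_def length_label_forest F(1) del: upt_Suc)
  have 1: "isgn (forest_word (labelled n F \<sigma>)) = sign \<sigma>"
    unfolding w isgn_map_permutes[OF s distinct_upt set] isgn_sorted[OF sorted_wrt_upt] by (rule mult_1_right)
  have 2: "forest_sgn (labelled n F \<sigma>) = forest_sgn F"
    unfolding labelled_def by (rule forest_sgn_label)
  show "gsgn (labelled n F \<sigma>) = sign \<sigma> * forest_sgn F" unfolding gsgn_def 1 2 ..
qed

text \<open>The leaf word, read as values at 1, ..., n and continued by the identity, is the
  permutation. Hence the values prescribed on \<open>BF n r\<close> cover all generators, which
  gives uniqueness.\<close>

lemma MF_labelled:
  assumes G: "G \<in> MF {1..n} r"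
  shows "\<exists>F \<sigma>. (F, \<sigma>) \<in> BF n r \<and> labelled n F \<sigma> = G"
proof -
  define w where "w = forest_word G"
  have w: "distinct w" "set w = {1..n}" "length G = r" using G by (auto simp: MF_def w_def)
  have len: "length w = n" using distinct_card[OF w(1)] w(2) by simp
  define \<sigma> where "\<sigma> i = (if i \<in> {1..n} then w ! (i - 1) else i)" for i
  have "bij_betw (\<lambda>i. w ! (i - 1)) {1..n} {1..n}"
  proof -
    have 1: "bij_betw (\<lambda>i. i - 1) {1..n} {..<n}" by (rule bij_betwI[where g = Suc]) auto
    have 2: "bij_betw ((!) w) {..<n} {1..n}" by (rule bij_betw_nth) (simp_all add: w len)
    from bij_betw_trans[OF 1 2] show ?thesis by (simp add: o_def)
  qed
  moreover have "bij_betw \<sigma> {1..n} {1..n} \<longleftrightarrow> bij_betw (\<lambda>i. w ! (i - 1)) {1..n} {1..n}"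
    by (rule bij_betw_cong) (simp add: \<sigma>_def)
  ultimately have "bij_betw \<sigma> {1..n} {1..n}" by blast
  then have s: "\<sigma> permutes {1..n}" by (rule bij_imp_permutes) (auto simp: \<sigma>_def)
  have m: "map \<sigma> [1..<Suc n] = w"
    by (rule nth_equalityI) (simp_all add: len \<sigma>_def del: upt_Suc)
  let ?F = "map (map_btree (\<lambda>_. ())) G"
  have "(\<Sum>T\<leftarrow>?F. nleaves T) = n"
    using len unfolding w_def by (simp add: length_concat nleaves_map_btree o_def)
  then have "(?F, \<sigma>) \<in> BF n r" using w(3) s by (simp add: BF_def)
  moreover have "labelled n ?F \<sigma> = G" unfolding labelled_def m w_def by (rule label_forest_erase)
  ultimately show ?thesis by blast
qed

section \<open>The symmetric group acts on weighted partitions\<close>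

abbreviation bact :: "(nat \<Rightarrow> nat) \<Rightarrow> nat set \<times> nat \<Rightarrow> nat set \<times> nat" where
  "bact \<tau> x \<equiv> (\<tau> ` fst x, snd x)"

lemma wp_act_eq: "wp_act \<tau> p = bact \<tau> ` p"
  by (simp add: wp_act_def case_prod_beta)

lemma inj_bact: "inj \<tau> \<Longrightarrow> inj (bact \<tau>)"
  by (rule injI) (simp add: prod_eq_iff inj_image_eq_iff)

lemma wp_act_comp: "wp_act \<sigma> (wp_act \<tau> p) = wp_act (\<sigma> \<circ> \<tau>) p"
  by (simp add: wp_act_eq image_image image_comp o_def)

lemma wp_act_id: "wp_act id p = p"
  by (simp add: wp_act_eq)

lemma wp_act_inverse:
  assumes "\<tau> permutes X"
  shows "wp_act \<tau> (wp_act (Hilbert_Choice.inv \<tau>) p) = p" "wp_act (Hilbert_Choice.inv \<tau>) (wp_act \<tau> p) = p"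
  unfolding wp_act_comp permutes_inv_o[OF assms] wp_act_id by (rule refl)+

lemma inj_wp_act: "inj \<tau> \<Longrightarrow> inj (wp_act \<tau>)"
  by (rule injI) (simp add: wp_act_eq inj_image_eq_iff[OF inj_bact])

lemma filter_image_set: "{x \<in> f ` A. P x} = f ` {x \<in> A. P (f x)}"
  by auto

lemma below_act: "inj \<tau> \<Longrightarrow> below (wp_act \<tau> p) (\<tau> ` D) = bact \<tau> ` below p D"
  unfolding below_def wp_act_eq filter_image_set fst_conv by (simp add: inj_image_subset_iff)

text \<open>An injective relabelling preserves containment, counts and weight sums, through which
  the order is expressed.\<close>

lemma wp_le_act:
  assumes "inj \<tau>"
  shows "wp_le (wp_act \<tau> p) (wp_act \<tau> q) \<longleftrightarrow> wp_le p q"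
proof -
  have c: "cnt (wp_act \<tau> p) (\<tau> ` D) = cnt p D" for D
    unfolding below_act[OF assms] by (rule card_image[OF inj_on_subset[OF inj_bact[OF assms]]]) simp
  have s: "wsum (wp_act \<tau> p) (\<tau> ` D) = wsum p D" for D
    unfolding wsum_def below_act[OF assms]
    by (subst sum.reindex[OF inj_on_subset[OF inj_bact[OF assms]]]) simp_all
  show ?thesis
    unfolding wp_le_iff slack_def wp_act_eq[of \<tau> q]
    by (simp add: c s) (simp add: wp_act_eq inj_image_subset_iff[OF assms])
qed

lemma wlt_act: "inj \<tau> \<Longrightarrow> wlt (wp_act \<tau> p) (wp_act \<tau> q) \<longleftrightarrow> wlt p q"
  by (simp add: strict_def wp_le_act inj_eq[OF inj_wp_act])

lemma wp_act_in:
  assumes t: "\<tau> permutes {1..n}" and p: "p \<in> wpartitions n"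
  shows "wp_act \<tau> p \<in> wpartitions n"
proof (rule wpartitionsI)
  note inj = permutes_inj[OF t] and D = wpartitionsD[OF p]
  fix x assume "x \<in> wp_act \<tau> p"
  then obtain a where a: "a \<in> p" "x = bact \<tau> a" by (auto simp: wp_act_eq)
  show "fst x \<noteq> {}" using D(2)[OF a(1)] a(2) by simp
  show "fst x \<subseteq> {1..n}" using image_mono[OF D(4)[OF a(1)], of \<tau>] permutes_image[OF t] a(2) by simp
  show "snd x < card (fst x)"
    using D(7)[OF a(1)] a(2) card_image[OF inj_on_subset[OF inj, of "fst a"]] by simp
  fix y i assume "y \<in> wp_act \<tau> p" and i: "i \<in> fst x" "i \<in> fst y"
  then obtain b where b: "b \<in> p" "y = bact \<tau> b" by (auto simp: wp_act_eq)
  obtain j where "j \<in> fst a" "j \<in> fst b" using i inj_eq[OF inj] unfolding a(2) b(2) by auto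
  from D(5)[OF a(1) b(1) this] show "x = y" using a b by simp
next
  fix i assume "i \<in> {1..n}"
  then obtain j where "j \<in> {1..n}" "i = \<tau> j" using permutes_image[OF t] by blast
  then show "\<exists>x\<in>wp_act \<tau> p. i \<in> fst x" using wpartitionsD(6)[OF p, of j] by (auto simp: wp_act_eq)
qed

lemma wp_act_bot:
  assumes t: "\<tau> permutes {1..n}"
  shows "wp_act \<tau> (wp_bot n) = wp_bot n"
proof -
  have "wp_act \<tau> (wp_bot n) = (\<lambda>i. ({i}, 0)) ` \<tau> ` {1..n}" by (simp add: wp_act_eq wp_bot_def image_image)
  then show ?thesis unfolding permutes_image[OF t] wp_bot_def .
qed

lemma wt_act: "inj \<tau> \<Longrightarrow> wt (wp_act \<tau> P) (\<tau> ` A) = wt P A"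
proof -
  assume t: "inj \<tau>"
  have "(\<tau> ` A, v) \<in> wp_act \<tau> P \<longleftrightarrow> (A, v) \<in> P" for v
    unfolding wp_act_eq using inj_image_mem_iff[OF inj_bact[OF t], of "(A, v)" P] by simp
  then show ?thesis by (simp add: wt_def)
qed

lemma merge_act:
  assumes t: "inj \<tau>"
  shows "merge u (\<tau> ` A) (\<tau> ` B) (wp_act \<tau> P) = wp_act \<tau> (merge u A B P)"
proof -
  have "{(C, v) \<in> wp_act \<tau> P. C \<noteq> \<tau> ` A \<and> C \<noteq> \<tau> ` B} = bact \<tau> ` {(C, v) \<in> P. C \<noteq> A \<and> C \<noteq> B}"
    by (force simp: wp_act_eq inj_image_eq_iff[OF t])
  then show ?thesis by (simp add: merge_def wt_act[OF t]) (simp add: wp_act_eq image_Un)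
qed

abbreviation sact :: "(nat \<Rightarrow> nat) \<Rightarrow> color \<times> nat set \<times> nat set \<Rightarrow> color \<times> nat set \<times> nat set" where
  "sact \<tau> s \<equiv> (case s of (c, A, B) \<Rightarrow> (c, \<tau> ` A, \<tau> ` B))"

lemma merge_chain_act:
  assumes t: "inj \<tau>"
  shows "merge_chain (wp_act \<tau> p) (map (sact \<tau>) w) = map (wp_act \<tau>) (merge_chain p w)"
  by (induction w arbitrary: p) (auto simp: do_step_def merge_act[OF t] split: prod.splits)

lemma postorder_map_btree: "postorder (map_btree \<tau> T) = map (sact \<tau>) (postorder T)"
proof -
  have "leaf_word (map_btree \<tau> t) = map \<tau> (leaf_word t)" for t by (induction t) auto
  then show ?thesis by (induction T) auto
qed

lemma po_map: "po (map (map_btree \<tau>) G) = map (sact \<tau>) (po G)"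
  by (induction G) (simp_all add: postorder_map_btree)

lemma wchain_map:
  assumes "\<tau> permutes {1..n}"
  shows "wchain n (po (map (map_btree \<tau>) G)) = map (wp_act \<tau>) (wchain n (po G))"
  unfolding po_map using merge_chain_act[OF permutes_inj[OF assms], of "wp_bot n" "po G"] wp_act_bot[OF assms] by simp

section \<open>Cohomology of the lower intervals\<close>

abbreviation ivl0 :: "nat \<Rightarrow> wpartition \<Rightarrow> wpartition set" where
  "ivl0 n y \<equiv> open_interval (wpartitions n) wp_le (wp_bot n) y"

text \<open>With \<open>Cc\<close> this gives coboundaries and cocycles of the summand at
  \<open>y\<close>, the degenerate interval at the minimum included; \<open>m\<close> is the Whitney
  degree, so cochains have degree \<open>m - 2\<close>.\<close>

definition Zc :: "nat \<Rightarrow> nat \<Rightarrow> wpartition \<Rightarrow> (wpartition list \<Rightarrow>\<^sub>0 'k::field) set" where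
  "Zc n m y = (if y = wp_bot n then {0}
    else coboundary (ivl0 n y) wp_le ` carrier (cochains (ivl0 n y) wp_le (int m - 2 - 1)))"

definition Cc :: "nat \<Rightarrow> nat \<Rightarrow> wpartition \<Rightarrow> (wpartition list \<Rightarrow>\<^sub>0 'k::field) set" where
  "Cc n m y = (if y = wp_bot n then carrier (free_module (if m = 0 then {[]} else {}))
    else {f \<in> carrier (cochains (ivl0 n y) wp_le (int m - 2)). coboundary (ivl0 n y) wp_le f = 0})"

lemma lin_coboundary [simp]: "lin (coboundary P leq)"
  by (simp add: coboundary_def)

lemma pm_module_cochains [simp]: "pm_module (cochains P leq j)"
  by (simp add: cochains_def)

lemma subspace_Zc [simp]: "pm.subspace (Zc n m y)"
  unfolding Zc_def
  by (simp add: subspace_lin_image[OF lin_coboundary pm_moduleD(4)[OF pm_module_cochains]] pm.subspace_single_0)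

lemma subspace_Cc [simp]: "pm.subspace (Cc n m y :: (_ \<Rightarrow>\<^sub>0 'k::field) set)"
proof (cases "y = wp_bot n")
  case True
  then show ?thesis unfolding Cc_def using pm_moduleD(4)[OF pm_module_free] by simp
next
  case False
  have "pm.subspace (carrier (cochains (ivl0 n y) wp_le (int m - 2)) \<inter>
    {f. coboundary (ivl0 n y) wp_le f \<in> ({0} :: (_ \<Rightarrow>\<^sub>0 'k) set)})"
    by (intro pm.subspace_inter pm_moduleD(4) pm_module_cochains subspace_lin_vimage[OF lin_coboundary pm.subspace_single_0])
  moreover have "carrier (cochains (ivl0 n y) wp_le (int m - 2)) \<inter>
    {f. coboundary (ivl0 n y) wp_le f \<in> ({0} :: (_ \<Rightarrow>\<^sub>0 'k) set)} = Cc n m y"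
    using False by (auto simp: Cc_def)
  ultimately show ?thesis by simp
qed

lemma interval_cohomology_ops:
  fixes f g :: "wpartition list \<Rightarrow>\<^sub>0 'k::field" and n m y
  defines "H \<equiv> interval_cohomology (wpartitions n) wp_le (wp_bot n) y (int m - 2) :: ('k, (wpartition list \<Rightarrow>\<^sub>0 'k) set) module"
  shows "carrier H = cos (Zc n m y) ` Cc n m y" "\<zero>\<^bsub>H\<^esub> = Zc n m y"
    "cos (Zc n m y) f \<oplus>\<^bsub>H\<^esub> cos (Zc n m y) g = cos (Zc n m y) (f + g)"
    "a \<odot>\<^bsub>H\<^esub> cos (Zc n m y) f = cos (Zc n m y) (scale a f)"
proof -
  obtain M :: "('k, wpartition list \<Rightarrow>\<^sub>0 'k) module" where M: "H = quotient_module M (Zc n m y)"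
    "carrier M = Cc n m y" "add M = (+)" "smult M = scale"
  proof (cases "y = wp_bot n")
    case True
    show ?thesis
      by (rule that[of "free_module (if m = 0 then {[]} else {})"])
        (use True in \<open>simp_all add: H_def interval_cohomology_def Zc_def Cc_def free_module_def\<close>)
  next
    case False
    show ?thesis
      by (rule that[of "(cochains (ivl0 n y) wp_le (int m - 2))\<lparr>carrier :=
            {f \<in> carrier (cochains (ivl0 n y) wp_le (int m - 2)). coboundary (ivl0 n y) wp_le f = 0}\<rparr>"])
        (use False in \<open>simp_all add: H_def interval_cohomology_def reduced_cohomology_def Zc_def Cc_def
          cochains_def free_module_def\<close>)
  qed
  show "carrier H = cos (Zc n m y) ` Cc n m y" unfolding M(1) carrier_quotient[OF M(3)] M(2) ..
  show "\<zero>\<^bsub>H\<^esub> = Zc n m y" unfolding M(1) by simp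
  show "cos (Zc n m y) f \<oplus>\<^bsub>H\<^esub> cos (Zc n m y) g = cos (Zc n m y) (f + g)"
    unfolding M(1) by (rule add_quotient[OF M(3) subspace_Zc])
  show "a \<odot>\<^bsub>H\<^esub> cos (Zc n m y) f = cos (Zc n m y) (scale a f)"
    unfolding M(1) by (rule smult_quotient[OF M(3,4) subspace_Zc])
qed

text \<open>In Whitney degree \<open>m\<close> only elements of rank \<open>m\<close> contribute;
  elsewhere \<open>m - 2\<close> is not the top degree of the interval.\<close>

lemma Cc_subset_Zc:
  assumes y: "y \<in> wpartitions n" and c: "card y + m \<noteq> n"
  shows "Cc n m y \<subseteq> (Zc n m y :: (_ \<Rightarrow>\<^sub>0 'k::field) set)"
proof (cases "y = wp_bot n")
  case True
  then have "m \<noteq> 0" using c card_wp_bot by auto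
  then show ?thesis using True by (simp add: Cc_def Zc_def carrier_free)
next
  case False
  show ?thesis
  proof
    fix f :: "_ \<Rightarrow>\<^sub>0 'k" assume "f \<in> Cc n m y"
    then have "f \<in> carrier (cochains (ivl0 n y) wp_le (int m - 2))" "coboundary (ivl0 n y) wp_le f = 0"
      using False by (auto simp: Cc_def)
    from wp_coboundary_vanish[OF y False this] c show "f \<in> Zc n m y" using False by (simp add: Zc_def)
  qed
qed

text \<open>Together with \<open>full\<close> this passes between chains with end points and chains
  of the open interval. At the minimum the two end points coincide, whence the case distinction in
  \<open>full\<close>.\<close>

definition strip :: "nat \<Rightarrow> wpartition \<Rightarrow> wpartition list \<Rightarrow> wpartition list" where
  "strip n y c = filter (\<lambda>p. p \<noteq> wp_bot n \<and> p \<noteq> y) c"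

definition full :: "nat \<Rightarrow> wpartition \<Rightarrow> wpartition list \<Rightarrow> wpartition list" where
  "full n y c = (if y = wp_bot n then [y] else wp_bot n # c @ [y])"

text \<open>The component at \<open>y\<close> of a combination of chains, recognised by the last
  element.\<close>

definition Sy :: "nat \<Rightarrow> wpartition \<Rightarrow> (wpartition list \<Rightarrow>\<^sub>0 'k::field) \<Rightarrow> (wpartition list \<Rightarrow>\<^sub>0 'k)" where
  "Sy n y = lin_ext (\<lambda>c. if last c = y then sng (strip n y c) else 0)"

lemma lin_Sy [simp]: "lin (Sy n y)"
  by (simp add: Sy_def)

lemma Sy_sng: "Sy n y (sng c) = (if last c = y then sng (strip n y c) else 0)"
  by (simp add: Sy_def)

lemma wlt_irrefl: "\<not> wlt x x"
  by (simp add: strict_def)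

lemma strip_full:
  assumes "y \<noteq> wp_bot n" "set d \<subseteq> ivl0 n y"
  shows "strip n y (wp_bot n # d @ [y]) = d"
proof -
  have "filter (\<lambda>p. p \<noteq> wp_bot n \<and> p \<noteq> y) d = d"
    using assms(2) wlt_irrefl by (intro filter_True) (auto simp: open_interval_def)
  then show ?thesis by (simp add: strip_def)
qed

lemma ends_decompose:
  assumes "c \<noteq> []" "hd c = b" "last c = y" "y \<noteq> b"
  obtains d where "c = b # d @ [y]"
proof -
  obtain c' where c': "c = b # c'" using assms(1,2) by (cases c) auto
  then have "c' \<noteq> []" using assms(3,4) by auto
  then have "c' = butlast c' @ [y]" using assms(3) c' by (metis append_butlast_last_id last_ConsR)
  then show ?thesis using that c' by blast
qed

lemma sorted_full_iff:
  assumes y: "y \<in> wpartitions n" "y \<noteq> wp_bot n"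
  shows "sorted_wrt wlt (wp_bot n # d @ [y]) \<and> set d \<subseteq> wpartitions n \<longleftrightarrow> sorted_wrt wlt d \<and> set d \<subseteq> ivl0 n y"
  using wp_bot_wlt[OF y] by (auto simp: sorted_wrt_append open_interval_def)

lemma fchains_bot: "c \<in> fchains n (wp_bot n) \<longleftrightarrow> c = [wp_bot n]"
  by (cases c) (auto simp: fchains_def card_wp_bot wp_bot_in)

lemma fchains_full:
  assumes y: "y \<in> wpartitions n" "y \<noteq> wp_bot n" and c: "card y + m = n"
  shows "wp_bot n # d @ [y] \<in> fchains n y \<longleftrightarrow> d \<in> poset_chains (ivl0 n y) wp_le (int m - 2)"
proof -
  have "wp_bot n # d @ [y] \<in> fchains n y \<longleftrightarrow> (sorted_wrt wlt (wp_bot n # d @ [y]) \<and> set d \<subseteq> wpartitions n)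
    \<and> length d + 2 + card y = Suc n"
    using wp_bot_in[of n] y(1) by (auto simp: fchains_def)
  also have "\<dots> \<longleftrightarrow> d \<in> poset_chains (ivl0 n y) wp_le (int m - 2)"
    unfolding sorted_full_iff[OF y] using c by (auto simp: poset_chains_def)
  finally show ?thesis .
qed

lemma fchains_cases:
  assumes y: "y \<in> wpartitions n" "y \<noteq> wp_bot n" and c: "c \<in> fchains n y"
  obtains d where "c = wp_bot n # d @ [y]" "set d \<subseteq> ivl0 n y" "strip n y c = d"
proof -
  have "c \<noteq> []" "hd c = wp_bot n" "last c = y" using c by (auto simp: fchains_def)
  then obtain d where d: "c = wp_bot n # d @ [y]" using ends_decompose[OF _ _ _ y(2)] by blast
  have "sorted_wrt wlt c \<and> set c \<subseteq> wpartitions n" using c by (auto simp: fchains_def)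
  then have "set d \<subseteq> ivl0 n y" using sorted_full_iff[OF y, of d] d by auto
  then show ?thesis using that[OF d] strip_full[OF y(2)] d by simp
qed

lemma full_strip:
  assumes y: "y \<in> wpartitions n" and c: "c \<in> fchains n y"
  shows "full n y (strip n y c) = c"
proof (cases "y = wp_bot n")
  case True
  then show ?thesis using c by (simp add: full_def fchains_bot)
next
  case False
  obtain d where "c = wp_bot n # d @ [y]" "strip n y c = d" using fchains_cases[OF y False c] .
  then show ?thesis using False by (simp add: full_def)
qed

text \<open>Counting blocks from both ends leaves a difference of at most one between neighbours,
  and so no room for a filler.\<close>

lemma saturated_step:
  assumes c: "c \<in> fchains n y" and k: "Suc k < length c"
  shows "wint n (c ! k) (c ! Suc k) = {}"
proof -
  have so: "sorted_wrt wlt c" and W: "set c \<subseteq> wpartitions n" and len: "length c + card y = Suc n"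
    and ne: "c \<noteq> []" and hd: "hd c = wp_bot n" and la: "last c = y" using c by (auto simp: fchains_def)
  have up: "card (c ! i) + i \<le> n" if "i < length c" for i
    using that
  proof (induction i)
    case 0
    then show ?case using hd ne by (simp add: hd_conv_nth card_wp_bot)
  next
    case (Suc i)
    have "wlt (c ! i) (c ! Suc i)" using sorted_wrt_nth_less[OF so] Suc.prems by simp
    then have "card (c ! Suc i) < card (c ! i)"
      using wlt_card W Suc.prems nth_mem by (metis Suc_lessD subsetD)
    then show ?case using Suc by simp
  qed
  have down: "i < length c \<Longrightarrow> card y + (length c - 1 - i) \<le> card (c ! i)" for i
  proof (induction "length c - 1 - i" arbitrary: i)
    case 0
    then have "i = length c - 1" by simp
    then show ?case using la ne by (simp add: last_conv_nth)
  next
    case (Suc j)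
    then have i: "Suc i < length c" by simp
    have "wlt (c ! i) (c ! Suc i)" using sorted_wrt_nth_less[OF so] i by simp
    then have "card (c ! Suc i) < card (c ! i)"
      using wlt_card W i nth_mem by (metis Suc_lessD subsetD)
    moreover have "card y + (length c - 1 - Suc i) \<le> card (c ! Suc i)" using Suc(1)[of "Suc i"] Suc(2) i by simp
    ultimately show ?case using i by linarith
  qed
  have tight: "card (c ! k) \<le> Suc (card (c ! Suc k))" using up[of k] down[OF k] k len by linarith
  have in2: "c ! k \<in> wpartitions n" "c ! Suc k \<in> wpartitions n" using W k nth_mem by (metis Suc_lessD subsetD)+
  have False if "a \<in> wint n (c ! k) (c ! Suc k)" for a
  proof -
    have "a \<in> wpartitions n" "wlt (c ! k) a" "wlt a (c ! Suc k)" using that by (auto simp: wint_def)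
    then have "card a < card (c ! k)" "card (c ! Suc k) < card a" using wlt_card in2 by blast+
    then show False using tight by linarith
  qed
  then show ?thesis by blast
qed

text \<open>With end points attached, an insertion at any position, the first and the last included,
  fills a gap between two neighbours.\<close>

lemma coboundary_sng:
  assumes y: "y \<in> wpartitions n" "y \<noteq> wp_bot n" and d: "sorted_wrt wlt d" "set d \<subseteq> ivl0 n y"
  defines "D \<equiv> wp_bot n # d @ [y]"
  shows "coboundary (ivl0 n y) wp_le (sng d) =
    (\<Sum>i\<le>length d. scale ((-1) ^ i) (\<Sum>a\<in>wint n (D ! i) (D ! Suc i). sng (take i d @ a # drop i d) :: _ \<Rightarrow>\<^sub>0 'k::field))"
proof -
  have bw: "wp_bot n \<in> wpartitions n" by (rule wp_bot_in)
  have dW: "x \<in> wpartitions n" "wlt (wp_bot n) x" "wlt x y" if "x \<in> set d" for x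
    using d(2) that by (auto simp: open_interval_def)
  have "{a. a \<in> ivl0 n y \<and> (0 < i \<longrightarrow> wlt (d ! (i - 1)) a) \<and> (i < length d \<longrightarrow> wlt a (d ! i))}
    = wint n (D ! i) (D ! Suc i)" if i: "i \<le> length d" for i
  proof -
    have D1: "D ! i = (if 0 < i then d ! (i - 1) else wp_bot n)" using i by (cases i) (auto simp: D_def nth_append)
    have D2: "D ! Suc i = (if i < length d then d ! i else y)" using i by (auto simp: D_def nth_append)
    have lo: "wlt (wp_bot n) a" if "a \<in> wpartitions n" "wlt (D ! i) a" for a
    proof (cases "0 < i")
      case True
      then have "d ! (i - 1) \<in> set d" using i by simp
      then show ?thesis using wlt_trans[OF bw dW(1) that(1) dW(2)] that(2) True D1 by simp
    qed (use that D1 in simp)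
    have hi: "wlt a y" if "a \<in> wpartitions n" "wlt a (D ! Suc i)" for a
    proof (cases "i < length d")
      case True
      then have "d ! i \<in> set d" by simp
      then show ?thesis using wlt_trans[OF that(1) dW(1) y(1) _ dW(3)] that(2) True D2 by simp
    qed (use that D2 in simp)
    show ?thesis
    proof (rule equalityI; rule subsetI)
      fix a assume a: "a \<in> {a. a \<in> ivl0 n y \<and> (0 < i \<longrightarrow> wlt (d ! (i - 1)) a) \<and> (i < length d \<longrightarrow> wlt a (d ! i))}"
      then show "a \<in> wint n (D ! i) (D ! Suc i)" by (simp add: wint_def open_interval_def D1 D2)
    next
      fix a assume a: "a \<in> wint n (D ! i) (D ! Suc i)"
      then have "a \<in> wpartitions n" "wlt (D ! i) a" "wlt a (D ! Suc i)" by (auto simp: wint_def)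
      moreover from this have "wlt (wp_bot n) a" "wlt a y" using lo hi by blast+
      ultimately show "a \<in> {a. a \<in> ivl0 n y \<and> (0 < i \<longrightarrow> wlt (d ! (i - 1)) a) \<and> (i < length d \<longrightarrow> wlt a (d ! i))}"
        unfolding D1 D2 by (auto simp: open_interval_def split: if_splits)
    qed
  qed
  then show ?thesis
    by (auto simp: coboundary_def pm.scale_sum_right pm.scale_one intro!: sum.cong)
qed

lemma split_at:
  assumes "Suc i < length D"
  shows "D = take i D @ D ! i # D ! Suc i # drop (Suc (Suc i)) D"
    "take (Suc i) D @ a # drop (Suc i) D = take i D @ D ! i # a # D ! Suc i # drop (Suc (Suc i)) D"
  using assms id_take_nth_drop[of i D] Cons_nth_drop_Suc[of "Suc i" D] take_Suc_conv_app_nth[of i D] by simp_all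

text \<open>Each position of a chain one element short of maximal satisfies \<open>gapped\<close>,
  so its coboundary is a signed sum of generators of \<open>Zs\<close>.\<close>

lemma push_full_Zc:
  assumes y: "y \<in> wpartitions n" and c: "card y + m = n" and f: "f \<in> Zc n m y"
  shows "push (full n y) f \<in> (Zs n y :: (_ \<Rightarrow>\<^sub>0 'k::field) set)"
proof (cases "y = wp_bot n")
  case True
  then show ?thesis using f by (simp add: Zc_def lin_0 pm.subspace_0)
next
  case False
  obtain g where g: "g \<in> carrier (cochains (ivl0 n y) wp_le (int m - 2 - 1))" "f = coboundary (ivl0 n y) wp_le g"
    using f False by (auto simp: Zc_def)
  show ?thesis unfolding g(2)
  proof (rule lin_in_subspace[where h = "\<lambda>g. push (full n y) (coboundary (ivl0 n y) wp_le g)"])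
    show "lin (\<lambda>g. push (full n y) (coboundary (ivl0 n y) wp_le g))" by (rule lin_comp[OF lin_push lin_coboundary])
    fix d assume "d \<in> Poly_Mapping.keys g"
    then have d: "sorted_wrt wlt d" "set d \<subseteq> ivl0 n y" "int (length d) = int m - 2"
      using g(1) by (auto simp: cochains_def carrier_free poset_chains_def)
    define D where "D = wp_bot n # d @ [y]"
    have lD: "length D = length d + 2" by (simp add: D_def)
    have sD: "sorted_wrt wlt D" "set D \<subseteq> wpartitions n"
      using sorted_full_iff[OF y False, of d] d y wp_bot_in[of n] by (auto simp: D_def)
    have termZ: "(\<Sum>a\<in>wint n (D ! i) (D ! Suc i). sng (full n y (take i d @ a # drop i d))) \<in> (Zs n y :: (_ \<Rightarrow>\<^sub>0 'k) set)"
      if i: "i \<le> length d" for i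
    proof -
      have i2: "Suc i < length D" using i lD by simp
      have "gapped n y (take i D) (D ! i) (D ! Suc i) (drop (Suc (Suc i)) D)"
        unfolding gapped_def split_at(1)[OF i2, symmetric]
      proof (intro conjI sD)
        have "take i D @ [D ! i] = take (Suc i) D" using i2 by (simp add: take_Suc_conv_app_nth)
        then show "hd (take i D @ [D ! i]) = wp_bot n" by (simp add: D_def)
        have "D ! Suc i # drop (Suc (Suc i)) D = drop (Suc i) D" using i2 by (simp add: Cons_nth_drop_Suc)
        then show "last (D ! Suc i # drop (Suc (Suc i)) D) = y" using i2 by (simp add: last_drop) (simp add: D_def)
        show "length D + card y = n" using lD d(3) c by linarith
      qed
      from Zs_gen[OF this, where ?'a = 'k] show ?thesis
        using False i unfolding split_at(2)[OF i2, symmetric] by (simp add: full_def D_def)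
    qed
    show "push (full n y) (coboundary (ivl0 n y) wp_le (sng d)) \<in> (Zs n y :: (_ \<Rightarrow>\<^sub>0 'k) set)"
      unfolding coboundary_sng[OF y False d(1,2)] D_def[symmetric] lin_sum[OF lin_push] lin_scale[OF lin_push] push_single
      by (rule pm.subspace_sum[OF subspace_Zs], rule pm.subspace_scale[OF subspace_Zs], rule termZ) simp
  qed simp
qed

text \<open>Here a single generator must be a coboundary. If its gap can be filled, all other
  positions are steps of a saturated chain and contribute nothing, so the coboundary of the gapped
  chain is the generator up to sign; a gap without filling gives 0.\<close>

lemma Sy_Zs:
  assumes y: "y \<in> wpartitions n" and c: "card y + m = n" and f: "f \<in> Zs n y"
  shows "Sy n y f \<in> (Zc n m y :: (_ \<Rightarrow>\<^sub>0 'k::field) set)"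
proof (rule lin_span_subset[OF lin_Sy subspace_Zc _ f[unfolded Zs_def]])
  fix g :: "wpartition list \<Rightarrow>\<^sub>0 'k"
  assume "g \<in> {\<Sum>a\<in>wint n p q. sng (c1 @ p # a # q # c2) | c1 p q c2. gapped n y c1 p q c2}"
  then obtain c1 p q c2 where g: "g = (\<Sum>a\<in>wint n p q. sng (c1 @ p # a # q # c2))" and gap: "gapped n y c1 p q c2" by blast
  show "Sy n y g \<in> Zc n m y"
  proof (cases "wint n p q = {}")
    case True
    then show ?thesis unfolding g by (simp add: lin_0 pm.subspace_0)
  next
    case False
    then obtain a0 where a0: "a0 \<in> wint n p q" by blast
    define D where "D = c1 @ p # q # c2"
    let ?i = "length c1"
    have D: "sorted_wrt wlt D" "set D \<subseteq> wpartitions n" "length D + card y = n" "last D = y"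
      using gap by (auto simp: gapped_def D_def)
    have hdD: "hd D = wp_bot n" using gap by (cases c1) (auto simp: gapped_def D_def)
    have i2: "Suc ?i < length D" and Di: "D ! ?i = p" "D ! Suc ?i = q" by (simp_all add: D_def nth_append)
    have ne: "y \<noteq> wp_bot n" using D(3) card_wp_bot[of n] i2 by auto
    have "D \<noteq> []" using i2 by auto
    then obtain d where d: "D = wp_bot n # d @ [y]" using ends_decompose[OF _ hdD D(4) ne] by blast
    have sd: "sorted_wrt wlt d" "set d \<subseteq> ivl0 n y" using sorted_full_iff[OF y ne, of d] D(1,2) d by auto
    have id: "?i \<le> length d" using i2 d by simp
    have ins: "c1 @ p # a # q # c2 = wp_bot n # (take ?i d @ a # drop ?i d) @ [y]" for a
    proof -
      have "c1 @ p # a # q # c2 = take (Suc ?i) D @ a # drop (Suc ?i) D" by (simp add: D_def)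
      then show ?thesis using id by (simp add: d)
    qed
    have Sg: "Sy n y g = (\<Sum>a\<in>wint n p q. sng (take ?i d @ a # drop ?i d))"
    proof -
      have "Sy n y (sng (c1 @ p # a # q # c2)) = (sng (take ?i d @ a # drop ?i d) :: _ \<Rightarrow>\<^sub>0 'k)" if a: "a \<in> wint n p q" for a
      proof -
        have "c1 @ p # a # q # c2 \<in> fchains n y" if "a \<in> wint n p q" for a
        proof -
          have aw: "a \<in> wpartitions n" "wlt p a" "wlt a q" using that by (auto simp: wint_def)
          have pq: "p \<in> wpartitions n" "q \<in> wpartitions n" using D(2) by (auto simp: D_def)
          have l: "wlt x a" if "x \<in> set c1" for x
            using that D(1,2) wlt_trans[OF _ pq(1) aw(1) _ aw(2), of x] by (auto simp: D_def sorted_wrt_append)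
          have u: "wlt a x" if "x \<in> set c2" for x
            using that D(1,2) wlt_trans[OF aw(1) pq(2) _ aw(3), of x] by (auto simp: D_def sorted_wrt_append)
          have "sorted_wrt wlt (c1 @ p # a # q # c2)" using D(1) aw l u by (auto simp: D_def sorted_wrt_append)
          moreover have "hd (c1 @ p # a # q # c2) = wp_bot n" using hdD by (cases c1) (auto simp: D_def)
          ultimately show ?thesis using D(2-4) aw(1) by (auto simp: fchains_def D_def)
        qed
        from this[OF a] obtain d' where "c1 @ p # a # q # c2 = wp_bot n # d' @ [y]" "strip n y (c1 @ p # a # q # c2) = d'"
          by (rule fchains_cases[OF y ne])
        then have "strip n y (c1 @ p # a # q # c2) = take ?i d @ a # drop ?i d" unfolding ins by simp
        moreover have "last (c1 @ p # a # q # c2) = y" unfolding ins by simp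
        ultimately show ?thesis unfolding Sy_sng by simp
      qed
      then show ?thesis unfolding g lin_sum[OF lin_Sy] by (rule sum.cong[OF refl])
    qed
    have a0c: "c1 @ p # a0 # q # c2 \<in> fchains n y"
    proof -
      have aw: "a0 \<in> wpartitions n" "wlt p a0" "wlt a0 q" using a0 by (auto simp: wint_def)
      have pq: "p \<in> wpartitions n" "q \<in> wpartitions n" using D(2) by (auto simp: D_def)
      have l: "wlt x a0" if "x \<in> set c1" for x
        using that D(1,2) wlt_trans[OF _ pq(1) aw(1) _ aw(2), of x] by (auto simp: D_def sorted_wrt_append)
      have u: "wlt a0 x" if "x \<in> set c2" for x
        using that D(1,2) wlt_trans[OF aw(1) pq(2) _ aw(3), of x] by (auto simp: D_def sorted_wrt_append)
      have "sorted_wrt wlt (c1 @ p # a0 # q # c2)" using D(1) aw l u by (auto simp: D_def sorted_wrt_append)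
      moreover have "hd (c1 @ p # a0 # q # c2) = wp_bot n" using hdD by (cases c1) (auto simp: D_def)
      ultimately show ?thesis using D(2-4) aw(1) by (auto simp: fchains_def D_def)
    qed
    have empty: "wint n (D ! j) (D ! Suc j) = {}" if j: "j \<le> length d" "j \<noteq> ?i" for j
    proof (cases "j < ?i")
      case True
      have "(c1 @ p # a0 # q # c2) ! j = D ! j" "(c1 @ p # a0 # q # c2) ! Suc j = D ! Suc j"
        using True by (auto simp: D_def nth_append nth_Cons split: nat.splits)
      then show ?thesis using saturated_step[OF a0c, of j] True by simp
    next
      case False
      then obtain k where k: "j = Suc (?i + k)" using j(2) by (metis less_imp_Suc_add linorder_neqE_nat add_Suc_right)
      have "(c1 @ p # a0 # q # c2) ! Suc j = D ! j" "(c1 @ p # a0 # q # c2) ! Suc (Suc j) = D ! Suc j"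
        unfolding k D_def by (simp_all add: nth_append)
      moreover have "Suc (Suc j) < length (c1 @ p # a0 # q # c2)" using j(1) arg_cong[OF d, of length] by (simp add: D_def)
      ultimately show ?thesis using saturated_step[OF a0c, of "Suc j"] by simp
    qed
    have "coboundary (ivl0 n y) wp_le (sng d) = (\<Sum>i\<le>length d. scale ((-1) ^ i) (\<Sum>a\<in>wint n (D ! i) (D ! Suc i). sng (take i d @ a # drop i d) :: _ \<Rightarrow>\<^sub>0 'k))"
      using coboundary_sng[OF y ne sd] unfolding d .
    also have "\<dots> = (\<Sum>i\<in>{?i}. scale ((-1) ^ i) (\<Sum>a\<in>wint n (D ! i) (D ! Suc i). sng (take i d @ a # drop i d)))"
      by (rule sum.mono_neutral_right) (use id empty in auto)
    also have "\<dots> = scale ((-1) ^ ?i) (Sy n y g)" by (simp add: Di Sg)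
    finally have cb: "coboundary (ivl0 n y) wp_le (sng d) = scale ((-1) ^ ?i) (Sy n y g)" .
    have "Sy n y g = scale ((-1) ^ ?i) (coboundary (ivl0 n y) wp_le (sng d))"
      unfolding cb by (simp flip: power_mult_distrib)
    moreover have "coboundary (ivl0 n y) wp_le (sng d) \<in> (Zc n m y :: (_ \<Rightarrow>\<^sub>0 'k) set)"
    proof -
      have "length D = length d + 2" by (simp add: d)
      then have "int (length d) = int m - 2 - 1 + 1" using D(3) c by linarith
      then have "d \<in> poset_chains (ivl0 n y) wp_le (int m - 2 - 1)" using sd by (simp add: poset_chains_def)
      then have "(sng d :: _ \<Rightarrow>\<^sub>0 'k) \<in> carrier (cochains (ivl0 n y) wp_le (int m - 2 - 1))" by (simp add: cochains_def carrier_free)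
      then show ?thesis using ne by (auto simp: Zc_def)
    qed
    ultimately show ?thesis using pm.subspace_scale[OF subspace_Zc] by simp
  qed
qed

text \<open>A saturated chain has no room for insertions, so all sums in its coboundary are
  empty.\<close>

lemma sng_strip_Cc:
  assumes y: "y \<in> wpartitions n" and c: "card y + m = n" and f: "c \<in> fchains n y"
  shows "sng (strip n y c) \<in> (Cc n m y :: (_ \<Rightarrow>\<^sub>0 'k::field) set)"
proof (cases "y = wp_bot n")
  case True
  then show ?thesis using c f card_wp_bot[of n] by (simp add: fchains_bot strip_def Cc_def carrier_free)
next
  case False
  obtain d where d: "c = wp_bot n # d @ [y]" "set d \<subseteq> ivl0 n y" "strip n y c = d" using fchains_cases[OF y False f] .
  have pc: "d \<in> poset_chains (ivl0 n y) wp_le (int m - 2)" using fchains_full[OF y False assms(2), of d] f d(1) by simp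
  then have so: "sorted_wrt wlt d" by (simp add: poset_chains_def)
  have "coboundary (ivl0 n y) wp_le (sng d) = (0 :: _ \<Rightarrow>\<^sub>0 'k)"
    unfolding coboundary_sng[OF y False so d(2)] d(1)[symmetric]
  proof (rule sum.neutral, rule ballI)
    fix i assume "i \<in> {..length d}"
    then have "Suc i < length c" by (simp add: d(1))
    from saturated_step[OF f this] show "scale ((-1) ^ i) (\<Sum>a\<in>wint n (c ! i) (c ! Suc i). sng (take i d @ a # drop i d)) = (0 :: _ \<Rightarrow>\<^sub>0 'k)"
      by simp
  qed
  then show ?thesis using False pc by (simp add: Cc_def d(3) cochains_def carrier_free)
qed

lemma Cc_keys:
  assumes y: "y \<in> wpartitions n" and c: "card y + m = n" and f: "f \<in> (Cc n m y :: (_ \<Rightarrow>\<^sub>0 'k::field) set)"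
    and d: "d \<in> Poly_Mapping.keys f"
  shows "full n y d \<in> fchains n y" "strip n y (full n y d) = d"
proof -
  have "full n y d \<in> fchains n y \<and> strip n y (full n y d) = d"
  proof (cases "y = wp_bot n")
    case True
    then have "d = []" using f d by (auto simp: Cc_def carrier_free split: if_splits)
    then show ?thesis using True by (simp add: fchains_bot full_def strip_def)
  next
    case False
    then have "d \<in> poset_chains (ivl0 n y) wp_le (int m - 2)" using f d by (auto simp: Cc_def cochains_def carrier_free)
    then show ?thesis using fchains_full[OF y False c, of d] strip_full[OF False, of d] False
      by (simp add: full_def poset_chains_def)
  qed
  then show "full n y d \<in> fchains n y" "strip n y (full n y d) = d" by auto
qed

lemma coboundary_act:
  fixes f :: "wpartition list \<Rightarrow>\<^sub>0 'k::field"
  assumes t: "\<tau> permutes {1..n}"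
  shows "push (map (wp_act \<tau>)) (coboundary (ivl0 n y) wp_le f) =
    coboundary (ivl0 n (wp_act \<tau> y)) wp_le (push (map (wp_act \<tau>)) f)"
proof (rule lin_eqI[OF lin_comp[OF lin_push lin_coboundary] lin_comp[OF lin_coboundary lin_push]])
  note inj = permutes_inj[OF t]
  have iv: "wp_act \<tau> a \<in> ivl0 n (wp_act \<tau> y) \<longleftrightarrow> a \<in> ivl0 n y" for a
  proof -
    have "wp_act \<tau> a \<in> wpartitions n \<longleftrightarrow> a \<in> wpartitions n"
      using wp_act_in[OF t, of a] wp_act_in[OF permutes_inv[OF t], of "wp_act \<tau> a"] wp_act_inverse(2)[OF t] by auto
    moreover have "wlt (wp_bot n) (wp_act \<tau> a) \<longleftrightarrow> wlt (wp_bot n) a"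
      using wlt_act[OF inj, of "wp_bot n" a] wp_act_bot[OF t] by simp
    ultimately show ?thesis by (simp add: open_interval_def wlt_act[OF inj])
  qed
  fix c :: "wpartition list"
  let ?A = "\<lambda>y c i. {\<alpha>. \<alpha> \<in> ivl0 n y \<and> (0 < i \<longrightarrow> wlt (c ! (i - 1)) \<alpha>) \<and> (i < length c \<longrightarrow> wlt \<alpha> (c ! i))}"
  have A: "?A (wp_act \<tau> y) (map (wp_act \<tau>) c) i = wp_act \<tau> ` ?A y c i" if "i \<le> length c" for i
  proof (rule equalityI; rule subsetI)
    fix b assume b: "b \<in> ?A (wp_act \<tau> y) (map (wp_act \<tau>) c) i"
    define a where "a = wp_act (Hilbert_Choice.inv \<tau>) b"
    have ba: "b = wp_act \<tau> a" unfolding a_def by (simp add: wp_act_inverse[OF t])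
    have "a \<in> ?A y c i" using b that unfolding ba by (auto simp: iv wlt_act[OF inj])
    then show "b \<in> wp_act \<tau> ` ?A y c i" unfolding ba by (rule imageI)
  next
    fix b assume "b \<in> wp_act \<tau> ` ?A y c i"
    then show "b \<in> ?A (wp_act \<tau> y) (map (wp_act \<tau>) c) i" using that by (auto simp: iv wlt_act[OF inj])
  qed
  have "(\<Sum>\<alpha>\<in>?A (wp_act \<tau> y) (map (wp_act \<tau>) c) i.
      Poly_Mapping.single (take i (map (wp_act \<tau>) c) @ \<alpha> # drop i (map (wp_act \<tau>) c)) ((-1) ^ i :: 'k)) =
    (\<Sum>\<alpha>\<in>?A y c i. Poly_Mapping.single (map (wp_act \<tau>) (take i c @ \<alpha> # drop i c)) ((-1) ^ i))" if "i \<le> length c" for i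
    unfolding A[OF that]
    by (subst sum.reindex[OF inj_on_subset[OF inj_wp_act[OF inj]]]) (simp_all add: take_map drop_map)
  then show "push (map (wp_act \<tau>)) (coboundary (ivl0 n y) wp_le (sng c)) =
    coboundary (ivl0 n (wp_act \<tau> y)) wp_le (push (map (wp_act \<tau>)) (sng c) :: _ \<Rightarrow>\<^sub>0 'k)"
    unfolding coboundary_def push_single lin_ext_single pm.scale_one lin_sum[OF lin_push] length_map
    by (intro sum.cong[OF refl]) simp
qed

lemma cochains_act:
  assumes t: "\<tau> permutes {1..n}" and f: "f \<in> carrier (cochains (ivl0 n y) wp_le j)"
  shows "push (map (wp_act \<tau>)) f \<in> carrier (cochains (ivl0 n (wp_act \<tau> y)) wp_le j :: ('k::field, _) module)"
proof -
  note inj = permutes_inj[OF t]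
  have "map (wp_act \<tau>) c \<in> poset_chains (ivl0 n (wp_act \<tau> y)) wp_le j" if "c \<in> poset_chains (ivl0 n y) wp_le j" for c
  proof -
    have "wp_act \<tau> a \<in> ivl0 n (wp_act \<tau> y)" if "a \<in> ivl0 n y" for a
      using that wp_act_in[OF t, of a] wlt_act[OF inj, of "wp_bot n" a] wp_act_bot[OF t]
      by (simp add: open_interval_def wlt_act[OF inj])
    then show ?thesis using that by (auto simp: poset_chains_def sorted_wrt_map wlt_act[OF inj])
  qed
  then show ?thesis using push_keys[of "map (wp_act \<tau>)" f] f unfolding cochains_def carrier_free by blast
qed

lemma Zc_act:
  assumes t: "\<tau> permutes {1..n}" and f: "f \<in> Zc n m y"
  shows "push (map (wp_act \<tau>)) f \<in> (Zc n m (wp_act \<tau> y) :: (_ \<Rightarrow>\<^sub>0 'k::field) set)"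
proof (cases "y = wp_bot n")
  case True
  then show ?thesis using f by (simp add: Zc_def wp_act_bot[OF t] lin_0)
next
  case False
  then have ne: "wp_act \<tau> y \<noteq> wp_bot n" using inj_eq[OF inj_wp_act[OF permutes_inj[OF t]], of y "wp_bot n"] wp_act_bot[OF t] by simp
  obtain g where g: "g \<in> carrier (cochains (ivl0 n y) wp_le (int m - 2 - 1))" "f = coboundary (ivl0 n y) wp_le g"
    using f False by (auto simp: Zc_def)
  then show ?thesis using ne imageI[OF cochains_act[OF t g(1)]] by (simp add: Zc_def coboundary_act[OF t])
qed

lemma Zc_act_image:
  assumes t: "\<tau> permutes {1..n}"
  shows "push (map (wp_act \<tau>)) ` Zc n m (wp_act (Hilbert_Choice.inv \<tau>) y) = (Zc n m y :: (_ \<Rightarrow>\<^sub>0 'k::field) set)"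
proof (rule equalityI; rule subsetI)
  fix f :: "wpartition list \<Rightarrow>\<^sub>0 'k"
  assume "f \<in> push (map (wp_act \<tau>)) ` Zc n m (wp_act (Hilbert_Choice.inv \<tau>) y)"
  then show "f \<in> Zc n m y" using Zc_act[OF t, of _ m "wp_act (Hilbert_Choice.inv \<tau>) y"] wp_act_inverse(1)[OF t, of y] by auto
next
  fix f :: "wpartition list \<Rightarrow>\<^sub>0 'k"
  assume f: "f \<in> Zc n m y"
  have "push (map (wp_act \<tau>)) (push (map (wp_act (Hilbert_Choice.inv \<tau>))) f) = f"
  proof -
    have "map (wp_act \<tau>) \<circ> map (wp_act (Hilbert_Choice.inv \<tau>)) = id"
      by (rule ext) (simp add: wp_act_inverse(1)[OF t] o_def)
    then show ?thesis by (simp add: push_push)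
  qed
  then show "f \<in> push (map (wp_act \<tau>)) ` Zc n m (wp_act (Hilbert_Choice.inv \<tau>) y)"
    using Zc_act[OF permutes_inv[OF t] f] by (metis imageI)
qed

section \<open>The isomorphism\<close>

text \<open>The isomorphism before division by relations: all components of the signed chains of a
  combination of forests.\<close>

definition Bm :: "nat \<Rightarrow> nat \<Rightarrow> nat \<Rightarrow> (nat btree list \<Rightarrow>\<^sub>0 'k::field) \<Rightarrow> wpartition \<Rightarrow> (wpartition list \<Rightarrow>\<^sub>0 'k) set" where
  "Bm n m r f = (\<lambda>y\<in>wpartitions n. cos (Zc n m y) (Sy n y (betM n r f)))"

lemma MF_chain:
  assumes "G \<in> MF {1..n} r"
  shows "wchain n (po G) \<in> fchains n (wpf G)" "last (wchain n (po G)) = wpf G" "wpf G \<in> wpartitions n" "card (wpf G) = r"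
proof -
  have m: "mlin n G" "length G = r" using MF_mlin[OF assms] by auto
  note re = real_postorder[OF m(1)]
  show "wchain n (po G) \<in> fchains n (wpf G)" by (rule real_fchains[OF re])
  show "last (wchain n (po G)) = wpf G" by (rule real_last[OF re])
  show "wpf G \<in> wpartitions n" by (rule wpf_in[OF m(1)])
  show "card (wpf G) = r" using card_wpf[OF m(1)] m(2) by simp
qed

lemma Sy_betM_sng:
  assumes "G \<in> MF {1..n} r"
  shows "Sy n y (betM n r (sng G)) = (if wpf G = y then
    scale (of_int (gsgn G)) (sng (strip n y (wchain n (po G)))) else (0 :: _ \<Rightarrow>\<^sub>0 'k::field))"
  unfolding betM_sng if_P[OF assms] bet_def lin_scale[OF lin_Sy] Sy_sng MF_chain(2)[OF assms] by simp

lemma Sy_betM_Cc: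
  assumes f: "f \<in> MFsp n r" and y: "y \<in> wpartitions n" and m: "r + m = n"
  shows "Sy n y (betM n r f) \<in> (Cc n m y :: (_ \<Rightarrow>\<^sub>0 'k::field) set)"
proof (rule lin_in_subspace[where h = "\<lambda>f. Sy n y (betM n r f)"])
  show "lin (\<lambda>f. Sy n y (betM n r f))" by (rule lin_comp[OF lin_Sy lin_betM])
  fix G assume "G \<in> Poly_Mapping.keys f"
  then have G: "G \<in> MF {1..n} r" using f by auto
  show "Sy n y (betM n r (sng G)) \<in> (Cc n m y :: (_ \<Rightarrow>\<^sub>0 'k) set)"
  proof (cases "wpf G = y")
    case True
    have "card y + m = n" using MF_chain(4)[OF G] True m by simp
    then have "(sng (strip n y (wchain n (po G))) :: _ \<Rightarrow>\<^sub>0 'k) \<in> Cc n m y"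
      by (rule sng_strip_Cc[OF y]) (use MF_chain(1)[OF G] True in simp)
    from pm.subspace_scale[OF subspace_Cc this] show ?thesis unfolding Sy_betM_sng[OF G] using True by simp
  next
    case False
    then show ?thesis unfolding Sy_betM_sng[OF G] using pm.subspace_0[OF subspace_Cc] by simp
  qed
qed simp

lemma Sy_Zs_other:
  assumes "y' \<noteq> y" and f: "f \<in> Zs n y'"
  shows "Sy n y f = (0 :: _ \<Rightarrow>\<^sub>0 'k::field)"
proof -
  have "Sy n y f \<in> ({0} :: (_ \<Rightarrow>\<^sub>0 'k) set)"
  proof (rule lin_span_subset[OF lin_Sy pm.subspace_single_0 _ f[unfolded Zs_def]])
    fix g :: "wpartition list \<Rightarrow>\<^sub>0 'k"
    assume "g \<in> {\<Sum>a\<in>wint n p q. sng (c1 @ p # a # q # c2) | c1 p q c2. gapped n y' c1 p q c2}"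
    then obtain c1 p q c2 where g: "g = (\<Sum>a\<in>wint n p q. sng (c1 @ p # a # q # c2))" and gap: "gapped n y' c1 p q c2" by blast
    have "last (c1 @ p # a # q # c2) \<noteq> y" for a using gap assms(1) by (simp add: gapped_def)
    then show "Sy n y g \<in> {0}" unfolding g lin_sum[OF lin_Sy] Sy_sng by simp
  qed
  then show ?thesis by simp
qed

text \<open>Splitting by last elements and reattaching the end points loses nothing, so relations
  can be tested componentwise.\<close>

lemma betM_decompose:
  assumes f: "f \<in> MFsp n r"
  shows "(\<Sum>y\<in>{y \<in> wpartitions n. card y = r}. push (full n y) (Sy n y (betM n r f))) = (betM n r f :: _ \<Rightarrow>\<^sub>0 'k::field)"
proof (rule lin_eqI[where h = "\<lambda>f. \<Sum>y\<in>{y \<in> wpartitions n. card y = r}. push (full n y) (Sy n y (betM n r f))"])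
  show "lin (\<lambda>f. \<Sum>y\<in>{y \<in> wpartitions n. card y = r}. push (full n y) (Sy n y (betM n r f)))"
    by (rule lin_sum_fun, rule lin_comp[OF lin_push], rule lin_comp[OF lin_Sy lin_betM])
  show "lin (betM n r)" by simp
  fix G assume "G \<in> Poly_Mapping.keys f"
  then have G: "G \<in> MF {1..n} r" using f by auto
  note C = MF_chain[OF G]
  have fin: "finite {y \<in> wpartitions n. card y = r}" using finite_wpartitions by simp
  have "push (full n y) (Sy n y (betM n r (sng G))) = (if y = wpf G then betM n r (sng G) else (0 :: _ \<Rightarrow>\<^sub>0 'k))" for y
  proof (cases "y = wpf G")
    case True
    then show ?thesis unfolding Sy_betM_sng[OF G]
      using full_strip[OF C(3,1)] G by (simp add: lin_scale betM_sng bet_def del: scale_single push_single)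
        (simp add: full_strip[OF C(3,1)])
  next
    case False
    then show ?thesis unfolding Sy_betM_sng[OF G] by (simp add: lin_0)
  qed
  then show "(\<Sum>y\<in>{y \<in> wpartitions n. card y = r}. push (full n y) (Sy n y (betM n r (sng G)))) = (betM n r (sng G) :: _ \<Rightarrow>\<^sub>0 'k)"
    using C(3,4) fin by (simp add: sum.delta)
qed

lemma betM_Zall_iff:
  assumes f: "f \<in> MFsp n r" and m: "r + m = n"
  shows "betM n r f \<in> Zall n r \<longleftrightarrow> (\<forall>y\<in>wpartitions n. Sy n y (betM n r f) \<in> (Zc n m y :: (_ \<Rightarrow>\<^sub>0 'k::field) set))"
proof
  assume b: "betM n r f \<in> Zall n r"
  show "\<forall>y\<in>wpartitions n. Sy n y (betM n r f) \<in> (Zc n m y :: (_ \<Rightarrow>\<^sub>0 'k) set)"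
  proof
    fix y assume y: "y \<in> wpartitions n"
    show "Sy n y (betM n r f) \<in> (Zc n m y :: (_ \<Rightarrow>\<^sub>0 'k) set)"
    proof (rule lin_span_subset[OF lin_Sy subspace_Zc _ b[unfolded Zall_def]])
      fix g :: "wpartition list \<Rightarrow>\<^sub>0 'k" assume "g \<in> (\<Union>y\<in>{y \<in> wpartitions n. card y = r}. Zs n y)"
      then obtain y' where y': "card y' = r" "g \<in> Zs n y'" by blast
      show "Sy n y g \<in> Zc n m y"
      proof (cases "y' = y")
        case True
        then have "card y + m = n" using y'(1) m by simp
        then show ?thesis using Sy_Zs[OF y _ ] y'(2) True by blast
      next
        case False
        then show ?thesis using Sy_Zs_other[OF False y'(2)] pm.subspace_0[OF subspace_Zc] by simp
      qed
    qed
  qed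
next
  assume a: "\<forall>y\<in>wpartitions n. Sy n y (betM n r f) \<in> (Zc n m y :: (_ \<Rightarrow>\<^sub>0 'k) set)"
  have "(\<Sum>y\<in>{y \<in> wpartitions n. card y = r}. push (full n y) (Sy n y (betM n r f))) \<in> (Zall n r :: (_ \<Rightarrow>\<^sub>0 'k) set)"
  proof (rule pm.subspace_sum[OF subspace_Zall])
    fix y assume "y \<in> {y \<in> wpartitions n. card y = r}"
    then have y: "y \<in> wpartitions n" "card y = r" by auto
    then have "card y + m = n" using m by simp
    from push_full_Zc[OF y(1) this] a y(1) have "push (full n y) (Sy n y (betM n r f)) \<in> (Zs n y :: (_ \<Rightarrow>\<^sub>0 'k) set)" by blast
    then show "push (full n y) (Sy n y (betM n r f)) \<in> (Zall n r :: (_ \<Rightarrow>\<^sub>0 'k) set)" using Zs_Zall[OF y] by blast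
  qed
  then show "betM n r f \<in> Zall n r" unfolding betM_decompose[OF f] .
qed

text \<open>The kernel is the same \<open>relspace\<close> that \<open>wcls_eq_iff\<close> finds on
  the Lie side; this coincidence yields both well-definedness and injectivity.\<close>

lemma Bm_eq_iff:
  assumes f: "f \<in> MFsp n r" and g: "g \<in> MFsp n r" and n: "n \<ge> 1" and m: "r + m = n"
  shows "Bm n m r f = Bm n m r g \<longleftrightarrow> f - g \<in> (relspace {1..n} r :: (_ \<Rightarrow>\<^sub>0 'k::field) set)"
proof -
  have fg: "f - g \<in> MFsp n r" by (rule pm.subspace_diff[OF subspace_keys f g])
  have "Bm n m r f = Bm n m r g \<longleftrightarrow> (\<forall>y\<in>wpartitions n.
    cos (Zc n m y) (Sy n y (betM n r f)) = cos (Zc n m y) (Sy n y (betM n r g)))"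
    unfolding Bm_def by (auto simp: fun_eq_iff restrict_def)
  also have "\<dots> \<longleftrightarrow> (\<forall>y\<in>wpartitions n. Sy n y (betM n r (f - g)) \<in> Zc n m y)"
    by (simp add: cos_eq_iff lin_diff)
  also have "\<dots> \<longleftrightarrow> f - g \<in> relspace {1..n} r"
    using betM_Zall_iff[OF fg m] betM_kernel[OF n, of "f - g" r] fg by simp
  finally show ?thesis .
qed

lemma carrier_WH: "carrier (WH n m :: ('k::field, _) module) = (\<Pi>\<^sub>E y\<in>wpartitions n. cos (Zc n m y) ` Cc n m y)"
  by (simp add: WH_def whitney_cohomology_def direct_sum_def interval_cohomology_ops(1))

lemma WH_ops:
  fixes F F' :: "wpartition \<Rightarrow> (wpartition list \<Rightarrow>\<^sub>0 'k::field)"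
  shows "(\<lambda>y\<in>wpartitions n. cos (Zc n m y) (F y)) \<oplus>\<^bsub>WH n m\<^esub> (\<lambda>y\<in>wpartitions n. cos (Zc n m y) (F' y))
      = (\<lambda>y\<in>wpartitions n. cos (Zc n m y) (F y + F' y))"
    "a \<odot>\<^bsub>WH n m\<^esub> (\<lambda>y\<in>wpartitions n. cos (Zc n m y) (F y)) = (\<lambda>y\<in>wpartitions n. cos (Zc n m y) (scale a (F y)))"
  by (simp_all add: WH_def whitney_cohomology_def direct_sum_def restrict_def interval_cohomology_ops(3,4) fun_eq_iff)

lemma Bm_ops:
  "Bm n m r f \<oplus>\<^bsub>WH n m\<^esub> Bm n m r g = Bm n m r (f + g)"
  "a \<odot>\<^bsub>WH n m\<^esub> Bm n m r f = Bm n m r (scale a f)"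
  unfolding Bm_def WH_ops by (simp_all add: lin_add lin_scale)

lemma Bm_carrier:
  assumes "f \<in> MFsp n r" "r + m = n"
  shows "Bm n m r f \<in> carrier (WH n m)"
  unfolding carrier_WH Bm_def using Sy_betM_Cc[OF assms(1) _ assms(2)] by (intro restrict_PiE_iff[THEN iffD2] ballI imageI)

text \<open>At a wrong rank every cocycle is a coboundary and 0 serves. At the right rank each chain
  is, up to relations, a multiple of the signed chain of one forest, whose other components vanish
  because its chain ends at \<open>y\<close>.\<close>

lemma slot_surj:
  assumes y: "y \<in> wpartitions n" and g: "g \<in> (Cc n m y :: (_ \<Rightarrow>\<^sub>0 'k::field) set)" and n: "n \<ge> 1" and m: "r + m = n"
  shows "\<exists>h\<in>MFsp n r. Sy n y (betM n r h) - g \<in> Zc n m y \<and> (\<forall>y'. y' \<noteq> y \<longrightarrow> Sy n y' (betM n r h) = 0)"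
proof (cases "card y = r")
  case False
  then have "card y + m \<noteq> n" using m by simp
  then have "- g \<in> Zc n m y" using Cc_subset_Zc[OF y] g pm.subspace_neg[OF subspace_Zc] by blast
  then show ?thesis by (intro bexI[of _ 0]) (simp_all add: lin_0)
next
  case True
  then have cm: "card y + m = n" using m by simp
  let ?Q = "\<lambda>g h. Sy n y (betM n r h) - g \<in> Zc n m y \<and> (\<forall>y'. y' \<noteq> y \<longrightarrow> Sy n y' (betM n r h) = 0)"
  let ?V = "{g. \<exists>h\<in>MFsp n r. ?Q g h} :: (_ \<Rightarrow>\<^sub>0 'k) set"
  have V: "pm.subspace ?V"
  proof (rule pm.subspaceI, unfold mem_Collect_eq)
    show "\<exists>h\<in>MFsp n r. ?Q 0 h" using pm.subspace_0[OF subspace_Zc] by (intro bexI[of _ 0]) (simp_all add: lin_0)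
  next
    fix g1 g2 :: "_ \<Rightarrow>\<^sub>0 'k" assume a: "\<exists>h\<in>MFsp n r. ?Q g1 h" and b: "\<exists>h\<in>MFsp n r. ?Q g2 h"
    obtain h1 where h1: "h1 \<in> MFsp n r" "?Q g1 h1" using a by (rule bexE)
    obtain h2 where h2: "h2 \<in> MFsp n r" "?Q g2 h2" using b by (rule bexE)
    have "(Sy n y (betM n r h1) - g1) + (Sy n y (betM n r h2) - g2) \<in> Zc n m y"
      by (rule pm.subspace_add[OF subspace_Zc conjunct1[OF h1(2)] conjunct1[OF h2(2)]])
    then have q: "?Q (g1 + g2) (h1 + h2)" using conjunct2[OF h1(2)] conjunct2[OF h2(2)] by (simp add: lin_add algebra_simps)
    show "\<exists>h\<in>MFsp n r. ?Q (g1 + g2) h"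
      by (rule bexI[of _ "h1 + h2"], rule q, rule pm.subspace_add[OF subspace_keys h1(1) h2(1)])
  next
    fix a and g1 :: "_ \<Rightarrow>\<^sub>0 'k" assume b: "\<exists>h\<in>MFsp n r. ?Q g1 h"
    obtain h where h: "h \<in> MFsp n r" "?Q g1 h" using b by (rule bexE)
    have "scale a (Sy n y (betM n r h) - g1) \<in> Zc n m y"
      by (rule pm.subspace_scale[OF subspace_Zc conjunct1[OF h(2)]])
    then have q: "?Q (scale a g1) (scale a h)" using conjunct2[OF h(2)] by (simp add: lin_scale pm.scale_right_diff_distrib)
    show "\<exists>h\<in>MFsp n r. ?Q (scale a g1) h"
      by (rule bexI[of _ "scale a h"], rule q, rule pm.subspace_scale[OF subspace_keys h(1)])
  qed
  have "g \<in> ?V"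
  proof (rule lin_in_subspace[OF lin_id V])
    fix d assume d: "d \<in> Poly_Mapping.keys g"
    note K = Cc_keys[OF y cm g d]
    obtain G e where G: "G \<in> MF {1..n} (card y)" "wpf G = y"
      and Z: "sng (full n y d) - scale (of_int e) (bet n G) \<in> (Zs n y :: (_ \<Rightarrow>\<^sub>0 'k) set)"
      using chain_is_bet[OF n K(1), where ?'k = 'k] by blast
    have Gr: "G \<in> MF {1..n} r" using G(1) True by simp
    let ?h = "scale (of_int e) (sng G) :: _ \<Rightarrow>\<^sub>0 'k"
    have h: "?h \<in> MFsp n r" by (rule pm.subspace_scale[OF subspace_keys]) (use Gr in simp)
    have bh: "betM n r ?h = scale (of_int e) (bet n G)" unfolding lin_scale[OF lin_betM] betM_sng using Gr by simp
    have "last (full n y d) = y" by (simp add: full_def)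
    then have "Sy n y (sng (full n y d)) = (sng d :: _ \<Rightarrow>\<^sub>0 'k)" unfolding Sy_sng using K(2) by simp
    then have "sng d - Sy n y (betM n r ?h) \<in> Zc n m y"
      using Sy_Zs[OF y cm Z] unfolding lin_diff[OF lin_Sy] bh by simp
    from sub_sym[OF subspace_Zc this] have 1: "Sy n y (betM n r ?h) - sng d \<in> Zc n m y" .
    have 2: "Sy n y' (betM n r ?h) = 0" if "y' \<noteq> y" for y'
      unfolding lin_scale[OF lin_betM] lin_scale[OF lin_Sy] Sy_betM_sng[OF Gr] using G(2) that by auto
    show "sng d \<in> ?V" unfolding mem_Collect_eq
      by (rule bexI[of _ ?h], intro conjI allI impI, rule 1, erule 2, rule h)
  qed
  then show ?thesis unfolding mem_Collect_eq .
qed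

text \<open>Preimages of the components can simply be added, as each contributes to one component
  only.\<close>

lemma Bm_surj:
  assumes v: "v \<in> carrier (WH n m :: ('k::field, _) module)" and n: "n \<ge> 1" and m: "r + m = n"
  shows "\<exists>f\<in>MFsp n r. Bm n m r f = v"
proof -
  have "\<forall>y\<in>wpartitions n. \<exists>h\<in>MFsp n r. v y = cos (Zc n m y) (Sy n y (betM n r h)) \<and> (\<forall>y'. y' \<noteq> y \<longrightarrow> Sy n y' (betM n r h) = 0)"
  proof
    fix y assume y: "y \<in> wpartitions n"
    then have "v y \<in> cos (Zc n m y) ` Cc n m y" using v unfolding carrier_WH by (rule PiE_mem[rotated])
    then obtain g where g: "g \<in> Cc n m y" "v y = cos (Zc n m y) g" by blast
    from slot_surj[OF y g(1) n m] obtain h where h: "h \<in> MFsp n r" "Sy n y (betM n r h) - g \<in> Zc n m y"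
      "\<forall>y'. y' \<noteq> y \<longrightarrow> Sy n y' (betM n r h) = 0" by (elim bexE conjE) (rule that)
    have "cos (Zc n m y) (Sy n y (betM n r h)) = cos (Zc n m y) g"
      using h(2) unfolding cos_eq_iff[OF subspace_Zc] .
    then have vy: "v y = cos (Zc n m y) (Sy n y (betM n r h))" unfolding g(2) by (rule sym)
    show "\<exists>h\<in>MFsp n r. v y = cos (Zc n m y) (Sy n y (betM n r h)) \<and> (\<forall>y'. y' \<noteq> y \<longrightarrow> Sy n y' (betM n r h) = 0)"
      by (rule bexI[of _ h], rule conjI, rule vy, rule h(3), rule h(1))
  qed
  from bchoice[OF this[unfolded Bex_def]] obtain h where h: "\<forall>y\<in>wpartitions n. h y \<in> MFsp n r \<and>
    v y = cos (Zc n m y) (Sy n y (betM n r (h y))) \<and> (\<forall>y'. y' \<noteq> y \<longrightarrow> Sy n y' (betM n r (h y)) = 0)" by (rule exE)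
  let ?f = "\<Sum>y\<in>wpartitions n. h y"
  have "?f \<in> MFsp n r" by (rule pm.subspace_sum[OF subspace_keys], rule conjunct1[OF bspec[OF h]])
  moreover have "Bm n m r ?f = v"
  proof
    fix y
    show "Bm n m r ?f y = v y"
    proof (cases "y \<in> wpartitions n")
      case True
      have "Sy n y (betM n r ?f) = (\<Sum>y'\<in>wpartitions n. Sy n y (betM n r (h y')))"
        by (simp add: lin_sum)
      also have "\<dots> = (\<Sum>y'\<in>{y}. Sy n y (betM n r (h y')))"
      proof (rule sum.mono_neutral_right[OF finite_wpartitions])
        show "{y} \<subseteq> wpartitions n" using True by simp
        show "\<forall>i\<in>wpartitions n - {y}. Sy n y (betM n r (h i)) = 0"
        proof
          fix i assume "i \<in> wpartitions n - {y}"
          then have "i \<in> wpartitions n" "y \<noteq> i" by blast+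
          then show "Sy n y (betM n r (h i)) = 0" using bspec[OF h, of i] by blast
        qed
      qed
      finally have "Sy n y (betM n r ?f) = Sy n y (betM n r (h y))" by simp
      then show ?thesis using True bspec[OF h True] by (simp add: Bm_def)
    next
      case False
      then show ?thesis using v unfolding carrier_WH Bm_def by (simp add: PiE_arb[of v])
    qed
  qed
  ultimately show ?thesis by blast
qed

lemma forest_class_eq:
  assumes G: "G \<in> MF {1..n} r" and m: "n - r = m"
  shows "forest_class n G = (\<lambda>y\<in>wpartitions n. cos (Zc n m y)
    (if y = wpf G then sng (strip n y (wchain n (po G))) else (0 :: _ \<Rightarrow>\<^sub>0 'k::field)))"
proof -
  have len: "n - length G = m" using G m by (simp add: MF_def)
  have a: "add (free_module UNIV :: ('k, wpartition list \<Rightarrow>\<^sub>0 'k) module) = (+)" by (simp add: free_module_def)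
  show ?thesis
    unfolding forest_class_def Let_def forest_chain_def MF_chain(2)[OF G] chain_class_def len
      interval_cohomology_ops(2) a_r_coset_pm[OF a]
    by (auto simp: restrict_def fun_eq_iff strip_def)
qed

lemma forest_class_Bm:
  assumes G: "G \<in> MF {1..n} r" and m: "n - r = m"
  shows "of_int (gsgn G) \<odot>\<^bsub>WH n m\<^esub> forest_class n G = (Bm n m r (sng G) :: _ \<Rightarrow> (_ \<Rightarrow>\<^sub>0 'k::field) set)"
  unfolding forest_class_eq[OF assms] WH_ops Bm_def Sy_betM_sng[OF G]
  by (rule restrict_ext) (auto simp: pm.scale_zero_right)

text \<open>Relabelling a forest relabels its chain, while \<open>gsgn\<close> acquires the factor
  \<open>sign \<tau>\<close>; this is the source of the twist by the sign representation.\<close>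

lemma Sy_betM_act:
  assumes t: "\<tau> permutes {1..n}" and f: "f \<in> MFsp n r"
  shows "push (map (wp_act \<tau>)) (Sy n (wp_act (Hilbert_Choice.inv \<tau>) y) (betM n r f)) =
    scale (of_int (sign \<tau>)) (Sy n y (betM n r (push (map (map_btree \<tau>)) f)) :: _ \<Rightarrow>\<^sub>0 'k::field)"
proof (rule lin_eqI[where h = "\<lambda>f. push (map (wp_act \<tau>)) (Sy n (wp_act (Hilbert_Choice.inv \<tau>) y) (betM n r f))"
      and h' = "\<lambda>f. scale (of_int (sign \<tau>)) (Sy n y (betM n r (push (map (map_btree \<tau>)) f)))"])
  show "lin (\<lambda>f. push (map (wp_act \<tau>)) (Sy n (wp_act (Hilbert_Choice.inv \<tau>) y) (betM n r f)))"
    by (rule lin_comp[OF lin_push], rule lin_comp[OF lin_Sy lin_betM])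
  show "lin (\<lambda>f. scale (of_int (sign \<tau>)) (Sy n y (betM n r (push (map (map_btree \<tau>)) f))))"
    by (rule lin_smult, rule lin_comp[OF lin_Sy], rule lin_comp[OF lin_betM lin_push])
  note inj = permutes_inj[OF t]
  fix G assume "G \<in> Poly_Mapping.keys f"
  then have G: "G \<in> MF {1..n} r" using f by auto
  note tG = MF_map[OF t G]
  let ?y = "wp_act (Hilbert_Choice.inv \<tau>) y"
  have y: "wp_act \<tau> p = y \<longleftrightarrow> p = ?y" for p using wp_act_inverse[OF t] by metis
  have b: "wp_act \<tau> p = wp_bot n \<longleftrightarrow> p = wp_bot n" for p
    using inj_eq[OF inj_wp_act[OF inj], of p "wp_bot n"] wp_act_bot[OF t] by simp
  have w: "wpf (map (map_btree \<tau>) G) = wp_act \<tau> (wpf G)"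
    using MF_chain(2)[OF tG] MF_chain(2)[OF G] unfolding wchain_map[OF t] by (simp add: last_map)
  have s: "strip n y (wchain n (po (map (map_btree \<tau>) G))) = map (wp_act \<tau>) (strip n ?y (wchain n (po G)))"
    unfolding wchain_map[OF t] strip_def filter_map by (simp add: o_def y b)
  have ss: "of_int (sign \<tau>) * (of_int (sign \<tau>) * x) = (x :: 'k)" for x
    by (cases \<tau> rule: sign_cases) simp_all
  show "push (map (wp_act \<tau>)) (Sy n ?y (betM n r (sng G))) =
    scale (of_int (sign \<tau>)) (Sy n y (betM n r (push (map (map_btree \<tau>)) (sng G))) :: _ \<Rightarrow>\<^sub>0 'k)"
    unfolding push_single Sy_betM_sng[OF G] Sy_betM_sng[OF tG] w y s gsgn_map[OF t G]
    by (cases "wpf G = ?y") (simp_all add: lin_0 ss)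
qed

lemma sign_twist_Bm:
  assumes t: "\<tau> permutes {1..n}" and f: "f \<in> MFsp n r"
  shows "sign_twist (WH n m) (WH_act n) \<tau> (Bm n m r f) = (Bm n m r (push (map (map_btree \<tau>)) f) :: _ \<Rightarrow> (_ \<Rightarrow>\<^sub>0 'k::field) set)"
proof -
  have 1: "WH_act n \<tau> (Bm n m r f) = (\<lambda>y\<in>wpartitions n. cos (Zc n m y)
    (scale (of_int (sign \<tau>)) (Sy n y (betM n r (push (map (map_btree \<tau>)) f)) :: _ \<Rightarrow>\<^sub>0 'k)))"
    unfolding WH_act_def
  proof (rule restrict_ext)
    fix y assume "y \<in> wpartitions n"
    then have "wp_act (Hilbert_Choice.inv \<tau>) y \<in> wpartitions n" by (rule wp_act_in[OF permutes_inv[OF t]])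
    then show "push (map (wp_act \<tau>)) ` Bm n m r f (wp_act (Hilbert_Choice.inv \<tau>) y) =
      cos (Zc n m y) (scale (of_int (sign \<tau>)) (Sy n y (betM n r (push (map (map_btree \<tau>)) f)) :: _ \<Rightarrow>\<^sub>0 'k))"
      by (simp add: Bm_def lin_cos_image Zc_act_image[OF t] Sy_betM_act[OF t f])
  qed
  have ss: "scale (of_int (sign \<tau>)) (scale (of_int (sign \<tau>)) x) = (x :: _ \<Rightarrow>\<^sub>0 'k)" for x
    by (cases \<tau> rule: sign_cases) simp_all
  show ?thesis unfolding sign_twist_def 1 WH_ops(2) ss unfolding Bm_def by (rule refl)
qed

theorem theorem6p1:
  fixes n r :: nat
  assumes "n \<ge> 1" and "1 \<le> r" and "r \<le> n"
  shows "\<exists>\<phi> \<in> equivariant_isos n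
            (wedge_lie2 n r :: ('k::field, ((nat btree \<Rightarrow>\<^sub>0 'k) set list \<Rightarrow>\<^sub>0 'k) set) module)
            wedge_lie2_act
            (WH n (n - r)) (sign_twist (WH n (n - r)) (WH_act n)).
           (\<forall>(F, \<sigma>)\<in>BF n r. \<phi> (wedge_bracketing {1..n} (labelled n F \<sigma>)) =
              of_int (sign \<sigma> * forest_sgn F) \<odot>\<^bsub>WH n (n - r)\<^esub> forest_class n (labelled n F \<sigma>)) \<and>
           (\<forall>\<psi>\<in>linear_maps (wedge_lie2 n r) (WH n (n - r)).
              (\<forall>(F, \<sigma>)\<in>BF n r. \<psi> (wedge_bracketing {1..n} (labelled n F \<sigma>)) =
                 of_int (sign \<sigma> * forest_sgn F) \<odot>\<^bsub>WH n (n - r)\<^esub> forest_class n (labelled n F \<sigma>)) \<longrightarrow>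
              (\<forall>v\<in>carrier (wedge_lie2 n r). \<psi> v = \<phi> v))"
proof -
  define m where "m = n - r"
  have m: "r + m = n" "n - r = m" using assms by (simp_all add: m_def)
  note n = assms(1)
  let ?L = "wedge_lie2 n r :: ('k, ((nat btree \<Rightarrow>\<^sub>0 'k) set list \<Rightarrow>\<^sub>0 'k) set) module"
  let ?W = "WH n m :: ('k, wpartition \<Rightarrow> (wpartition list \<Rightarrow>\<^sub>0 'k) set) module"
  \<comment> \<open>A class is sent to the value of a chosen representative; since the kernels of
    \<open>wcls\<close> and \<open>Bm\<close> agree, every representative gives the same
    value.\<close>
  define \<phi> where "\<phi> v = Bm n m r (SOME f. f \<in> MFsp n r \<and> wcls n r f = v)" for v :: "((nat btree \<Rightarrow>\<^sub>0 'k) set list \<Rightarrow>\<^sub>0 'k) set"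
  have phi: "\<phi> (wcls n r f) = Bm n m r f" if f: "f \<in> MFsp n r" for f :: "_ \<Rightarrow>\<^sub>0 'k"
  proof -
    let ?g = "SOME g. g \<in> MFsp n r \<and> wcls n r g = wcls n r f"
    have g: "?g \<in> MFsp n r \<and> wcls n r ?g = wcls n r f" by (rule someI[of _ f]) (use f in blast)
    then have "?g - f \<in> relspace {1..n} r" using wcls_eq_iff[OF conjunct1[OF g] f] by blast
    then show ?thesis unfolding \<phi>_def using Bm_eq_iff[OF conjunct1[OF g] f n m(1)] by blast
  qed
  have lin: "\<phi> \<in> linear_maps ?L ?W" unfolding linear_maps_def mem_Collect_eq
  proof (intro conjI ballI allI funcsetI)
    fix v assume "v \<in> carrier ?L"
    then obtain f where f: "f \<in> MFsp n r" "v = wcls n r f" unfolding carrier_wedge by blast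
    show "\<phi> v \<in> carrier ?W" unfolding f(2) phi[OF f(1)] by (rule Bm_carrier[OF f(1) m(1)])
    show "\<phi> (a \<odot>\<^bsub>?L\<^esub> v) = a \<odot>\<^bsub>?W\<^esub> \<phi> v" for a
      unfolding f(2) wedge_ops phi[OF f(1)] phi[OF pm.subspace_scale[OF subspace_keys f(1)]] Bm_ops ..
    fix w assume "w \<in> carrier ?L"
    then obtain g where g: "g \<in> MFsp n r" "w = wcls n r g" unfolding carrier_wedge by blast
    show "\<phi> (v \<oplus>\<^bsub>?L\<^esub> w) = \<phi> v \<oplus>\<^bsub>?W\<^esub> \<phi> w"
      unfolding f(2) g(2) wedge_ops phi[OF f(1)] phi[OF g(1)] phi[OF pm.subspace_add[OF subspace_keys f(1) g(1)]] Bm_ops ..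
  qed
  have bij: "bij_betw \<phi> (carrier ?L) (carrier ?W)"
  proof (rule bij_betw_imageI)
    show "inj_on \<phi> (carrier ?L)"
    proof (rule inj_onI)
      fix v w assume "v \<in> carrier ?L" "w \<in> carrier ?L" and eq: "\<phi> v = \<phi> w"
      then obtain f g where f: "f \<in> MFsp n r" "v = wcls n r f" and g: "g \<in> MFsp n r" "w = wcls n r g"
        unfolding carrier_wedge by blast
      show "v = w" using eq unfolding f(2) g(2) phi[OF f(1)] phi[OF g(1)]
        using Bm_eq_iff[OF f(1) g(1) n m(1)] wcls_eq_iff[OF f(1) g(1)] by blast
    qed
    show "\<phi> ` carrier ?L = carrier ?W"
    proof (rule equalityI; rule subsetI)
      fix w assume "w \<in> \<phi> ` carrier ?L"
      then show "w \<in> carrier ?W" using lin unfolding linear_maps_def by blast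
    next
      fix w assume "w \<in> carrier ?W"
      from Bm_surj[OF this n m(1)] obtain f where f: "f \<in> MFsp n r" "Bm n m r f = w" by blast
      have "wcls n r f \<in> carrier ?L" unfolding carrier_wedge using f(1) by (rule imageI)
      then show "w \<in> \<phi> ` carrier ?L" using phi[OF f(1)] f(2) by (metis imageI)
    qed
  qed
  have eqv: "\<phi> (wedge_lie2_act \<tau> v) = sign_twist ?W (WH_act n) \<tau> (\<phi> v)"
    if "\<tau> \<in> carrier (sym_group n)" "v \<in> carrier ?L" for \<tau> v
  proof -
    have t: "\<tau> permutes {1..n}" using that(1) by (simp add: sym_group_def)
    from that(2) obtain f where f: "f \<in> MFsp n r" "v = wcls n r f" unfolding carrier_wedge by blast
    show ?thesis
      unfolding f(2) wedge_act_wcls[OF t f(1)] phi[OF push_MFsp[OF t f(1)]] phi[OF f(1)] sign_twist_Bm[OF t f(1)] ..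
  qed
  have sngM: "(sng G :: _ \<Rightarrow>\<^sub>0 'k) \<in> MFsp n r" if "G \<in> MF {1..n} r" for G using that by simp
  have val: "(of_int (sign \<sigma> * forest_sgn F) :: 'k) \<odot>\<^bsub>?W\<^esub> forest_class n (labelled n F \<sigma>) = Bm n m r (sng (labelled n F \<sigma>))"
    if "(F, \<sigma>) \<in> BF n r" for F \<sigma>
    using forest_class_Bm[OF labelled_MF(1)[OF that] m(2), where ?'k = 'k] unfolding labelled_MF(2)[OF that] .
  have vals: "\<forall>(F, \<sigma>)\<in>BF n r. \<phi> (wedge_bracketing {1..n} (labelled n F \<sigma>)) =
      of_int (sign \<sigma> * forest_sgn F) \<odot>\<^bsub>?W\<^esub> forest_class n (labelled n F \<sigma>)"
  proof clarify
    fix F \<sigma> assume F: "(F, \<sigma>) \<in> BF n r"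
    show "\<phi> (wedge_bracketing {1..n} (labelled n F \<sigma>)) =
      of_int (sign \<sigma> * forest_sgn F) \<odot>\<^bsub>?W\<^esub> forest_class n (labelled n F \<sigma>)"
      unfolding val[OF F] wedge_bracketing_wcls[OF labelled_MF(1)[OF F]] by (rule phi[OF sngM[OF labelled_MF(1)[OF F]]])
  qed
  have unique: "\<psi> v = \<phi> v" if psi: "\<psi> \<in> linear_maps ?L ?W"
    and eq: "\<forall>(F, \<sigma>)\<in>BF n r. \<psi> (wedge_bracketing {1..n} (labelled n F \<sigma>)) =
      of_int (sign \<sigma> * forest_sgn F) \<odot>\<^bsub>?W\<^esub> forest_class n (labelled n F \<sigma>)"
    and v: "v \<in> carrier ?L" for \<psi> v
  proof -
    have ca: "wcls n r f \<in> carrier ?L" if "f \<in> MFsp n r" for f unfolding carrier_wedge using that by (rule imageI)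
    have padd: "\<psi> (x \<oplus>\<^bsub>?L\<^esub> y) = \<psi> x \<oplus>\<^bsub>?W\<^esub> \<psi> y" and psc: "\<psi> (a \<odot>\<^bsub>?L\<^esub> x) = a \<odot>\<^bsub>?W\<^esub> \<psi> x" and pc: "\<psi> x \<in> carrier ?W"
      if "x \<in> carrier ?L" "y \<in> carrier ?L" for x y a
      using psi that unfolding linear_maps_def by blast+
    \<comment> \<open>The combinations on which both maps agree form a subspace, so it suffices that
      all single forests belong to it.\<close>
    let ?V = "{f. f \<in> MFsp n r \<and> \<psi> (wcls n r f) = Bm n m r f}"
    have VI: "f \<in> ?V \<longleftrightarrow> f \<in> MFsp n r \<and> \<psi> (wcls n r f) = Bm n m r f" for f by (rule mem_Collect_eq)
    have V: "pm.subspace ?V"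
    proof (rule pm.subspaceI)
      have z: "(0 :: _ \<Rightarrow>\<^sub>0 'k) \<in> MFsp n r" by simp
      \<comment> \<open>\<open>linear_maps\<close> makes no direct statement about 0. Writing the
        value as some \<open>Bm n m r g\<close> allows its multiple by the scalar 0 to be
        computed.\<close>
      obtain g where g: "Bm n m r g = \<psi> (wcls n r 0)" using Bm_surj[OF pc[OF ca[OF z] ca[OF z]] n m(1)] by blast
      have "\<psi> (wcls n r 0) = \<psi> ((0 :: 'k) \<odot>\<^bsub>?L\<^esub> wcls n r 0)" by (simp add: wedge_ops)
      also have "\<dots> = (0 :: 'k) \<odot>\<^bsub>?W\<^esub> Bm n m r g" unfolding psc[OF ca[OF z] ca[OF z]] g ..
      also have "\<dots> = Bm n m r 0" unfolding Bm_ops by simp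
      finally have "\<psi> (wcls n r 0) = Bm n m r 0" .
      with z show "(0 :: _ \<Rightarrow>\<^sub>0 'k) \<in> ?V" unfolding VI by (rule conjI)
    next
      fix f g :: "_ \<Rightarrow>\<^sub>0 'k"
      assume "f \<in> ?V" "g \<in> ?V"
      then have f: "f \<in> MFsp n r \<and> \<psi> (wcls n r f) = Bm n m r f" and g: "g \<in> MFsp n r \<and> \<psi> (wcls n r g) = Bm n m r g"
        by (simp_all only: VI)
      have "\<psi> (wcls n r (f + g)) = Bm n m r (f + g)"
        using padd[OF ca[OF conjunct1[OF f]] ca[OF conjunct1[OF g]]]
        unfolding wedge_ops(1) conjunct2[OF f] conjunct2[OF g] Bm_ops(1) .
      with pm.subspace_add[OF subspace_keys conjunct1[OF f] conjunct1[OF g]]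
      show "f + g \<in> ?V" unfolding VI by (rule conjI)
    next
      fix a and f :: "_ \<Rightarrow>\<^sub>0 'k"
      assume "f \<in> ?V"
      then have f: "f \<in> MFsp n r \<and> \<psi> (wcls n r f) = Bm n m r f" by (simp only: VI)
      have "\<psi> (wcls n r (scale a f)) = Bm n m r (scale a f)"
        using psc[OF ca[OF conjunct1[OF f]] ca[OF conjunct1[OF f]], of a]
        unfolding wedge_ops(2) conjunct2[OF f] Bm_ops(2) .
      with pm.subspace_scale[OF subspace_keys conjunct1[OF f]]
      show "scale a f \<in> ?V" unfolding VI by (rule conjI)
    qed
    obtain f where f: "f \<in> MFsp n r" "v = wcls n r f" using v unfolding carrier_wedge by blast
    have "f \<in> ?V"
    proof (rule lin_in_subspace[OF lin_id V])
      fix G assume "G \<in> Poly_Mapping.keys f"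
      then have G: "G \<in> MF {1..n} r" using f(1) by auto
      obtain F \<sigma> where F: "(F, \<sigma>) \<in> BF n r" "labelled n F \<sigma> = G" using MF_labelled[OF G] by blast
      have "\<psi> (wedge_bracketing {1..n} (labelled n F \<sigma>)) = Bm n m r (sng (labelled n F \<sigma>))"
        using bspec[OF eq F(1)] unfolding prod.case val[OF F(1)] .
      then have "\<psi> (wcls n r (sng G)) = Bm n m r (sng G)" unfolding F(2) wedge_bracketing_wcls[OF G] .
      with sngM[OF G] show "sng G \<in> ?V" unfolding VI by (rule conjI)
    qed
    then have "\<psi> (wcls n r f) = Bm n m r f" unfolding VI by (rule conjunct2)
    then show ?thesis unfolding f(2) phi[OF f(1)] .
  qed
  show ?thesis unfolding m(2)
  proof (rule bexI[of _ \<phi>], intro conjI ballI impI)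
    show "\<phi> \<in> equivariant_isos n ?L wedge_lie2_act ?W (sign_twist ?W (WH_act n))"
      unfolding equivariant_isos_def mem_Collect_eq
      by (intro conjI ballI, rule lin, rule bij, rule eqv)
    show "case x of (F, \<sigma>) \<Rightarrow> \<phi> (wedge_bracketing {1..n} (labelled n F \<sigma>)) =
      of_int (sign \<sigma> * forest_sgn F) \<odot>\<^bsub>?W\<^esub> forest_class n (labelled n F \<sigma>)" if "x \<in> BF n r" for x
      by (rule bspec[OF vals that])
    show "\<psi> v = \<phi> v" if "\<psi> \<in> linear_maps ?L ?W"
      "\<forall>(F, \<sigma>)\<in>BF n r. \<psi> (wedge_bracketing {1..n} (labelled n F \<sigma>)) =
        of_int (sign \<sigma> * forest_sgn F) \<odot>\<^bsub>?W\<^esub> forest_class n (labelled n F \<sigma>)"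
      "v \<in> carrier ?L" for \<psi> v using unique[OF that] .
  qed
qed

end
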